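(* Let $p\in\mathcal P^{\log}$, $\omega\in A_{p(\cdot)}$ and $r\in\mathbb N$. There exist positive constants $c_1,c_2,c_3,c_4$ depending only on $r,\omega,p$ such that for all $n\in\mathbb N$, $\delta>0$, $T_n\in\mathcal T_n$, $f\in W^r_{p(\cdot),\omega}$ and $g\in L^{p(\cdot)}_{2\pi,\omega}$: $$\|\Delta_\delta^rf\|_{p(\cdot),\omega}\le c_1\,\delta^r\|f^{(r)}\|_{p(\cdot),\omega},$$ $$\frac1{n^r}\|T_n^{(r)}\|_{p(\cdot),\omega}\le c_2\,K_r\Big(T_n,\frac\pi n,p(\cdot),\omega\Big),$$ $$c_3\,K_r(g,\delta,p(\cdot),\omega)\le\|\Delta_\delta^rg\|_{p(\cdot),\omega}\le c_4\,K_r(g,\delta,p(\cdot),\omega).$$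
   Context: Let $\mathsf T=[-\pi,\pi]$; $|B|$ denotes the Lebesgue measure of $B$; $\mathbb N=\{1,2,\dots\}$. $\mathcal P$ is the set of measurable $p:\mathsf T\to[1,\infty)$ with $\operatorname{ess\,sup}_{\mathsf T}p<\infty$. $\mathcal P^{\log}$ is the set of $p\in\mathcal P$ such that $q=1/p$ satisfies, for some constant $c>0$, $|q(x)-q(y)|\le c/\ln(e+1/|x-y|)$ for all $x\ne y$ in $\mathsf T$. A weight $\omega$ is a $2\pi$-periodic Lebesgue measurable function with values in $[0,\infty]$ that is positive a.e. $L^{p(\cdot)}_{2\pi,\omega}$ is the space of $2\pi$-periodic measurable real functions $f$ with $\|f\|_{p(\cdot),\omega}=\inf\{\alpha>0:\int_{\mathsf T}|f(x)/\alpha|^{p(x)}\omega(x)\,dx\le1\}<\infty$ (the same definitions are used for complex-valued functions such as trigonometric polynomials). $p'(x)=p(x)/(p(x)-1)$ if $p(x)>1$ and $p'(x)=\infty$ if $p(x)=1$. $A_{p(\cdot)}$ is the class of weights $\omega$ with $$\sup_{B}\frac{\|\omega\|_{L^1(B)}}{|B|^{p_B}}\left\|\frac1\omega\right\|_{B,p'(\cdot)/p(\cdot)}<\infty,\qquad \frac1{p_B}=\frac1{|B|}\int_B\frac{dx}{p(x)},$$ the supremum being over intervals $B\subseteq\mathsf T$ of positive length. Here $\|g\|_{B,q(\cdot)}=\inf\{\alpha>0:\int_B\varphi_{q(x)}(|g(x)|/\alpha)\,dx\le1\}$ with $\varphi_q(t)=t^q$ for $0<q<\infty$, and $\varphi_\infty(t)=0$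 for $t\le1$, $\varphi_\infty(t)=\infty$ for $t>1$; $p'(x)/p(x)=1/(p(x)-1)$, equal to $\infty$ where $p(x)=1$. $W^r_{p(\cdot),\omega}$ is the set of $f\in L^{p(\cdot)}_{2\pi,\omega}$ such that $f^{(r-1)}$ is absolutely continuous and $f^{(r)}\in L^{p(\cdot)}_{2\pi,\omega}$. $K_r(f,\delta,p(\cdot),\omega)=\inf_{g\in W^r_{p(\cdot),\omega}}\{\|f-g\|_{p(\cdot),\omega}+\delta^r\|g^{(r)}\|_{p(\cdot),\omega}\}$ is Peetre's K-functional. $\mathcal T_n$ is the set of complex trigonometric polynomials of degree at most $n$. For $h>0$, $T_hf(x)=\frac1h\int_x^{x+h}f(t)\,dt$ (an operator, not to be confused with the polynomial $T_n$) and $\Delta_h^rf=(T_h-I)^rf$, with $I$ the identity.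
   Formalization: In the definition of A_{p(·)} the supremum also runs over intervals of the circle passing through π = −π, not only intervals B ⊆ [−π,π]; otherwise the claim fails, e.g. for p = 2, r = 1, ω = ((π+x)/(π−x))^{1/2}. *)

theory Defs
  imports "HOL-Analysis.Analysis" "HOL-Probability.Essential_Supremum"
begin

text \<open>
  \<open>circ\<close> is the fundamental period on which all functions are integrated; functions that
  are \<open>2\<pi>\<close>-periodic are functions on the circle obtained by identifying its endpoints.
\<close>

abbreviation circ :: "real set" where
  "circ \<equiv> {-pi..pi}"

definition periodic_2pi :: "(real \<Rightarrow> 'a) \<Rightarrow> bool" where
  "periodic_2pi f \<longleftrightarrow> (\<forall>x. f (x + 2 * pi) = f x)"


section \<open>Variable exponents\<close>

text \<open>An exponent is a function on \<^term>\<open>circ\<close>: its values outside \<^term>\<open>circ\<close> are never used.\<close>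

definition exponents :: "(real \<Rightarrow> real) set" where
  "exponents = {p. p \<in> borel_measurable (lebesgue_on circ) \<and> (\<forall>x\<in>circ. 1 \<le> p x) \<and>
     esssup (lebesgue_on circ) (\<lambda>x. ereal (p x)) < \<infinity>}"

definition log_exponents :: "(real \<Rightarrow> real) set" where
  "log_exponents = {p \<in> exponents. \<exists>c>0. \<forall>x\<in>circ. \<forall>y\<in>circ. x \<noteq> y \<longrightarrow>
     \<bar>1 / p x - 1 / p y\<bar> \<le> c / ln (exp 1 + 1 / \<bar>x - y\<bar>)}"

definition conj_exponent :: "(real \<Rightarrow> real) \<Rightarrow> real \<Rightarrow> ennreal" where
  "conj_exponent p x = (if p x > 1 then ennreal (p x / (p x - 1)) else \<infinity>)"


section \<open>Weighted variable exponent Lebesgue spaces\<close>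

definition weights :: "(real \<Rightarrow> ennreal) set" where
  "weights = {w. periodic_2pi w \<and> w \<in> borel_measurable lebesgue \<and> (AE x in lebesgue. 0 < w x)}"

text \<open>The value is \<open>\<infinity>\<close>, the infimum of the empty set, for functions outside the space.\<close>

definition wnorm :: "(real \<Rightarrow> real) \<Rightarrow> (real \<Rightarrow> ennreal) \<Rightarrow> (real \<Rightarrow> 'a::real_normed_vector) \<Rightarrow> ennreal"
  where "wnorm p w f = (INF \<alpha>\<in>{\<alpha>::real. 0 < \<alpha> \<and>
     (\<integral>\<^sup>+x\<in>circ. (ennreal ((norm (f x) / \<alpha>) powr p x) * w x) \<partial>lebesgue) \<le> 1}. ennreal \<alpha>)"

definition wL :: "(real \<Rightarrow> real) \<Rightarrow> (real \<Rightarrow> ennreal) \<Rightarrow> (real \<Rightarrow> 'a::real_normed_vector) set" where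
  "wL p w = {f. periodic_2pi f \<and> f \<in> borel_measurable lebesgue \<and> wnorm p w f < \<infinity>}"


section \<open>Muckenhoupt weights\<close>

definition phi :: "ennreal \<Rightarrow> ennreal \<Rightarrow> ennreal" where
  "phi q t = (if q = \<infinity> then (if t \<le> 1 then 0 else \<infinity>)
              else if t = \<infinity> then \<infinity> else ennreal (enn2real t powr enn2real q))"

definition lux :: "real set \<Rightarrow> (real \<Rightarrow> ennreal) \<Rightarrow> (real \<Rightarrow> ennreal) \<Rightarrow> ennreal" where
  "lux B q g = (INF \<alpha>\<in>{\<alpha>::real. 0 < \<alpha> \<and>
     (\<integral>\<^sup>+x\<in>B. phi (q x) (g x / ennreal \<alpha>) \<partial>lebesgue) \<le> 1}. ennreal \<alpha>)"

definition harm_mean :: "(real \<Rightarrow> real) \<Rightarrow> real set \<Rightarrow> real" where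
  "harm_mean p B = 1 / (1 / measure lebesgue B * (LINT x:B|lebesgue. 1 / p x))"

text \<open>
  The intervals of positive length of the circle: besides the intervals \<open>{a..b}\<close> of
  \<^term>\<open>circ\<close> there are those that run from \<open>b\<close> to \<open>a\<close> through the point \<open>\<pi> = -\<pi>\<close>. Those
  cannot be dropped: testing only subintervals of the real interval \<^term>\<open>circ\<close> would admit the
  periodic weight equal to \<open>((\<pi> + x) / (\<pi> - x)) powr (1/2)\<close> on \<open>{-\<pi><..<\<pi>}\<close> for \<open>p = 2\<close>, and the
  means \<open>steklov h\<close> are not uniformly bounded (as \<open>h \<rightarrow> 0\<close>) in the corresponding space.
  Endpoints are irrelevant to all the quantities involved, so closed intervals suffice.
\<close>

definition circ_intervals :: "real set set" where
  "circ_intervals = {B. 0 < measure lebesgue B \<and>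
     (\<exists>a b. -pi \<le> a \<and> a \<le> b \<and> b \<le> pi \<and> (B = {a..b} \<or> B = {-pi..a} \<union> {b..pi}))}"

definition muckenhoupt :: "(real \<Rightarrow> real) \<Rightarrow> (real \<Rightarrow> ennreal) set" where
  "muckenhoupt p = {w \<in> weights.
     (SUP B\<in>circ_intervals.
        (\<integral>\<^sup>+x\<in>B. w x \<partial>lebesgue) / ennreal (measure lebesgue B powr harm_mean p B)
        * lux B (\<lambda>x. conj_exponent p x / ennreal (p x)) (\<lambda>x. 1 / w x)) < \<infinity>}"


section \<open>Sobolev classes and the K-functional\<close>

definition vderiv :: "nat \<Rightarrow> (real \<Rightarrow> 'a::real_normed_vector) \<Rightarrow> real \<Rightarrow> 'a" where
  "vderiv k f = ((\<lambda>u x. vector_derivative u (at x)) ^^ k) f"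

definition abs_cont_on :: "real \<Rightarrow> real \<Rightarrow> (real \<Rightarrow> 'a::real_normed_vector) \<Rightarrow> bool" where
  "abs_cont_on a b F \<longleftrightarrow> (\<forall>\<epsilon>>0. \<exists>\<delta>>0. \<forall>(n::nat) s t.
     (\<forall>i<n. a \<le> s i \<and> s i \<le> t i \<and> t i \<le> b) \<and>
     (\<forall>i<n. \<forall>j<n. i \<noteq> j \<longrightarrow> {s i<..<t i} \<inter> {s j<..<t j} = {}) \<and>
     (\<Sum>i<n. t i - s i) < \<delta> \<longrightarrow> (\<Sum>i<n. norm (F (t i) - F (s i))) < \<epsilon>)"

text \<open>
  The classical derivatives up to order \<open>r - 1\<close> exist everywhere; the one of order \<open>r\<close> exists only
  almost everywhere, and \<^term>\<open>vderiv r f\<close> has an unspecified value at the remaining points, which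
  form a null set. By periodicity, absolute continuity on one period is enough.
\<close>

definition wW :: "nat \<Rightarrow> (real \<Rightarrow> real) \<Rightarrow> (real \<Rightarrow> ennreal) \<Rightarrow> (real \<Rightarrow> 'a::real_normed_vector) set"
  where "wW r p w = {f \<in> wL p w.
     (\<forall>k<r - 1. \<forall>x. vderiv k f differentiable (at x)) \<and>
     abs_cont_on (-pi) pi (vderiv (r - 1) f) \<and> vderiv r f \<in> wL p w}"

definition Kfun :: "nat \<Rightarrow> (real \<Rightarrow> 'a::real_normed_vector) \<Rightarrow> real \<Rightarrow> (real \<Rightarrow> real) \<Rightarrow>
    (real \<Rightarrow> ennreal) \<Rightarrow> ennreal" where
  "Kfun r f \<delta> p w =
     (INF g\<in>wW r p w. wnorm p w (\<lambda>x. f x - g x) + ennreal (\<delta> ^ r) * wnorm p w (vderiv r g))"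


section \<open>Trigonometric polynomials and differences\<close>

definition trig_polys :: "nat \<Rightarrow> (real \<Rightarrow> complex) set" where
  "trig_polys n = {T. \<exists>c::int \<Rightarrow> complex. T = (\<lambda>x. \<Sum>k\<in>{- int n..int n}. c k * cis (of_int k * x))}"

definition steklov :: "real \<Rightarrow> (real \<Rightarrow> 'a::{banach, second_countable_topology}) \<Rightarrow> real \<Rightarrow> 'a" where
  "steklov h f x = (1 / h) *\<^sub>R (LINT t:{x..x + h}|lebesgue. f t)"

definition Delta :: "nat \<Rightarrow> real \<Rightarrow> (real \<Rightarrow> 'a::{banach, second_countable_topology}) \<Rightarrow> real \<Rightarrow> 'a"
  where "Delta r h f = ((\<lambda>u x. steklov h u x - u x) ^^ r) f"

end

theory Submission
  imports Defs
begin

text \<open>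
  Write \<open>\<parallel>_\<parallel>\<close> for \<^term>\<open>wnorm p w\<close>. Everything rests on one property of the pair \<open>p\<close>, \<open>w\<close>: the
  averages of \<open>\<bar>f\<bar>\<close> over the intervals \<open>{x - h..x + h}\<close> have norm at most \<open>C \<parallel>f\<parallel>\<close>, with \<open>C\<close>
  independent of \<open>h\<close> (\<open>averages_bounded\<close>). This is weaker than the boundedness of the maximal
  function and has a direct proof. The intervals of one fixed length that are needed for all \<open>x\<close>
  are covered by finitely many intervals of the circle with bounded overlap, so that it is enough
  to bound the average over a single interval \<open>B\<close>. There the Muckenhoupt condition, used as a
  duality between \<open>w\<close> and \<open>1 / w\<close>, gives the bound, provided that the powers of the length of \<open>B\<close>
  and of the average with exponents \<open>p x\<close>, \<open>p y\<close> and \<^term>\<open>harm_mean p B\<close> may be interchanged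
  for points \<open>x\<close>, \<open>y\<close> of \<open>B\<close>. They may, because \<open>1 / p\<close> is log-Hoelder continuous
  (\<open>power_comparison\<close>, \<open>mean_power_bound\<close>). All later estimates have the same shape: a pointwise
  bound by averages of a function, integrated by \<open>wnorm_le_window\<close> or \<open>wnorm_le_sum_windows\<close>.

  The first inequality and the upper bound by the K-functional follow because one difference of
  a primitive of \<open>f\<close> is at most \<open>2 h\<close> times an average of \<open>\<bar>f\<bar>\<close> (\<open>wnorm_Delta_wW\<close>,
  \<open>wnorm_Delta_le_Kfun\<close>).

  For the lower bound a smooth approximation of \<open>g\<close> is built from
  \<open>L g x = 2 \<integral>\<^sub>0\<^sup>1 (1 - t) g (x + h t) dt\<close>. It gains one derivative, \<open>(L g)' = (2 / h) \<Delta>\<^sub>h g\<close>, and its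
  error is controlled by the first difference: \<open>\<parallel>g - L g\<parallel> \<le> K \<parallel>\<Delta>\<^sub>h g\<parallel>\<close> (\<open>wnorm_wmean_error\<close>). The
  last estimate amounts to dividing the multiplier of \<open>1 - L\<close> by that of \<open>\<Delta>\<^sub>h\<close>. The quotient is a
  convolution with an explicit kernel on the half line, which solves the renewal equation of the
  uniform distribution on \<open>[0, 1]\<close> and decays exponentially (\<open>renewal_bound\<close>); convolution
  with it is a convergent series of averages. With \<open>E = 1 - L\<^sup>r\<close>, the function \<open>g - E\<^sup>r g\<close> is \<open>L\<^sup>r v\<close>
  with \<open>v = (1 + E + \<dots> + E\<^sup>r\<^sup>-\<^sup>1) g\<close>. It is therefore \<open>r\<close> times differentiable with
  \<open>r\<close>th derivative \<open>(2 / h)\<^sup>r \<Delta>\<^sub>h\<^sup>r v\<close>, while \<open>\<parallel>E\<^sup>r g\<parallel> \<le> K' \<parallel>\<Delta>\<^sub>h\<^sup>r g\<parallel>\<close> (\<open>Kfun_le_wnorm_Delta\<close>).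

  For a trigonometric polynomial \<open>T\<close> of degree \<open>n\<close> the formula of \<open>T'\<close> as a convolution of \<open>T\<close> with
  a modulated Fejer kernel yields Bernstein's inequality \<open>\<parallel>T'\<parallel> \<le> c n \<parallel>T\<parallel>\<close> (\<open>bernstein\<close>). Since
  \<open>\<Delta>\<^sub>h T = (h / 2) T'\<close> up to an error of order \<open>h\<^sup>2 T''\<close>, it follows that \<open>(h / 4) \<parallel>T'\<parallel> \<le> \<parallel>\<Delta>\<^sub>h T\<parallel>\<close> when
  \<open>h\<close> is a small multiple of \<open>1 / n\<close>; iteration and the upper bound by the K-functional give the
  second inequality (\<open>wnorm_vderiv_le_Kfun\<close>).

  The Sobolev classes are defined through absolute continuity, so the fundamental theorem of
  calculus for absolutely continuous functions is needed in both directions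
  (\<open>abs_cont_has_integral_vector_derivative\<close>, \<open>indefinite_integral_derivative_ae\<close>).
\<close>

section \<open>Absolutely continuous functions\<close>

lemma abs_cont_on_finite_family:
  fixes F :: "real \<Rightarrow> 'a::real_normed_vector"
  assumes "abs_cont_on a b F" "0 < \<epsilon>"
  shows "\<exists>\<delta>>0. \<forall>(A::'i set) s t. finite A \<longrightarrow> (\<forall>i\<in>A. a \<le> s i \<and> s i \<le> t i \<and> t i \<le> b) \<longrightarrow>
       pairwise (\<lambda>i j. {s i<..<t i} \<inter> {s j<..<t j} = {}) A \<longrightarrow> (\<Sum>i\<in>A. t i - s i) < \<delta> \<longrightarrow>
      (\<Sum>i\<in>A. norm (F (t i) - F (s i))) < \<epsilon>"
proof -
  from assms(1)[unfolded abs_cont_on_def, rule_format, OF assms(2)]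
  obtain \<delta> where "\<delta> > 0" and \<delta>: "\<forall>(n::nat) s t.
     (\<forall>i<n. a \<le> s i \<and> s i \<le> t i \<and> t i \<le> b) \<and>
     (\<forall>i<n. \<forall>j<n. i \<noteq> j \<longrightarrow> {s i<..<t i} \<inter> {s j<..<t j} = {}) \<and>
     (\<Sum>i<n. t i - s i) < \<delta> \<longrightarrow> (\<Sum>i<n. norm (F (t i) - F (s i))) < \<epsilon>"
    by (elim exE conjE) (rule that)
  show ?thesis
  proof (intro exI[of _ \<delta>] conjI \<open>\<delta> > 0\<close> allI impI)
    fix A :: "'i set" and s t
    assume A: "finite A" "\<forall>i\<in>A. a \<le> s i \<and> s i \<le> t i \<and> t i \<le> b"
       "pairwise (\<lambda>i j. {s i<..<t i} \<inter> {s j<..<t j} = {}) A" "(\<Sum>i\<in>A. t i - s i) < \<delta>"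
    obtain e where e: "bij_betw e {..<card A} A"
      using ex_bij_betw_nat_finite[OF A(1)] by (metis atLeast0LessThan)
    have eA: "e i \<in> A" if "i < card A" for i using e that by (auto simp: bij_betw_def)
    have "(\<Sum>i<card A. norm (F (t (e i)) - F (s (e i)))) < \<epsilon>"
    proof (rule \<delta>[rule_format], intro conjI allI impI)
      fix i j assume ij: "i < card A" "j < card A" "i \<noteq> j"
      then have "e i \<noteq> e j" using e by (auto simp: bij_betw_def inj_on_def)
      then show "{s (e i)<..<t (e i)} \<inter> {s (e j)<..<t (e j)} = {}"
        using A(3) eA ij unfolding pairwise_def by blast
    next
      show "(\<Sum>i<card A. t (e i) - s (e i)) < \<delta>"
        using A(4) sum.reindex_bij_betw[OF e, of "\<lambda>i. t i - s i"] by simp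
    qed (use A(2) eA in auto)
    then show "(\<Sum>i\<in>A. norm (F (t i) - F (s i))) < \<epsilon>"
      using sum.reindex_bij_betw[OF e, of "\<lambda>i. norm (F (t i) - F (s i))"] by simp
  qed
qed

text \<open>
  Increments over the members of \<open>\<J>\<close> are compared below with the increment over the whole
  interval \<open>{c..d}\<close>. The gaps \<open>\<R>\<close> are the same for every \<open>F\<close>: the identity is used both for the
  function in question and for \<open>F x = x\<close>, where it computes total lengths.
\<close>

lemma complement_family:
  fixes \<J> :: "(real \<times> real) set"
  assumes "finite \<J>" "c \<le> d" and J: "\<And>s t. (s,t) \<in> \<J> \<Longrightarrow> c \<le> s \<and> s < t \<and> t \<le> d"
    and disj: "pairwise (\<lambda>i j. {fst i..snd i} \<inter> {fst j..snd j} = {}) \<J>"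
  shows "\<exists>\<R> :: (real \<times> real) set. finite \<R> \<and>
    (\<forall>s t. (s,t) \<in> \<R> \<longrightarrow> c \<le> s \<and> s \<le> t \<and> t \<le> d) \<and>
    pairwise (\<lambda>i j. {fst i<..<snd i} \<inter> {fst j<..<snd j} = {}) \<R> \<and>
    (\<forall>F::real\<Rightarrow>real. F d - F c = (\<Sum>(s,t)\<in>\<J>. F t - F s) + (\<Sum>(s,t)\<in>\<R>. F t - F s))"
proof -
  define p where "p = (\<lambda>(s,t). {s..t}) ` \<J>"
  have p: "p division_of \<Union>p"
  proof (rule division_ofI)
    show "finite p" using assms(1) by (simp add: p_def)
    fix K assume "K \<in> p"
    then show "K \<subseteq> \<Union>p" by auto
    show "K \<noteq> {}" using \<open>K \<in> p\<close> J unfolding p_def by fastforce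
    show "\<exists>a b. K = cbox a b" using \<open>K \<in> p\<close> by (auto simp: p_def)
  next
    fix K L assume "K \<in> p" "L \<in> p" "K \<noteq> L"
    then obtain i j where ij: "i \<in> \<J>" "j \<in> \<J>" "i \<noteq> j" "K = {fst i..snd i}" "L = {fst j..snd j}"
      by (auto simp: p_def split_beta)
    then have "K \<inter> L = {}" using disj unfolding pairwise_def by blast
    then show "interior K \<inter> interior L = {}" using interior_subset by blast
  qed simp
  have "\<Union>p \<subseteq> cbox c d" using J by (force simp: p_def)
  with p obtain q where q: "p \<subseteq> q" "q division_of cbox c d"
    by (rule partial_division_extend_interval)
  have finq: "finite q" using q(2) by auto
  have qI: "\<exists>x y. K = {x..y} \<and> x \<le> y \<and> c \<le> x \<and> y \<le> d" if "K \<in> q" for K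
  proof -
    have "K \<subseteq> cbox c d" "K \<noteq> {}" "\<exists>x y. K = cbox x y"
      using division_ofD[OF q(2)] that by blast+
    then obtain x y where xy: "K = {x..y}" by auto
    with \<open>K \<noteq> {}\<close> have "x \<le> y" by simp
    then have "x \<in> cbox c d" "y \<in> cbox c d" using \<open>K \<subseteq> cbox c d\<close> xy by auto
    then show ?thesis using xy \<open>x \<le> y\<close> by auto
  qed
  define g where "g K = (Inf K, Sup K)" for K :: "real set"
  have inj: "inj_on g q"
  proof (rule inj_onI)
    fix K L assume "K \<in> q" "L \<in> q" "g K = g L"
    then show "K = L" using qI[of K] qI[of L] by (auto simp: g_def)
  qed
  have sumq: "(\<Sum>K\<in>q. F (Sup K) - F (Inf K)) = F d - F c" for F :: "real \<Rightarrow> real"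
  proof -
    have td: "(\<lambda>K. (Inf K, K)) ` q tagged_division_of {c..d}"
    proof (rule tagged_division_ofI)
      fix x K assume "(x,K) \<in> (\<lambda>K. (Inf K, K)) ` q"
      then have K: "K \<in> q" "x = Inf K" by auto
      then obtain u v where "K = {u..v}" "u \<le> v" "c \<le> u" "v \<le> d" using qI by blast
      then show "x \<in> K" "K \<subseteq> {c..d}" using K(2) by simp_all
      show "\<exists>a b. K = cbox a b" using \<open>K = {u..v}\<close> box_real by blast
    next
      fix x K y L assume "(x,K) \<in> (\<lambda>K. (Inf K, K)) ` q" "(y,L) \<in> (\<lambda>K. (Inf K, K)) ` q" "(x,K) \<noteq> (y,L)"
      then have "K \<in> q" "L \<in> q" "K \<noteq> L" by auto
      then show "interior K \<inter> interior L = {}" using division_ofD(5)[OF q(2)] by blast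
    next
      show "\<Union>{K. \<exists>x. (x,K) \<in> (\<lambda>K. (Inf K, K)) ` q} = {c..d}"
        using division_ofD(6)[OF q(2)] by (auto simp: image_iff)
    qed (use finq in auto)
    have "sum (\<lambda>(x,K). F (Sup K) - F (Inf K)) ((\<lambda>K. (Inf K, K)) ` q) = F d - F c"
      by (rule additive_tagged_division_1[OF \<open>c \<le> d\<close> td])
    then show ?thesis by (subst (asm) sum.reindex) (auto simp: inj_on_def)
  qed
  have gp: "g ` p = \<J>"
  proof -
    have "g {s..t} = (s,t)" if "(s,t) \<in> \<J>" for s t
      using J[OF that] by (simp add: g_def)
    then show ?thesis unfolding p_def image_image
      by (metis (mono_tags, lifting) image_cong image_ident split_beta surjective_pairing)
  qed
  show ?thesis
  proof (intro exI[of _ "g ` (q - p)"] conjI allI impI)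
    show "finite (g ` (q - p))" using finq by auto
  next
    fix s t assume "(s,t) \<in> g ` (q - p)"
    then show "c \<le> s" "s \<le> t" "t \<le> d" using qI by (fastforce simp: g_def)+
  next
    show "pairwise (\<lambda>i j. {fst i<..<snd i} \<inter> {fst j<..<snd j} = {}) (g ` (q - p))"
    proof (rule pairwiseI)
      fix i j assume "i \<in> g ` (q - p)" "j \<in> g ` (q - p)" "i \<noteq> j"
      then obtain K L where KL: "K \<in> q" "L \<in> q" "i = g K" "j = g L" "K \<noteq> L" by auto
      then have "interior K \<inter> interior L = {}" using division_ofD(5)[OF q(2)] by blast
      then show "{fst i<..<snd i} \<inter> {fst j<..<snd j} = {}"
        using qI[OF KL(1)] qI[OF KL(2)] KL by (auto simp: g_def)
    qed
  next
    fix F :: "real \<Rightarrow> real"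
    have "F d - F c = (\<Sum>K\<in>p. F (Sup K) - F (Inf K)) + (\<Sum>K\<in>q-p. F (Sup K) - F (Inf K))"
      using sumq[of F] sum.subset_diff[OF q(1) finq, of "\<lambda>K. F (Sup K) - F (Inf K)"] by simp
    also have "(\<Sum>K\<in>p. F (Sup K) - F (Inf K)) = (\<Sum>(s,t)\<in>g ` p. F t - F s)"
      by (subst sum.reindex) (auto simp: g_def inj_on_subset[OF inj q(1)])
    also have "(\<Sum>K\<in>q-p. F (Sup K) - F (Inf K)) = (\<Sum>(s,t)\<in>g ` (q - p). F t - F s)"
      by (subst sum.reindex) (auto simp: g_def inj_on_diff[OF inj])
    finally show "F d - F c = (\<Sum>(s,t)\<in>\<J>. F t - F s) + (\<Sum>(s,t)\<in>g ` (q - p). F t - F s)"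
      by (simp add: gp)
  qed
qed

text \<open>
  The form in which Vitali's covering theorem is used: a fine cover of an arbitrary, possibly
  nonmeasurable, set contains a finite disjoint family that misses only a set of small measure.
  The predicate \<open>P\<close> records what is known about the increments over the covering intervals.
\<close>

lemma vitali_finite_subfamily:
  fixes E :: "real set"
  assumes U: "open U" "U \<in> lmeasurable" "E \<subseteq> U" and "0 < e"
    and fine: "\<forall>x\<in>E. \<forall>d>0. \<exists>s t. s \<le> x \<and> x \<le> t \<and> s < t \<and> t - s < d \<and> P s t"
  shows "\<exists>\<J> N. finite \<J> \<and> (\<forall>(s,t)\<in>\<J>. s < t \<and> P s t \<and> {s..t} \<subseteq> U) \<and>
    pairwise (\<lambda>i j. {fst i..snd i} \<inter> {fst j..snd j} = {}) \<J> \<and>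
    N \<in> lmeasurable \<and> measure lebesgue N < e \<and> E \<subseteq> (\<Union>(s,t)\<in>\<J>. {s..t}) \<union> N"
proof -
  define K where "K = {(c,r). 0 < r \<and> P (c - r) (c + r) \<and> {c-r..c+r} \<subseteq> U}"
  define I where "I i = {fst i - snd i..fst i + snd i}" for i :: "real \<times> real"
  have Ic: "cball (fst i) (snd i) = I i" for i by (simp add: I_def cball_eq_atLeastAtMost)
  have 1: "\<exists>i. i \<in> K \<and> x \<in> cball (fst i) (snd i) \<and> snd i < d" if x: "x \<in> E" "0 < d" for x d
  proof -
    obtain d' where d': "0 < d'" "ball x d' \<subseteq> U" using U x by (meson open_contains_ball subsetD)
    obtain s t where st: "s \<le> x" "x \<le> t" "s < t" "t - s < min d d'" "P s t"
      using fine[rule_format, of x "min d d'"] x d' by auto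
    have "{s..t} \<subseteq> U"
    proof
      fix y assume "y \<in> {s..t}"
      then have "dist x y < d'" using st by (auto simp: dist_real_def)
      then show "y \<in> U" using d' by auto
    qed
    moreover have "(s+t)/2 - (t-s)/2 = s" "(s+t)/2 + (t-s)/2 = t" by (simp_all add: field_simps)
    ultimately have "((s+t)/2, (t-s)/2) \<in> K" using st by (auto simp: K_def)
    moreover have "x \<in> I ((s+t)/2, (t-s)/2)" using st by (simp add: I_def field_simps)
    ultimately show ?thesis unfolding Ic using st by (intro exI[of _ "((s+t)/2, (t-s)/2)"]) simp
  qed
  have 0: "0 < snd i" if "i \<in> K" for i using that by (auto simp: K_def)
  obtain C where C: "countable C" "C \<subseteq> K" "pairwise (\<lambda>i j. disjnt (I i) (I j)) C" "negligible (E - (\<Union>i\<in>C. I i))"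
    using Vitali_covering_theorem_cballs[of K snd E fst, OF 0 1] unfolding Ic by blast
  have "I i \<subseteq> U" if "i \<in> K" for i using that by (cases i) (simp add: K_def I_def)
  then have IU: "(\<Union>i\<in>C. I i) \<subseteq> U" using C(2) by blast
  have "\<exists>D. finite D \<and> D \<subseteq> C \<and> measure lebesgue ((\<Union>i\<in>C. I i) - (\<Union>i\<in>D. I i)) < e"
  proof (cases "C = {}")
    case False
    define A where "A n = (\<Union>i\<in>from_nat_into C ` {..<n}. I i)" for n
    have r: "range (from_nat_into C) = C" using range_from_nat_into[OF False C(1)] .
    have UA: "(\<Union>n. A n) = (\<Union>i\<in>C. I i)"
    proof (intro equalityI subsetI)
      fix x assume "x \<in> (\<Union>i\<in>C. I i)"
      then obtain i where "i \<in> range (from_nat_into C)" "x \<in> I i" unfolding r by blast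
      then obtain n where "x \<in> I (from_nat_into C n)" by blast
      then have "x \<in> A (Suc n)" unfolding A_def by blast
      then show "x \<in> (\<Union>n. A n)" by blast
    qed (use r in \<open>auto simp: A_def\<close>)
    have As: "A n \<in> sets lebesgue" for n unfolding A_def I_def by (intro sets.finite_UN) auto
    have lm: "(\<Union>i\<in>C. I i) \<in> lmeasurable"
      by (rule fmeasurableI2[OF U(2) IU]) (auto simp: I_def C(1) intro!: sets.countable_UN')
    have Al: "A n \<in> lmeasurable" for n
      by (rule fmeasurableI2[OF lm _ As]) (use UA in blast)
    have "(\<lambda>n. measure lebesgue (A n)) \<longlonglongrightarrow> measure lebesgue (\<Union>n. A n)"
    proof (rule Lim_measure_incseq)
      show "range A \<subseteq> sets lebesgue" using As by auto
      show "incseq A" unfolding incseq_def A_def by (intro allI impI UN_mono image_mono) auto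
      show "emeasure lebesgue (\<Union>n. A n) \<noteq> \<infinity>"
        unfolding UA infinity_ennreal_def by (rule fmeasurableD2[OF lm])
    qed
    then have "\<forall>\<^sub>F n in sequentially. measure lebesgue (A n) > measure lebesgue (\<Union>n. A n) - e"
      by (rule order_tendstoD) (use \<open>0 < e\<close> in simp)
    then obtain n where n: "measure lebesgue (A n) > measure lebesgue (\<Union>n. A n) - e"
      by (auto simp: eventually_sequentially)
    have "measure lebesgue ((\<Union>i\<in>C. I i) - A n) = measure lebesgue (\<Union>i\<in>C. I i) - measure lebesgue (A n)"
      by (rule measurable_measure_Diff[OF lm As]) (use UA in blast)
    then show ?thesis using n r UA unfolding A_def
      by (intro exI[of _ "from_nat_into C ` {..<n}"]) auto
  qed (use \<open>0 < e\<close> in auto)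
  then obtain D where D: "finite D" "D \<subseteq> C" "measure lebesgue ((\<Union>i\<in>C. I i) - (\<Union>i\<in>D. I i)) < e" by blast
  define g where "g i = (fst i - snd i, fst i + snd i)" for i :: "real \<times> real"
  have gI: "{fst (g i)..snd (g i)} = I i" for i by (simp add: g_def I_def)
  define N where "N = ((\<Union>i\<in>C. I i) - (\<Union>i\<in>D. I i)) \<union> (E - (\<Union>i\<in>C. I i))"
  have Dm: "(\<Union>i\<in>C. I i) - (\<Union>i\<in>D. I i) \<in> lmeasurable"
  proof (rule fmeasurableI2[OF U(2)])
    show "(\<Union>i\<in>C. I i) - (\<Union>i\<in>D. I i) \<in> sets lebesgue"
      using C(1) D(1) by (intro sets.Diff sets.countable_UN' sets.finite_UN) (auto simp: I_def)
  qed (use IU in blast)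
  show ?thesis
  proof (intro exI[of _ "g ` D"] exI[of _ N] conjI)
    show "finite (g ` D)" using D by auto
    show "N \<in> lmeasurable" unfolding N_def
      by (rule fmeasurable.Un[OF Dm negligible_imp_measurable[OF C(4)]])
    show "measure lebesgue N < e"
      by (simp only: N_def measure_Un_null_set[OF fmeasurableD[OF Dm] C(4)[unfolded negligible_iff_null_sets]] D(3))
    show "E \<subseteq> (\<Union>(s,t)\<in>g ` D. {s..t}) \<union> N"
      unfolding N_def using gI by (auto simp: split_beta)
    show "pairwise (\<lambda>i j. {fst i..snd i} \<inter> {fst j..snd j} = {}) (g ` D)"
    proof (rule pairwiseI)
      fix i j assume "i \<in> g ` D" "j \<in> g ` D" "i \<noteq> j"
      then obtain k l where "k \<in> D" "l \<in> D" "i = g k" "j = g l" "k \<noteq> l" by blast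
      then have "disjnt (I k) (I l)" using D(2) by (intro pairwiseD[OF C(3)]) auto
      then show "{fst i..snd i} \<inter> {fst j..snd j} = {}"
        using \<open>i = g k\<close> \<open>j = g l\<close> by (simp only: gI disjnt_def)
    qed
  next
    show "\<forall>(s,t)\<in>g ` D. s < t \<and> P s t \<and> {s..t} \<subseteq> U"
    proof
      fix z assume "z \<in> g ` D"
      then obtain i where i: "i \<in> K" "z = g i" using D(2) C(2) by blast
      then have "0 < snd i \<and> P (fst i - snd i) (fst i + snd i) \<and> {fst i - snd i..fst i + snd i} \<subseteq> U"
        by (cases i) (simp add: K_def)
      then show "case z of (s,t) \<Rightarrow> s < t \<and> P s t \<and> {s..t} \<subseteq> U" using i by (simp add: g_def)
    qed
  qed
qed

text \<open>
  The sets where derivates behave badly are not known to be measurable, so their size is measured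
  by the infimum \<open>m\<close> over measurable supersets, the Lebesgue outer measure.
\<close>

lemma outer_approx:
  fixes E :: "real set"
  assumes E: "E \<subseteq> {a<..<b}" and "0 < \<delta>"
  defines "m \<equiv> Inf {measure lebesgue T |T. T \<in> lmeasurable \<and> E \<subseteq> T}"
  obtains U where "open U" "U \<in> lmeasurable" "E \<subseteq> U" "U \<subseteq> {a<..<b}" "measure lebesgue U < m + \<delta>"
proof -
  let ?S = "{measure lebesgue T |T. T \<in> lmeasurable \<and> E \<subseteq> T}"
  have "?S \<noteq> {}" using E by (auto intro!: exI[of _ "{a<..<b}"])
  then obtain x where "x \<in> ?S" "x < m + \<delta>/2"
    using cInf_lessD[of ?S "m + \<delta>/2"] \<open>0 < \<delta>\<close> unfolding m_def by auto
  then obtain T where T: "T \<in> lmeasurable" "E \<subseteq> T" "measure lebesgue T < m + \<delta>/2" by auto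
  obtain U where U: "open U" "T \<subseteq> U" "U - T \<in> lmeasurable" "emeasure lebesgue (U - T) < ennreal (\<delta>/2)"
    using sets_lebesgue_outer_open[of T "\<delta>/2"] T \<open>0 < \<delta>\<close> fmeasurableD by auto
  have lU: "U \<in> lmeasurable" using fmeasurable.Un[OF T(1) U(3)] U(2) by (simp add: Un_absorb1)
  have "measure lebesgue (U - T) < \<delta>/2"
    using U(3,4) \<open>0 < \<delta>\<close> by (simp add: emeasure_eq_measure2 ennreal_less_iff)
  moreover have "measure lebesgue (U - T) = measure lebesgue U - measure lebesgue T"
    using measurable_measure_Diff[OF lU _ U(2)] T(1) by (simp add: fmeasurableD)
  ultimately have mU: "measure lebesgue U < m + \<delta>" using T(3) by simp
  show ?thesis
  proof (rule that[of "U \<inter> {a<..<b}"])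
    show "U \<inter> {a<..<b} \<in> lmeasurable" by (rule fmeasurableI2[OF lU]) (use lU in auto)
    have "measure lebesgue (U \<inter> {a<..<b}) \<le> measure lebesgue U"
      by (rule measure_mono_fmeasurable[OF _ _ lU]) (use lU in auto)
    then show "measure lebesgue (U \<inter> {a<..<b}) < m + \<delta>" using mU by simp
  qed (use U T E in auto)
qed

lemma outer_le:
  assumes "T \<in> lmeasurable" "E \<subseteq> T"
  shows "Inf {measure lebesgue T |T. T \<in> lmeasurable \<and> E \<subseteq> T} \<le> measure lebesgue T"
  using assms by (intro cInf_lower) (auto intro!: bdd_belowI[of _ 0])

lemma outer_zero_imp_negligible:
  fixes E :: "real set"
  assumes E: "E \<subseteq> {a<..<b}"
    and m: "\<And>e. 0 < e \<Longrightarrow> Inf {measure lebesgue T |T. T \<in> lmeasurable \<and> E \<subseteq> T} \<le> e"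
  shows "negligible E"
  unfolding negligible_outer
proof (intro allI impI)
  fix e :: real assume "0 < e"
  obtain U where "open U" "U \<in> lmeasurable" "E \<subseteq> U" "U \<subseteq> {a<..<b}"
      "measure lebesgue U < Inf {measure lebesgue T |T. T \<in> lmeasurable \<and> E \<subseteq> T} + e/2"
    by (rule outer_approx[OF E half_gt_zero[OF \<open>0 < e\<close>]])
  then show "\<exists>T. E \<subseteq> T \<and> T \<in> lmeasurable \<and> measure lebesgue T < e"
    using m[of "e/2"] \<open>0 < e\<close> by (intro exI[of _ U]) auto
qed

lemma measure_disjoint_family:
  fixes \<J> :: "(real \<times> real) set"
  assumes "finite \<J>" "\<And>s t. (s,t) \<in> \<J> \<Longrightarrow> s < t"
    "pairwise (\<lambda>i j. {fst i..snd i} \<inter> {fst j..snd j} = {}) \<J>"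
  shows "(\<Union>(s,t)\<in>\<J>. {s..t}) \<in> lmeasurable"
    "measure lebesgue (\<Union>(s,t)\<in>\<J>. {s..t}) = (\<Sum>(s,t)\<in>\<J>. t - s)"
proof -
  show "(\<Union>(s,t)\<in>\<J>. {s..t}) \<in> lmeasurable"
    using assms(1) by (intro fmeasurable.finite_UN) (auto simp: split_beta)
  have "measure lebesgue (\<Union>i\<in>\<J>. {fst i..snd i}) = (\<Sum>i\<in>\<J>. measure lebesgue {fst i..snd i})"
    using assms(1,3) by (intro measure_finite_Union)
      (auto simp: disjoint_family_on_def pairwise_def emeasure_lborel_Icc_eq)
  also have "\<dots> = (\<Sum>i\<in>\<J>. snd i - fst i)"
    using assms(2) by (intro sum.cong) (auto simp: less_imp_le)
  finally show "measure lebesgue (\<Union>(s,t)\<in>\<J>. {s..t}) = (\<Sum>(s,t)\<in>\<J>. t - s)"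
    by (simp add: split_beta)
qed

text \<open>
  Every point of \<open>E\<close> lies in arbitrarily short intervals of slope at most \<open>u\<close> and in
  arbitrarily short intervals of slope at least \<open>v\<close>. Cover \<open>E\<close> by disjoint intervals \<open>\<I>\<close> of the
  first kind, of total length barely above the outer measure \<open>m\<close> of \<open>E\<close>, and then cover it again,
  inside them, by intervals \<open>\<J>\<close> of the second kind. Their total lengths agree up to a small error,
  so by absolute continuity the increments over \<open>\<I>\<close> and \<open>\<J>\<close> also agree up to a small error. But
  these are at most \<open>u m\<close> and at least \<open>v m\<close> approximately, which forces \<open>m = 0\<close>.
\<close>

lemma abs_cont_two_derivates_negligible:
  fixes F :: "real \<Rightarrow> real"
  assumes ac: "abs_cont_on a b F" and E: "E \<subseteq> {a<..<b}" and "u < v"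
    and lo: "\<And>x d. \<lbrakk>x \<in> E; 0 < d\<rbrakk> \<Longrightarrow> \<exists>s t. s \<le> x \<and> x \<le> t \<and> s < t \<and> t - s < d \<and> F t - F s \<le> u * (t - s)"
    and hi: "\<And>x d. \<lbrakk>x \<in> E; 0 < d\<rbrakk> \<Longrightarrow> \<exists>s t. s \<le> x \<and> x \<le> t \<and> s < t \<and> t - s < d \<and> v * (t - s) \<le> F t - F s"
  shows "negligible E"
proof (rule outer_zero_imp_negligible[OF E])
  define m where "m = Inf {measure lebesgue T |T. T \<in> lmeasurable \<and> E \<subseteq> T}"
  fix e :: real assume "0 < e"
  define k where "k = v - u"
  have "0 < k" using \<open>u < v\<close> by (simp add: k_def)
  have "0 < k*e/4" using \<open>0 < k\<close> \<open>0 < e\<close> by simp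
  obtain \<delta>0 where "0 < \<delta>0" and \<delta>0: "\<forall>(A::((real\<times>real)\<times>(real\<times>real)) set) s t. finite A \<longrightarrow> (\<forall>i\<in>A. a \<le> s i \<and> s i \<le> t i \<and> t i \<le> b) \<longrightarrow>
       pairwise (\<lambda>i j. {s i<..<t i} \<inter> {s j<..<t j} = {}) A \<longrightarrow> (\<Sum>i\<in>A. t i - s i) < \<delta>0 \<longrightarrow>
       (\<Sum>i\<in>A. norm (F (t i) - F (s i))) < k*e/4"
    using abs_cont_on_finite_family[OF ac \<open>0 < k*e/4\<close>] by (elim exE conjE) (rule that)
  \<comment> \<open>The gaps that \<open>\<J>\<close> leaves in \<open>\<I>\<close> will have total length below \<open>4 \<delta>\<close>, which must be small both for
    absolute continuity and in comparison with \<open>k e / \<bar>u\<bar>\<close>.\<close>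
  define \<delta> where "\<delta> = Min {\<delta>0/4, k*e/(16*(\<bar>u\<bar>+1)), e/8}"
  have \<delta>: "0 < \<delta>" "4*\<delta> \<le> \<delta>0" "\<delta> \<le> k*e/(16*(\<bar>u\<bar>+1))" "\<delta> \<le> e/8"
  proof -
    show "0 < \<delta>" unfolding \<delta>_def by (subst Min_gr_iff) (use \<open>0 < \<delta>0\<close> \<open>0 < k\<close> \<open>0 < e\<close> in auto)
    have "\<delta> \<le> \<delta>0/4" unfolding \<delta>_def by (rule Min_le) auto
    then show "4*\<delta> \<le> \<delta>0" by simp
    show "\<delta> \<le> k*e/(16*(\<bar>u\<bar>+1))" "\<delta> \<le> e/8" unfolding \<delta>_def by (rule Min_le; simp)+
  qed
  obtain U where U: "open U" "U \<in> lmeasurable" "E \<subseteq> U" "U \<subseteq> {a<..<b}" "measure lebesgue U < m + \<delta>"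
    using outer_approx[OF E \<delta>(1)] unfolding m_def by blast
  have lo': "\<forall>x\<in>E. \<forall>d>0. \<exists>s t. s \<le> x \<and> x \<le> t \<and> s < t \<and> t - s < d \<and> F t - F s \<le> u * (t - s)"
    using lo by simp
  obtain \<I> N1 where I: "finite \<I>" and I2: "\<forall>(s,t)\<in>\<I>. s < t \<and> F t - F s \<le> u * (t - s) \<and> {s..t} \<subseteq> U"
    and I3: "pairwise (\<lambda>i j. {fst i..snd i} \<inter> {fst j..snd j} = {}) \<I>"
    and N1: "N1 \<in> lmeasurable" and N1': "measure lebesgue N1 < \<delta>" and N1'': "E \<subseteq> (\<Union>(s,t)\<in>\<I>. {s..t}) \<union> N1"
    using vitali_finite_subfamily[OF U(1-3) \<delta>(1) lo'] by (elim exE conjE) (rule that)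
  have I2': "s < t \<and> F t - F s \<le> u * (t - s) \<and> {s..t} \<subseteq> U" if "(s,t) \<in> \<I>" for s t using I2 that by blast
  note I = I I2' I3 and N1 = N1 N1' N1''
  define U2 where "U2 = (\<Union>i\<in>\<I>. {fst i<..<snd i})"
  have U2: "open U2" "U2 \<subseteq> U" using I(2) by (force simp: U2_def)+
  have U2m: "U2 \<in> lmeasurable" by (rule fmeasurableI2[OF U(2) U2(2)]) (use U2 in auto)
  have hi2: "\<exists>s t. s \<le> x \<and> x \<le> t \<and> s < t \<and> t - s < d \<and> v * (t - s) \<le> F t - F s \<and> (\<exists>i\<in>\<I>. {s..t} \<subseteq> {fst i<..<snd i})"
    if x: "x \<in> E \<inter> U2" "0 < d" for x d
  proof -
    obtain i where i: "i \<in> \<I>" "fst i < x" "x < snd i" using x by (auto simp: U2_def)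
    obtain s t where st: "s \<le> x" "x \<le> t" "s < t" "t - s < min d (min (x - fst i) (snd i - x))" "v * (t - s) \<le> F t - F s"
      using hi[of x "min d (min (x - fst i) (snd i - x))"] i x by auto
    then show ?thesis using i by (intro exI[of _ s] exI[of _ t] conjI bexI[of _ i]) auto
  qed
  have EU: "E \<inter> U2 \<subseteq> U2" by blast
  have hi3: "\<forall>x\<in>E \<inter> U2. \<forall>d>0. \<exists>s t. s \<le> x \<and> x \<le> t \<and> s < t \<and> t - s < d \<and> v * (t - s) \<le> F t - F s \<and> (\<exists>i\<in>\<I>. {s..t} \<subseteq> {fst i<..<snd i})"
    using hi2 by simp
  obtain \<J> N2 where J: "finite \<J>" and J2: "\<forall>(s,t)\<in>\<J>. s < t \<and> (v * (t - s) \<le> F t - F s \<and> (\<exists>i\<in>\<I>. {s..t} \<subseteq> {fst i<..<snd i})) \<and> {s..t} \<subseteq> U2"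
    and J3: "pairwise (\<lambda>i j. {fst i..snd i} \<inter> {fst j..snd j} = {}) \<J>"
    and N2: "N2 \<in> lmeasurable" and N2': "measure lebesgue N2 < \<delta>" and N2'': "E \<inter> U2 \<subseteq> (\<Union>(s,t)\<in>\<J>. {s..t}) \<union> N2"
    using vitali_finite_subfamily[OF U2(1) U2m EU \<delta>(1) hi3] by (elim exE conjE) (rule that)
  have J2': "s < t \<and> (v * (t - s) \<le> F t - F s \<and> (\<exists>i\<in>\<I>. {s..t} \<subseteq> {fst i<..<snd i})) \<and> {s..t} \<subseteq> U2"
    if "(s,t) \<in> \<J>" for s t using J2 that by blast
  note J = J J2' J3 and N2 = N2 N2' N2''
  define SI where "SI = (\<Sum>(s,t)\<in>\<I>. t - s)"
  define SJ where "SJ = (\<Sum>(s,t)\<in>\<J>. t - s)"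
  have mI: "(\<Union>(s,t)\<in>\<I>. {s..t}) \<in> lmeasurable" "measure lebesgue (\<Union>(s,t)\<in>\<I>. {s..t}) = SI"
    using measure_disjoint_family[OF I(1) _ I(3)] I(2) by (auto simp: SI_def)
  have mJ: "(\<Union>(s,t)\<in>\<J>. {s..t}) \<in> lmeasurable" "measure lebesgue (\<Union>(s,t)\<in>\<J>. {s..t}) = SJ"
    using measure_disjoint_family[OF J(1) _ J(3)] J(2) by (auto simp: SJ_def)
  have "SI \<le> measure lebesgue U"
    unfolding mI(2)[symmetric] using mI(1) I(2) U(2) by (intro measure_mono_fmeasurable) (auto simp: fmeasurableD)
  then have SI: "SI < m + \<delta>" using U(5) by simp
  define N3 where "N3 = fst ` \<I> \<union> snd ` \<I>"
  have N3: "N3 \<in> null_sets lebesgue" unfolding N3_def using I(1) by (intro finite_imp_null_set_lborel null_sets_completionI) auto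
  have cov: "E \<subseteq> ((\<Union>(s,t)\<in>\<J>. {s..t}) \<union> N1 \<union> N2) \<union> N3"
  proof
    fix x assume x: "x \<in> E"
    show "x \<in> ((\<Union>(s,t)\<in>\<J>. {s..t}) \<union> N1 \<union> N2) \<union> N3"
    proof (cases "x \<in> N1 \<or> x \<in> N3")
      case False
      with x N1(3) obtain i where "i \<in> \<I>" "x \<in> {fst i..snd i}" by (auto simp: split_beta)
      moreover with False have "x \<noteq> fst i" "x \<noteq> snd i" by (auto simp: N3_def)
      ultimately have "x \<in> U2" unfolding U2_def by (intro UN_I[of i]) auto
      with x N2(3) show ?thesis by blast
    qed auto
  qed
  have "m \<le> measure lebesgue (((\<Union>(s,t)\<in>\<J>. {s..t}) \<union> N1 \<union> N2) \<union> N3)"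
    unfolding m_def using N3 negligible_iff_null_sets negligible_imp_measurable
    by (intro outer_le[OF _ cov] fmeasurable.Un mJ(1) N1(1) N2(1)) blast
  also have "\<dots> = measure lebesgue ((\<Union>(s,t)\<in>\<J>. {s..t}) \<union> N1 \<union> N2)"
    by (rule measure_Un_null_set[OF _ N3]) (use mJ(1) N1(1) N2(1) in \<open>auto simp: fmeasurableD\<close>)
  also have "\<dots> \<le> measure lebesgue ((\<Union>(s,t)\<in>\<J>. {s..t}) \<union> N1) + measure lebesgue N2"
    by (rule measure_Un_le) (use mJ(1) N1(1) N2(1) in \<open>auto simp: fmeasurableD\<close>)
  also have "\<dots> \<le> (SJ + measure lebesgue N1) + measure lebesgue N2"
    unfolding mJ(2)[symmetric]
    by (intro add_right_mono measure_Un_le) (use mJ(1) N1(1) N2(1) in \<open>auto simp: fmeasurableD\<close>)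
  finally have SJ: "m \<le> SJ + 2*\<delta>" using N1(2) N2(2) by simp
  define h where "h i = {j\<in>\<J>. {fst j..snd j} \<subseteq> {fst i<..<snd i}}" for i :: "real \<times> real"
  have hfin: "finite (h i)" for i using J(1) by (simp add: h_def)
  have ex: "\<exists>R. finite R \<and> (\<forall>s t. (s,t) \<in> R \<longrightarrow> fst i \<le> s \<and> s \<le> t \<and> t \<le> snd i) \<and>
    pairwise (\<lambda>i j. {fst i<..<snd i} \<inter> {fst j<..<snd j} = {}) R \<and>
    (\<forall>G::real\<Rightarrow>real. G (snd i) - G (fst i) = (\<Sum>(s,t)\<in>h i. G t - G s) + (\<Sum>(s,t)\<in>R. G t - G s))"
    if "i \<in> \<I>" for i
  proof -
    have le: "fst i \<le> snd i" using I(2)[of "fst i" "snd i"] that by simp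
    have mem: "fst i \<le> s \<and> s < t \<and> t \<le> snd i" if "(s,t) \<in> h i" for s t
    proof -
      have "s < t" "{s..t} \<subseteq> {fst i<..<snd i}" using that J(2) by (auto simp: h_def)
      then have "s \<in> {fst i<..<snd i}" "t \<in> {fst i<..<snd i}" by (meson atLeastAtMost_iff less_imp_le order_refl subsetD)+
      then show ?thesis using \<open>s < t\<close> by auto
    qed
    have dis: "pairwise (\<lambda>i j. {fst i..snd i} \<inter> {fst j..snd j} = {}) (h i)"
      by (rule pairwise_subset[OF J(3)]) (auto simp: h_def)
    show ?thesis by (rule complement_family[OF hfin le mem dis])
  qed
  have "\<forall>i\<in>\<I>. \<exists>R. finite R \<and> (\<forall>s t. (s,t) \<in> R \<longrightarrow> fst i \<le> s \<and> s \<le> t \<and> t \<le> snd i) \<and>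
    pairwise (\<lambda>i j. {fst i<..<snd i} \<inter> {fst j<..<snd j} = {}) R \<and>
    (\<forall>G::real\<Rightarrow>real. G (snd i) - G (fst i) = (\<Sum>(s,t)\<in>h i. G t - G s) + (\<Sum>(s,t)\<in>R. G t - G s))"
    using ex by (rule ballI)
  from bchoice[OF this] obtain R where RR: "\<forall>i\<in>\<I>. finite (R i) \<and> (\<forall>s t. (s,t) \<in> R i \<longrightarrow> fst i \<le> s \<and> s \<le> t \<and> t \<le> snd i) \<and>
    pairwise (\<lambda>i j. {fst i<..<snd i} \<inter> {fst j<..<snd j} = {}) (R i) \<and>
    (\<forall>G::real\<Rightarrow>real. G (snd i) - G (fst i) = (\<Sum>(s,t)\<in>h i. G t - G s) + (\<Sum>(s,t)\<in>R i. G t - G s))"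
    by (elim exE) (rule that)
  have R: "finite (R i)" "\<And>s t. (s,t) \<in> R i \<Longrightarrow> fst i \<le> s \<and> s \<le> t \<and> t \<le> snd i"
    "pairwise (\<lambda>i j. {fst i<..<snd i} \<inter> {fst j<..<snd j} = {}) (R i)"
    "\<And>G::real\<Rightarrow>real. G (snd i) - G (fst i) = (\<Sum>(s,t)\<in>h i. G t - G s) + (\<Sum>(s,t)\<in>R i. G t - G s)"
    if "i \<in> \<I>" for i using bspec[OF RR that] by simp_all
  define A where "A = (SIGMA i:\<I>. R i)"
  have split: "(\<Sum>(s,t)\<in>\<I>. G t - G s) = (\<Sum>(s,t)\<in>\<J>. G t - G s) + (\<Sum>i\<in>A. G (snd (snd i)) - G (fst (snd i)))"
    for G :: "real \<Rightarrow> real"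
  proof -
    have UJ: "\<J> = (\<Union>i\<in>\<I>. h i)" using J(2) by (fastforce simp: h_def)
    have "(\<Sum>(s,t)\<in>\<J>. G t - G s) = (\<Sum>i\<in>\<I>. \<Sum>(s,t)\<in>h i. G t - G s)"
      unfolding UJ
    proof (rule sum.UNION_disjoint)
      show "\<forall>i\<in>\<I>. \<forall>j\<in>\<I>. i \<noteq> j \<longrightarrow> h i \<inter> h j = {}"
      proof (intro ballI impI)
        fix i j assume ij: "i \<in> \<I>" "j \<in> \<I>" "i \<noteq> j"
        show "h i \<inter> h j = {}"
        proof (rule ccontr)
          assume "h i \<inter> h j \<noteq> {}"
          then obtain k where k: "k \<in> \<J>" "{fst k..snd k} \<subseteq> {fst i<..<snd i}" "{fst k..snd k} \<subseteq> {fst j<..<snd j}"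
            by (auto simp: h_def)
          have "fst k < snd k" using J(2)[of "fst k" "snd k"] k(1) by simp
          then have "fst k \<in> {fst i<..<snd i}" "fst k \<in> {fst j<..<snd j}" using k(2,3)
            by (meson atLeastAtMost_iff less_imp_le order_refl subsetD)+
          then have "fst k \<in> {fst i..snd i} \<inter> {fst j..snd j}" by auto
          then show False using I(3) ij unfolding pairwise_def by blast
        qed
      qed
    qed (use I(1) hfin in auto)
    moreover have "(\<Sum>i\<in>A. G (snd (snd i)) - G (fst (snd i))) = (\<Sum>i\<in>\<I>. \<Sum>(s,t)\<in>R i. G t - G s)"
      unfolding A_def using sum.Sigma[of \<I> R "\<lambda>i k. G (snd k) - G (fst k)"] I(1) R(1) by (simp add: split_beta)
    moreover have "(\<Sum>(s,t)\<in>\<I>. G t - G s) = (\<Sum>i\<in>\<I>. (\<Sum>(s,t)\<in>h i. G t - G s) + (\<Sum>(s,t)\<in>R i. G t - G s))"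
      unfolding split_beta using R(4)[of _ G] by (intro sum.cong) (auto simp: split_beta)
    ultimately show ?thesis by (simp add: sum.distrib)
  qed
  define SR where "SR = (\<Sum>i\<in>A. snd (snd i) - fst (snd i))"
  have S: "SI = SJ + SR" using split[of "\<lambda>x. x"] by (simp add: SI_def SJ_def SR_def)
  have "(\<Sum>i\<in>A. norm (F (snd (snd i)) - F (fst (snd i)))) < k*e/4"
  proof (rule \<delta>0[rule_format])
    show "finite A" unfolding A_def using I(1) R(1) by auto
    fix i assume "i \<in> A"
    then have i: "fst i \<in> \<I>" "snd i \<in> R (fst i)" by (auto simp: A_def)
    then have "fst (fst i) < snd (fst i)" "{fst (fst i)..snd (fst i)} \<subseteq> {a<..<b}"
      using I(2)[of "fst (fst i)" "snd (fst i)"] U(4) by auto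
    moreover then have "fst (fst i) \<in> {a<..<b}" "snd (fst i) \<in> {a<..<b}"
      by (meson atLeastAtMost_iff less_imp_le order_refl subsetD)+
    ultimately show "a \<le> fst (snd i) \<and> fst (snd i) \<le> snd (snd i) \<and> snd (snd i) \<le> b"
      using R(2)[OF i(1), of "fst (snd i)" "snd (snd i)"] i(2) by auto
  next
    show "pairwise (\<lambda>i j. {fst (snd i)<..<snd (snd i)} \<inter> {fst (snd j)<..<snd (snd j)} = {}) A"
    proof (rule pairwiseI)
      fix i j assume ij: "i \<in> A" "j \<in> A" "i \<noteq> j"
      then have m: "fst i \<in> \<I>" "snd i \<in> R (fst i)" "fst j \<in> \<I>" "snd j \<in> R (fst j)" by (auto simp: A_def)
      show "{fst (snd i)<..<snd (snd i)} \<inter> {fst (snd j)<..<snd (snd j)} = {}"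
      proof (cases "fst i = fst j")
        case True
        then have "snd i \<noteq> snd j" using ij(3) prod_eqI by blast
        then show ?thesis using R(3)[OF m(1)] m True unfolding pairwise_def by auto
      next
        case False
        then have "{fst (fst i)..snd (fst i)} \<inter> {fst (fst j)..snd (fst j)} = {}"
          using I(3) m unfolding pairwise_def by blast
        moreover have "{fst (snd i)<..<snd (snd i)} \<subseteq> {fst (fst i)..snd (fst i)}"
          "{fst (snd j)<..<snd (snd j)} \<subseteq> {fst (fst j)..snd (fst j)}"
          using R(2)[OF m(1), of "fst (snd i)" "snd (snd i)"] R(2)[OF m(3), of "fst (snd j)" "snd (snd j)"] m by auto
        ultimately show ?thesis by blast
      qed
    qed
  next
    show "(\<Sum>i\<in>A. snd (snd i) - fst (snd i)) < \<delta>0" using S SI SJ \<delta> by (simp add: SR_def)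
  qed
  then have FR: "\<bar>\<Sum>i\<in>A. F (snd (snd i)) - F (fst (snd i))\<bar> < k*e/4"
    by (intro le_less_trans[OF sum_abs]) simp
  have "(\<Sum>(s,t)\<in>\<I>. F t - F s) \<le> u * SI"
    unfolding SI_def sum_distrib_left using I(2) by (intro sum_mono) auto
  moreover have "v * SJ \<le> (\<Sum>(s,t)\<in>\<J>. F t - F s)"
    unfolding SJ_def sum_distrib_left using J(2) by (intro sum_mono) auto
  ultimately have "v * SJ - k*e/4 \<le> u * (SJ + SR)" using split[of F] FR S by simp
  then have 1: "k * SJ \<le> k*e/4 + u * SR" by (simp add: k_def algebra_simps)
  have SR0: "0 \<le> SR" unfolding SR_def A_def using R(2) by (intro sum_nonneg) auto
  have "u * SR \<le> (\<bar>u\<bar>+1) * (4*\<delta>)"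
    using SR0 S SI SJ \<delta>(1) by (intro mult_mono) auto
  also have "\<dots> \<le> (\<bar>u\<bar>+1) * (4 * (k*e/(16*(\<bar>u\<bar>+1))))"
    using \<delta>(3) by (intro mult_left_mono) auto
  also have "\<dots> = k*e/4" by (simp add: field_simps)
  finally have "k * SJ \<le> k * (e/2)" using 1 by simp
  then have "SJ \<le> e/2" using \<open>0 < k\<close> by (simp only: mult_le_cancel_left_pos)
  then have "m \<le> e" using SJ \<delta>(4) \<open>0 < e\<close> by linarith
  then show "Inf {measure lebesgue T |T. T \<in> lmeasurable \<and> E \<subseteq> T} \<le> e" by (simp add: m_def)
qed

text \<open>
  On an interval so short that the total variation of \<open>F\<close> is below 1, disjoint intervals of slope
  at least \<open>2 / e\<close> have total length at most \<open>e / 2\<close>.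
\<close>

lemma abs_cont_infinite_derivate_negligible:
  fixes F :: "real \<Rightarrow> real"
  assumes ac: "abs_cont_on a b F" and E: "E \<subseteq> {a<..<b}"
    and hi: "\<And>x d v. \<lbrakk>x \<in> E; 0 < d\<rbrakk> \<Longrightarrow> \<exists>s t. s \<le> x \<and> x \<le> t \<and> s < t \<and> t - s < d \<and> v * (t - s) \<le> F t - F s"
  shows "negligible E"
proof -
  obtain \<delta>0 where "0 < \<delta>0" and \<delta>0: "\<forall>(A::(real\<times>real) set) s t. finite A \<longrightarrow> (\<forall>i\<in>A. a \<le> s i \<and> s i \<le> t i \<and> t i \<le> b) \<longrightarrow>
       pairwise (\<lambda>i j. {s i<..<t i} \<inter> {s j<..<t j} = {}) A \<longrightarrow> (\<Sum>i\<in>A. t i - s i) < \<delta>0 \<longrightarrow>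
       (\<Sum>i\<in>A. norm (F (t i) - F (s i))) < 1"
    using abs_cont_on_finite_family[OF ac zero_less_one] by (elim exE conjE) (rule that)
  have neg: "negligible (E \<inter> {c<..<c+\<delta>0/2})" for c
  proof (rule outer_zero_imp_negligible)
    let ?E = "E \<inter> {c<..<c+\<delta>0/2}"
    show "?E \<subseteq> {a<..<b}" using E by blast
    fix e :: real assume "0 < e"
    define U where "U = {a<..<b} \<inter> {c<..<c+\<delta>0/2}"
    have U: "open U" "U \<in> lmeasurable" "?E \<subseteq> U"
      using E by (auto simp: U_def)
    have hi': "\<forall>x\<in>?E. \<forall>d>0. \<exists>s t. s \<le> x \<and> x \<le> t \<and> s < t \<and> t - s < d \<and> (2/e) * (t - s) \<le> F t - F s"
    proof (intro ballI allI impI)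
      fix x d :: real assume "x \<in> ?E" "0 < d"
      then show "\<exists>s t. s \<le> x \<and> x \<le> t \<and> s < t \<and> t - s < d \<and> (2/e) * (t - s) \<le> F t - F s"
        using hi[of x d "2/e"] by blast
    qed
    obtain \<J> N where J: "finite \<J>" and J2: "\<forall>(s,t)\<in>\<J>. s < t \<and> (2/e) * (t - s) \<le> F t - F s \<and> {s..t} \<subseteq> U"
      and J3: "pairwise (\<lambda>i j. {fst i..snd i} \<inter> {fst j..snd j} = {}) \<J>"
      and N: "N \<in> lmeasurable" and N': "measure lebesgue N < e/2" and N'': "?E \<subseteq> (\<Union>(s,t)\<in>\<J>. {s..t}) \<union> N"
      using vitali_finite_subfamily[OF U half_gt_zero[OF \<open>0 < e\<close>] hi'] by (elim exE conjE) (rule that)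
    have J2': "s < t \<and> (2/e) * (t - s) \<le> F t - F s \<and> {s..t} \<subseteq> U" if "(s,t) \<in> \<J>" for s t using J2 that by blast
    note J = J J2' J3 and N = N N' N''
    define SJ where "SJ = (\<Sum>(s,t)\<in>\<J>. t - s)"
    have mJ: "(\<Union>(s,t)\<in>\<J>. {s..t}) \<in> lmeasurable" "measure lebesgue (\<Union>(s,t)\<in>\<J>. {s..t}) = SJ"
      using measure_disjoint_family[OF J(1) _ J(3)] J(2) by (auto simp: SJ_def)
    have JU: "(\<Union>(s,t)\<in>\<J>. {s..t}) \<subseteq> {c..c+\<delta>0/2}" using J(2) by (fastforce simp: U_def)
    have "SJ \<le> measure lebesgue {c..c+\<delta>0/2}"
      unfolding mJ(2)[symmetric] using mJ(1) JU by (intro measure_mono_fmeasurable) (auto simp: fmeasurableD)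
    then have "SJ < \<delta>0" using \<open>0 < \<delta>0\<close> by simp
    have "(\<Sum>i\<in>\<J>. norm (F (snd i) - F (fst i))) < 1"
    proof (rule \<delta>0[rule_format])
      fix i assume "i \<in> \<J>"
      then have "fst i < snd i" "{fst i..snd i} \<subseteq> {a<..<b}" using J(2)[of "fst i" "snd i"] by (auto simp: U_def)
      moreover then have "fst i \<in> {a<..<b}" "snd i \<in> {a<..<b}"
        by (meson atLeastAtMost_iff less_imp_le order_refl subsetD)+
      ultimately show "a \<le> fst i \<and> fst i \<le> snd i \<and> snd i \<le> b" by auto
    next
      show "pairwise (\<lambda>i j. {fst i<..<snd i} \<inter> {fst j<..<snd j} = {}) \<J>"
        by (rule pairwise_mono[OF J(3)]) (auto simp del: greaterThanLessThan_iff atLeastAtMost_iff intro: subsetD[OF greaterThanLessThan_subseteq_atLeastAtMost_iff[THEN iffD2]])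
    next
      show "(\<Sum>i\<in>\<J>. snd i - fst i) < \<delta>0" using \<open>SJ < \<delta>0\<close> by (simp add: SJ_def split_beta)
    qed (use J in auto)
    moreover have "(\<Sum>i\<in>\<J>. F (snd i) - F (fst i)) \<le> (\<Sum>i\<in>\<J>. norm (F (snd i) - F (fst i)))"
      by (intro sum_mono) auto
    ultimately have "(\<Sum>(s,t)\<in>\<J>. F t - F s) < 1" unfolding split_beta by linarith
    moreover have "(2/e) * SJ \<le> (\<Sum>(s,t)\<in>\<J>. F t - F s)"
      unfolding SJ_def sum_distrib_left using J(2) by (intro sum_mono) auto
    ultimately have "(2/e) * SJ \<le> 1" by linarith
    then have "SJ \<le> e/2" using \<open>0 < e\<close> by (simp add: field_simps)
    have "Inf {measure lebesgue T |T. T \<in> lmeasurable \<and> ?E \<subseteq> T} \<le> measure lebesgue ((\<Union>(s,t)\<in>\<J>. {s..t}) \<union> N)"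
      by (rule outer_le[OF _ N(3)]) (use mJ N in auto)
    also have "\<dots> \<le> SJ + measure lebesgue N"
      unfolding mJ(2)[symmetric] by (rule measure_Un_le) (use mJ N in \<open>auto simp: fmeasurableD\<close>)
    finally show "Inf {measure lebesgue T |T. T \<in> lmeasurable \<and> ?E \<subseteq> T} \<le> e"
      using \<open>SJ \<le> e/2\<close> N(2) by simp
  qed
  have "E \<subseteq> (\<Union>k::int. E \<inter> {of_int k * (\<delta>0/4)<..<of_int k * (\<delta>0/4)+\<delta>0/2})"
  proof
    fix x assume "x \<in> E"
    define k where "k = \<lceil>x / (\<delta>0/4)\<rceil> - 1"
    have "of_int k < x / (\<delta>0/4)" "x / (\<delta>0/4) < of_int k + 2" unfolding k_def by linarith+
    then have "of_int k * (\<delta>0/4) < x" "x < of_int k * (\<delta>0/4) + \<delta>0/2"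
      using \<open>0 < \<delta>0\<close> by (simp_all add: field_simps)
    with \<open>x \<in> E\<close> show "x \<in> (\<Union>k::int. E \<inter> {of_int k * (\<delta>0/4)<..<of_int k * (\<delta>0/4)+\<delta>0/2})" by auto
  qed
  moreover have "negligible (\<Union>k::int. E \<inter> {of_int k * (\<delta>0/4)<..<of_int k * (\<delta>0/4)+\<delta>0/2})"
    by (rule negligible_countable_Union) (use neg in auto)
  ultimately show ?thesis using negligible_subset by blast
qed

text \<open>
  If \<open>x\<close> belongs to none of the exceptional sets of the two preceding lemmas, the infimum \<open>L\<close>
  of the numbers that exceed the slopes over all short intervals around \<open>x\<close> is finite and is the
  derivative at \<open>x\<close>.
\<close>

lemma abs_cont_differentiable_ae_real:
  fixes F :: "real \<Rightarrow> real"
  assumes ac: "abs_cont_on a b F"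
  shows "negligible {x\<in>{a<..<b}. \<not> F differentiable (at x)}"
proof -
  define hi where "hi v = {x\<in>{a<..<b}. \<forall>d>0. \<exists>s t. s \<le> x \<and> x \<le> t \<and> s < t \<and> t - s < d \<and> v * (t - s) \<le> F t - F s}" for v
  define lo where "lo v = {x\<in>{a<..<b}. \<forall>d>0. \<exists>s t. s \<le> x \<and> x \<le> t \<and> s < t \<and> t - s < d \<and> F t - F s \<le> v * (t - s)}" for v
  define N1 where "N1 = (\<Inter>v. hi v)"
  define N2 where "N2 = (\<Inter>v. lo v)"
  define N3 where "N3 = (\<Union>u\<in>\<rat>. \<Union>v\<in>{v\<in>\<rat>. u < v}. lo u \<inter> hi v)"
  have "negligible N1"
    by (rule abs_cont_infinite_derivate_negligible[OF ac]) (auto simp: N1_def hi_def)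
  moreover have "negligible N2"
  proof (rule abs_cont_infinite_derivate_negligible)
    have "norm (- F u - - F v) = norm (F u - F v)" for u v by simp
    then show "abs_cont_on a b (\<lambda>x. - F x)" using ac unfolding abs_cont_on_def by presburger
    fix x d v :: real assume "x \<in> N2" "0 < d"
    then obtain s t where "s \<le> x" "x \<le> t" "s < t" "t - s < d" "F t - F s \<le> (-v) * (t - s)"
      unfolding N2_def lo_def by blast
    then show "\<exists>s t. s \<le> x \<and> x \<le> t \<and> s < t \<and> t - s < d \<and> v * (t - s) \<le> - F t - - F s"
      by (intro exI[of _ s] exI[of _ t]) auto
  qed (auto simp: N2_def lo_def)
  moreover have "negligible N3"
  proof -
    have "negligible (lo u \<inter> hi v)" if "u < v" for u v
      by (rule abs_cont_two_derivates_negligible[OF ac _ that]) (auto simp: lo_def hi_def)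
    then have 1: "negligible (\<Union>v\<in>{v\<in>\<rat>. u < v}. lo u \<inter> hi v)" for u
      by (intro negligible_countable_Union countable_image countable_subset[OF _ countable_rat]) auto
    then show ?thesis unfolding N3_def by (intro negligible_countable_Union countable_image countable_rat) auto
  qed
  ultimately have "negligible (N1 \<union> N2 \<union> N3)" by simp
  moreover have "{x\<in>{a<..<b}. \<not> F differentiable (at x)} \<subseteq> N1 \<union> N2 \<union> N3"
  proof (rule subsetI, rule ccontr)
    fix x assume x: "x \<in> {x\<in>{a<..<b}. \<not> F differentiable (at x)}" "x \<notin> N1 \<union> N2 \<union> N3"
    then have ab: "x \<in> {a<..<b}" and n1: "x \<notin> N1" and n2: "x \<notin> N2" and n3: "x \<notin> N3" by auto
    define L where "L = Inf {v. x \<notin> hi v}"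
    obtain v0 where v0: "x \<notin> hi v0" using n1 by (auto simp: N1_def)
    obtain u0 where u0: "x \<notin> lo u0" using n2 by (auto simp: N2_def)
    have hilo: "x \<in> lo v \<or> x \<in> hi v" for v
    proof (rule ccontr)
      assume "\<not> (x \<in> lo v \<or> x \<in> hi v)"
      then obtain d d' where d: "0 < d" "0 < d'"
        "\<And>s t. s \<le> x \<Longrightarrow> x \<le> t \<Longrightarrow> s < t \<Longrightarrow> t - s < d \<Longrightarrow> \<not> F t - F s \<le> v * (t - s)"
        "\<And>s t. s \<le> x \<Longrightarrow> x \<le> t \<Longrightarrow> s < t \<Longrightarrow> t - s < d' \<Longrightarrow> \<not> v * (t - s) \<le> F t - F s"
        using ab unfolding lo_def hi_def mem_Collect_eq by blast
      define y where "y = min d d' / 2"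
      have y: "0 < y" "y < d" "y < d'" using d(1,2) by (auto simp: y_def min_def)
      show False using d(3)[of x "x + y"] d(4)[of x "x + y"] y by simp
    qed
    have himono: "x \<in> hi u" if "x \<in> hi v" "u \<le> v" for u v
    proof -
      have "\<exists>s t. s \<le> x \<and> x \<le> t \<and> s < t \<and> t - s < d \<and> u * (t - s) \<le> F t - F s" if "0 < d" for d
      proof -
        obtain s t where st: "s \<le> x" "x \<le> t" "s < t" "t - s < d" "v * (t - s) \<le> F t - F s"
          using \<open>x \<in> hi v\<close> \<open>0 < d\<close> unfolding hi_def by blast
        moreover have "u * (t - s) \<le> F t - F s"
          by (rule order_trans[OF mult_right_mono[OF \<open>u \<le> v\<close>] st(5)]) (use st in simp)
        ultimately show ?thesis by blast
      qed
      then show ?thesis using ab by (simp add: hi_def)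
    qed
    have lomono: "x \<in> lo v" if "x \<in> lo u" "u \<le> v" for u v
    proof -
      have "\<exists>s t. s \<le> x \<and> x \<le> t \<and> s < t \<and> t - s < d \<and> F t - F s \<le> v * (t - s)" if "0 < d" for d
      proof -
        obtain s t where st: "s \<le> x" "x \<le> t" "s < t" "t - s < d" "F t - F s \<le> u * (t - s)"
          using \<open>x \<in> lo u\<close> \<open>0 < d\<close> unfolding lo_def by blast
        moreover have "F t - F s \<le> v * (t - s)"
          by (rule order_trans[OF st(5) mult_right_mono[OF \<open>u \<le> v\<close>]]) (use st in simp)
        ultimately show ?thesis by blast
      qed
      then show ?thesis using ab by (simp add: lo_def)
    qed
    have bdd: "bdd_below {v. x \<notin> hi v}"
    proof (rule bdd_belowI[of _ u0], rule ccontr)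
      fix v assume "v \<in> {v. x \<notin> hi v}" "\<not> u0 \<le> v"
      then show False using hilo[of v] lomono[of v u0] u0 by auto
    qed
    have above: "x \<notin> hi v" if "L < v" for v
    proof
      assume hv: "x \<in> hi v"
      obtain v' where "x \<notin> hi v'" "v' < v"
        using cInf_lessD[of "{v. x \<notin> hi v}" v] \<open>L < v\<close> v0 by (auto simp: L_def)
      then show False using himono[OF hv, of v'] by auto
    qed
    have below: "x \<notin> lo u" if uL: "u < L" for u
    proof
      assume lu: "x \<in> lo u"
      obtain u' where u': "u' \<in> \<rat>" "u < u'" "u' < L" using Rats_dense_in_real[OF uL] by auto
      obtain v' where v': "v' \<in> \<rat>" "u' < v'" "v' < L" using Rats_dense_in_real[OF u'(3)] by auto
      have "x \<in> hi v'"
      proof (rule ccontr)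
        assume "x \<notin> hi v'"
        then have "L \<le> v'" unfolding L_def by (intro cInf_lower bdd) auto
        then show False using v' by simp
      qed
      moreover have "x \<in> lo u'" using lomono[OF lu, of u'] u' by simp
      ultimately have "x \<in> N3" using u' v' unfolding N3_def by blast
      then show False using n3 by simp
    qed
    have "(F has_real_derivative L) (at x)"
      unfolding has_field_derivative_iff LIM_eq
    proof (intro allI impI)
      fix e :: real assume "0 < e"
      obtain d where d: "0 < d"
        "\<And>s t. s \<le> x \<Longrightarrow> x \<le> t \<Longrightarrow> s < t \<Longrightarrow> t - s < d \<Longrightarrow> F t - F s < (L+e) * (t - s)"
        using above[of "L+e"] \<open>0 < e\<close> ab unfolding hi_def by force
      obtain d' where d': "0 < d'"
        "\<And>s t. s \<le> x \<Longrightarrow> x \<le> t \<Longrightarrow> s < t \<Longrightarrow> t - s < d' \<Longrightarrow> (L-e) * (t - s) < F t - F s"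
        using below[of "L-e"] \<open>0 < e\<close> ab unfolding lo_def by force
      show "\<exists>s>0. \<forall>y. y \<noteq> x \<and> norm (y - x) < s \<longrightarrow> norm ((F y - F x) / (y - x) - L) < e"
      proof (intro exI[of _ "min d d'"] conjI allI impI)
        fix y assume y: "y \<noteq> x \<and> norm (y - x) < min d d'"
        show "norm ((F y - F x) / (y - x) - L) < e"
        proof (cases "x < y")
          case True
          have "F y - F x < (L+e) * (y - x)" "(L-e) * (y - x) < F y - F x"
            using d(2)[of x y] d'(2)[of x y] True y by auto
          then have "(F y - F x) / (y - x) < L + e" "L - e < (F y - F x) / (y - x)"
            using True by (simp_all add: pos_divide_less_eq pos_less_divide_eq)
          then show ?thesis by (simp add: abs_less_iff)
        next
          case False
          then have "y < x" using y by auto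
          have "F x - F y < (L+e) * (x - y)" "(L-e) * (x - y) < F x - F y"
            using d(2)[of y x] d'(2)[of y x] \<open>y < x\<close> y by auto
          then have "(F x - F y) / (x - y) < L + e" "L - e < (F x - F y) / (x - y)"
            using \<open>y < x\<close> by (simp_all add: pos_divide_less_eq pos_less_divide_eq)
          moreover have "(F x - F y) / (x - y) = (F y - F x) / (y - x)"
            by (metis minus_diff_eq minus_divide_divide)
          ultimately show ?thesis by (simp add: abs_less_iff)
        qed
      qed (use d(1) d'(1) in auto)
    qed
    then have "F differentiable (at x)" using real_differentiable_def by blast
    then show False using x by auto
  qed
  ultimately show ?thesis using negligible_subset by blast
qed

lemma emeasure_Ioo_finite: "emeasure lborel {l<..<u::real} \<noteq> top"
  by (cases "l \<le> u") simp_all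

text \<open>
  Choose a gauge that follows the derivative outside the null set and confines the intervals
  tagged in the null set to an open set of small measure. The terms of the first kind approximate
  increments of \<open>F\<close>; those of the second kind are small by absolute continuity.
\<close>

lemma abs_cont_has_integral:
  fixes F f :: "real \<Rightarrow> 'a::banach"
  assumes ac: "abs_cont_on a b F" and "a \<le> b" and N: "negligible N"
    and deriv: "\<And>x. x \<in> {a<..<b} - N \<Longrightarrow> (F has_vector_derivative f x) (at x)"
  shows "(f has_integral (F b - F a)) {a..b}"
proof -
  define M where "M = (N \<inter> {a..b}) \<union> {a,b}"
  have M: "negligible M" using N by (auto simp: M_def intro: negligible_subset)
  \<comment> \<open>Modified on \<open>M\<close>, so that Riemann sums see only increments of \<open>F\<close> there.\<close>
  define k where "k x = (if x \<in> M then 0 else f x)" for x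
  have "(k has_integral (F b - F a)) {a..b}"
    unfolding has_integral_real
  proof (intro allI impI)
    fix e :: real assume "0 < e"
    define \<epsilon> where "\<epsilon> = e / (2 * (b - a + 1))"
    have "0 < \<epsilon>" using \<open>0 < e\<close> \<open>a \<le> b\<close> by (simp add: \<epsilon>_def)
    obtain \<delta> where "0 < \<delta>" and \<delta>: "\<forall>(A::(real\<times>real set) set) s t. finite A \<longrightarrow> (\<forall>i\<in>A. a \<le> s i \<and> s i \<le> t i \<and> t i \<le> b) \<longrightarrow>
       pairwise (\<lambda>i j. {s i<..<t i} \<inter> {s j<..<t j} = {}) A \<longrightarrow> (\<Sum>i\<in>A. t i - s i) < \<delta> \<longrightarrow>
       (\<Sum>i\<in>A. norm (F (t i) - F (s i))) < e/2"
      using abs_cont_on_finite_family[OF ac half_gt_zero[OF \<open>0 < e\<close>]] by (elim exE conjE) (rule that)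
    have Ms: "M \<in> sets lebesgue" using M by (simp add: negligible_imp_sets)
    obtain U where U: "open U" "M \<subseteq> U" "U - M \<in> lmeasurable" "emeasure lebesgue (U - M) < ennreal \<delta>"
      using sets_lebesgue_outer_open[OF Ms \<open>0 < \<delta>\<close>] by blast
    have lU: "U \<in> lmeasurable" using fmeasurable.Un[OF negligible_imp_measurable[OF M] U(3)] U(2) by (simp add: Un_absorb1)
    have mU: "measure lebesgue U < \<delta>"
    proof -
      have "measure lebesgue (U - M) < \<delta>" using U(3,4) \<open>0 < \<delta>\<close> by (simp add: emeasure_eq_measure2 ennreal_less_iff)
      then show ?thesis using M lU by (simp add: measure_Diff_null_set negligible_iff_null_sets fmeasurableD)
    qed
    have "\<exists>d>0. \<forall>y. norm (y - x) < d \<longrightarrow> norm (F y - F x - (y - x) *\<^sub>R f x) \<le> \<epsilon> * norm (y - x)" if "x \<in> {a<..<b} - M" for x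
    proof -
      have "(F has_vector_derivative f x) (at x)" using deriv that by (auto simp: M_def)
      then show ?thesis unfolding has_vector_derivative_def has_derivative_at_alt using \<open>0 < \<epsilon>\<close> by blast
    qed
    then obtain d where d: "\<And>x. x \<in> {a<..<b} - M \<Longrightarrow> 0 < d x \<and> (\<forall>y. norm (y - x) < d x \<longrightarrow> norm (F y - F x - (y - x) *\<^sub>R f x) \<le> \<epsilon> * norm (y - x))"
      by metis
    define \<gamma> where "\<gamma> x = (if x \<in> M then U else if x \<in> {a<..<b} then ball x (d x) else ball x 1)" for x
    show "\<exists>\<gamma>. gauge \<gamma> \<and> (\<forall>\<D>. \<D> tagged_division_of {a..b} \<and> \<gamma> fine \<D> \<longrightarrow>
           norm ((\<Sum>(x,K)\<in>\<D>. measure lborel K *\<^sub>R k x) - (F b - F a)) < e)"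
    proof (intro exI[of _ \<gamma>] conjI allI impI)
      show "gauge \<gamma>" using U d by (auto simp: gauge_def \<gamma>_def)
      fix \<D> assume D: "\<D> tagged_division_of {a..b} \<and> \<gamma> fine \<D>"
      then have Dt: "\<D> tagged_division_of {a..b}" and fine: "\<And>x K. (x,K) \<in> \<D> \<Longrightarrow> K \<subseteq> \<gamma> x" by auto
      have fin: "finite \<D>" using Dt by auto
      have Dk: "\<exists>u v. K = {u..v} \<and> u \<le> x \<and> x \<le> v \<and> a \<le> u \<and> v \<le> b" if z: "(x,K) \<in> \<D>" for x K
      proof -
        obtain u v where uv: "K = {u..v}" using tagged_division_ofD(4)[OF Dt z] by auto
        have "x \<in> K" "K \<subseteq> {a..b}" using tagged_division_ofD(2,3)[OF Dt z] by auto
        then show ?thesis using uv by (intro exI[of _ u] exI[of _ v]) auto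
      qed
      define A where "A = {z\<in>\<D>. fst z \<in> M}"
      define G where "G K = F (Sup K) - F (Inf K)" for K
      have sumG: "(\<Sum>(x,K)\<in>\<D>. G K) = F b - F a"
        unfolding G_def by (rule additive_tagged_division_1[OF \<open>a \<le> b\<close> Dt])
      have out: "norm (measure lborel K *\<^sub>R k x - G K) \<le> \<epsilon> * measure lborel K" if z: "(x,K) \<in> \<D> - A" for x K
      proof -
        have xM: "x \<notin> M" using z by (auto simp: A_def)
        obtain u v where uv: "K = {u..v}" "u \<le> x" "x \<le> v" "a \<le> u" "v \<le> b" using Dk z by blast
        then have x: "x \<in> {a<..<b} - M" using xM by (auto simp: M_def)
        have "K \<subseteq> ball x (d x)" using fine[of x K] z x by (auto simp: \<gamma>_def)
        moreover have "u \<in> K" "v \<in> K" using uv by auto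
        ultimately have "u \<in> ball x (d x)" "v \<in> ball x (d x)" by blast+
        then have "norm (u - x) < d x" "norm (v - x) < d x" by (simp_all add: dist_real_def abs_minus_commute)
        then have "norm (F u - F x - (u - x) *\<^sub>R f x) \<le> \<epsilon> * norm (u - x)"
          "norm (F v - F x - (v - x) *\<^sub>R f x) \<le> \<epsilon> * norm (v - x)" using d[OF x] by auto
        moreover have "measure lborel K *\<^sub>R k x - G K = (F u - F x - (u - x) *\<^sub>R f x) - (F v - F x - (v - x) *\<^sub>R f x)"
          using uv xM by (simp add: k_def G_def algebra_simps)
        moreover have "norm ((F u - F x - (u - x) *\<^sub>R f x) - (F v - F x - (v - x) *\<^sub>R f x))
            \<le> norm (F u - F x - (u - x) *\<^sub>R f x) + norm (F v - F x - (v - x) *\<^sub>R f x)"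
          by (rule norm_triangle_ineq4)
        ultimately have "norm (measure lborel K *\<^sub>R k x - G K) \<le> \<epsilon> * norm (u - x) + \<epsilon> * norm (v - x)"
          by (simp only:)
        also have "\<dots> = \<epsilon> * measure lborel K" using uv by (simp add: algebra_simps)
        finally show ?thesis .
      qed
      have finA: "finite A" using fin by (simp add: A_def)
      have disj: "pairwise (\<lambda>i j. {Inf (snd i)<..<Sup (snd i)} \<inter> {Inf (snd j)<..<Sup (snd j)} = {}) A"
      proof (rule pairwiseI)
        fix i j assume "i \<in> A" "j \<in> A" "i \<noteq> j"
        then have ij: "(fst i, snd i) \<in> \<D>" "(fst j, snd j) \<in> \<D>" "(fst i, snd i) \<noteq> (fst j, snd j)" by (auto simp: A_def)
        have "interior (snd i) \<inter> interior (snd j) = {}" by (rule tagged_division_ofD(5)[OF Dt ij])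
        then show "{Inf (snd i)<..<Sup (snd i)} \<inter> {Inf (snd j)<..<Sup (snd j)} = {}"
          using Dk[OF ij(1)] Dk[OF ij(2)] by (auto simp: interior_atLeastAtMost_real)
      qed
      have sumA: "(\<Sum>i\<in>A. Sup (snd i) - Inf (snd i)) \<le> measure lebesgue U"
      proof -
        have "(\<Sum>i\<in>A. Sup (snd i) - Inf (snd i)) = (\<Sum>i\<in>A. measure lebesgue {Inf (snd i)<..<Sup (snd i)})"
        proof (rule sum.cong[OF refl])
          fix i assume "i \<in> A"
          then have "(fst i, snd i) \<in> \<D>" by (auto simp: A_def)
          from Dk[OF this] show "Sup (snd i) - Inf (snd i) = measure lebesgue {Inf (snd i)<..<Sup (snd i)}" by auto
        qed
        also have "\<dots> = measure lebesgue (\<Union>i\<in>A. {Inf (snd i)<..<Sup (snd i)})"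
          using finA disj by (intro measure_finite_Union[symmetric])
            (auto simp: disjoint_family_on_def pairwise_def emeasure_Ioo_finite)
        also have "\<dots> \<le> measure lebesgue U"
        proof (rule measure_mono_fmeasurable[OF _ _ lU])
          show "(\<Union>i\<in>A. {Inf (snd i)<..<Sup (snd i)}) \<subseteq> U"
          proof
            fix y assume "y \<in> (\<Union>i\<in>A. {Inf (snd i)<..<Sup (snd i)})"
            then obtain i where i: "i \<in> A" "y \<in> {Inf (snd i)<..<Sup (snd i)}" by blast
            then have z: "(fst i, snd i) \<in> \<D>" "fst i \<in> M" unfolding A_def by simp_all
            have "snd i \<subseteq> U" using fine[OF z(1)] z(2) by (simp add: \<gamma>_def)
            moreover obtain u v where "snd i = {u..v}" "u \<le> v" using Dk[OF z(1)] by (metis order_trans)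
            then have "y \<in> snd i" using i(2) by simp
            ultimately show "y \<in> U" by blast
          qed
        qed (use finA in auto)
        finally show ?thesis .
      qed
      have inA: "(\<Sum>i\<in>A. norm (F (Sup (snd i)) - F (Inf (snd i)))) < e/2"
      proof (rule \<delta>[rule_format, OF finA _ disj])
        fix i assume "i \<in> A"
        then have "(fst i, snd i) \<in> \<D>" by (auto simp: A_def)
        from Dk[OF this] show "a \<le> Inf (snd i) \<and> Inf (snd i) \<le> Sup (snd i) \<and> Sup (snd i) \<le> b" by auto
      qed (use sumA mU in simp)
      have "(\<Sum>(x,K)\<in>\<D>. measure lborel K *\<^sub>R k x) - (F b - F a) = (\<Sum>(x,K)\<in>\<D>. measure lborel K *\<^sub>R k x - G K)"
        unfolding sumG[symmetric] by (simp add: split_beta sum_subtractf)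
      then have "norm ((\<Sum>(x,K)\<in>\<D>. measure lborel K *\<^sub>R k x) - (F b - F a)) \<le> (\<Sum>(x,K)\<in>\<D>. norm (measure lborel K *\<^sub>R k x - G K))"
        by (simp add: norm_sum split_beta)
      also have "\<dots> = (\<Sum>(x,K)\<in>\<D>-A. norm (measure lborel K *\<^sub>R k x - G K)) + (\<Sum>(x,K)\<in>A. norm (measure lborel K *\<^sub>R k x - G K))"
        using fin by (intro sum.subset_diff) (auto simp: A_def)
      also have "(\<Sum>(x,K)\<in>A. norm (measure lborel K *\<^sub>R k x - G K)) = (\<Sum>i\<in>A. norm (F (Sup (snd i)) - F (Inf (snd i))))"
        by (rule sum.cong) (auto simp: A_def k_def G_def intro: norm_minus_commute)
      also have "(\<Sum>(x,K)\<in>\<D>-A. norm (measure lborel K *\<^sub>R k x - G K)) \<le> (\<Sum>(x,K)\<in>\<D>-A. \<epsilon> * measure lborel K)"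
        using out by (intro sum_mono) auto
      also have "\<dots> \<le> (\<Sum>(x,K)\<in>\<D>. \<epsilon> * measure lborel K)"
        using fin \<open>0 < \<epsilon>\<close> by (intro sum_mono2) (auto intro: mult_nonneg_nonneg)
      also have "\<dots> = \<epsilon> * (b - a)"
        using additive_content_tagged_division[of \<D> a b] Dt \<open>a \<le> b\<close> by (simp add: sum_distrib_left[symmetric] split_beta)
      also have "\<dots> \<le> e/2"
      proof -
        have "e * (b - a) \<le> e * (b - a + 1)" using \<open>0 < e\<close> by (intro mult_left_mono) auto
        then show ?thesis using \<open>a \<le> b\<close> by (simp add: \<epsilon>_def field_simps)
      qed
      finally show "norm ((\<Sum>(x,K)\<in>\<D>. measure lborel K *\<^sub>R k x) - (F b - F a)) < e" using inA by linarith
    qed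
  qed
  then show ?thesis by (rule has_integral_spike[OF M, rotated]) (auto simp: k_def)
qed

lemma abs_cont_differentiable_ae:
  fixes F :: "real \<Rightarrow> 'a::euclidean_space"
  assumes ac: "abs_cont_on a b F"
  shows "negligible {x\<in>{a<..<b}. \<not> F differentiable (at x)}"
proof -
  have "abs_cont_on a b (\<lambda>x. F x \<bullet> i)" if i: "i \<in> Basis" for i
    unfolding abs_cont_on_def
  proof (intro allI impI)
    fix \<epsilon> :: real assume "0 < \<epsilon>"
    from ac[unfolded abs_cont_on_def, rule_format, OF this]
    obtain \<delta> where "\<delta> > 0" and \<delta>: "\<forall>(n::nat) s t.
     (\<forall>i<n. a \<le> s i \<and> s i \<le> t i \<and> t i \<le> b) \<and>
     (\<forall>i<n. \<forall>j<n. i \<noteq> j \<longrightarrow> {s i<..<t i} \<inter> {s j<..<t j} = {}) \<and>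
     (\<Sum>i<n. t i - s i) < \<delta> \<longrightarrow> (\<Sum>i<n. norm (F (t i) - F (s i))) < \<epsilon>"
      by (elim exE conjE) (rule that)
    have le: "(\<Sum>k<n. norm (F (t k) \<bullet> i - F (s k) \<bullet> i)) \<le> (\<Sum>k<n. norm (F (t k) - F (s k)))" for n :: nat and s t
      using Basis_le_norm[OF i] by (intro sum_mono) (simp add: inner_diff_left[symmetric])
    show "\<exists>\<delta>>0. \<forall>(n::nat) s t.
     (\<forall>i<n. a \<le> s i \<and> s i \<le> t i \<and> t i \<le> b) \<and>
     (\<forall>i<n. \<forall>j<n. i \<noteq> j \<longrightarrow> {s i<..<t i} \<inter> {s j<..<t j} = {}) \<and>
     (\<Sum>i<n. t i - s i) < \<delta> \<longrightarrow> (\<Sum>k<n. norm (F (t k) \<bullet> i - F (s k) \<bullet> i)) < \<epsilon>"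
    proof (intro exI[of _ \<delta>] conjI \<open>\<delta> > 0\<close> allI impI)
      fix n :: nat and s t
      assume "(\<forall>i<n. a \<le> s i \<and> s i \<le> t i \<and> t i \<le> b) \<and>
       (\<forall>i<n. \<forall>j<n. i \<noteq> j \<longrightarrow> {s i<..<t i} \<inter> {s j<..<t j} = {}) \<and> (\<Sum>i<n. t i - s i) < \<delta>"
      from le_less_trans[OF le \<delta>[rule_format, OF this]]
      show "(\<Sum>k<n. norm (F (t k) \<bullet> i - F (s k) \<bullet> i)) < \<epsilon>" .
    qed
  qed
  then have neg: "negligible {x\<in>{a<..<b}. \<not> (\<lambda>x. F x \<bullet> i) differentiable (at x)}" if "i \<in> Basis" for i
    using abs_cont_differentiable_ae_real that by blast
  have "{x\<in>{a<..<b}. \<not> F differentiable (at x)} \<subseteq> (\<Union>i\<in>Basis. {x\<in>{a<..<b}. \<not> (\<lambda>x. F x \<bullet> i) differentiable (at x)})"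
    using differentiable_componentwise_within[of F _ UNIV] by auto
  moreover have "negligible (\<Union>i\<in>Basis. {x\<in>{a<..<b}. \<not> (\<lambda>x. F x \<bullet> i) differentiable (at x)})"
    using neg by (intro negligible_Union) auto
  ultimately show ?thesis using negligible_subset by blast
qed

lemma abs_cont_has_integral_vector_derivative:
  fixes F :: "real \<Rightarrow> 'a::euclidean_space"
  assumes "abs_cont_on a b F" "a \<le> b"
  shows "((\<lambda>x. vector_derivative F (at x)) has_integral (F b - F a)) {a..b}"
  by (rule abs_cont_has_integral[OF assms abs_cont_differentiable_ae[OF assms(1)]])
    (auto simp: vector_derivative_works)

text \<open>
  The densities given by the positive and the negative part of \<open>D\<close> define measures that agree on
  all half lines, hence are equal.
\<close>

lemma AE_zero_of_half_line_integrals: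
  fixes D :: "real \<Rightarrow> real"
  assumes D: "integrable lborel D" and zero: "\<And>x. (LINT y:{x<..}|lborel. D y) = 0"
  shows "AE x in lborel. D x = 0"
proof -
  have [measurable]: "D \<in> borel_measurable borel" using borel_measurable_integrable[OF D] by simp
  have fin: "(\<integral>\<^sup>+y. ennreal (D y) * indicator {x<..} y \<partial>lborel) < \<infinity>"
    "(\<integral>\<^sup>+y. ennreal (- D y) * indicator {x<..} y \<partial>lborel) < \<infinity>" for x
  proof -
    have "(\<integral>\<^sup>+y. ennreal (D y) * indicator {x<..} y \<partial>lborel) \<le> (\<integral>\<^sup>+y. ennreal (norm (D y)) \<partial>lborel)"
      by (intro nn_integral_mono) (auto simp: indicator_def ennreal_leI)
    moreover have "(\<integral>\<^sup>+y. ennreal (- D y) * indicator {x<..} y \<partial>lborel) \<le> (\<integral>\<^sup>+y. ennreal (norm (D y)) \<partial>lborel)"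
      by (intro nn_integral_mono) (auto simp: indicator_def ennreal_leI)
    moreover have "(\<integral>\<^sup>+y. ennreal (norm (D y)) \<partial>lborel) < \<infinity>"
      using D by (simp add: integrable_iff_bounded)
    ultimately show "(\<integral>\<^sup>+y. ennreal (D y) * indicator {x<..} y \<partial>lborel) < \<infinity>"
      "(\<integral>\<^sup>+y. ennreal (- D y) * indicator {x<..} y \<partial>lborel) < \<infinity>" by (auto intro: le_less_trans)
  qed
  have eq: "(\<integral>\<^sup>+y. ennreal (D y) * indicator {x<..} y \<partial>lborel) = (\<integral>\<^sup>+y. ennreal (- D y) * indicator {x<..} y \<partial>lborel)" for x
  proof -
    have int: "integrable lborel (\<lambda>y. indicator {x<..} y *\<^sub>R D y)"
      using D by (intro integrable_mult_indicator) auto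
    have e: "ennreal (indicator {x<..} y *\<^sub>R D y) = ennreal (D y) * indicator {x<..} y"
      "ennreal (- (indicator {x<..} y *\<^sub>R D y)) = ennreal (- D y) * indicator {x<..} y" for y
      by (auto simp: indicator_def)
    have "0 = enn2real (\<integral>\<^sup>+y. ennreal (D y) * indicator {x<..} y \<partial>lborel) - enn2real (\<integral>\<^sup>+y. ennreal (- D y) * indicator {x<..} y \<partial>lborel)"
      using zero[of x] unfolding set_lebesgue_integral_def real_lebesgue_integral_def[OF int] e by simp
    then have "enn2real (\<integral>\<^sup>+y. ennreal (D y) * indicator {x<..} y \<partial>lborel) = enn2real (\<integral>\<^sup>+y. ennreal (- D y) * indicator {x<..} y \<partial>lborel)"
      by simp
    then show ?thesis using fin[of x] by (metis ennreal_enn2real infinity_ennreal_def)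
  qed
  have "density lborel (\<lambda>y. ennreal (D y)) = density lborel (\<lambda>y. ennreal (- D y))"
    by (rule measure_eqI_lessThan) (use fin eq in \<open>auto simp: emeasure_density\<close>)
  then have "AE x in lborel. ennreal (D x) = ennreal (- D x)"
    by (subst (asm) sigma_finite_measure.density_unique_iff[OF lborel.sigma_finite_measure_axioms]) auto
  then show ?thesis
  proof eventually_elim
    fix x assume "ennreal (D x) = ennreal (- D x)"
    then show "D x = 0" by (cases "D x \<ge> 0") (auto simp: ennreal_eq_0_iff ennreal_neg)
  qed
qed

text \<open>
  Truncate: \<open>G\<close> is the sum of a function bounded by \<open>n\<close> and one with integral below \<open>\<epsilon> / 2\<close>.
\<close>

lemma integrable_small_on_small_sets:
  fixes G :: "real \<Rightarrow> real"
  assumes G: "integrable lebesgue G" "\<And>x. 0 \<le> G x" and "0 < \<epsilon>"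
  obtains \<delta> where "0 < \<delta>" "\<And>A. A \<in> lmeasurable \<Longrightarrow> measure lebesgue A < \<delta> \<Longrightarrow> (LINT x:A|lebesgue. G x) < \<epsilon>"
proof -
  have [measurable]: "G \<in> borel_measurable lebesgue" using G by auto
  have "(\<lambda>n. LINT x|lebesgue. G x - min (G x) (real n)) \<longlonglongrightarrow> (LINT (x::real)|lebesgue. 0)"
  proof (rule integral_dominated_convergence[where w=G])
    show "AE x in lebesgue. (\<lambda>n. G x - min (G x) (real n)) \<longlonglongrightarrow> 0"
    proof (rule AE_I2)
      fix x
      obtain N :: nat where "G x \<le> real N" using real_arch_simple by blast
      then have "\<forall>\<^sub>F n in sequentially. G x - min (G x) (real n) = 0"
        by (intro eventually_sequentiallyI[of N]) auto
      then show "(\<lambda>n. G x - min (G x) (real n)) \<longlonglongrightarrow> 0" by (rule tendsto_eventually)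
    qed
    show "AE x in lebesgue. norm (G x - min (G x) (real n)) \<le> G x" for n
      using G(2) by (intro AE_I2) (auto simp: min_def)
  qed (use G in auto)
  then have "\<forall>\<^sub>F n in sequentially. (LINT x|lebesgue. G x - min (G x) (real n)) < \<epsilon>/2"
    by (rule order_tendstoD) (use \<open>0 < \<epsilon>\<close> in simp)
  then obtain n where n: "(LINT x|lebesgue. G x - min (G x) (real n)) < \<epsilon>/2"
    by (auto simp: eventually_sequentially)
  define H where "H x = G x - min (G x) (real n)" for x
  have H: "integrable lebesgue H" "\<And>x. 0 \<le> H x"
    unfolding H_def by (rule Bochner_Integration.integrable_bound[OF G(1)]) (use G(2) in auto)
  show ?thesis
  proof (rule that[of "\<epsilon> / (2 * (real n + 1))"])
    show "0 < \<epsilon> / (2 * (real n + 1))" using \<open>0 < \<epsilon>\<close> by auto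
    fix A :: "real set" assume A: "A \<in> lmeasurable" "measure lebesgue A < \<epsilon> / (2 * (real n + 1))"
    have iA: "integrable lebesgue (\<lambda>x. indicator A x * real n)"
      using A(1) by (intro integrable_mult_left integrable_real_indicator) (auto simp: fmeasurable_def)
    have "(LINT x:A|lebesgue. G x) \<le> (LINT x|lebesgue. H x + indicator A x * real n)"
      unfolding set_lebesgue_integral_def
    proof (rule integral_mono)
      show "integrable lebesgue (\<lambda>x. indicator A x *\<^sub>R G x)"
        using G A(1) by (intro integrable_mult_indicator) (auto simp: fmeasurableD)
      show "integrable lebesgue (\<lambda>x. H x + indicator A x * real n)"
        using H iA by auto
      show "indicator A x *\<^sub>R G x \<le> H x + indicator A x * real n" for x
        using H(2)[of x] by (auto simp: H_def indicator_def)
    qed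
    also have "\<dots> = (LINT x|lebesgue. H x) + measure lebesgue A * real n"
      using H iA A(1) by simp
    also have "\<dots> < \<epsilon>/2 + \<epsilon>/2"
    proof (rule add_less_le_mono)
      have "measure lebesgue A * real n \<le> (\<epsilon> / (2 * (real n + 1))) * (real n + 1)"
        using A(2) \<open>0 < \<epsilon>\<close> by (intro mult_mono) auto
      also have "\<dots> = \<epsilon>/2" by (simp add: field_simps)
      finally show "measure lebesgue A * real n \<le> \<epsilon>/2" .
    qed (use n in \<open>simp add: H_def\<close>)
    finally show "(LINT x:A|lebesgue. G x) < \<epsilon>" by simp
  qed
qed

lemma indefinite_integral_abs_cont:
  fixes F g :: "real \<Rightarrow> 'a::euclidean_space"
  assumes g: "set_integrable lebesgue {a..b} g"
    and F: "\<And>s t. \<lbrakk>a \<le> s; s \<le> t; t \<le> b\<rbrakk> \<Longrightarrow> F t - F s = (LINT x:{s..t}|lebesgue. g x)"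
  shows "abs_cont_on a b F"
  unfolding abs_cont_on_def
proof (intro allI impI)
  fix \<epsilon> :: real assume "0 < \<epsilon>"
  define G where "G x = indicator {a..b} x * norm (g x)" for x
  have G: "integrable lebesgue G" "\<And>x. 0 \<le> G x"
    using integrable_norm[OF g[unfolded set_integrable_def]] by (auto simp: G_def[abs_def] abs_mult)
  obtain \<delta> where "0 < \<delta>" and \<delta>: "\<And>A. A \<in> lmeasurable \<Longrightarrow> measure lebesgue A < \<delta> \<Longrightarrow> (LINT x:A|lebesgue. G x) < \<epsilon>"
    using integrable_small_on_small_sets[OF G \<open>0 < \<epsilon>\<close>] by blast
  show "\<exists>\<delta>>0. \<forall>(n::nat) s t.
     (\<forall>i<n. a \<le> s i \<and> s i \<le> t i \<and> t i \<le> b) \<and>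
     (\<forall>i<n. \<forall>j<n. i \<noteq> j \<longrightarrow> {s i<..<t i} \<inter> {s j<..<t j} = {}) \<and>
     (\<Sum>i<n. t i - s i) < \<delta> \<longrightarrow> (\<Sum>i<n. norm (F (t i) - F (s i))) < \<epsilon>"
  proof (intro exI[of _ \<delta>] conjI \<open>0 < \<delta>\<close> allI impI)
    fix n :: nat and s t :: "nat \<Rightarrow> real"
    assume A: "(\<forall>i<n. a \<le> s i \<and> s i \<le> t i \<and> t i \<le> b) \<and>
     (\<forall>i<n. \<forall>j<n. i \<noteq> j \<longrightarrow> {s i<..<t i} \<inter> {s j<..<t j} = {}) \<and> (\<Sum>i<n. t i - s i) < \<delta>"
    define V where "V = (\<Union>i<n. {s i<..<t i})"
    have disj: "disjoint_family_on (\<lambda>i. {s i<..<t i}) {..<n}" using A by (auto simp: disjoint_family_on_def)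
    have V: "V \<in> lmeasurable" unfolding V_def by (intro fmeasurable.finite_UN) auto
    have "measure lebesgue V = (\<Sum>i<n. measure lebesgue {s i<..<t i})"
      unfolding V_def using disj by (intro measure_finite_Union) (auto simp: emeasure_Ioo_finite)
    also have "\<dots> = (\<Sum>i<n. t i - s i)" using A by (intro sum.cong) auto
    finally have "measure lebesgue V < \<delta>" using A by simp
    then have "(LINT x:V|lebesgue. G x) < \<epsilon>" by (rule \<delta>[OF V])
    moreover have "(LINT x:V|lebesgue. G x) = (\<Sum>i<n. LINT x:{s i<..<t i}|lebesgue. G x)"
      unfolding V_def using disj G(1)
      by (intro set_integral_finite_Union) (auto simp: set_integrable_def simp del: real_scaleR_def intro!: integrable_mult_indicator)
    moreover have "norm (F (t i) - F (s i)) \<le> (LINT x:{s i<..<t i}|lebesgue. G x)" if "i < n" for i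
    proof -
      have i: "a \<le> s i" "s i \<le> t i" "t i \<le> b" using A that by auto
      have "norm (F (t i) - F (s i)) = norm (LINT x:{s i..t i}|lebesgue. g x)" by (simp add: F[OF i])
      also have "\<dots> \<le> (LINT x:{s i..t i}|lebesgue. norm (g x))"
        by (rule set_integral_norm_bound, rule set_integrable_subset[OF g]) (use i in auto)
      also have "\<dots> = (LINT x:{s i..t i}|lebesgue. G x)"
        using i by (intro set_lebesgue_integral_cong) (auto simp: G_def)
      also have "\<dots> = (LINT x:{s i<..<t i}|lebesgue. G x)"
        unfolding set_lebesgue_integral_def
      proof (rule integral_cong_AE)
        have "AE x in lebesgue. x \<noteq> s i \<and> x \<noteq> t i"
          by (intro AE_conjI) (auto intro!: AE_completion AE_lborel_singleton)
        then show "AE x in lebesgue. indicat_real {s i..t i} x *\<^sub>R G x = indicat_real {s i<..<t i} x *\<^sub>R G x"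
          by eventually_elim (auto simp: indicator_def)
      qed (intro borel_measurable_scaleR borel_measurable_indicator borel_measurable_integrable[OF G(1)]; simp)+
      finally show ?thesis .
    qed
    ultimately show "(\<Sum>i<n. norm (F (t i) - F (s i))) < \<epsilon>"
      using sum_mono[of "{..<n}" "\<lambda>i. norm (F (t i) - F (s i))" "\<lambda>i. LINT x:{s i<..<t i}|lebesgue. G x"] by simp
  qed
qed

text \<open>
  \<open>F\<close> is absolutely continuous, so it is the integral of its almost everywhere defined derivative
  \<open>k\<close>. The functions \<open>k\<close> and \<open>g\<close> have the same integral over every interval and must agree almost
  everywhere.
\<close>

lemma indefinite_integral_derivative_ae:
  fixes F g :: "real \<Rightarrow> real"
  assumes g: "set_integrable lebesgue {a..b} g"
    and F: "\<And>s t. \<lbrakk>a \<le> s; s \<le> t; t \<le> b\<rbrakk> \<Longrightarrow> F t - F s = (LINT x:{s..t}|lebesgue. g x)"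
  shows "AE x in lebesgue. x \<in> {a<..<b} \<longrightarrow> (F has_vector_derivative g x) (at x)"
proof (cases "a \<le> b")
  case True
  have ac: "abs_cont_on a b F" by (rule indefinite_integral_abs_cont[OF g F])
  define k where "k x = vector_derivative F (at x)" for x
  define d where "d x = k x - g x" for x
  have d0: "(d has_integral 0) {s..t}" if st: "a \<le> s" "s \<le> t" "t \<le> b" for s t
  proof -
    have "abs_cont_on s t F"
      by (rule indefinite_integral_abs_cont[OF set_integrable_subset[OF g]]) (use st F in auto)
    then have "(k has_integral (F t - F s)) {s..t}"
      unfolding k_def using st by (intro abs_cont_has_integral_vector_derivative) auto
    moreover have "(g has_integral (F t - F s)) {s..t}"
      unfolding F[OF st] by (rule has_integral_set_lebesgue, rule set_integrable_subset[OF g]) (use st in auto)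
    ultimately show ?thesis unfolding d_def by (rule has_integral_diff[of k "F t - F s" _ g "F t - F s", simplified])
  qed
  have "d absolutely_integrable_on cbox a b"
  proof (rule bounded_variation_absolutely_integrable_interval[where B=0])
    show "d integrable_on cbox a b" using d0[of a b] True by auto
    fix D assume D: "D division_of cbox a b"
    have "norm (integral K d) = 0" if K: "K \<in> D" for K
    proof -
      obtain u v where uv: "K = {u..v}" "u \<le> v" "K \<subseteq> {a..b}"
        using division_ofD(2-4)[OF D K] by (metis atLeastatMost_empty_iff2 box_real(2) not_le)
      then show ?thesis using d0[of u v] by (auto intro: integral_unique)
    qed
    then show "(\<Sum>K\<in>D. norm (integral K d)) \<le> 0" by simp
  qed
  then have di: "set_integrable lebesgue {a..b} d" by simp
  define D where "D x = indicator {a..b} x * d x" for x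
  have D: "integrable lebesgue D" using di by (simp add: D_def[abs_def] set_integrable_def)
  obtain D' where D'm: "D' \<in> borel_measurable lborel" and D'ae: "AE x in lborel. D x = D' x"
    using completion_ex_borel_measurable_real[OF borel_measurable_integrable[OF D]] by blast
  have D'ae': "AE x in lebesgue. D x = D' x" using D'ae by (rule AE_completion)
  have D'l: "D' \<in> borel_measurable lebesgue" using D'm by (simp add: measurable_completion)
  have "integrable lebesgue D'" using D D'ae' D'l by (subst integrable_cong_AE[symmetric]) auto
  then have D'i: "integrable lborel D'" using D'm by (simp add: integrable_completion)
  have "(LINT y:{x<..}|lborel. D' y) = 0" for x
  proof -
    have "(LINT y:{x<..}|lborel. D' y) = (LINT y:{x<..}|lebesgue. D' y)"
      unfolding set_lebesgue_integral_def using D'm by (intro integral_completion[symmetric]) auto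
    also have "\<dots> = (LINT y:{x<..}|lebesgue. D y)"
      unfolding set_lebesgue_integral_def
    proof (rule integral_cong_AE)
      show "AE y in lebesgue. indicat_real {x<..} y *\<^sub>R D' y = indicat_real {x<..} y *\<^sub>R D y"
        using D'ae' by eventually_elim simp
    qed (intro borel_measurable_scaleR borel_measurable_indicator borel_measurable_integrable[OF D] D'l; simp)+
    also have "\<dots> = (LINT y:{max a x..b}|lebesgue. d y)"
      unfolding set_lebesgue_integral_def
    proof (rule integral_cong_AE)
      have "AE y in lebesgue. y \<noteq> x" by (auto intro!: AE_completion AE_lborel_singleton)
      then show "AE y in lebesgue. indicat_real {x<..} y *\<^sub>R D y = indicat_real {max a x..b} y *\<^sub>R d y"
        by eventually_elim (auto simp: indicator_def D_def)
      show "(\<lambda>y. indicat_real {max a x..b} y *\<^sub>R d y) \<in> borel_measurable lebesgue"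
        using set_integrable_subset[OF di, of "{max a x..b}"] unfolding set_integrable_def by auto
    qed (intro borel_measurable_scaleR borel_measurable_indicator borel_measurable_integrable[OF D]; simp)
    also have "\<dots> = 0"
    proof (cases "max a x \<le> b")
      case True
      have si: "set_integrable lebesgue {max a x..b} d" by (rule set_integrable_subset[OF di]) auto
      show ?thesis using has_integral_unique[OF has_integral_set_lebesgue[OF si] d0[of "max a x" b]] True by simp
    qed (simp add: set_lebesgue_integral_def)
    finally show ?thesis .
  qed
  then have "AE x in lborel. D' x = 0" by (rule AE_zero_of_half_line_integrals[OF D'i])
  then have "AE x in lebesgue. D' x = 0" by (rule AE_completion)
  moreover have "AE x in lebesgue. x \<notin> {x\<in>{a<..<b}. \<not> F differentiable (at x)}"
    using abs_cont_differentiable_ae[OF ac] by (intro AE_not_in) (simp add: negligible_iff_null_sets)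
  ultimately show ?thesis using D'ae'
  proof eventually_elim
    fix x assume "D' x = 0" "x \<notin> {x\<in>{a<..<b}. \<not> F differentiable (at x)}" "D x = D' x"
    then show "x \<in> {a<..<b} \<longrightarrow> (F has_vector_derivative g x) (at x)"
      by (auto simp: D_def d_def k_def vector_derivative_works)
  qed
qed simp

section \<open>The norm of a weighted variable exponent Lebesgue space\<close>

locale weighted_lebesgue =
  fixes p :: "real \<Rightarrow> real" and w :: "real \<Rightarrow> ennreal"
  assumes p_measurable: "p \<in> borel_measurable (lebesgue_on circ)"
    and p_ge_1: "\<And>x. x \<in> circ \<Longrightarrow> 1 \<le> p x"
    and w_measurable [measurable]: "w \<in> borel_measurable lebesgue"
begin

lemma modular_measurable [measurable]:
  fixes f :: "real \<Rightarrow> 'a::{real_normed_vector, second_countable_topology}"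
  assumes [measurable]: "f \<in> borel_measurable lebesgue"
  shows "(\<lambda>x. ennreal ((norm (f x) / \<alpha>) powr p x) * w x * indicator circ x) \<in> borel_measurable lebesgue"
proof -
  define p' where "p' x = (if x \<in> circ then p x else 0)" for x
  have [measurable]: "p' \<in> borel_measurable lebesgue"
  proof -
    have "(\<lambda>x. if x \<in> circ then p x else 0) \<in> borel_measurable lebesgue"
      by (rule borel_measurable_if_I) (use p_measurable in auto)
    then show ?thesis by (simp add: p'_def[abs_def])
  qed
  have "(\<lambda>x. ennreal ((norm (f x) / \<alpha>) powr p' x) * w x) \<in> borel_measurable lebesgue"
    by measurable
  then have "(\<lambda>x. ennreal ((norm (f x) / \<alpha>) powr p' x) * w x * indicator circ x) \<in> borel_measurable lebesgue"
    by (intro borel_measurable_times_ennreal borel_measurable_indicator) auto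
  also have "(\<lambda>x. ennreal ((norm (f x) / \<alpha>) powr p' x) * w x * indicator circ x)
    = (\<lambda>x. ennreal ((norm (f x) / \<alpha>) powr p x) * w x * indicator circ x)"
    by (auto simp: p'_def fun_eq_iff indicator_def)
  finally show ?thesis .
qed

lemma wnorm_leI:
  assumes "0 < \<alpha>" "(\<integral>\<^sup>+x\<in>circ. (ennreal ((norm (f x) / \<alpha>) powr p x) * w x) \<partial>lebesgue) \<le> 1"
  shows "wnorm p w f \<le> ennreal \<alpha>"
  unfolding wnorm_def using assms by (intro INF_lower) auto

lemma modular_le:
  assumes "AE x in lebesgue. x \<in> circ \<longrightarrow> norm (f x) / \<alpha> \<le> norm (g x) / \<beta>" "0 < \<alpha>"
  shows "(\<integral>\<^sup>+x\<in>circ. (ennreal ((norm (f x) / \<alpha>) powr p x) * w x) \<partial>lebesgue)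
    \<le> (\<integral>\<^sup>+x\<in>circ. (ennreal ((norm (g x) / \<beta>) powr p x) * w x) \<partial>lebesgue)"
proof (rule nn_integral_mono_AE)
  show "AE x in lebesgue. ennreal ((norm (f x) / \<alpha>) powr p x) * w x * indicator circ x
      \<le> ennreal ((norm (g x) / \<beta>) powr p x) * w x * indicator circ x"
    using assms(1)
  proof eventually_elim
    fix x assume x: "x \<in> circ \<longrightarrow> norm (f x) / \<alpha> \<le> norm (g x) / \<beta>"
    show "ennreal ((norm (f x) / \<alpha>) powr p x) * w x * indicator circ x
      \<le> ennreal ((norm (g x) / \<beta>) powr p x) * w x * indicator circ x"
    proof (cases "x \<in> circ")
      case True
      then have "(norm (f x) / \<alpha>) powr p x \<le> (norm (g x) / \<beta>) powr p x"
        using x p_ge_1[OF True] \<open>0 < \<alpha>\<close> by (intro powr_mono2) auto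
      then show ?thesis by (intro mult_right_mono) (auto intro: ennreal_leI)
    qed auto
  qed
qed

lemma modular_le_1:
  assumes "wnorm p w f < ennreal \<alpha>"
  shows "(\<integral>\<^sup>+x\<in>circ. (ennreal ((norm (f x) / \<alpha>) powr p x) * w x) \<partial>lebesgue) \<le> 1"
proof -
  obtain \<beta> where \<beta>: "0 < \<beta>" "(\<integral>\<^sup>+x\<in>circ. (ennreal ((norm (f x) / \<beta>) powr p x) * w x) \<partial>lebesgue) \<le> 1"
      "ennreal \<beta> < ennreal \<alpha>"
    using assms unfolding wnorm_def INF_less_iff by auto
  then have "\<beta> < \<alpha>" by (metis ennreal_leI not_le)
  have "(\<integral>\<^sup>+x\<in>circ. (ennreal ((norm (f x) / \<alpha>) powr p x) * w x) \<partial>lebesgue)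
    \<le> (\<integral>\<^sup>+x\<in>circ. (ennreal ((norm (f x) / \<beta>) powr p x) * w x) \<partial>lebesgue)"
    using \<beta>(1) \<open>\<beta> < \<alpha>\<close> by (intro modular_le) (auto intro!: divide_left_mono)
  then show ?thesis using \<beta>(2) by simp
qed

lemma wnorm_mono_AE:
  assumes "AE x in lebesgue. x \<in> circ \<longrightarrow> norm (f x) \<le> norm (g x)"
  shows "wnorm p w f \<le> wnorm p w g"
  unfolding wnorm_def[of _ _ g]
proof (rule INF_greatest)
  fix \<alpha> assume "\<alpha> \<in> {\<alpha>::real. 0 < \<alpha> \<and> (\<integral>\<^sup>+x\<in>circ. (ennreal ((norm (g x) / \<alpha>) powr p x) * w x) \<partial>lebesgue) \<le> 1}"
  then have \<alpha>: "0 < \<alpha>" "(\<integral>\<^sup>+x\<in>circ. (ennreal ((norm (g x) / \<alpha>) powr p x) * w x) \<partial>lebesgue) \<le> 1" by auto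
  have "(\<integral>\<^sup>+x\<in>circ. (ennreal ((norm (f x) / \<alpha>) powr p x) * w x) \<partial>lebesgue) \<le> 1"
    by (rule order_trans[OF modular_le \<alpha>(2)]) (use assms \<alpha>(1) in \<open>auto simp: divide_right_mono elim!: eventually_mono\<close>)
  then show "wnorm p w f \<le> ennreal \<alpha>" using \<alpha>(1) by (rule wnorm_leI[rotated])
qed

lemma wnorm_cong_AE:
  assumes "AE x in lebesgue. x \<in> circ \<longrightarrow> norm (f x) = norm (g x)"
  shows "wnorm p w f = wnorm p w g"
  by (rule antisym; rule wnorm_mono_AE) (use assms in \<open>auto elim!: eventually_mono\<close>)

lemma wnorm_mono: "(\<And>x. norm (f x) \<le> norm (g x)) \<Longrightarrow> wnorm p w f \<le> wnorm p w g"
  by (rule wnorm_mono_AE) auto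

lemma wnorm_norm [simp]: "wnorm p w (\<lambda>x. norm (f x)) = wnorm p w f"
  by (rule wnorm_cong_AE) auto

lemma wnorm_zero [simp]: "wnorm p w (\<lambda>x. 0) = 0"
proof -
  have "wnorm p w (\<lambda>x. 0) \<le> ennreal e" if "0 < e" for e
    by (rule wnorm_leI) (use that in auto)
  then show ?thesis
    by (metis ennreal_le_epsilon add.left_neutral ennreal_less_top top.not_eq_extremum le_zero_eq)
qed

lemma wnorm_scale_le: "wnorm p w (\<lambda>x. c *\<^sub>R f x) \<le> ennreal \<bar>c\<bar> * wnorm p w f"
proof (cases "c = 0")
  case False
  show ?thesis
  proof (cases "wnorm p w f = top")
    case True then show ?thesis using False by (simp add: ennreal_mult_top)
  next
    case nt: False
    then obtain N where N: "wnorm p w f = ennreal N" "0 \<le> N" by (cases "wnorm p w f") auto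
    show ?thesis
    proof (rule ennreal_le_epsilon)
      fix e :: real assume "0 < e"
      define \<alpha> where "\<alpha> = N + e / \<bar>c\<bar>"
      have \<alpha>: "N < \<alpha>" "0 < \<alpha>" using \<open>0 < e\<close> N False by (auto simp: \<alpha>_def intro: add_nonneg_pos)
      have 1: "(\<integral>\<^sup>+x\<in>circ. (ennreal ((norm (f x) / \<alpha>) powr p x) * w x) \<partial>lebesgue) \<le> 1"
        by (rule modular_le_1) (use N \<alpha> in \<open>auto intro: ennreal_lessI\<close>)
      have "wnorm p w (\<lambda>x. c *\<^sub>R f x) \<le> ennreal (\<bar>c\<bar> * \<alpha>)"
      proof (rule wnorm_leI)
        show "0 < \<bar>c\<bar> * \<alpha>" using \<alpha> False by auto
        show "(\<integral>\<^sup>+x\<in>circ. (ennreal ((norm (c *\<^sub>R f x) / (\<bar>c\<bar> * \<alpha>)) powr p x) * w x) \<partial>lebesgue) \<le> 1"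
          using 1 False by simp
      qed
      also have "ennreal (\<bar>c\<bar> * \<alpha>) = ennreal \<bar>c\<bar> * wnorm p w f + ennreal e"
        using N \<open>0 < e\<close> False by (simp add: \<alpha>_def ennreal_mult[symmetric] ennreal_plus[symmetric] algebra_simps del: ennreal_plus)
      finally show "wnorm p w (\<lambda>x. c *\<^sub>R f x) \<le> ennreal \<bar>c\<bar> * wnorm p w f + ennreal e" .
    qed
  qed
qed simp

lemma wnorm_scale: "wnorm p w (\<lambda>x. c *\<^sub>R f x) = ennreal \<bar>c\<bar> * wnorm p w f"
proof (cases "c = 0")
  case False
  have "ennreal \<bar>c\<bar> * wnorm p w f = ennreal \<bar>c\<bar> * wnorm p w (\<lambda>x. (1/c) *\<^sub>R (c *\<^sub>R f x))"
    using False by simp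
  also have "\<dots> \<le> ennreal \<bar>c\<bar> * (ennreal \<bar>1/c\<bar> * wnorm p w (\<lambda>x. c *\<^sub>R f x))"
    by (intro mult_left_mono wnorm_scale_le) auto
  also have "\<dots> = wnorm p w (\<lambda>x. c *\<^sub>R f x)"
    unfolding mult.assoc[symmetric] using False by (simp add: ennreal_mult[symmetric] abs_mult[symmetric])
  finally show ?thesis using wnorm_scale_le[of c f] by (intro antisym) auto
qed simp

text \<open>
  The convexity that makes the Luxemburg functional \<^const>\<open>wnorm\<close> subadditive.
\<close>

lemma powr_convex_combination:
  fixes a b \<theta> q :: real
  assumes "0 \<le> a" "0 \<le> b" "0 \<le> \<theta>" "\<theta> \<le> 1" "1 \<le> q"
  shows "(\<theta> * a + (1 - \<theta>) * b) powr q \<le> \<theta> * a powr q + (1 - \<theta>) * b powr q"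
proof -
  have le: "t powr q \<le> t" if "0 \<le> t" "t \<le> 1" for t :: real
    using powr_mono'[of 1 q t] that \<open>1 \<le> q\<close> by (cases "t = 0") auto
  consider "a = 0" | "b = 0" | "0 < a" "0 < b" using assms by linarith
  then show ?thesis
  proof cases
    case 3
    from convex_onD[OF powr_convex[OF \<open>1 \<le> q\<close>], of "1 - \<theta>" a b] 3 assms show ?thesis by simp
  next
    case 1
    then show ?thesis using assms le[of "1 - \<theta>"] by (simp add: powr_mult mult_right_mono)
  next
    case 2
    then show ?thesis using assms le[of \<theta>] by (simp add: powr_mult mult_right_mono)
  qed
qed

lemma wnorm_triangle:
  fixes f g :: "real \<Rightarrow> 'a::{real_normed_vector, second_countable_topology}"
  assumes [measurable]: "f \<in> borel_measurable lebesgue" "g \<in> borel_measurable lebesgue"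
  shows "wnorm p w (\<lambda>x. f x + g x) \<le> wnorm p w f + wnorm p w g"
proof (cases "wnorm p w f = top \<or> wnorm p w g = top")
  case False
  then obtain A B where AB: "wnorm p w f = ennreal A" "0 \<le> A" "wnorm p w g = ennreal B" "0 \<le> B"
    by (cases "wnorm p w f"; cases "wnorm p w g") auto
  show ?thesis
  proof (rule ennreal_le_epsilon)
    fix e :: real assume "0 < e"
    define \<alpha> \<beta> where "\<alpha> = A + e/2" and "\<beta> = B + e/2"
    have ab: "A < \<alpha>" "B < \<beta>" "0 < \<alpha>" "0 < \<beta>" using \<open>0 < e\<close> AB by (auto simp: \<alpha>_def \<beta>_def)
    define \<theta> where "\<theta> = \<alpha> / (\<alpha> + \<beta>)"
    have \<theta>: "0 \<le> \<theta>" "\<theta> \<le> 1" "1 - \<theta> = \<beta> / (\<alpha> + \<beta>)" using ab by (auto simp: \<theta>_def field_simps)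
    let ?F = "\<lambda>x. ennreal ((norm (f x) / \<alpha>) powr p x) * w x * indicator circ x"
    let ?G = "\<lambda>x. ennreal ((norm (g x) / \<beta>) powr p x) * w x * indicator circ x"
    have F: "(\<integral>\<^sup>+x. ?F x \<partial>lebesgue) \<le> 1" and G: "(\<integral>\<^sup>+x. ?G x \<partial>lebesgue) \<le> 1"
      by (intro modular_le_1; use AB ab in \<open>auto intro: ennreal_lessI\<close>)+
    have "wnorm p w (\<lambda>x. f x + g x) \<le> ennreal (\<alpha> + \<beta>)"
    proof (rule wnorm_leI)
      have "(\<integral>\<^sup>+x\<in>circ. (ennreal ((norm (f x + g x) / (\<alpha>+\<beta>)) powr p x) * w x) \<partial>lebesgue)
        \<le> (\<integral>\<^sup>+x. ennreal \<theta> * ?F x + ennreal (1 - \<theta>) * ?G x \<partial>lebesgue)"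
      proof (rule nn_integral_mono)
        fix x
        show "ennreal ((norm (f x + g x) / (\<alpha>+\<beta>)) powr p x) * w x * indicator circ x
          \<le> ennreal \<theta> * ?F x + ennreal (1 - \<theta>) * ?G x"
        proof (cases "x \<in> circ")
          case True
          have "norm (f x + g x) / (\<alpha>+\<beta>) \<le> (norm (f x) + norm (g x)) / (\<alpha>+\<beta>)"
            using ab norm_triangle_ineq by (intro divide_right_mono) auto
          also have "\<dots> = \<theta> * (norm (f x) / \<alpha>) + (1 - \<theta>) * (norm (g x) / \<beta>)"
            unfolding \<theta>(3) unfolding \<theta>_def using ab by (simp add: add_divide_distrib)
          finally have "(norm (f x + g x) / (\<alpha>+\<beta>)) powr p x \<le> (\<theta> * (norm (f x) / \<alpha>) + (1 - \<theta>) * (norm (g x) / \<beta>)) powr p x"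
            using ab p_ge_1[OF True] by (intro powr_mono2) auto
          also have "\<dots> \<le> \<theta> * (norm (f x) / \<alpha>) powr p x + (1 - \<theta>) * (norm (g x) / \<beta>) powr p x"
            using \<theta> ab p_ge_1[OF True] by (intro powr_convex_combination) auto
          finally have "ennreal ((norm (f x + g x) / (\<alpha>+\<beta>)) powr p x) * w x
            \<le> ennreal (\<theta> * (norm (f x) / \<alpha>) powr p x + (1 - \<theta>) * (norm (g x) / \<beta>) powr p x) * w x"
            by (intro mult_right_mono ennreal_leI) auto
          also have "ennreal (\<theta> * (norm (f x) / \<alpha>) powr p x + (1 - \<theta>) * (norm (g x) / \<beta>) powr p x)
            = ennreal \<theta> * ennreal ((norm (f x) / \<alpha>) powr p x) + ennreal (1 - \<theta>) * ennreal ((norm (g x) / \<beta>) powr p x)"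
            using \<theta>(1,2) by (subst ennreal_plus) (auto simp: ennreal_mult)
          also have "\<dots> * w x = ennreal \<theta> * ?F x + ennreal (1 - \<theta>) * ?G x"
            using True by (simp add: distrib_right mult.assoc)
          finally show ?thesis using True by simp
        qed simp
      qed
      also have "\<dots> = ennreal \<theta> * (\<integral>\<^sup>+x. ?F x \<partial>lebesgue) + ennreal (1 - \<theta>) * (\<integral>\<^sup>+x. ?G x \<partial>lebesgue)"
        by (subst nn_integral_add) (auto simp: nn_integral_cmult)
      also have "\<dots> \<le> ennreal \<theta> * 1 + ennreal (1 - \<theta>) * 1"
        by (intro add_mono mult_left_mono F G) auto
      also have "\<dots> = 1" using \<theta> by (simp add: ennreal_plus[symmetric] del: ennreal_plus)
      finally show "(\<integral>\<^sup>+x\<in>circ. (ennreal ((norm (f x + g x) / (\<alpha>+\<beta>)) powr p x) * w x) \<partial>lebesgue) \<le> 1" .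
    qed (use ab in auto)
    also have "ennreal (\<alpha> + \<beta>) = wnorm p w f + wnorm p w g + ennreal e"
      using AB \<open>0 < e\<close> by (simp add: \<alpha>_def \<beta>_def ennreal_plus[symmetric] algebra_simps del: ennreal_plus)
    finally show "wnorm p w (\<lambda>x. f x + g x) \<le> wnorm p w f + wnorm p w g + ennreal e" .
  qed
qed auto

lemma wnorm_triangle_diff:
  fixes f g :: "real \<Rightarrow> 'a::{real_normed_vector, second_countable_topology}"
  assumes [measurable]: "f \<in> borel_measurable lebesgue" "g \<in> borel_measurable lebesgue"
  shows "wnorm p w (\<lambda>x. f x - g x) \<le> wnorm p w f + wnorm p w g"
proof -
  have "wnorm p w (\<lambda>x. f x + - g x) \<le> wnorm p w f + wnorm p w (\<lambda>x. - g x)"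
    by (rule wnorm_triangle) measurable
  also have "wnorm p w (\<lambda>x. - g x) = wnorm p w g" by (rule wnorm_cong_AE) auto
  finally show ?thesis by simp
qed

lemma wnorm_sum:
  fixes f :: "'i \<Rightarrow> real \<Rightarrow> 'a::{real_normed_vector, second_countable_topology}"
  assumes "finite I" and [measurable]: "\<And>i. i \<in> I \<Longrightarrow> f i \<in> borel_measurable lebesgue"
  shows "wnorm p w (\<lambda>x. \<Sum>i\<in>I. f i x) \<le> (\<Sum>i\<in>I. wnorm p w (f i))"
  using assms
proof (induction I rule: finite_induct)
  case (insert i I)
  have "wnorm p w (\<lambda>x. f i x + (\<Sum>i\<in>I. f i x)) \<le> wnorm p w (f i) + wnorm p w (\<lambda>x. \<Sum>i\<in>I. f i x)"
    using insert.prems by (intro wnorm_triangle borel_measurable_sum) auto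
  also have "\<dots> \<le> wnorm p w (f i) + (\<Sum>i\<in>I. wnorm p w (f i))"
    using insert by (intro add_left_mono) auto
  finally show ?case using insert.hyps by simp
qed simp

end

section \<open>Muckenhoupt weights and the log-Hoelder condition\<close>

lemma nn_integral_add3:
  fixes f g h :: "'a \<Rightarrow> ennreal"
  assumes "f \<in> borel_measurable M" "g \<in> borel_measurable M" "h \<in> borel_measurable M"
  shows "(\<integral>\<^sup>+x. f x + g x + h x \<partial>M) = (\<integral>\<^sup>+x. f x \<partial>M) + (\<integral>\<^sup>+x. g x \<partial>M) + (\<integral>\<^sup>+x. h x \<partial>M)"
  using assms by (simp add: nn_integral_add)

lemma ennreal_one_le_of_two_le: "2 \<le> X + 1 \<Longrightarrow> 1 \<le> (X::ennreal)"
proof (cases X)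
  case (real r)
  assume "2 \<le> X + 1"
  then have "ennreal 2 \<le> ennreal (r + 1)" using real by (simp add: ennreal_plus)
  then have "1 \<le> r" using real by (subst (asm) ennreal_le_iff) auto
  then show ?thesis using real by (simp add: ennreal_leI flip: ennreal_1)
qed simp

text \<open>
  A form of Young's inequality: where the first summand is smaller than \<open>t\<close>, the number
  \<open>t powr (p x - 1)\<close> is below \<open>1 / (v \<alpha>)\<close>, and taking the root of order \<open>p x - 1\<close> turns this into
  a bound of \<open>t\<close> by the second summand. The point \<open>p x = 1\<close> corresponds to the value \<open>\<infinity>\<close> of the dual exponent,
  and \<open>v\<close> may be infinite.
\<close>

lemma phi_pointwise_bound:
  assumes "0 < \<alpha>" "0 < v" "0 \<le> t" "1 \<le> p x"
  shows "ennreal t \<le> ennreal (t powr p x) * v * ennreal \<alpha>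
    + phi (conj_exponent p x / ennreal (p x)) (1 / v / ennreal \<alpha>)"
proof (cases "v = top")
  case True
  then show ?thesis
  proof (cases "t = 0")
    case False
    then have "0 < t powr p x" using \<open>0 \<le> t\<close> by simp
    then have "ennreal (t powr p x) * v * ennreal \<alpha> = top"
      using True \<open>0 < \<alpha>\<close> by (simp add: ennreal_mult_top ennreal_top_mult)
    then show ?thesis by simp
  qed simp
next
  case False
  then obtain s where s: "v = ennreal s" "0 < s" using \<open>0 < v\<close> by (cases v) auto
  have q: "1 / v / ennreal \<alpha> = ennreal (1 / (s * \<alpha>))"
    using s \<open>0 < \<alpha>\<close> by (simp add: divide_ennreal ennreal_1[symmetric] del: ennreal_1)
  have m: "ennreal (t powr p x) * v * ennreal \<alpha> = ennreal (t powr p x * (s * \<alpha>))"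
    using s \<open>0 < \<alpha>\<close> by (simp add: ennreal_mult mult.assoc)
  show ?thesis
  proof (cases "p x = 1")
    case True
    then have e: "conj_exponent p x / ennreal (p x) = \<infinity>" by (simp add: conj_exponent_def ennreal_top_divide)
    show ?thesis
    proof (cases "1 / (s * \<alpha>) \<le> 1")
      case le: True
      then have "1 \<le> s * \<alpha>" using s \<open>0 < \<alpha>\<close> by (simp add: divide_le_eq)
      then have "t * 1 \<le> t powr p x * (s * \<alpha>)" using True \<open>0 \<le> t\<close> by (cases "t = 0") (auto intro!: mult_left_mono)
      then have "ennreal t \<le> ennreal (t powr p x * (s * \<alpha>))" by (intro ennreal_leI) simp
      then show ?thesis unfolding m by (rule order_trans) simp
    next
      case False
      then have "\<not> ennreal (1 / (s * \<alpha>)) \<le> 1" by simp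
      then show ?thesis unfolding e q phi_def by simp
    qed
  next
    case False
    then have "1 < p x" using \<open>1 \<le> p x\<close> by simp
    then have e: "conj_exponent p x / ennreal (p x) = ennreal (1 / (p x - 1))"
      by (simp add: conj_exponent_def divide_ennreal)
    have ph: "phi (conj_exponent p x / ennreal (p x)) (1 / v / ennreal \<alpha>) = ennreal ((1 / (s * \<alpha>)) powr (1 / (p x - 1)))"
      unfolding e q phi_def using s \<open>0 < \<alpha>\<close> \<open>1 < p x\<close> by simp
    have "t \<le> t powr p x * (s * \<alpha>) + (1 / (s * \<alpha>)) powr (1 / (p x - 1))"
    proof (cases "t = 0 \<or> 1 \<le> t powr (p x - 1) * (s * \<alpha>)")
      case True
      show ?thesis
      proof (cases "t = 0")
        case False
        then have "t * 1 \<le> t * (t powr (p x - 1) * (s * \<alpha>))" using True \<open>0 \<le> t\<close> by (intro mult_left_mono) auto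
        also have "\<dots> = t powr p x * (s * \<alpha>)"
          using False \<open>0 \<le> t\<close> powr_add[of t 1 "p x - 1"] by simp
        finally show ?thesis using powr_ge_zero[of "1 / (s * \<alpha>)" "1 / (p x - 1)"] by linarith
      qed simp
    next
      case False
      then have "0 < t" "t powr (p x - 1) < 1 / (s * \<alpha>)"
        using s \<open>0 < \<alpha>\<close> \<open>0 \<le> t\<close> by (auto simp: field_simps)
      then have "(t powr (p x - 1)) powr (1 / (p x - 1)) \<le> (1 / (s * \<alpha>)) powr (1 / (p x - 1))"
        using \<open>1 < p x\<close> by (intro powr_mono2) auto
      then have "t \<le> (1 / (s * \<alpha>)) powr (1 / (p x - 1))"
        using \<open>1 < p x\<close> \<open>0 < t\<close> by (simp add: powr_powr)
      moreover have "0 \<le> t powr p x * (s * \<alpha>)" using s \<open>0 < \<alpha>\<close> by simp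
      ultimately show ?thesis by linarith
    qed
    then have "ennreal t \<le> ennreal (t powr p x * (s * \<alpha>) + (1 / (s * \<alpha>)) powr (1 / (p x - 1)))"
      by (rule ennreal_leI)
    then show ?thesis unfolding m ph using s \<open>0 < \<alpha>\<close> by (simp add: ennreal_plus)
  qed
qed

lemma circ_intervals_props:
  assumes "B \<in> circ_intervals"
  shows "B \<subseteq> circ" "B \<in> lmeasurable" "0 < measure lebesgue B" "measure lebesgue B \<le> 2 * pi"
proof -
  show "0 < measure lebesgue B" using assms by (simp add: circ_intervals_def)
  show sub: "B \<subseteq> circ" "B \<in> lmeasurable" using assms by (auto simp: circ_intervals_def)
  have "measure lebesgue B \<le> measure lebesgue circ"
    by (rule measure_mono_fmeasurable) (use sub in auto)
  then show "measure lebesgue B \<le> 2 * pi" by simp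
qed

lemma circ_in_circ_intervals: "circ \<in> circ_intervals"
  unfolding circ_intervals_def using pi_gt_zero by (auto intro!: exI[of _ "-pi"] exI[of _ pi])

definition log_modulus :: "real \<Rightarrow> real \<Rightarrow> real" where
  "log_modulus c d = c / ln (exp 1 + 1 / d)"

lemma log_modulus_mono:
  assumes "0 \<le> c" "0 < d" "d \<le> d'"
  shows "log_modulus c d \<le> log_modulus c d'"
proof -
  have "1 / d' \<le> 1 / d" using assms by (intro divide_left_mono) auto
  then have "ln (exp 1 + 1 / d') \<le> ln (exp 1 + 1 / d)"
    using assms by (subst ln_le_cancel_iff) (auto intro: add_pos_nonneg)
  moreover have "0 < ln (exp 1 + 1 / d')"
  proof -
    have "exp 0 < exp (1::real)" by (subst exp_less_cancel_iff) simp
    moreover have "0 < 1 / d'" using assms by simp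
    ultimately have "1 < exp 1 + 1 / d'" unfolding exp_zero by linarith
    then show ?thesis by simp
  qed
  ultimately show ?thesis unfolding log_modulus_def using assms by (intro divide_left_mono) (auto intro: mult_pos_pos)
qed

lemma log_modulus_nonneg: "0 \<le> c \<Longrightarrow> 0 < d \<Longrightarrow> 0 \<le> log_modulus c d"
proof -
  assume "0 \<le> c" "0 < d"
  have "exp 0 < exp (1::real)" by (subst exp_less_cancel_iff) simp
  moreover have "0 < 1 / d" using \<open>0 < d\<close> by simp
  ultimately have "1 < exp 1 + 1 / d" unfolding exp_zero by linarith
  then show ?thesis using \<open>0 \<le> c\<close> by (simp add: log_modulus_def)
qed

lemma log_modulus_small:
  assumes "0 < c" "0 < \<epsilon>"
  obtains d where "0 < d" "d \<le> 1" "log_modulus c d \<le> \<epsilon>"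
proof -
  define d where "d = exp (- (c / \<epsilon>))"
  have d: "0 < d" "d \<le> 1" using assms by (auto simp: d_def)
  have "1 / d = exp (c / \<epsilon>)" by (simp add: d_def exp_minus inverse_eq_divide)
  then have "exp (c / \<epsilon>) \<le> exp 1 + 1 / d" by simp
  moreover have "0 < exp 1 + 1 / d" using d by (intro add_pos_pos) auto
  ultimately have "c / \<epsilon> \<le> ln (exp 1 + 1 / d)" by (simp add: ln_ge_iff)
  moreover have ce: "0 < c / \<epsilon>" using assms by simp
  ultimately have "c / ln (exp 1 + 1 / d) \<le> c / (c / \<epsilon>)"
    using assms(1) by (intro divide_left_mono mult_pos_pos) linarith+
  then have "log_modulus c d \<le> \<epsilon>" using assms by (simp add: log_modulus_def)
  then show ?thesis using that d by blast
qed

text \<open>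
  The hypotheses of the theorem in the form in which they are used: the constants \<open>c\<close>, \<open>P\<close> and \<open>A\<close>
  are those of the log-Hoelder condition, a bound of the exponent, and the Muckenhoupt constant.
\<close>

locale muckenhoupt_weight = weighted_lebesgue +
  fixes c P A :: real
  assumes c_pos: "0 < c"
    and log_hoelder: "\<And>x y. x \<in> circ \<Longrightarrow> y \<in> circ \<Longrightarrow> x \<noteq> y \<Longrightarrow> \<bar>1 / p x - 1 / p y\<bar> \<le> log_modulus c \<bar>x - y\<bar>"
    and p_le: "\<And>x. x \<in> circ \<Longrightarrow> p x \<le> P"
    and A_nonneg: "0 \<le> A"
    and A_bound: "\<And>B. B \<in> circ_intervals \<Longrightarrow>
        (\<integral>\<^sup>+x\<in>B. w x \<partial>lebesgue) / ennreal (measure lebesgue B powr harm_mean p B)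
        * lux B (\<lambda>x. conj_exponent p x / ennreal (p x)) (\<lambda>x. 1 / w x) \<le> ennreal A"
    and w_pos: "AE x in lebesgue. 0 < w x"
begin

lemma P_ge_1: "1 \<le> P"
  using p_ge_1[of 0] p_le[of 0] by auto

lemma phi_measurable:
  assumes "B \<subseteq> circ" "B \<in> sets lebesgue"
  shows "(\<lambda>x. phi (conj_exponent p x / ennreal (p x)) (1 / w x / ennreal \<alpha>) * indicator B x) \<in> borel_measurable lebesgue"
proof -
  define p' where "p' x = (if x \<in> circ then p x else 0)" for x
  have [measurable]: "p' \<in> borel_measurable lebesgue"
  proof -
    have "(\<lambda>x. if x \<in> circ then p x else 0) \<in> borel_measurable lebesgue"
      by (rule borel_measurable_if_I) (use p_measurable in auto)
    then show ?thesis by (simp add: p'_def[abs_def])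
  qed
  have "(\<lambda>x. phi (conj_exponent p' x / ennreal (p' x)) (1 / w x / ennreal \<alpha>)) \<in> borel_measurable lebesgue"
    unfolding phi_def conj_exponent_def by measurable
  then have "(\<lambda>x. phi (conj_exponent p' x / ennreal (p' x)) (1 / w x / ennreal \<alpha>) * indicator B x) \<in> borel_measurable lebesgue"
    using assms(2) by (intro borel_measurable_times_ennreal borel_measurable_indicator)
  also have "(\<lambda>x. phi (conj_exponent p' x / ennreal (p' x)) (1 / w x / ennreal \<alpha>) * indicator B x)
     = (\<lambda>x. phi (conj_exponent p x / ennreal (p x)) (1 / w x / ennreal \<alpha>) * indicator B x)"
    using assms(1) by (auto simp: fun_eq_iff indicator_def p'_def conj_exponent_def subset_iff)
  finally show ?thesis .
qed

lemma modular_on_measurable: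
  fixes f :: "real \<Rightarrow> real"
  assumes "f \<in> borel_measurable lebesgue" "\<And>x. 0 \<le> f x" "B \<subseteq> circ" "B \<in> sets lebesgue"
  shows "(\<lambda>x. ennreal (f x powr p x) * w x * indicator B x) \<in> borel_measurable lebesgue"
proof -
  have "(\<lambda>x. ennreal ((norm (f x) / 1) powr p x) * w x * indicator circ x * indicator B x) \<in> borel_measurable lebesgue"
    using assms by (intro borel_measurable_times_ennreal[OF modular_measurable] borel_measurable_indicator) auto
  also have "(\<lambda>x. ennreal ((norm (f x) / 1) powr p x) * w x * indicator circ x * indicator B x)
    = (\<lambda>x. ennreal (f x powr p x) * w x * indicator B x)"
    using assms(2,3) by (auto simp: fun_eq_iff indicator_def subset_iff)
  finally show ?thesis .
qed

text \<open>
  The duality between \<open>w\<close> and \<open>1 / w\<close>: if \<open>\<alpha>\<close> is admissible in the definition of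
  \<^term>\<open>lux B (\<lambda>x. conj_exponent p x / ennreal (p x)) (\<lambda>x. 1 / w x)\<close>, integrals over \<open>B\<close> are bounded
  by weighted modulars. This is how the Muckenhoupt condition enters every estimate.
\<close>

lemma integral_le_modular:
  fixes f :: "real \<Rightarrow> real"
  assumes f: "f \<in> borel_measurable lebesgue" "\<And>x. 0 \<le> f x" and B: "B \<subseteq> circ" "B \<in> sets lebesgue" and "0 < \<alpha>"
    and adm: "(\<integral>\<^sup>+x\<in>B. phi (conj_exponent p x / ennreal (p x)) (1 / w x / ennreal \<alpha>) \<partial>lebesgue) \<le> 1"
  shows "(\<integral>\<^sup>+x\<in>B. f x \<partial>lebesgue) \<le> ennreal \<alpha> * (\<integral>\<^sup>+x\<in>B. (ennreal (f x powr p x) * w x) \<partial>lebesgue) + 1"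
proof -
  have "(\<integral>\<^sup>+x\<in>B. f x \<partial>lebesgue) \<le> (\<integral>\<^sup>+x. ennreal \<alpha> * (ennreal (f x powr p x) * w x * indicator B x)
      + phi (conj_exponent p x / ennreal (p x)) (1 / w x / ennreal \<alpha>) * indicator B x \<partial>lebesgue)"
  proof (rule nn_integral_mono_AE)
    show "AE x in lebesgue. ennreal (f x) * indicator B x \<le> ennreal \<alpha> * (ennreal (f x powr p x) * w x * indicator B x)
      + phi (conj_exponent p x / ennreal (p x)) (1 / w x / ennreal \<alpha>) * indicator B x"
      using w_pos
    proof eventually_elim
      fix x assume "0 < w x"
      then show "ennreal (f x) * indicator B x \<le> ennreal \<alpha> * (ennreal (f x powr p x) * w x * indicator B x)
      + phi (conj_exponent p x / ennreal (p x)) (1 / w x / ennreal \<alpha>) * indicator B x"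
        using phi_pointwise_bound[OF \<open>0 < \<alpha>\<close> _ f(2), of "w x" p x x] p_ge_1[of x] B(1)
        by (cases "x \<in> B") (auto simp: mult.commute subset_iff)
    qed
  qed
  also have "\<dots> = ennreal \<alpha> * (\<integral>\<^sup>+x\<in>B. (ennreal (f x powr p x) * w x) \<partial>lebesgue)
      + (\<integral>\<^sup>+x\<in>B. phi (conj_exponent p x / ennreal (p x)) (1 / w x / ennreal \<alpha>) \<partial>lebesgue)"
    using modular_on_measurable[OF f B] phi_measurable[OF B, of \<alpha>]
    by (subst nn_integral_add) (auto simp: nn_integral_cmult intro!: borel_measurable_times_ennreal)
  also have "\<dots> \<le> ennreal \<alpha> * (\<integral>\<^sup>+x\<in>B. (ennreal (f x powr p x) * w x) \<partial>lebesgue) + 1"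
    by (intro add_left_mono adm)
  finally show ?thesis .
qed

lemma weight_integral_pos:
  assumes "B \<in> sets lebesgue" "0 < measure lebesgue B"
  shows "0 < (\<integral>\<^sup>+x\<in>B. w x \<partial>lebesgue)"
proof (rule ccontr)
  assume "\<not> 0 < (\<integral>\<^sup>+x\<in>B. w x \<partial>lebesgue)"
  then have "(\<integral>\<^sup>+x. w x * indicator B x \<partial>lebesgue) = 0" by simp
  then have "AE x in lebesgue. w x * indicator B x = 0"
    by (subst (asm) nn_integral_0_iff_AE) (use assms in \<open>auto intro!: borel_measurable_times_ennreal\<close>)
  with w_pos have "AE x in lebesgue. x \<notin> B" by eventually_elim (auto simp: indicator_def split: if_splits)
  then have "B \<in> null_sets lebesgue" using assms(1) by (simp add: AE_iff_null_sets)
  then show False using assms(2) by (simp add: null_sets_def measure_def)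
qed

text \<open>
  The definition of a weight admits infinite values and weights that are not integrable. If the
  integral over the circle is infinite, the Muckenhoupt condition on the whole circle makes the
  dual factor vanish. Then \<open>\<alpha>\<close> can be taken arbitrarily small in \<open>integral_le_modular\<close>, and testing
  with multiples of indicators shows that the sets where \<open>w\<close> is bounded are null. The space then
  consists of functions that vanish almost everywhere.
\<close>

lemma infinite_weight:
  assumes "(\<integral>\<^sup>+x\<in>circ. w x \<partial>lebesgue) = top"
  shows "AE x in lebesgue. x \<in> circ \<longrightarrow> w x = top"
proof -
  let ?L = "lux circ (\<lambda>x. conj_exponent p x / ennreal (p x)) (\<lambda>x. 1 / w x)"
  have "top / ennreal (measure lebesgue circ powr harm_mean p circ) = top"
    by (simp add: ennreal_top_divide)
  with A_bound[OF circ_in_circ_intervals] assms have "top * ?L \<le> ennreal A" by simp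
  then have L: "?L = 0" by (metis ennreal_less_top ennreal_top_mult not_le)
  define S where "S n = {x\<in>circ. w x \<le> ennreal (real n)}" for n :: nat
  have Sm: "S n \<in> sets lebesgue" for n
  proof -
    have "S n = {x\<in>space lebesgue. w x \<le> ennreal (real n)} \<inter> circ" by (auto simp: S_def)
    also have "\<dots> \<in> sets lebesgue" by (intro sets.Int) (measurable, auto)
    finally show ?thesis .
  qed
  have Sl: "S n \<in> lmeasurable" for n by (rule fmeasurableI2[OF _ _ Sm, of circ]) (auto simp: S_def)
  have bound: "t * measure lebesgue (S n) \<le> 2" if t: "1 \<le> t" for t :: real and n
  proof -
    \<comment> \<open>Makes \<open>\<alpha>\<close> times the modular of \<open>t\<close> on \<open>S n\<close> at most 1 as soon as \<open>\<alpha> < 1 / M\<close>.\<close>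
    define M where "M = t powr P * real n * (2 * pi) + 1"
    have M: "0 < M" by (simp add: M_def add_nonneg_pos)
    have "?L < ennreal (1 / M)" using L M by simp
    then obtain \<alpha> where \<alpha>: "0 < \<alpha>" "(\<integral>\<^sup>+x\<in>circ. phi (conj_exponent p x / ennreal (p x)) (1 / w x / ennreal \<alpha>) \<partial>lebesgue) \<le> 1"
        "ennreal \<alpha> < ennreal (1/M)"
      unfolding lux_def INF_less_iff by auto
    then have "\<alpha> < 1/M" by (metis ennreal_leI not_le)
    have f: "(\<lambda>x. t * indicator (S n) x) \<in> borel_measurable lebesgue" using Sm by auto
    have "ennreal (t * measure lebesgue (S n)) = (\<integral>\<^sup>+x\<in>circ. (t * indicator (S n) x) \<partial>lebesgue)"
    proof -
      have "(\<integral>\<^sup>+x\<in>circ. (t * indicator (S n) x) \<partial>lebesgue) = (\<integral>\<^sup>+x. ennreal t * indicator (S n) x \<partial>lebesgue)"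
        by (intro nn_integral_cong) (auto simp: indicator_def S_def)
      also have "\<dots> = ennreal t * emeasure lebesgue (S n)" using Sm by (simp add: nn_integral_cmult_indicator)
      also have "\<dots> = ennreal (t * measure lebesgue (S n))"
        using Sl t by (simp add: emeasure_eq_measure2 ennreal_mult)
      finally show ?thesis by simp
    qed
    also have "\<dots> \<le> ennreal \<alpha> * (\<integral>\<^sup>+x\<in>circ. (ennreal ((t * indicator (S n) x) powr p x) * w x) \<partial>lebesgue) + 1"
      by (rule integral_le_modular[OF f _ _ _ \<alpha>(1,2)]) (use t in auto)
    also have "(\<integral>\<^sup>+x\<in>circ. (ennreal ((t * indicator (S n) x) powr p x) * w x) \<partial>lebesgue)
      \<le> (\<integral>\<^sup>+x. ennreal (t powr P * real n) * indicator circ x \<partial>lebesgue)"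
    proof (rule nn_integral_mono)
      fix x
      show "ennreal ((t * indicator (S n) x) powr p x) * w x * indicator circ x \<le> ennreal (t powr P * real n) * indicator circ x"
      proof (cases "x \<in> S n")
        case True
        then have "t powr p x \<le> t powr P" using t p_le by (intro powr_mono) (auto simp: S_def)
        then have "ennreal (t powr p x) * w x \<le> ennreal (t powr P) * ennreal (real n)"
          using True by (intro mult_mono ennreal_leI) (auto simp: S_def)
        then show ?thesis using True by (simp add: S_def ennreal_mult)
      qed (use p_ge_1[of x] in \<open>auto simp: indicator_def\<close>)
    qed
    also have "\<dots> = ennreal (t powr P * real n) * ennreal (2*pi)"
      by (subst nn_integral_cmult_indicator) auto
    finally have "ennreal (t * measure lebesgue (S n)) \<le> ennreal \<alpha> * (ennreal (t powr P * real n) * ennreal (2*pi)) + 1"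
      by (simp add: mult_left_mono add_right_mono)
    also have "\<dots> = ennreal (\<alpha> * (t powr P * real n * (2*pi)) + 1)"
      using \<alpha>(1) by (simp add: ennreal_mult ennreal_plus)
    finally have "t * measure lebesgue (S n) \<le> \<alpha> * (t powr P * real n * (2*pi)) + 1"
      using \<alpha>(1) by (subst (asm) ennreal_le_iff) (auto intro!: add_nonneg_nonneg mult_nonneg_nonneg)
    also have "\<alpha> * (t powr P * real n * (2*pi)) \<le> (1/M) * M"
      using \<open>\<alpha> < 1/M\<close> \<alpha>(1) M by (intro mult_mono) (auto simp: M_def)
    also have "(1/M) * M = 1" using M by simp
    finally show ?thesis by simp
  qed
  have "measure lebesgue (S n) = 0" for n
  proof (rule ccontr)
    assume "measure lebesgue (S n) \<noteq> 0"
    then have "0 < measure lebesgue (S n)" by (simp add: zero_less_measure_iff)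
    moreover from this have "(3 / measure lebesgue (S n) + 1) * measure lebesgue (S n) = 3 + measure lebesgue (S n)"
      by (simp add: distrib_right)
    ultimately show False using bound[of "3 / measure lebesgue (S n) + 1" n] by simp
  qed
  then have "S n \<in> null_sets lebesgue" for n
    using Sl[of n] by (simp add: null_sets_def emeasure_eq_measure2 fmeasurableD)
  then have "(\<Union>n. S n) \<in> null_sets lebesgue" by blast
  then have "AE x in lebesgue. x \<notin> (\<Union>n. S n)" by (rule AE_not_in)
  then show ?thesis
  proof eventually_elim
    fix x assume x: "x \<notin> (\<Union>n. S n)"
    show "x \<in> circ \<longrightarrow> w x = top"
    proof
      assume "x \<in> circ"
      show "w x = top"
      proof (rule ccontr)
        assume "w x \<noteq> top"
        then obtain r where r: "w x = ennreal r" "0 \<le> r" by (cases "w x") auto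
        obtain n :: nat where "r \<le> real n" using real_arch_simple by blast
        then have "x \<in> S n" using r \<open>x \<in> circ\<close> by (auto simp: S_def intro: ennreal_leI)
        then show False using x by blast
      qed
    qed
  qed
qed

definition qmean :: "real set \<Rightarrow> real" where
  "qmean B = 1 / measure lebesgue B * (LINT x:B|lebesgue. 1 / p x)"

lemma harm_mean_qmean: "harm_mean p B = 1 / qmean B"
  by (simp add: harm_mean_def qmean_def)

lemma inverse_p_integrable:
  assumes "B \<subseteq> circ" "B \<in> lmeasurable"
  shows "set_integrable lebesgue B (\<lambda>x. 1 / p x)"
proof -
  define p' where "p' x = (if x \<in> circ then p x else 0)" for x
  have [measurable]: "p' \<in> borel_measurable lebesgue"
  proof -
    have "(\<lambda>x. if x \<in> circ then p x else 0) \<in> borel_measurable lebesgue"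
      by (rule borel_measurable_if_I) (use p_measurable in auto)
    then show ?thesis by (simp add: p'_def[abs_def])
  qed
  have [measurable]: "B \<in> sets lebesgue" using assms(2) by (simp add: fmeasurableD)
  have m: "(\<lambda>x. indicator B x *\<^sub>R (1 / p' x)) \<in> borel_measurable lebesgue"
    by (intro borel_measurable_scaleR borel_measurable_indicator) (auto simp: fmeasurableD)
  have e: "indicator B x *\<^sub>R (1 / p' x) = indicator B x *\<^sub>R (1 / p x)" for x
    using assms(1) by (auto simp: indicator_def p'_def subset_iff)
  have "integrable lebesgue (\<lambda>x. indicator B x *\<^sub>R (1 / p x))"
  proof (rule Bochner_Integration.integrable_bound)
    show "integrable lebesgue (indicator B :: real \<Rightarrow> real)"
      using assms(2) by (intro integrable_real_indicator) (auto simp: fmeasurable_def)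
    show "(\<lambda>x. indicator B x *\<^sub>R (1 / p x)) \<in> borel_measurable lebesgue" using m unfolding e .
    show "AE x in lebesgue. norm (indicator B x *\<^sub>R (1 / p x)) \<le> norm (indicator B x :: real)"
    proof (rule AE_I2)
      fix x show "norm (indicator B x *\<^sub>R (1 / p x)) \<le> norm (indicator B x :: real)"
        using p_ge_1[of x] assms(1) by (auto simp: indicator_def divide_le_eq)
    qed
  qed
  then show ?thesis by (simp add: set_integrable_def)
qed

lemma integral_inverse_p_le:
  assumes "B \<subseteq> circ" "B \<in> lmeasurable" "\<And>x. x \<in> B \<Longrightarrow> 1 / p x \<le> hi"
  shows "(LINT x:B|lebesgue. 1 / p x) \<le> measure lebesgue B * hi"
proof -
  have c: "set_integrable lebesgue B (\<lambda>x. hi)"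
    unfolding set_integrable_def using assms(2)
    by (intro integrable_scaleR_left integrable_real_indicator) (auto simp: fmeasurable_def)
  have "(LINT x:B|lebesgue. 1 / p x) \<le> (LINT x:B|lebesgue. hi)"
    by (rule set_integral_mono[OF inverse_p_integrable[OF assms(1,2)] c assms(3)])
  also have "\<dots> = measure lebesgue B * hi" using assms(2) by (simp add: set_lebesgue_integral_def)
  finally show ?thesis .
qed

lemma integral_inverse_p_ge:
  assumes "B \<subseteq> circ" "B \<in> lmeasurable" "\<And>x. x \<in> B \<Longrightarrow> lo \<le> 1 / p x"
  shows "measure lebesgue B * lo \<le> (LINT x:B|lebesgue. 1 / p x)"
proof -
  have c: "set_integrable lebesgue B (\<lambda>x. lo)"
    unfolding set_integrable_def using assms(2)
    by (intro integrable_scaleR_left integrable_real_indicator) (auto simp: fmeasurable_def)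
  have "(LINT x:B|lebesgue. lo) \<le> (LINT x:B|lebesgue. 1 / p x)"
    by (rule set_integral_mono[OF c inverse_p_integrable[OF assms(1,2)] assms(3)])
  moreover have "(LINT x:B|lebesgue. lo) = measure lebesgue B * lo" using assms(2) by (simp add: set_lebesgue_integral_def)
  ultimately show ?thesis by simp
qed

lemma qmean_bounds:
  assumes B: "B \<in> circ_intervals" and "\<And>x. x \<in> B \<Longrightarrow> lo \<le> 1 / p x" "\<And>x. x \<in> B \<Longrightarrow> 1 / p x \<le> hi"
  shows "lo \<le> qmean B" "qmean B \<le> hi"
  using integral_inverse_p_ge[OF circ_intervals_props(1,2)[OF B] assms(2)]
    integral_inverse_p_le[OF circ_intervals_props(1,2)[OF B] assms(3)] circ_intervals_props(3)[OF B]
  unfolding qmean_def by (simp_all add: field_simps)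

lemma inverse_p_bounds: "x \<in> circ \<Longrightarrow> 1 / P \<le> 1 / p x" "x \<in> circ \<Longrightarrow> 1 / p x \<le> 1"
  using p_ge_1[of x] p_le[of x] P_ge_1 by (auto intro!: divide_left_mono simp: divide_le_eq)

lemma qmean_range: "B \<in> circ_intervals \<Longrightarrow> 1 / P \<le> qmean B \<and> qmean B \<le> 1"
  using qmean_bounds[of B "1/P" 1] inverse_p_bounds circ_intervals_props(1)[of B] by blast

lemma harm_mean_range:
  assumes "B \<in> circ_intervals" shows "1 \<le> harm_mean p B" "harm_mean p B \<le> P"
proof -
  have q: "1 / P \<le> qmean B" "qmean B \<le> 1" using qmean_range[OF assms] by auto
  moreover have "0 < 1 / P" using P_ge_1 by simp
  ultimately have "0 < qmean B" by linarith
  then show "1 \<le> harm_mean p B" "harm_mean p B \<le> P"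
    using q P_ge_1 unfolding harm_mean_qmean by (auto simp: field_simps)
qed

text \<open>
  The infimum in \<^const>\<open>lux\<close> need not be attained; replacing \<open>A\<close> by \<open>A + 1\<close> leaves room for an
  admissible \<open>\<alpha>\<close>.
\<close>

lemma admissible_constant:
  assumes B: "B \<in> circ_intervals" and fin: "(\<integral>\<^sup>+x\<in>B. w x \<partial>lebesgue) = ennreal V" and "0 < V"
  obtains \<alpha> where "0 < \<alpha>" "V * \<alpha> \<le> (A + 1) * measure lebesgue B powr harm_mean p B"
    "(\<integral>\<^sup>+x\<in>B. phi (conj_exponent p x / ennreal (p x)) (1 / w x / ennreal \<alpha>) \<partial>lebesgue) \<le> 1"
proof -
  let ?L = "lux B (\<lambda>x. conj_exponent p x / ennreal (p x)) (\<lambda>x. 1 / w x)"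
  define R where "R = measure lebesgue B powr harm_mean p B"
  have R: "0 < R" using circ_intervals_props(3)[OF B] by (simp add: R_def)
  have *: "ennreal (V / R) * ?L \<le> ennreal A"
    using A_bound[OF B] fin \<open>0 < V\<close> R by (simp add: R_def[symmetric] divide_ennreal)
  have "?L < ennreal ((A + 1) * R / V)"
  proof (rule ccontr)
    assume "\<not> ?L < ennreal ((A + 1) * R / V)"
    then have "ennreal (V / R) * ennreal ((A + 1) * R / V) \<le> ennreal A"
      by (intro order_trans[OF mult_left_mono *]) auto
    then have "ennreal (A + 1) \<le> ennreal A"
      using \<open>0 < V\<close> R A_nonneg by (simp add: ennreal_mult[symmetric])
    then show False using A_nonneg by (simp add: ennreal_le_iff)
  qed
  then obtain \<alpha> where \<alpha>: "0 < \<alpha>" "(\<integral>\<^sup>+x\<in>B. phi (conj_exponent p x / ennreal (p x)) (1 / w x / ennreal \<alpha>) \<partial>lebesgue) \<le> 1"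
      "ennreal \<alpha> < ennreal ((A + 1) * R / V)"
    unfolding lux_def INF_less_iff by auto
  then have "\<alpha> < (A + 1) * R / V" by (metis ennreal_leI not_le)
  then have "V * \<alpha> \<le> (A + 1) * R" using \<open>0 < V\<close> by (simp add: field_simps)
  then show ?thesis using that \<alpha> by (auto simp: R_def)
qed

lemma weight_integral_real:
  assumes fin: "(\<integral>\<^sup>+x\<in>circ. w x \<partial>lebesgue) < top" and B: "B \<in> circ_intervals"
  obtains V where "(\<integral>\<^sup>+x\<in>B. w x \<partial>lebesgue) = ennreal V" "0 < V"
proof -
  have "(\<integral>\<^sup>+x\<in>B. w x \<partial>lebesgue) \<le> (\<integral>\<^sup>+x\<in>circ. w x \<partial>lebesgue)"
    using circ_intervals_props(1)[OF B] by (intro nn_integral_mono) (auto simp: indicator_def)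
  then have "(\<integral>\<^sup>+x\<in>B. w x \<partial>lebesgue) < top" using fin by (rule le_less_trans)
  moreover have "0 < (\<integral>\<^sup>+x\<in>B. w x \<partial>lebesgue)"
    by (rule weight_integral_pos) (use circ_intervals_props[OF B] in \<open>auto simp: fmeasurableD\<close>)
  ultimately show ?thesis using that by (cases "\<integral>\<^sup>+x\<in>B. w x \<partial>lebesgue") auto
qed

text \<open>
  The log-Hoelder condition is stated on the segment \<^term>\<open>circ\<close> and does not compare the values of
  \<open>p\<close> at the two endpoints, which are the same point of the circle. The Muckenhoupt condition on the
  intervals \<open>I\<close> through that point does. Suppose that \<open>p\<close> is smaller at \<open>z\<close> than at \<open>z'\<close>. On the half of
  \<open>I\<close> near \<open>z\<close> the exponent is then at most \<open>s\<close>, whereas the harmonic mean over \<open>I\<close> is at least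
  some \<open>t > s\<close>. Testing with a constant function on that half gives \<open>1 \<le> K d powr (t - s)\<close> for all
  small lengths \<open>d\<close>, which is absurd.
\<close>

lemma seam_exponent_le:
  assumes fin: "(\<integral>\<^sup>+x\<in>circ. w x \<partial>lebesgue) < top"
    and z: "(z = -pi \<and> z' = pi) \<or> (z = pi \<and> z' = -pi)"
  shows "p z' \<le> p z"
proof (rule ccontr)
  assume "\<not> p z' \<le> p z"
  then have ab: "p z < p z'" by simp
  have zc: "z \<in> circ" "z' \<in> circ" using z pi_gt_zero by auto
  have p1: "1 \<le> p z" "1 \<le> p z'" using zc p_ge_1 by auto
  define mid where "mid = (1 / p z + 1 / p z') / 2"
  have inv: "1 / p z' < 1 / p z" using ab p1 by (intro divide_strict_left_mono) auto
  \<comment> \<open>Small enough for \<open>mid + \<epsilon> < 1 / p z - \<epsilon>\<close>, which separates \<open>s\<close> from \<open>t\<close>.\<close>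
  define \<epsilon> where "\<epsilon> = (1 / p z - mid) / 4"
  have \<epsilon>: "0 < \<epsilon>" using inv by (simp add: \<epsilon>_def mid_def field_simps)
  define s where "s = 1 / (1 / p z - \<epsilon>)"
  define t where "t = 1 / (mid + \<epsilon>)"
  have mid0: "0 < mid" using p1 by (auto simp: mid_def intro!: add_pos_pos)
  have st1: "mid + \<epsilon> < 1 / p z - \<epsilon>" using \<epsilon> unfolding \<epsilon>_def by (simp add: field_simps)
  have st: "s < t" unfolding s_def t_def using st1 mid0 \<epsilon> by (intro divide_strict_left_mono) (auto intro: mult_pos_pos)
  obtain d0 where d0: "0 < d0" "d0 \<le> 1" "log_modulus c d0 \<le> \<epsilon>" using log_modulus_small[OF c_pos \<epsilon>] .
  define K where "K = (A + 1) * 4 powr P"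
  have K: "0 < K" using A_nonneg by (simp add: K_def)
  have main: "1 \<le> K * d powr (t - s)" if d: "0 < d" "d \<le> d0" for d
  proof -
    define Bz where "Bz u = (if u = -pi then {-pi..-pi+d} else {pi-d..pi})" for u
    have dpi: "d < pi" using d d0 pi_gt3 by linarith
    have Bc: "Bz u \<subseteq> circ" "Bz u \<in> lmeasurable" "measure lebesgue (Bz u) = d" for u
      using d dpi by (auto simp: Bz_def)
    define I where "I = {-pi..-pi+d} \<union> {pi-d..pi}"
    have BI: "Bz z \<subseteq> I" "I = Bz z \<union> Bz z'" using z pi_gt_zero by (auto simp: Bz_def I_def)
    have disj: "Bz z \<inter> Bz z' = {}" using z d dpi by (auto simp: Bz_def)
    have mI: "measure lebesgue I = 2 * d"
    proof -
      have "Bz z' - Bz z = Bz z'" using disj by blast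
      then show ?thesis unfolding BI(2) using measure_Un2[OF Bc(2)[of z] Bc(2)[of z']] Bc(3) by simp
    qed
    have I: "I \<in> circ_intervals"
      unfolding circ_intervals_def
    proof (intro CollectI conjI)
      show "\<exists>a b. - pi \<le> a \<and> a \<le> b \<and> b \<le> pi \<and> (I = {a..b} \<or> I = {- pi..a} \<union> {b..pi})"
        by (rule exI[of _ "-pi+d"], rule exI[of _ "pi-d"]) (use d dpi in \<open>simp add: I_def\<close>)
    qed (use d mI in simp)
    have close: "\<bar>1 / p x - 1 / p u\<bar> \<le> \<epsilon>" if x: "x \<in> Bz u" "u = z \<or> u = z'" for x u
    proof (cases "x = u")
      case False
      have "x \<in> circ" "u \<in> circ" using x Bc zc by blast+
      then have "\<bar>1 / p x - 1 / p u\<bar> \<le> log_modulus c \<bar>x - u\<bar>" using False by (rule log_hoelder)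
      also have "\<dots> \<le> log_modulus c d0"
        using False x z d c_pos by (intro log_modulus_mono) (auto simp: Bz_def split: if_splits)
      finally show ?thesis using d0 by simp
    qed (use \<epsilon> in simp)
    obtain V where V: "(\<integral>\<^sup>+x\<in>I. w x \<partial>lebesgue) = ennreal V" "0 < V" using weight_integral_real[OF fin I] .
    obtain \<alpha> where \<alpha>: "0 < \<alpha>" "V * \<alpha> \<le> (A + 1) * measure lebesgue I powr harm_mean p I"
      "(\<integral>\<^sup>+x\<in>I. phi (conj_exponent p x / ennreal (p x)) (1 / w x / ennreal \<alpha>) \<partial>lebesgue) \<le> 1"
      using admissible_constant[OF I V] .
    have adm: "(\<integral>\<^sup>+x\<in>Bz z. phi (conj_exponent p x / ennreal (p x)) (1 / w x / ennreal \<alpha>) \<partial>lebesgue) \<le> 1"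
      by (rule order_trans[OF nn_integral_mono \<alpha>(3)]) (use BI(1) in \<open>auto simp: indicator_def\<close>)
    have g1: "(\<integral>\<^sup>+x\<in>Bz z. ennreal (2/d) \<partial>lebesgue) \<le> ennreal \<alpha> * (\<integral>\<^sup>+x\<in>Bz z. (ennreal ((2/d) powr p x) * w x) \<partial>lebesgue) + 1"
      by (rule integral_le_modular[OF _ _ _ _ \<alpha>(1) adm]) (use Bc d in \<open>auto simp: fmeasurableD\<close>)
    have g2: "(\<integral>\<^sup>+x\<in>Bz z. ennreal (2/d) \<partial>lebesgue) = ennreal 2"
      using Bc[of z] d by (subst nn_integral_cmult_indicator) (auto simp: fmeasurableD emeasure_eq_measure2 ennreal_mult[symmetric])
    have g3: "(\<integral>\<^sup>+x\<in>Bz z. (ennreal ((2/d) powr p x) * w x) \<partial>lebesgue) \<le> (\<integral>\<^sup>+x. ennreal ((2/d) powr s) * (w x * indicator I x) \<partial>lebesgue)"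
    proof (rule nn_integral_mono)
      fix x
      show "ennreal ((2/d) powr p x) * w x * indicator (Bz z) x \<le> ennreal ((2/d) powr s) * (w x * indicator I x)"
      proof (cases "x \<in> Bz z")
        case True
        have "1 / p z - \<epsilon> \<le> 1 / p x" using close[of x z] True by (auto simp: abs_le_iff)
        moreover have "0 < 1 / p z - \<epsilon>" using st1 mid0 \<epsilon> by linarith
        moreover have "1 \<le> p x" using p_ge_1 True Bc by blast
        ultimately have "p x \<le> s" unfolding s_def by (simp add: field_simps)
        then have "(2/d) powr p x \<le> (2/d) powr s" using d d0 by (intro powr_mono) auto
        then show ?thesis using True BI(1) by (auto intro!: mult_mono ennreal_leI simp: indicator_def)
      qed simp
    qed
    have g4: "(\<integral>\<^sup>+x. ennreal ((2/d) powr s) * (w x * indicator I x) \<partial>lebesgue) = ennreal ((2/d) powr s * V)"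
      using V circ_intervals_props(2)[OF I]
      by (subst nn_integral_cmult) (auto simp: ennreal_mult fmeasurableD intro!: borel_measurable_times_ennreal)
    have "ennreal 2 \<le> ennreal \<alpha> * ennreal ((2/d) powr s * V) + 1"
      unfolding g2[symmetric] g4[symmetric] by (rule order_trans[OF g1]) (intro add_right_mono mult_left_mono g3 zero_le)
    also have "\<dots> = ennreal (\<alpha> * ((2/d) powr s * V) + 1)"
      using \<alpha>(1) V(2) by (simp add: ennreal_mult ennreal_plus)
    finally have "1 \<le> \<alpha> * ((2/d) powr s * V)"
      using \<alpha>(1) V(2) by (subst (asm) ennreal_le_iff) auto
    also have "\<dots> = (2/d) powr s * (V * \<alpha>)" by simp
    also have "\<dots> \<le> (2/d) powr s * ((A + 1) * (2*d) powr harm_mean p I)"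
      using \<alpha>(2) mI by (intro mult_left_mono) auto
    also have "\<dots> \<le> (2/d) powr s * ((A + 1) * (2 powr P * d powr t))"
    proof -
      have "qmean I \<le> mid + \<epsilon>"
      proof -
        have "(LINT x:I|lebesgue. 1 / p x) = (LINT x:Bz z|lebesgue. 1 / p x) + (LINT x:Bz z'|lebesgue. 1 / p x)"
          unfolding BI(2) by (rule set_integral_Un[OF disj]) (intro inverse_p_integrable Bc)+
        also have "(LINT x:Bz z|lebesgue. 1 / p x) \<le> measure lebesgue (Bz z) * (1 / p z + \<epsilon>)"
        proof (intro integral_inverse_p_le Bc)
          show "1 / p x \<le> 1 / p z + \<epsilon>" if "x \<in> Bz z" for x using close[OF that] by linarith
        qed
        also have "(LINT x:Bz z'|lebesgue. 1 / p x) \<le> measure lebesgue (Bz z') * (1 / p z' + \<epsilon>)"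
        proof (intro integral_inverse_p_le Bc)
          show "1 / p x \<le> 1 / p z' + \<epsilon>" if "x \<in> Bz z'" for x using close[OF that] by linarith
        qed
        also have "measure lebesgue (Bz z) * (1 / p z + \<epsilon>) + measure lebesgue (Bz z') * (1 / p z' + \<epsilon>) = (2*d) * (mid + \<epsilon>)"
          by (simp add: Bc mid_def field_simps)
        finally show ?thesis unfolding qmean_def mI using d by (simp add: divide_le_eq mult.commute)
      qed
      moreover have "0 < qmean I" using qmean_range[OF I] P_ge_1 by (auto intro: less_le_trans[of 0 "1/P"])
      ultimately have "t \<le> harm_mean p I" unfolding t_def harm_mean_qmean using mid0 \<epsilon>
        by (intro divide_left_mono) (auto intro: mult_pos_pos)
      then have "d powr harm_mean p I \<le> d powr t" using d d0 by (intro powr_mono') auto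
      moreover have "2 powr harm_mean p I \<le> 2 powr P" using harm_mean_range[OF I] by (intro powr_mono) auto
      ultimately have "(2*d) powr harm_mean p I \<le> 2 powr P * d powr t"
        using d by (simp add: powr_mult mult_mono)
      then show ?thesis using A_nonneg by (intro mult_left_mono) auto
    qed
    also have "\<dots> = 2 powr s * (A + 1) * 2 powr P * d powr (t - s)"
      using d by (simp add: powr_divide powr_diff)
    also have "\<dots> \<le> 2 powr P * (A + 1) * 2 powr P * d powr (t - s)"
    proof -
      have "s \<le> P"
      proof -
        have "1 / P \<le> 1 / p z'" using inverse_p_bounds zc by blast
        then have "1 / P < 1 / p z - \<epsilon>" using st1 \<epsilon> inv unfolding mid_def by (simp add: field_simps)
        moreover then have "0 < 1 / p z - \<epsilon>" using P_ge_1 by (meson divide_pos_pos less_trans zero_less_one less_le_trans)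
        ultimately show ?thesis unfolding s_def using P_ge_1 by (simp add: field_simps)
      qed
      then have "2 powr s \<le> 2 powr P" by (intro powr_mono) auto
      then show ?thesis using A_nonneg by (intro mult_right_mono) auto
    qed
    also have "\<dots> = K * d powr (t - s)"
    proof -
      have "(4::real) powr P = 2 powr P * 2 powr P" using powr_mult[of 2 2 P] by simp
      then show ?thesis by (simp add: K_def)
    qed
    finally show ?thesis .
  qed
  define d where "d = min d0 ((1 / (2 * K)) powr (1 / (t - s)))"
  have d: "0 < d" "d \<le> d0" using d0 K by (auto simp: d_def)
  have "d powr (t - s) \<le> ((1 / (2 * K)) powr (1 / (t - s))) powr (t - s)"
    using d st by (intro powr_mono2) (auto simp: d_def)
  also have "\<dots> = 1 / (2 * K)" using st K by (simp add: powr_powr)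
  finally have "K * d powr (t - s) \<le> K * (1 / (2 * K))" using K by (intro mult_left_mono) auto
  then show False using main[OF d] K by simp
qed

lemma p_seam:
  assumes "(\<integral>\<^sup>+x\<in>circ. w x \<partial>lebesgue) < top"
  shows "p (-pi) = p pi"
  using seam_exponent_le[OF assms, of pi "-pi"] seam_exponent_le[OF assms, of "-pi" pi] by simp

text \<open>
  On an interval through the endpoints the comparison passes through the common value of \<open>p\<close>
  there, which costs the factor 2.
\<close>

lemma inverse_exponent_oscillation:
  assumes fin: "(\<integral>\<^sup>+x\<in>circ. w x \<partial>lebesgue) < top" and B: "B \<in> circ_intervals" and xy: "x \<in> B" "y \<in> B"
  shows "\<bar>1 / p x - 1 / p y\<bar> \<le> 2 * log_modulus c (measure lebesgue B)"
proof -
  define d where "d = measure lebesgue B"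
  have d: "0 < d" using circ_intervals_props(3)[OF B] by (simp add: d_def)
  have one: "\<bar>1 / p u - 1 / p v\<bar> \<le> log_modulus c d" if "u \<in> circ" "v \<in> circ" "\<bar>u - v\<bar> \<le> d" for u v
  proof (cases "u = v")
    case False
    have "\<bar>1 / p u - 1 / p v\<bar> \<le> log_modulus c \<bar>u - v\<bar>" by (rule log_hoelder) (use that False in auto)
    also have "\<dots> \<le> log_modulus c d" using that False c_pos by (intro log_modulus_mono) auto
    finally show ?thesis .
  qed (use log_modulus_nonneg[of c d] c_pos d in simp)
  have nn: "0 \<le> log_modulus c d" using log_modulus_nonneg c_pos d by simp
  have xyc: "x \<in> circ" "y \<in> circ" using circ_intervals_props(1)[OF B] xy by blast+
  have pic: "pi \<in> circ" "-pi \<in> circ" using pi_gt_zero by auto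
  obtain a b where ab: "-pi \<le> a" "a \<le> b" "b \<le> pi" "B = {a..b} \<or> B = {-pi..a} \<union> {b..pi}"
    using B by (auto simp: circ_intervals_def)
  from ab(4) have "\<bar>1 / p x - 1 / p y\<bar> \<le> 2 * log_modulus c d"
  proof
    assume "B = {a..b}"
    then have "d = b - a" using ab by (simp add: d_def)
    then have "\<bar>x - y\<bar> \<le> d" using xy \<open>B = {a..b}\<close> by (auto simp: abs_le_iff)
    then show ?thesis using one[OF xyc] nn by simp
  next
    assume Beq: "B = {-pi..a} \<union> {b..pi}"
    have dd: "a + pi \<le> d" "pi - b \<le> d"
    proof -
      have "measure lebesgue {-pi..a} \<le> d" unfolding d_def Beq by (rule measure_mono_fmeasurable) auto
      then show "a + pi \<le> d" using ab by simp
      have "measure lebesgue {b..pi} \<le> d" unfolding d_def Beq by (rule measure_mono_fmeasurable) auto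
      then show "pi - b \<le> d" using ab by simp
    qed
    have seam: "p (-pi) = p pi" by (rule p_seam[OF fin])
    have end1: "\<bar>1 / p u - 1 / p pi\<bar> \<le> log_modulus c d" if u: "u \<in> B" for u
    proof -
      have uc: "u \<in> circ" using circ_intervals_props(1)[OF B] u by blast
      from u Beq consider "u \<in> {-pi..a}" | "u \<in> {b..pi}" by blast
      then show ?thesis
      proof cases
        case 1
        then have "\<bar>u - (-pi)\<bar> \<le> d" using dd by auto
        from one[OF uc pic(2) this] show ?thesis by (simp add: seam)
      next
        case 2
        then have "\<bar>u - pi\<bar> \<le> d" using dd by auto
        from one[OF uc pic(1) this] show ?thesis .
      qed
    qed
    show ?thesis using end1[OF xy(1)] end1[OF xy(2)] by (simp add: abs_le_iff)
  qed
  then show ?thesis by (simp add: d_def)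
qed

lemma exponent_oscillation:
  assumes fin: "(\<integral>\<^sup>+x\<in>circ. w x \<partial>lebesgue) < top" and B: "B \<in> circ_intervals" and xy: "x \<in> B" "y \<in> B"
  shows "\<bar>p x - p y\<bar> \<le> 2 * log_modulus c (measure lebesgue B) * P\<^sup>2"
    "\<bar>harm_mean p B - p y\<bar> \<le> 2 * log_modulus c (measure lebesgue B) * P\<^sup>2"
proof -
  let ?D = "2 * log_modulus c (measure lebesgue B)"
  have gen: "\<bar>1 / u - 1 / v\<bar> \<le> ?D * P\<^sup>2"
    if uv: "1 / P \<le> u" "1 / P \<le> v" "\<bar>u - v\<bar> \<le> ?D" for u v :: real
  proof -
    have P0: "0 < 1 / P" using P_ge_1 by simp
    then have pos: "0 < u" "0 < v" using uv by linarith+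
    have "1 / u \<le> P" "1 / v \<le> P" using uv pos P_ge_1 by (simp_all add: field_simps)
    then have PP: "(1 / u) * (1 / v) \<le> P * P" using pos P_ge_1 by (intro mult_mono) auto
    have "0 \<le> ?D" using uv(3) by linarith
    then have "\<bar>u - v\<bar> * ((1 / u) * (1 / v)) \<le> ?D * (P * P)"
      by (rule mult_mono[OF uv(3) PP]) (use pos in simp)
    moreover have "\<bar>1 / u - 1 / v\<bar> = \<bar>u - v\<bar> * ((1 / u) * (1 / v))"
    proof -
      have "1 / u - 1 / v = (v - u) * ((1 / u) * (1 / v))" using pos by (simp add: field_simps)
      then show ?thesis using pos by (simp only: abs_mult abs_minus_commute[of v u]) simp
    qed
    ultimately show ?thesis by (simp add: power2_eq_square)
  qed
  have c: "x \<in> circ" "y \<in> circ" using xy circ_intervals_props(1)[OF B] by blast+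
  show "\<bar>p x - p y\<bar> \<le> ?D * P\<^sup>2"
    using gen[of "1 / p x" "1 / p y"] inverse_p_bounds(1) c inverse_exponent_oscillation[OF fin B xy] by simp
  have "1 / p y - ?D \<le> qmean B \<and> qmean B \<le> 1 / p y + ?D"
  proof -
    have "1 / p y - ?D \<le> 1 / p u \<and> 1 / p u \<le> 1 / p y + ?D" if "u \<in> B" for u
      using inverse_exponent_oscillation[OF fin B that xy(2)] by (simp add: abs_le_iff)
    then show ?thesis using qmean_bounds[OF B, of "1 / p y - ?D" "1 / p y + ?D"] by blast
  qed
  then have "\<bar>qmean B - 1 / p y\<bar> \<le> ?D" by (simp add: abs_le_iff)
  then show "\<bar>harm_mean p B - p y\<bar> \<le> ?D * P\<^sup>2"
    using gen[of "qmean B" "1 / p y"] inverse_p_bounds(1)[OF c(2)] qmean_range[OF B] by (simp add: harm_mean_qmean)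
qed

text \<open>
  Changing an exponent by \<open>\<delta>\<close> changes a power of \<open>N = exp 1 + 1 / b\<close> by the factor \<open>N powr \<delta>\<close>, which is
  bounded because \<open>\<delta>\<close> is at most a multiple of \<open>1 / ln N\<close>; this is the point of the logarithmic
  modulus of continuity. It applies to the length \<open>b\<close> and also to the average \<open>m\<close>, since \<open>m\<close>
  is at most a multiple of \<open>1 / b\<close>.
\<close>

lemma power_comparison:
  fixes m b :: real
  assumes m: "1 < m" "m \<le> C1 / b" and C1: "1 \<le> C1" and b: "0 < b" "b \<le> 2 * pi"
    and d1: "\<bar>px - py\<bar> \<le> \<delta>" and d2: "\<bar>pB - py\<bar> \<le> \<delta>" and \<delta>: "\<delta> \<le> 2 * log_modulus c b * P\<^sup>2" "\<delta> \<le> P" and py: "py \<le> P"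
  shows "(2 / (m * b)) powr py
    \<le> (2 powr P * C1 powr P * (2 * pi) powr P * (exp (2 * c * P\<^sup>2))\<^sup>2) * (m powr (- px) * b powr (- pB))"
proof -
  \<comment> \<open>The argument of the logarithm in \<^term>\<open>log_modulus c b\<close>.\<close>
  define N where "N = exp 1 + 1 / b"
  define E where "E = exp (2 * c * P\<^sup>2)"
  have N1: "1 < N"
  proof -
    have "exp 0 < exp (1::real)" by (subst exp_less_cancel_iff) simp
    moreover have "0 < 1 / b" using b by simp
    ultimately show ?thesis unfolding N_def exp_zero by linarith
  qed
  have lnN: "0 < ln N" using N1 by simp
  have \<delta>0: "0 \<le> \<delta>" using d1 by linarith
  have ND: "N powr \<delta> \<le> E"
  proof -
    have "\<delta> * ln N \<le> (2 * log_modulus c b * P\<^sup>2) * ln N" using \<delta>(1) lnN by (intro mult_right_mono) auto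
    also have "\<dots> = 2 * c * P\<^sup>2" using lnN by (simp add: log_modulus_def N_def)
    finally show ?thesis using N1 by (simp add: E_def powr_def)
  qed
  have E1: "1 \<le> E" using c_pos by (simp add: E_def)
  have "m \<le> C1 * N"
  proof -
    have "C1 * (1 / b) \<le> C1 * N" using C1 by (intro mult_left_mono) (auto simp: N_def)
    then show ?thesis using m(2) by simp
  qed
  have "m powr (- py) \<le> m powr (\<delta> - px)" using d1 m by (intro powr_mono) auto
  also have "\<dots> = m powr \<delta> * m powr (- px)" by (simp add: powr_add[symmetric])
  also have "m powr \<delta> \<le> (C1 * N) powr \<delta>" using \<open>m \<le> C1 * N\<close> m \<delta>0 by (intro powr_mono2) auto
  also have "(C1 * N) powr \<delta> = C1 powr \<delta> * N powr \<delta>" using C1 N1 by (simp add: powr_mult)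
  also have "\<dots> \<le> C1 powr P * E" using C1 ND \<delta>(2) by (intro mult_mono powr_mono) auto
  finally have mpy: "m powr (- py) \<le> C1 powr P * E * m powr (- px)" by (simp add: mult_right_mono)
  have bpy: "b powr (- py) \<le> (2 * pi) powr P * E * b powr (- pB)"
  proof -
    have "b powr (pB - py) \<le> (2 * pi) powr P * E"
    proof (cases "1 \<le> b")
      case True
      then have "b powr (pB - py) \<le> b powr P" using d2 \<delta>(2) by (intro powr_mono) auto
      also have "\<dots> \<le> (2 * pi) powr P" using b P_ge_1 by (intro powr_mono2) auto
      also have "\<dots> \<le> (2 * pi) powr P * E" using E1 mult_left_mono[of 1 E "(2 * pi) powr P"] by simp
      finally show ?thesis .
    next
      case False
      then have "b powr (pB - py) \<le> b powr (- \<delta>)" using d2 b by (intro powr_mono') auto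
      also have "\<dots> = (1 / b) powr \<delta>" using b by (simp add: powr_minus powr_divide inverse_eq_divide)
      also have "\<dots> \<le> N powr \<delta>" using b \<delta>0 by (intro powr_mono2) (auto simp: N_def)
      also have "\<dots> \<le> E" by (rule ND)
      also have "\<dots> \<le> (2 * pi) powr P * E"
        using E1 ge_one_powr_ge_zero[of "2*pi" P] P_ge_1 pi_gt3 mult_right_mono[of 1 "(2 * pi) powr P" E] by simp
      finally show ?thesis .
    qed
    then have "b powr (pB - py) * b powr (- pB) \<le> (2 * pi) powr P * E * b powr (- pB)" by (intro mult_right_mono) auto
    then show ?thesis by (simp add: powr_add[symmetric])
  qed
  have "(2 / (m * b)) powr py = 2 powr py * (m powr (- py) * b powr (- py))"
    using m b by (simp add: powr_divide powr_mult powr_minus field_simps)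
  also have "\<dots> \<le> 2 powr P * ((C1 powr P * E * m powr (- px)) * ((2 * pi) powr P * E * b powr (- pB)))"
    using py mpy bpy by (intro mult_mono powr_mono) (auto intro!: mult_nonneg_nonneg simp: E_def)
  finally show ?thesis by (simp add: E_def power2_eq_square mult_ac)
qed

text \<open>
  The bound for one interval. Let \<open>m > 1\<close> be the average of \<open>f\<close> over \<open>B\<close> (for \<open>m \<le> 1\<close> the term \<open>V\<close>
  suffices). The function \<open>2 f / (m b)\<close> has integral 2 over \<open>B\<close>, so \<open>integral_le_modular\<close>
  yields that \<open>\<alpha>\<close> times its modular is at least 1; the choice of the integral 2 makes the additive
  constant 1 harmless. By \<open>power_comparison\<close> its modular is at most that of \<open>f\<close> times a
  multiple of \<open>m powr (- p x) * b powr (- harm_mean p B)\<close>, and \<open>V \<alpha>\<close> is at most a multiple of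
  \<open>b powr harm_mean p B\<close> by the Muckenhoupt condition, so the powers of \<open>b\<close> cancel. The
  modular of \<open>f\<close> must be normalised, because the bound is not homogeneous in \<open>f\<close>.
\<close>

lemma mean_power_bound:
  assumes fin: "(\<integral>\<^sup>+x\<in>circ. w x \<partial>lebesgue) < top"
  obtains C where "0 \<le> C" "\<And>(f::real\<Rightarrow>real) B x V. \<lbrakk>f \<in> borel_measurable lebesgue; \<And>x. 0 \<le> f x;
      (\<integral>\<^sup>+x\<in>circ. (ennreal (f x powr p x) * w x) \<partial>lebesgue) \<le> 1; B \<in> circ_intervals; x \<in> B;
      (\<integral>\<^sup>+x\<in>B. w x \<partial>lebesgue) = ennreal V\<rbrakk>
    \<Longrightarrow> ennreal V * ennreal ((enn2real (\<integral>\<^sup>+x\<in>B. f x \<partial>lebesgue) / measure lebesgue B) powr p x)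
       \<le> ennreal V + ennreal C * (\<integral>\<^sup>+x\<in>B. (ennreal (f x powr p x) * w x) \<partial>lebesgue)"
    and "\<And>(f::real\<Rightarrow>real). \<lbrakk>f \<in> borel_measurable lebesgue; \<And>x. 0 \<le> f x;
      (\<integral>\<^sup>+x\<in>circ. (ennreal (f x powr p x) * w x) \<partial>lebesgue) \<le> 1\<rbrakk> \<Longrightarrow> (\<integral>\<^sup>+x\<in>circ. f x \<partial>lebesgue) < top"
proof -
  obtain Vc where Vc: "(\<integral>\<^sup>+x\<in>circ. w x \<partial>lebesgue) = ennreal Vc" "0 < Vc"
    using weight_integral_real[OF fin circ_in_circ_intervals] .
  obtain \<alpha>c where \<alpha>c: "0 < \<alpha>c" "Vc * \<alpha>c \<le> (A + 1) * measure lebesgue circ powr harm_mean p circ"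
    "(\<integral>\<^sup>+x\<in>circ. phi (conj_exponent p x / ennreal (p x)) (1 / w x / ennreal \<alpha>c) \<partial>lebesgue) \<le> 1"
    using admissible_constant[OF circ_in_circ_intervals Vc] .
  define C1 where "C1 = \<alpha>c + 1"
  have C1: "1 \<le> C1" using \<alpha>c by (simp add: C1_def)
  define K where "K = 2 powr P * C1 powr P * (2 * pi) powr P * (exp (2 * c * P\<^sup>2))\<^sup>2"
  have K0: "0 \<le> K" by (simp add: K_def)
  have total: "(\<integral>\<^sup>+x\<in>circ. f x \<partial>lebesgue) \<le> ennreal C1"
    if f: "f \<in> borel_measurable lebesgue" "\<And>x. 0 \<le> f x"
      "(\<integral>\<^sup>+x\<in>circ. (ennreal (f x powr p x) * w x) \<partial>lebesgue) \<le> 1" for f :: "real \<Rightarrow> real"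
  proof -
    have "(\<integral>\<^sup>+x\<in>circ. f x \<partial>lebesgue) \<le> ennreal \<alpha>c * (\<integral>\<^sup>+x\<in>circ. (ennreal (f x powr p x) * w x) \<partial>lebesgue) + 1"
      by (rule integral_le_modular[OF f(1,2) _ _ \<alpha>c(1,3)]) auto
    also have "\<dots> \<le> ennreal \<alpha>c * 1 + 1" by (intro add_right_mono mult_left_mono f(3)) auto
    also have "\<dots> = ennreal C1" using \<alpha>c by (simp add: C1_def ennreal_plus)
    finally show ?thesis .
  qed
  show ?thesis
  proof (rule that[of "(A + 1) * K"])
    show "0 \<le> (A + 1) * K" using A_nonneg K0 by simp
  next
    fix f :: "real \<Rightarrow> real" and B x V
    assume f: "f \<in> borel_measurable lebesgue" "\<And>x. 0 \<le> f x"
      "(\<integral>\<^sup>+x\<in>circ. (ennreal (f x powr p x) * w x) \<partial>lebesgue) \<le> 1"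
      and B: "B \<in> circ_intervals" and x: "x \<in> B" and V: "(\<integral>\<^sup>+x\<in>B. w x \<partial>lebesgue) = ennreal V"
    let ?F = "\<integral>\<^sup>+x\<in>B. (ennreal (f x powr p x) * w x) \<partial>lebesgue"
    note Bp = circ_intervals_props[OF B]
    have Bs: "B \<in> sets lebesgue" using Bp by (simp add: fmeasurableD)
    have xc: "x \<in> circ" using x Bp by blast
    define b where "b = measure lebesgue B"
    have b: "0 < b" "b \<le> 2 * pi" using Bp by (auto simp: b_def)
    have V0: "0 < V" using weight_integral_pos[OF Bs Bp(3)] V by simp
    have "(\<integral>\<^sup>+x\<in>B. f x \<partial>lebesgue) \<le> (\<integral>\<^sup>+x\<in>circ. f x \<partial>lebesgue)"
      using Bp(1) by (intro nn_integral_mono) (auto simp: indicator_def)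
    then have le: "(\<integral>\<^sup>+x\<in>B. f x \<partial>lebesgue) \<le> ennreal C1" using total[OF f] by (rule order_trans)
    then have lt: "(\<integral>\<^sup>+x\<in>B. f x \<partial>lebesgue) < top" by (rule le_less_trans) simp
    then obtain i where i: "(\<integral>\<^sup>+x\<in>B. f x \<partial>lebesgue) = ennreal i" "0 \<le> i"
      by (cases "\<integral>\<^sup>+x\<in>B. f x \<partial>lebesgue") auto
    have iC: "i \<le> C1" using le i C1 by simp
    define m where "m = i / b"
    have m0: "0 \<le> m" using i b by (simp add: m_def)
    have "ennreal V * ennreal (m powr p x) \<le> ennreal V + ennreal ((A + 1) * K) * ?F"
    proof (cases "m \<le> 1")
      case True
      have "m powr p x \<le> 1 powr p x" using True m0 p_ge_1[OF xc] by (intro powr_mono2) auto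
      then have "ennreal V * ennreal (m powr p x) \<le> ennreal V * ennreal 1"
        by (intro mult_left_mono ennreal_leI) auto
      then show ?thesis by (simp add: add_increasing2)
    next
      case False
      then have m1: "1 < m" by simp
      then have i0: "0 < i" using b i by (auto simp: m_def field_simps)
      have imb: "i = m * b" using b by (simp add: m_def)
      obtain \<alpha> where \<alpha>: "0 < \<alpha>" "V * \<alpha> \<le> (A + 1) * measure lebesgue B powr harm_mean p B"
        "(\<integral>\<^sup>+x\<in>B. phi (conj_exponent p x / ennreal (p x)) (1 / w x / ennreal \<alpha>) \<partial>lebesgue) \<le> 1"
        using admissible_constant[OF B V V0] .
      define R where "R = K * (m powr (- p x) * b powr (- harm_mean p B))"
      have R0: "0 \<le> R" using K0 by (simp add: R_def)
      have g: "(\<lambda>y. 2 / i * f y) \<in> borel_measurable lebesgue" using f(1) by measurable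
      have g1: "(\<integral>\<^sup>+y\<in>B. (2 / i * f y) \<partial>lebesgue) \<le> ennreal \<alpha> * (\<integral>\<^sup>+y\<in>B. (ennreal ((2 / i * f y) powr p y) * w y) \<partial>lebesgue) + 1"
        by (rule integral_le_modular[OF g _ Bp(1) Bs \<alpha>(1,3)]) (use f(2) i0 in auto)
      have g2: "(\<integral>\<^sup>+y\<in>B. (2 / i * f y) \<partial>lebesgue) = ennreal 2"
      proof -
        have "(\<integral>\<^sup>+y\<in>B. (2 / i * f y) \<partial>lebesgue) = (\<integral>\<^sup>+y. ennreal (2/i) * (ennreal (f y) * indicator B y) \<partial>lebesgue)"
          using i0 f(2) by (intro nn_integral_cong) (simp add: ennreal_mult[symmetric] mult.assoc[symmetric])
        also have "\<dots> = ennreal (2/i) * ennreal i"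
          unfolding i(1)[symmetric] using f(1) Bs by (intro nn_integral_cmult) (auto intro!: borel_measurable_times_ennreal)
        also have "\<dots> = ennreal 2" using i0 by (simp add: ennreal_mult[symmetric])
        finally show ?thesis .
      qed
      have g3: "(\<integral>\<^sup>+y\<in>B. (ennreal ((2 / i * f y) powr p y) * w y) \<partial>lebesgue) \<le> ennreal R * ?F"
      proof -
        have "(\<integral>\<^sup>+y\<in>B. (ennreal ((2 / i * f y) powr p y) * w y) \<partial>lebesgue)
          \<le> (\<integral>\<^sup>+y. ennreal R * (ennreal (f y powr p y) * w y * indicator B y) \<partial>lebesgue)"
        proof (rule nn_integral_mono)
          fix y
          show "ennreal ((2 / i * f y) powr p y) * w y * indicator B y \<le> ennreal R * (ennreal (f y powr p y) * w y * indicator B y)"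
          proof (cases "y \<in> B")
            case True
            then have yc: "y \<in> circ" using Bp by blast
            define \<delta> where "\<delta> = max \<bar>p x - p y\<bar> \<bar>harm_mean p B - p y\<bar>"
            have "(2 / (m * b)) powr p y \<le> R"
              unfolding R_def K_def
            proof (rule power_comparison[OF m1 _ C1 b])
              show "m \<le> C1 / b" unfolding m_def using iC b by (intro divide_right_mono) auto
              show "\<bar>p x - p y\<bar> \<le> \<delta>" "\<bar>harm_mean p B - p y\<bar> \<le> \<delta>" by (auto simp: \<delta>_def)
              show "\<delta> \<le> 2 * log_modulus c b * P\<^sup>2"
                unfolding \<delta>_def b_def using exponent_oscillation[OF fin B x True] by simp
              show "\<delta> \<le> P" unfolding \<delta>_def using harm_mean_range[OF B] p_ge_1[OF xc] p_le[OF xc] p_ge_1[OF yc] p_le[OF yc]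
                by (auto simp: abs_le_iff)
              show "p y \<le> P" by (rule p_le[OF yc])
            qed
            then have "(2 / i * f y) powr p y \<le> R * f y powr p y"
              unfolding imb using f(2)[of y] m1 b by (subst powr_mult) (auto intro!: mult_right_mono)
            then have "ennreal ((2 / i * f y) powr p y) \<le> ennreal R * ennreal (f y powr p y)"
              using R0 by (simp add: ennreal_mult[symmetric] ennreal_leI)
            then have "ennreal ((2 / i * f y) powr p y) * w y \<le> ennreal R * ennreal (f y powr p y) * w y"
              by (intro mult_right_mono) auto
            then show ?thesis using True by (simp add: mult.assoc)
          qed simp
        qed
        also have "\<dots> = ennreal R * ?F"
          by (rule nn_integral_cmult[OF modular_on_measurable[OF f(1,2) Bp(1) Bs]])
        finally show ?thesis .
      qed
      have "ennreal 2 \<le> ennreal \<alpha> * (ennreal R * ?F) + 1"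
        unfolding g2[symmetric] by (rule order_trans[OF g1]) (intro add_right_mono mult_left_mono g3 zero_le)
      then have "1 \<le> ennreal \<alpha> * (ennreal R * ?F)" by (intro ennreal_one_le_of_two_le) simp
      then have "ennreal (V * m powr p x) * 1 \<le> ennreal (V * m powr p x) * (ennreal \<alpha> * (ennreal R * ?F))"
        by (intro mult_left_mono) auto
      also have "\<dots> = ennreal (V * m powr p x * \<alpha> * R) * ?F"
        using V0 \<alpha>(1) R0 by (simp add: ennreal_mult mult.assoc)
      also have "V * m powr p x * \<alpha> * R = (V * \<alpha>) * K * (b powr (- harm_mean p B))"
        using m1 by (simp add: R_def powr_minus field_simps)
      also have "\<dots> \<le> ((A + 1) * b powr harm_mean p B) * K * (b powr (- harm_mean p B))"
        using \<alpha>(2) K0 by (intro mult_right_mono) (auto simp: b_def)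
      also have "\<dots> = (A + 1) * K" using b by (simp add: powr_minus field_simps)
      finally have "ennreal (V * m powr p x) \<le> ennreal ((A + 1) * K) * ?F"
        by (simp add: ennreal_leI mult_right_mono)
      then show ?thesis using V0 by (simp add: ennreal_mult add_increasing)
    qed
    then show "ennreal V * ennreal ((enn2real (\<integral>\<^sup>+x\<in>B. f x \<partial>lebesgue) / measure lebesgue B) powr p x)
       \<le> ennreal V + ennreal ((A + 1) * K) * ?F"
      by (simp add: i m_def b_def)
  next
    fix f :: "real \<Rightarrow> real"
    assume "f \<in> borel_measurable lebesgue" "\<And>x. 0 \<le> f x"
      "(\<integral>\<^sup>+x\<in>circ. (ennreal (f x powr p x) * w x) \<partial>lebesgue) \<le> 1"
    from total[OF this] show "(\<integral>\<^sup>+x\<in>circ. f x \<partial>lebesgue) < top" by (rule le_less_trans) simp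
  qed
qed

end

section \<open>Averages over intervals of a fixed length\<close>

lemma window_integral_measurable:
  fixes f :: "real \<Rightarrow> ennreal"
  assumes "f \<in> borel_measurable lebesgue"
  shows "(\<lambda>x. \<integral>\<^sup>+t\<in>{x - h..x + h}. f t \<partial>lebesgue) \<in> borel_measurable lebesgue"
proof -
  obtain f0 where f0m: "f0 \<in> borel_measurable lborel" and f0: "AE x in lborel. f x = f0 x"
    using completion_ex_borel_measurable[OF assms] by blast
  have [measurable]: "f0 \<in> borel_measurable borel" using f0m by simp
  have eq: "(\<integral>\<^sup>+t\<in>{x - h..x + h}. f t \<partial>lebesgue) = (\<integral>\<^sup>+t. (if x - h \<le> t \<and> t \<le> x + h then f0 t else 0) \<partial>lborel)" for x
  proof -
    have "(\<integral>\<^sup>+t\<in>{x - h..x + h}. f t \<partial>lebesgue) = (\<integral>\<^sup>+t. (if x - h \<le> t \<and> t \<le> x + h then f0 t else 0) \<partial>lebesgue)"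
      by (rule nn_integral_cong_AE) (use AE_completion[OF f0] in \<open>auto simp: indicator_def elim!: eventually_mono\<close>)
    also have "\<dots> = (\<integral>\<^sup>+t. (if x - h \<le> t \<and> t \<le> x + h then f0 t else 0) \<partial>lborel)"
      by (rule nn_integral_completion)
    finally show ?thesis .
  qed
  have "(\<lambda>x. \<integral>\<^sup>+t. (if x - h \<le> t \<and> t \<le> x + h then f0 t else 0) \<partial>lborel) \<in> borel_measurable lborel"
    by measurable
  then show ?thesis unfolding eq by (rule measurable_completion)
qed

lemma nn_integral_shift_interval:
  fixes f :: "real \<Rightarrow> ennreal"
  assumes f: "f \<in> borel_measurable lebesgue" and per: "\<And>x. f (x + T) = f x"
  shows "(\<integral>\<^sup>+x\<in>{a + T..<b + T}. f x \<partial>lebesgue) = (\<integral>\<^sup>+x\<in>{a..<b}. f x \<partial>lebesgue)"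
proof -
  have "(\<integral>\<^sup>+x\<in>{a + T..<b + T}. f x \<partial>lebesgue) = ennreal \<bar>1\<bar> * (\<integral>\<^sup>+x. f (T + 1 * x) * indicator {a + T..<b + T} (T + 1 * x) \<partial>lebesgue)"
    by (rule nn_integral_real_affine_lebesgue) (use f in \<open>auto intro!: borel_measurable_times_ennreal borel_measurable_indicator\<close>)
  also have "\<dots> = (\<integral>\<^sup>+x\<in>{a..<b}. f x \<partial>lebesgue)"
    using per by (simp add: add.commute indicator_def)
  finally show ?thesis .
qed

lemma nn_integral_split_interval:
  fixes f :: "real \<Rightarrow> ennreal"
  assumes f: "f \<in> borel_measurable lebesgue" and "a \<le> b" "b \<le> d"
  shows "(\<integral>\<^sup>+x\<in>{a..<d}. f x \<partial>lebesgue) = (\<integral>\<^sup>+x\<in>{a..<b}. f x \<partial>lebesgue) + (\<integral>\<^sup>+x\<in>{b..<d}. f x \<partial>lebesgue)"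
proof -
  have "(\<integral>\<^sup>+x\<in>{a..<d}. f x \<partial>lebesgue) = (\<integral>\<^sup>+x. f x * indicator {a..<b} x + f x * indicator {b..<d} x \<partial>lebesgue)"
    using assms(2,3) by (intro nn_integral_cong) (auto simp: indicator_def)
  also have "\<dots> = (\<integral>\<^sup>+x\<in>{a..<b}. f x \<partial>lebesgue) + (\<integral>\<^sup>+x\<in>{b..<d}. f x \<partial>lebesgue)"
    by (rule nn_integral_add) (use f in \<open>auto intro!: borel_measurable_times_ennreal borel_measurable_indicator\<close>)
  finally show ?thesis .
qed

lemma nn_integral_Icc_Ico:
  "(\<integral>\<^sup>+x\<in>{a..b::real}. f x \<partial>lebesgue) = (\<integral>\<^sup>+x\<in>{a..<b}. f x \<partial>lebesgue)"
proof (rule nn_integral_cong_AE)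
  have "AE x in lebesgue. x \<noteq> b" by (auto intro!: AE_completion AE_lborel_singleton)
  then show "AE x in lebesgue. f x * indicator {a..b} x = f x * indicator {a..<b} x"
    by eventually_elim (auto simp: indicator_def)
qed

lemma nn_integral_period:
  fixes f :: "real \<Rightarrow> ennreal"
  assumes f: "f \<in> borel_measurable lebesgue" and per: "periodic_2pi f"
  shows "(\<integral>\<^sup>+x\<in>{a..<a + 2 * pi}. f x \<partial>lebesgue) = (\<integral>\<^sup>+x\<in>circ. f x \<partial>lebesgue)"
proof -
  have per_int: "f (x + 2 * pi * of_int k) = f x" for x :: real and k :: int
  proof -
    have nat: "f (x + 2 * pi * real n) = f x" for x n
    proof (induction n)
      case (Suc n)
      have "f (x + 2 * pi * real (Suc n)) = f ((x + 2 * pi * real n) + 2 * pi)" by (simp add: algebra_simps)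
      then show ?case using per Suc by (simp add: periodic_2pi_def)
    qed simp
    show ?thesis
    proof (cases "0 \<le> k")
      case True then show ?thesis using nat[of x "nat k"] by simp
    next
      case False
      then show ?thesis using nat[of "x + 2 * pi * of_int k" "nat (- k)"] by (simp add: algebra_simps)
    qed
  qed
  define k where "k = \<lfloor>(a + pi) / (2 * pi)\<rfloor>"
  define z where "z = - pi + 2 * pi * of_int k"
  have "of_int k \<le> (a + pi) / (2 * pi)" "(a + pi) / (2 * pi) < of_int k + 1" unfolding k_def by linarith+
  then have z: "z \<le> a" "a < z + 2 * pi" unfolding z_def by (simp_all add: field_simps)
  let ?I = "\<lambda>a b. \<integral>\<^sup>+x\<in>{a..<b}. f x \<partial>lebesgue"
  have "?I a (a + 2 * pi) = ?I a (z + 2 * pi) + ?I (z + 2 * pi) (a + 2 * pi)"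
    by (rule nn_integral_split_interval[OF f]) (use z in auto)
  also have "?I (z + 2 * pi) (a + 2 * pi) = ?I z a"
    by (rule nn_integral_shift_interval[OF f]) (use per in \<open>simp add: periodic_2pi_def\<close>)
  also have "?I a (z + 2 * pi) + ?I z a = ?I z (z + 2 * pi)"
    using nn_integral_split_interval[OF f z(1), of "z + 2 * pi"] z by (simp add: add.commute)
  also have "z = - pi + 2 * pi * of_int k" by (simp add: z_def)
  also have "?I (- pi + 2 * pi * of_int k) (- pi + 2 * pi * of_int k + 2 * pi) = ?I (- pi) pi"
    using nn_integral_shift_interval[OF f per_int, of "-pi" k pi] by (simp add: algebra_simps)
  also have "\<dots> = (\<integral>\<^sup>+x\<in>circ. f x \<partial>lebesgue)" by (simp add: nn_integral_Icc_Ico)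
  finally show ?thesis .
qed

lemma nn_integral_periods:
  fixes f :: "real \<Rightarrow> ennreal"
  assumes f: "f \<in> borel_measurable lebesgue" and per: "periodic_2pi f"
  shows "(\<integral>\<^sup>+x\<in>{a..<a + 2 * pi * real n}. f x \<partial>lebesgue) = of_nat n * (\<integral>\<^sup>+x\<in>circ. f x \<partial>lebesgue)"
proof (induction n)
  case (Suc n)
  have "(\<integral>\<^sup>+x\<in>{a..<a + 2 * pi * real (Suc n)}. f x \<partial>lebesgue)
    = (\<integral>\<^sup>+x\<in>{a..<a + 2 * pi * real n}. f x \<partial>lebesgue) + (\<integral>\<^sup>+x\<in>{a + 2 * pi * real n..<a + 2 * pi * real (Suc n)}. f x \<partial>lebesgue)"
    by (rule nn_integral_split_interval[OF f]) (auto simp: algebra_simps)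
  also have "(\<integral>\<^sup>+x\<in>{a + 2 * pi * real n..<a + 2 * pi * real (Suc n)}. f x \<partial>lebesgue) = (\<integral>\<^sup>+x\<in>circ. f x \<partial>lebesgue)"
    using nn_integral_period[OF f per, of "a + 2 * pi * real n"] by (simp add: algebra_simps)
  finally show ?case using Suc by (simp add: algebra_simps)
qed simp

text \<open>
  Divide the circle into \<open>N\<close> arcs \<open>Q j\<close> of length \<open>l\<close>, where \<open>l\<close> is comparable with \<open>h\<close> and not smaller. For
  \<open>x\<close> in \<open>Q j\<close> the interval of radius \<open>h\<close> about \<open>x\<close> is contained in the union \<open>I j\<close> of
  \<open>Q j\<close> and its two neighbours \<open>Q (pr j)\<close> and \<open>Q (su j)\<close>, cyclically. There are at least three arcs,
  so that the neighbours are different; \<open>pr\<close> and \<open>su\<close> are permutations, so sums over the \<open>I j\<close>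
  are three times the sums over the \<open>Q j\<close>.
\<close>

lemma averages_partition:
  fixes h :: real
  assumes h: "0 < h" "3 \<le> nat \<lfloor>2 * pi / h\<rfloor>"
  shows "\<exists>(N::nat) l Q I pr su. 0 < N \<and> h \<le> l \<and> 3 * l \<le> 4 * h \<and>
     (\<forall>j<N. I j \<in> circ_intervals \<and> Q j \<subseteq> I j \<and> Q j \<in> sets lebesgue \<and> measure lebesgue (I j) = 3 * l \<and>
        (AE x in lebesgue. indicator (I j) x = (indicator (Q (pr j)) x + indicator (Q j) x + indicator (Q (su j)) x :: ennreal))) \<and>
     bij_betw pr {..<N} {..<N} \<and> bij_betw su {..<N} {..<N} \<and>
     (\<forall>x. indicator {-pi..<pi} x = (\<Sum>j<N. indicator (Q j) x :: ennreal)) \<and>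
     (\<forall>f j x. f \<in> borel_measurable lebesgue \<longrightarrow> periodic_2pi f \<longrightarrow> j < N \<longrightarrow> x \<in> Q j \<longrightarrow>
        (\<integral>\<^sup>+t\<in>{x - h..x + h}. f t \<partial>lebesgue) \<le> (\<integral>\<^sup>+t\<in>I j. (f t :: ennreal) \<partial>lebesgue))"
proof -
  define N where "N = nat \<lfloor>2 * pi / h\<rfloor>"
  have N3: "3 \<le> N" using h by (simp add: N_def)
  define l where "l = 2 * pi / real N"
  have fl: "real N \<le> 2 * pi / h" "2 * pi / h < real N + 1"
    using h unfolding N_def by (auto simp: of_nat_nat)
  have Nl: "real N * l = 2 * pi" using N3 by (simp add: l_def)
  have l0: "0 < l" using N3 by (simp add: l_def)
  have hl: "h \<le> l"
  proof -
    have "real N * h \<le> real N * l" unfolding Nl using fl(1) h(1) by (simp add: pos_le_divide_eq)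
    then show ?thesis using N3 by simp
  qed
  have lh: "3 * l \<le> 4 * h"
  proof -
    have "real N * l \<le> (real N + 1) * h" unfolding Nl using fl(2) h(1) by (simp add: pos_divide_less_eq)
    also have "\<dots> \<le> (real N * (4/3)) * h" using N3 h(1) by (intro mult_right_mono) auto
    finally have "real N * l \<le> real N * (4/3 * h)" by simp
    then have "l \<le> 4/3 * h" using N3 by (subst (asm) mult_le_cancel_left_pos) auto
    then show ?thesis by simp
  qed
  define e where "e j = -pi + real j * l" for j
  have e0: "e 0 = -pi" and eN: "e N = pi" using Nl by (simp_all add: e_def)
  have eS: "e (Suc j) = e j + l" for j by (simp add: e_def algebra_simps)
  have emono: "e i \<le> e j" if "i \<le> j" for i j using that l0 by (simp add: e_def)
  have emono': "e i < e j" if "i < j" for i j using that l0 by (simp add: e_def)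
  define Q where "Q j = {e j..<e (Suc j)}" for j
  define pr where "pr j = (if j = 0 then N - 1 else j - 1)" for j
  define su where "su j = (if j = N - 1 then 0 else j + 1)" for j
  define I where "I j = (if j = 0 then {-pi..e 2} \<union> {e (N - 1)..pi}
     else if j = N - 1 then {-pi..e 1} \<union> {e (N - 2)..pi} else {e (j - 1)..e (j + 2)})" for j
  have N1: "Suc (N - 1) = N" "Suc (N - 2) = N - 1" using N3 by auto
  have ind: "AE x in lebesgue. indicator (I j) x = (indicator (Q (pr j)) x + indicator (Q j) x + indicator (Q (su j)) x :: ennreal)"
    if j: "j < N" for j
  proof -
    have "AE x in lebesgue. \<forall>k\<in>{..N}. x \<noteq> e k"
      by (intro AE_finite_allI) (auto intro!: AE_completion AE_lborel_singleton)
    then show ?thesis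
    proof eventually_elim
      fix x assume x: "\<forall>k\<in>{..N}. x \<noteq> e k"
      consider "j = 0" | "j = N - 1" "j \<noteq> 0" | "0 < j" "j + 2 \<le> N" using j by linarith
      then show "indicator (I j) x = (indicator (Q (pr j)) x + indicator (Q j) x + indicator (Q (su j)) x :: ennreal)"
      proof cases
        case 1
        have m: "e 0 \<le> e 1" "e 1 \<le> e 2" "e 2 \<le> e (N - 1)" "e (N - 1) \<le> e N" using N3 by (auto intro!: emono)
        have d: "x \<noteq> e 2" "x \<noteq> pi" using x N3 eN by force+
        have "I j = {e 0..e 2} \<union> {e (N - 1)..e N}" "Q (pr j) = {e (N - 1)..<e N}" "Q j = {e 0..<e 1}" "Q (su j) = {e 1..<e 2}"
          using 1 N1 N3 by (simp_all add: I_def Q_def pr_def su_def e0 eN numeral_2_eq_2)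
        then show ?thesis using m d eN by (auto simp: indicator_def)
      next
        case 2
        have m: "e 0 \<le> e 1" "e 1 \<le> e (N - 2)" "e (N - 2) \<le> e (N - 1)" "e (N - 1) \<le> e N" using N3 by (auto intro!: emono)
        have d: "x \<noteq> e 1" "x \<noteq> pi" using x N3 eN by force+
        have "I j = {e 0..e 1} \<union> {e (N - 2)..e N}" "Q (pr j) = {e (N - 2)..<e (N - 1)}" "Q j = {e (N - 1)..<e N}" "Q (su j) = {e 0..<e 1}"
          using 2 N1 N3 by (simp_all add: I_def Q_def pr_def su_def e0 eN numeral_2_eq_2)
        then show ?thesis using m d eN by (auto simp: indicator_def)
      next
        case 3
        have m: "e (j - 1) \<le> e j" "e j \<le> e (j + 1)" "e (j + 1) \<le> e (j + 2)" by (auto intro!: emono)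
        have d: "x \<noteq> e (j + 2)" using x 3 by force
        have "I j = {e (j - 1)..e (j + 2)}" "Q (pr j) = {e (j - 1)..<e j}" "Q j = {e j..<e (j + 1)}" "Q (su j) = {e (j + 1)..<e (j + 2)}"
          using 3 N3 by (auto simp add: I_def Q_def pr_def su_def)
        then show ?thesis using m d by (auto simp: indicator_def)
      qed
    qed
  qed
  have Qs: "Q j \<in> sets lebesgue" for j by (simp add: Q_def)
  have prsu: "pr j < N" "su j < N" if "j < N" for j using that N3 by (auto simp: pr_def su_def)
  have Is: "I j \<in> sets lebesgue" for j by (auto simp: I_def)
  have sumI: "(\<integral>\<^sup>+t\<in>I j. g t \<partial>lebesgue) = (\<integral>\<^sup>+t\<in>Q (pr j). g t \<partial>lebesgue) + (\<integral>\<^sup>+t\<in>Q j. g t \<partial>lebesgue) + (\<integral>\<^sup>+t\<in>Q (su j). g t \<partial>lebesgue)"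
    if j: "j < N" and g: "g \<in> borel_measurable lebesgue" for g :: "real \<Rightarrow> ennreal" and j
  proof -
    have "(\<integral>\<^sup>+t\<in>I j. g t \<partial>lebesgue) = (\<integral>\<^sup>+t. (g t * indicator (Q (pr j)) t + g t * indicator (Q j) t) + g t * indicator (Q (su j)) t \<partial>lebesgue)"
      by (rule nn_integral_cong_AE) (use ind[OF j] in \<open>auto simp: distrib_left elim!: eventually_mono\<close>)
    also have "\<dots> = (\<integral>\<^sup>+t\<in>Q (pr j). g t \<partial>lebesgue) + (\<integral>\<^sup>+t\<in>Q j. g t \<partial>lebesgue) + (\<integral>\<^sup>+t\<in>Q (su j). g t \<partial>lebesgue)"
      using g by (intro nn_integral_add3 borel_measurable_times_ennreal borel_measurable_indicator Qs)
    finally show ?thesis .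
  qed
  have emQ: "emeasure lebesgue (Q j) = ennreal l" for j using l0 by (simp add: Q_def eS)
  have mI: "measure lebesgue (I j) = 3 * l" if j: "j < N" for j
  proof -
    have "emeasure lebesgue (I j) = ennreal l + ennreal l + ennreal l"
      using sumI[OF j, of "\<lambda>_. 1"] by (simp add: emQ Is Qs)
    also have "\<dots> = ennreal (3 * l)" using l0 by (simp add: ennreal_plus[symmetric] del: ennreal_plus)
    finally show ?thesis using l0 by (simp add: measure_def)
  qed
  have Ic: "I j \<in> circ_intervals" if j: "j < N" for j
  proof -
    have bounds: "-pi \<le> e i \<and> e i \<le> pi" if "i \<le> N" for i using emono[of 0 i] emono[of i N] that e0 eN by simp
    have "\<exists>a b. - pi \<le> a \<and> a \<le> b \<and> b \<le> pi \<and> (I j = {a..b} \<or> I j = {- pi..a} \<union> {b..pi})"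
    proof -
      consider "j = 0" | "j = N - 1" "j \<noteq> 0" | "0 < j" "j + 2 \<le> N" using j by linarith
      then show ?thesis
      proof cases
        case 1
        then show ?thesis using bounds[of 2] bounds[of "N - 1"] emono[of 2 "N - 1"] N3
          by (intro exI[of _ "e 2"] exI[of _ "e (N - 1)"]) (auto simp: I_def)
      next
        case 2
        then show ?thesis using bounds[of 1] bounds[of "N - 2"] emono[of 1 "N - 2"] N3
          by (intro exI[of _ "e 1"] exI[of _ "e (N - 2)"]) (auto simp: I_def)
      next
        case 3
        then have "I j = {e (j - 1)..e (j + 2)}" using N3 by (auto simp: I_def)
        then show ?thesis using bounds[of "j - 1"] bounds[of "j + 2"] emono[of "j - 1" "j + 2"] 3 j
          by - (rule exI[of _ "e (j - 1)"], rule exI[of _ "e (j + 2)"], simp)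
      qed
    qed
    moreover have "0 < measure lebesgue (I j)" using mI[OF j] l0 by simp
    ultimately show ?thesis unfolding circ_intervals_def by blast
  qed
  have QI: "Q j \<subseteq> I j" if j: "j < N" for j
  proof -
    consider "j = 0" | "j = N - 1" "j \<noteq> 0" | "0 < j" "j + 2 \<le> N" using j by linarith
    then show ?thesis
    proof cases
      case 1
      have "e 1 \<le> e 2" by (rule emono) simp
      then show ?thesis using 1 by (auto simp: Q_def I_def e0)
    next
      case 2
      have "e (N - 2) \<le> e (N - 1)" by (rule emono) simp
      then show ?thesis using 2 N1 eN by (auto simp: Q_def I_def)
    next
      case 3
      have "e (j - 1) \<le> e j" "e (Suc j) \<le> e (j + 2)" by (auto intro!: emono)
      then show ?thesis using 3 by (auto simp: Q_def I_def)
    qed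
  qed
  have cover: "indicator {-pi..<pi} x = (\<Sum>j<N. indicator (Q j) x :: ennreal)" for x
  proof -
    have "indicator {e 0..<e n} x = (\<Sum>j<n. indicator (Q j) x :: ennreal)" for n
    proof (induction n)
      case (Suc n)
      have "e 0 \<le> e n" "e n \<le> e (Suc n)" by (auto intro!: emono)
      then have "indicator {e 0..<e (Suc n)} x = (indicator {e 0..<e n} x + indicator (Q n) x :: ennreal)"
        by (auto simp: indicator_def Q_def)
      then show ?case using Suc by simp
    qed simp
    from this[of N] show ?thesis by (simp add: e0 eN)
  qed
  have avg: "(\<integral>\<^sup>+t\<in>{x - h..x + h}. f t \<partial>lebesgue) \<le> (\<integral>\<^sup>+t\<in>I j. (f t :: ennreal) \<partial>lebesgue)"
    if f: "f \<in> borel_measurable lebesgue" "periodic_2pi f" and j: "j < N" and x: "x \<in> Q j" for f j x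
  proof -
    let ?J = "\<lambda>a b. \<integral>\<^sup>+t\<in>{a..<b}. f t \<partial>lebesgue"
    have per: "f (t + 2 * pi) = f t" for t using f(2) by (simp add: periodic_2pi_def)
    have "(\<integral>\<^sup>+t\<in>{x - h..x + h}. f t \<partial>lebesgue) \<le> (\<integral>\<^sup>+t\<in>{e j - l..e j + 2 * l}. f t \<partial>lebesgue)"
      by (intro nn_integral_mono) (use x hl in \<open>auto simp: indicator_def Q_def eS\<close>)
    also have "\<dots> = ?J (e j - l) (e j + 2 * l)" by (rule nn_integral_Icc_Ico)
    also have "\<dots> = ?J (e j - l) (e j) + ?J (e j) (e j + 2 * l)"
      by (rule nn_integral_split_interval[OF f(1)]) (use l0 in auto)
    also have "?J (e j) (e j + 2 * l) = ?J (e j) (e j + l) + ?J (e j + l) (e j + 2 * l)"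
      by (rule nn_integral_split_interval[OF f(1)]) (use l0 in auto)
    also have "?J (e j - l) (e j) = (\<integral>\<^sup>+t\<in>Q (pr j). f t \<partial>lebesgue)"
    proof (cases "j = 0")
      case True
      have "e (N - 1) = pi - l" using eS[of "N - 1"] N1 eN by simp
      then have "Q (pr j) = {(e j - l) + 2 * pi..<e j + 2 * pi}" using True N1 eN e0 by (simp add: Q_def pr_def)
      then show ?thesis using nn_integral_shift_interval[OF f(1) per, of "e j - l" "e j"] by simp
    next
      case False
      then have "Suc (j - 1) = j" by simp
      then have "Q (pr j) = {e j - l..<e j}" using False eS[of "j - 1"] by (simp add: Q_def pr_def)
      then show ?thesis by simp
    qed
    also have "?J (e j) (e j + l) = (\<integral>\<^sup>+t\<in>Q j. f t \<partial>lebesgue)" by (simp add: Q_def eS)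
    also have "?J (e j + l) (e j + 2 * l) = (\<integral>\<^sup>+t\<in>Q (su j). f t \<partial>lebesgue)"
    proof (cases "j = N - 1")
      case True
      then have "e j + l = pi" using eS[of j] N1 eN by simp
      moreover from this have "e j + 2 * l = pi + l" by simp
      ultimately have "{e j + l..<e j + 2 * l} = {pi..<pi + l}" by (simp only:)
      then have "{e j + l..<e j + 2 * l} = {e 0 + 2 * pi..<e (Suc 0) + 2 * pi}" by (simp add: e0 eS)
      moreover have "Q (su j) = {e 0..<e (Suc 0)}" using True by (simp add: Q_def su_def)
      ultimately show ?thesis using nn_integral_shift_interval[OF f(1) per, of "e 0" "e (Suc 0)"] by simp
    next
      case False
      then have "Q (su j) = {e j + l..<e j + 2 * l}" by (auto simp: Q_def su_def eS)
      then show ?thesis by simp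
    qed
    also have "(\<integral>\<^sup>+t\<in>Q (pr j). f t \<partial>lebesgue) + ((\<integral>\<^sup>+t\<in>Q j. f t \<partial>lebesgue) + (\<integral>\<^sup>+t\<in>Q (su j). f t \<partial>lebesgue)) = (\<integral>\<^sup>+t\<in>I j. f t \<partial>lebesgue)"
      using sumI[OF j f(1)] by (simp add: add.assoc)
    finally show ?thesis .
  qed
  have bij: "bij_betw pr {..<N} {..<N}" "bij_betw su {..<N} {..<N}"
  proof -
    have sp: "su (pr j) = j" "pr (su j) = j" if "j < N" for j using that N3 by (auto simp: su_def pr_def)
    show "bij_betw pr {..<N} {..<N}" by (rule bij_betwI[of _ _ _ su]) (use sp prsu in auto)
    show "bij_betw su {..<N} {..<N}" by (rule bij_betwI[of _ _ _ pr]) (use sp prsu in auto)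
  qed
  show ?thesis
    by (rule exI[of _ N], rule exI[of _ l], rule exI[of _ Q], rule exI[of _ I], rule exI[of _ pr], rule exI[of _ su])
      (intro conjI allI impI bij hl lh Ic QI Qs mI ind cover avg; use N3 in simp)
qed

text \<open>
  When the circle has no room for three arcs of length \<open>h\<close>, an interval of radius \<open>h\<close> is compared with whole
  periods instead.
\<close>

lemma average_over_periods:
  fixes f :: "real \<Rightarrow> ennreal"
  assumes f: "f \<in> borel_measurable lebesgue" "periodic_2pi f" and h: "0 < h" "\<not> 3 \<le> nat \<lfloor>2 * pi / h\<rfloor>"
  shows "(\<integral>\<^sup>+t\<in>{x - h..x + h}. f t \<partial>lebesgue) \<le> ennreal (3 * h / pi) * (\<integral>\<^sup>+t\<in>circ. f t \<partial>lebesgue)"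
proof -
  have "2 * pi / h < 3" using h by linarith
  then have hpi: "2 * pi / 3 < h" using h(1) by (simp add: field_simps)
  define n where "n = nat \<lceil>h / pi\<rceil>"
  have n: "h / pi \<le> real n" "real n \<le> h / pi + 1"
    using h(1) unfolding n_def by (auto simp: of_nat_nat)
  have "(\<integral>\<^sup>+t\<in>{x - h..x + h}. f t \<partial>lebesgue) = (\<integral>\<^sup>+t\<in>{x - h..<x + h}. f t \<partial>lebesgue)"
    by (rule nn_integral_Icc_Ico)
  also have "\<dots> \<le> (\<integral>\<^sup>+t\<in>{x - h..<(x - h) + 2 * pi * real n}. f t \<partial>lebesgue)"
  proof (intro nn_integral_mono)
    have "x + h \<le> (x - h) + 2 * pi * real n" using n(1) by (simp add: field_simps)
    then show "f t * indicator {x - h..<x + h} t \<le> f t * indicator {x - h..<(x - h) + 2 * pi * real n} t" for t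
      by (auto simp: indicator_def)
  qed
  also have "\<dots> = of_nat n * (\<integral>\<^sup>+t\<in>circ. f t \<partial>lebesgue)" by (rule nn_integral_periods[OF f])
  also have "\<dots> \<le> ennreal (3 * h / pi) * (\<integral>\<^sup>+t\<in>circ. f t \<partial>lebesgue)"
  proof (intro mult_right_mono)
    have "real n \<le> 3 * h / pi" using n(2) hpi h(1) by (simp add: field_simps)
    then show "of_nat n \<le> ennreal (3 * h / pi)" by (simp add: ennreal_of_nat_eq_real_of_nat ennreal_leI)
  qed simp
  finally show ?thesis .
qed

context muckenhoupt_weight
begin

text \<open>
  Integrate \<open>mean_power_bound\<close> against \<open>w / V\<close> over the arcs of the partition and add up: the
  integral of \<open>w\<close> over an arc is at most the weight \<open>V\<close> of the enclosing interval, and the modulars of \<open>f\<close>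
  overlap three times.
\<close>

lemma average_modular_bound:
  assumes fin: "(\<integral>\<^sup>+x\<in>circ. w x \<partial>lebesgue) < top"
  obtains C where "1 \<le> C" "\<And>(f::real\<Rightarrow>real) h. \<lbrakk>f \<in> borel_measurable lebesgue; \<And>x. 0 \<le> f x; periodic_2pi f;
      (\<integral>\<^sup>+x\<in>circ. (ennreal (f x powr p x) * w x) \<partial>lebesgue) \<le> 1; 0 < h\<rbrakk>
    \<Longrightarrow> (\<integral>\<^sup>+x\<in>circ. (ennreal ((enn2real (\<integral>\<^sup>+t\<in>{x-h..x+h}. f t \<partial>lebesgue) / (2*h)) powr p x) * w x) \<partial>lebesgue) \<le> ennreal C"
    and "\<And>(f::real\<Rightarrow>real). \<lbrakk>f \<in> borel_measurable lebesgue; \<And>x. 0 \<le> f x;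
      (\<integral>\<^sup>+x\<in>circ. (ennreal (f x powr p x) * w x) \<partial>lebesgue) \<le> 1\<rbrakk> \<Longrightarrow> (\<integral>\<^sup>+x\<in>circ. f x \<partial>lebesgue) < top"
proof -
  obtain C where C: "0 \<le> C" "\<And>(f::real\<Rightarrow>real) B x V. \<lbrakk>f \<in> borel_measurable lebesgue; \<And>x. 0 \<le> f x;
      (\<integral>\<^sup>+x\<in>circ. (ennreal (f x powr p x) * w x) \<partial>lebesgue) \<le> 1; B \<in> circ_intervals; x \<in> B;
      (\<integral>\<^sup>+x\<in>B. w x \<partial>lebesgue) = ennreal V\<rbrakk>
    \<Longrightarrow> ennreal V * ennreal ((enn2real (\<integral>\<^sup>+x\<in>B. f x \<partial>lebesgue) / measure lebesgue B) powr p x)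
       \<le> ennreal V + ennreal C * (\<integral>\<^sup>+x\<in>B. (ennreal (f x powr p x) * w x) \<partial>lebesgue)"
    and L1: "\<And>(f::real\<Rightarrow>real). \<lbrakk>f \<in> borel_measurable lebesgue; \<And>x. 0 \<le> f x;
      (\<integral>\<^sup>+x\<in>circ. (ennreal (f x powr p x) * w x) \<partial>lebesgue) \<le> 1\<rbrakk> \<Longrightarrow> (\<integral>\<^sup>+x\<in>circ. f x \<partial>lebesgue) < top"
    using mean_power_bound[OF fin] by blast
  obtain Vc where Vc: "(\<integral>\<^sup>+x\<in>circ. w x \<partial>lebesgue) = ennreal Vc" "0 < Vc"
    using weight_integral_real[OF fin circ_in_circ_intervals] .
  define C2 where "C2 = 3 powr P * (Vc + C * 3) + 1"
  have C2: "1 \<le> C2" using Vc C by (simp add: C2_def)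
  have main: "(\<integral>\<^sup>+x\<in>circ. (ennreal ((enn2real (\<integral>\<^sup>+t\<in>{x-h..x+h}. f t \<partial>lebesgue) / (2*h)) powr p x) * w x) \<partial>lebesgue) \<le> ennreal C2"
    if f: "f \<in> borel_measurable lebesgue" "\<And>x. 0 \<le> f x" and per: "periodic_2pi f" and
      mod: "(\<integral>\<^sup>+x\<in>circ. (ennreal (f x powr p x) * w x) \<partial>lebesgue) \<le> 1" and h: "0 < h" for f :: "real \<Rightarrow> real" and h
  proof -
    define Af where "Af x = enn2real (\<integral>\<^sup>+t\<in>{x-h..x+h}. f t \<partial>lebesgue) / (2*h)" for x
    let ?F = "\<lambda>B. \<integral>\<^sup>+x\<in>B. (ennreal (f x powr p x) * w x) \<partial>lebesgue"
    have fe: "(\<lambda>x. ennreal (f x)) \<in> borel_measurable lebesgue" using f by measurable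
    have pere: "periodic_2pi (\<lambda>x. ennreal (f x))" using per by (simp add: periodic_2pi_def)
    have local: "(\<integral>\<^sup>+x\<in>Q. (ennreal (Af x powr p x) * w x) \<partial>lebesgue)
        \<le> ennreal (3 powr P) * ((\<integral>\<^sup>+x\<in>Q. w x \<partial>lebesgue) + ennreal C * ?F I)"
      if Q: "Q \<subseteq> I" "Q \<in> sets lebesgue" and I: "I \<in> circ_intervals"
        and b: "\<And>x. x \<in> Q \<Longrightarrow> (\<integral>\<^sup>+t\<in>{x-h..x+h}. f t \<partial>lebesgue) \<le> ennreal (6 * h / measure lebesgue I) * (\<integral>\<^sup>+t\<in>I. f t \<partial>lebesgue)"
      for Q I
    proof -
      note Ip = circ_intervals_props[OF I]
      obtain V where V: "(\<integral>\<^sup>+x\<in>I. w x \<partial>lebesgue) = ennreal V" "0 < V" using weight_integral_real[OF fin I] .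
      have "(\<integral>\<^sup>+x\<in>I. f x \<partial>lebesgue) \<le> (\<integral>\<^sup>+x\<in>circ. f x \<partial>lebesgue)"
        using Ip(1) by (intro nn_integral_mono) (auto simp: indicator_def)
      then have "(\<integral>\<^sup>+x\<in>I. f x \<partial>lebesgue) < top" using L1[OF f mod] by (rule le_less_trans)
      then obtain i where i: "(\<integral>\<^sup>+x\<in>I. f x \<partial>lebesgue) = ennreal i" "0 \<le> i" by (cases "\<integral>\<^sup>+x\<in>I. f x \<partial>lebesgue") auto
      define m where "m = i / measure lebesgue I"
      have m0: "0 \<le> m" using i Ip(3) by (simp add: m_def)
      \<comment> \<open>The factor 3 is room for both cases: \<open>I\<close> is longer than \<open>2 h\<close> by a bounded factor, or is the circle.\<close>
      have Am: "Af x \<le> 3 * m" if "x \<in> Q" for x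
      proof -
        have "(\<integral>\<^sup>+t\<in>{x-h..x+h}. f t \<partial>lebesgue) \<le> ennreal (6 * h / measure lebesgue I * i)"
          using b[OF that] i h Ip(3) ennreal_mult[of "6 * h / measure lebesgue I" i] by simp
        then have "enn2real (\<integral>\<^sup>+t\<in>{x-h..x+h}. f t \<partial>lebesgue) \<le> 6 * h / measure lebesgue I * i"
          using h i Ip(3) by (intro enn2real_leI) auto
        then have "Af x \<le> (6 * h / measure lebesgue I * i) / (2 * h)" unfolding Af_def using h by (intro divide_right_mono) auto
        also have "\<dots> = 3 * m" using h by (simp add: m_def)
        finally show ?thesis .
      qed
      have Af0: "0 \<le> Af x" for x using h by (simp add: Af_def)
      have pw: "ennreal (Af x powr p x) \<le> ennreal (3 powr P) * (1 + ennreal (C / V) * ?F I)" if x: "x \<in> Q" for x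
      proof -
        have xI: "x \<in> I" using x Q by blast
        then have xc: "x \<in> circ" using Ip by blast
        have "Af x powr p x \<le> (3 * m) powr p x" using Am[OF x] Af0 p_ge_1[OF xc] by (intro powr_mono2) auto
        also have "\<dots> = 3 powr p x * m powr p x" using m0 by (simp add: powr_mult)
        also have "\<dots> \<le> 3 powr P * m powr p x" using p_le[OF xc] by (intro mult_right_mono powr_mono) auto
        finally have 1: "ennreal (Af x powr p x) \<le> ennreal (3 powr P) * ennreal (m powr p x)"
          by (simp add: ennreal_mult[symmetric] ennreal_leI)
        have "ennreal V * ennreal (m powr p x) \<le> ennreal V + ennreal C * ?F I"
          using C(2)[OF f mod I xI V(1)] i by (simp add: m_def)
        then have "ennreal (1/V) * (ennreal V * ennreal (m powr p x)) \<le> ennreal (1/V) * (ennreal V + ennreal C * ?F I)"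
          by (intro mult_left_mono) auto
        moreover have "ennreal (1/V) * (ennreal V * ennreal (m powr p x)) = ennreal (m powr p x)"
          using V(2) by (simp add: ennreal_mult[symmetric])
        moreover have "ennreal (1/V) * (ennreal V + ennreal C * ?F I) = 1 + ennreal (C / V) * ?F I"
        proof -
          have "ennreal (1/V) * ennreal V = 1" using V(2) by (simp add: ennreal_mult[symmetric])
          moreover have "ennreal (1/V) * ennreal C = ennreal (C / V)" using V(2) C(1) by (simp add: ennreal_mult[symmetric])
          ultimately show ?thesis by (simp only: distrib_left mult.assoc[symmetric])
        qed
        ultimately have "ennreal (m powr p x) \<le> 1 + ennreal (C / V) * ?F I" by simp
        then show ?thesis by (intro order_trans[OF 1] mult_left_mono) auto
      qed
      have "(\<integral>\<^sup>+x\<in>Q. (ennreal (Af x powr p x) * w x) \<partial>lebesgue)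
        \<le> (\<integral>\<^sup>+x. ennreal (3 powr P) * (1 + ennreal (C / V) * ?F I) * (w x * indicator Q x) \<partial>lebesgue)"
        by (intro nn_integral_mono) (use pw in \<open>auto simp: indicator_def intro!: mult_right_mono\<close>)
      also have "\<dots> = ennreal (3 powr P) * (1 + ennreal (C / V) * ?F I) * (\<integral>\<^sup>+x\<in>Q. w x \<partial>lebesgue)"
        by (rule nn_integral_cmult) (use Q in \<open>auto intro!: borel_measurable_times_ennreal borel_measurable_indicator\<close>)
      also have "\<dots> = ennreal (3 powr P) * ((\<integral>\<^sup>+x\<in>Q. w x \<partial>lebesgue) + ennreal (C / V) * (\<integral>\<^sup>+x\<in>Q. w x \<partial>lebesgue) * ?F I)"
        by (simp add: distrib_left distrib_right mult_ac)
      also have "\<dots> \<le> ennreal (3 powr P) * ((\<integral>\<^sup>+x\<in>Q. w x \<partial>lebesgue) + ennreal (C / V) * ennreal V * ?F I)"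
      proof -
        have "(\<integral>\<^sup>+x\<in>Q. w x \<partial>lebesgue) \<le> ennreal V"
          unfolding V(1)[symmetric] using Q by (intro nn_integral_mono) (auto simp: indicator_def)
        then show ?thesis by (intro mult_left_mono add_left_mono mult_right_mono) auto
      qed
      also have "ennreal (C / V) * ennreal V = ennreal C" using V(2) C(1) by (simp add: ennreal_mult[symmetric])
      finally show ?thesis .
    qed
    have "(\<integral>\<^sup>+x\<in>circ. (ennreal (Af x powr p x) * w x) \<partial>lebesgue) \<le> ennreal (3 powr P) * (ennreal Vc + ennreal C * 3)"
    proof (cases "3 \<le> nat \<lfloor>2 * pi / h\<rfloor>")
      case False
      have "(\<integral>\<^sup>+x\<in>circ. (ennreal (Af x powr p x) * w x) \<partial>lebesgue)
        \<le> ennreal (3 powr P) * ((\<integral>\<^sup>+x\<in>circ. w x \<partial>lebesgue) + ennreal C * ?F circ)"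
      proof (rule local[OF _ _ circ_in_circ_intervals])
        fix x assume "x \<in> circ"
        show "(\<integral>\<^sup>+t\<in>{x-h..x+h}. f t \<partial>lebesgue) \<le> ennreal (6 * h / measure lebesgue circ) * (\<integral>\<^sup>+t\<in>circ. f t \<partial>lebesgue)"
          using average_over_periods[OF fe pere h False, of x] by simp
      qed auto
      also have "\<dots> \<le> ennreal (3 powr P) * (ennreal Vc + ennreal C * 3)"
        unfolding Vc(1) by (intro mult_left_mono add_left_mono order_trans[OF mod]) auto
      finally show ?thesis .
    next
      case True
      obtain N l Q I pr su where N: "0 < (N::nat)" "h \<le> l" "3 * l \<le> 4 * h" and
        QI: "\<forall>j<N. I j \<in> circ_intervals \<and> Q j \<subseteq> I j \<and> Q j \<in> sets lebesgue \<and> measure lebesgue (I j) = 3 * l \<and>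
        (AE x in lebesgue. indicator (I j) x = (indicator (Q (pr j)) x + indicator (Q j) x + indicator (Q (su j)) x :: ennreal))" and
        bij: "bij_betw pr {..<N} {..<N}" "bij_betw su {..<N} {..<N}" and
        cover: "\<forall>x. indicator {-pi..<pi} x = (\<Sum>j<N. indicator (Q j) x :: ennreal)" and
        avg: "\<forall>f j x. f \<in> borel_measurable lebesgue \<longrightarrow> periodic_2pi f \<longrightarrow> j < N \<longrightarrow> x \<in> Q j \<longrightarrow>
        (\<integral>\<^sup>+t\<in>{x - h..x + h}. f t \<partial>lebesgue) \<le> (\<integral>\<^sup>+t\<in>I j. (f t :: ennreal) \<partial>lebesgue)"
        using averages_partition[OF h True] by (elim exE conjE) (rule that)
      have Qm: "Q j \<in> sets lebesgue" "Q j \<subseteq> circ" if "j < N" for j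
        using QI that circ_intervals_props(1)[of "I j"] by blast+
      have prN: "pr j < N" "su j < N" if "j < N" for j using bij that by (auto dest: bij_betwE)
      have sumQ: "(\<integral>\<^sup>+x\<in>circ. g x \<partial>lebesgue) \<ge> (\<Sum>j<N. \<integral>\<^sup>+x\<in>Q j. g x \<partial>lebesgue)"
        if g: "\<And>j. j < N \<Longrightarrow> (\<lambda>x. g x * indicator (Q j) x) \<in> borel_measurable lebesgue" for g :: "real \<Rightarrow> ennreal"
      proof -
        have "(\<Sum>j<N. \<integral>\<^sup>+x\<in>Q j. g x \<partial>lebesgue) = (\<integral>\<^sup>+x. (\<Sum>j<N. g x * indicator (Q j) x) \<partial>lebesgue)"
          by (rule nn_integral_sum[symmetric]) (use g in auto)
        also have "\<dots> = (\<integral>\<^sup>+x. g x * indicator {-pi..<pi} x \<partial>lebesgue)"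
          using cover by (simp add: sum_distrib_left[symmetric])
        also have "\<dots> \<le> (\<integral>\<^sup>+x\<in>circ. g x \<partial>lebesgue)" by (intro nn_integral_mono) (auto simp: indicator_def)
        finally show ?thesis .
      qed
      have Fm: "(\<lambda>x. ennreal (f x powr p x) * w x * indicator (Q j) x) \<in> borel_measurable lebesgue" if "j < N" for j
        by (rule modular_on_measurable[OF f Qm(2,1)]) (use that in auto)
      have wm: "(\<lambda>x. w x * indicator (Q j) x) \<in> borel_measurable lebesgue" if "j < N" for j
        using Qm that by (intro borel_measurable_times_ennreal borel_measurable_indicator) auto
      have FQ: "(\<Sum>j<N. ?F (Q j)) \<le> 1" by (rule order_trans[OF sumQ[OF Fm] mod])
      have FI: "?F (I j) = ?F (Q (pr j)) + ?F (Q j) + ?F (Q (su j))" if j: "j < N" for j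
      proof -
        have "?F (I j) = (\<integral>\<^sup>+t. (ennreal (f t powr p t) * w t * indicator (Q (pr j)) t + ennreal (f t powr p t) * w t * indicator (Q j) t)
             + ennreal (f t powr p t) * w t * indicator (Q (su j)) t \<partial>lebesgue)"
          by (rule nn_integral_cong_AE) (use QI j in \<open>auto simp: distrib_left elim!: eventually_mono\<close>)
        also have "\<dots> = ?F (Q (pr j)) + ?F (Q j) + ?F (Q (su j))"
          by (rule nn_integral_add3[OF Fm[OF prN(1)[OF j]] Fm[OF j] Fm[OF prN(2)[OF j]]])
        finally show ?thesis .
      qed
      have "(\<integral>\<^sup>+x\<in>circ. (ennreal (Af x powr p x) * w x) \<partial>lebesgue) = (\<integral>\<^sup>+x\<in>{-pi..<pi}. (ennreal (Af x powr p x) * w x) \<partial>lebesgue)"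
        by (rule nn_integral_Icc_Ico)
      also have "\<dots> \<le> (\<Sum>j<N. ennreal (3 powr P) * ((\<integral>\<^sup>+x\<in>Q j. w x \<partial>lebesgue) + ennreal C * ?F (I j)))"
      proof -
        have "(\<integral>\<^sup>+t\<in>{x-h..x+h}. f t \<partial>lebesgue) \<le> ennreal (6 * h / measure lebesgue (I j)) * (\<integral>\<^sup>+t\<in>I j. f t \<partial>lebesgue)"
          if "j < N" "x \<in> Q j" for j x
        proof -
          have "(\<integral>\<^sup>+t\<in>{x-h..x+h}. f t \<partial>lebesgue) \<le> 1 * (\<integral>\<^sup>+t\<in>I j. f t \<partial>lebesgue)"
            using avg fe pere that by simp
          also have "1 \<le> ennreal (6 * h / measure lebesgue (I j))"
          proof -
            have "1 \<le> 6 * h / measure lebesgue (I j)" using QI that N h by (simp add: field_simps)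
            from ennreal_leI[OF this] show ?thesis by simp
          qed
          finally show ?thesis by (simp add: mult_right_mono)
        qed
        then have loc: "(\<integral>\<^sup>+x\<in>Q j. (ennreal (Af x powr p x) * w x) \<partial>lebesgue)
          \<le> ennreal (3 powr P) * ((\<integral>\<^sup>+x\<in>Q j. w x \<partial>lebesgue) + ennreal C * ?F (I j))" if "j < N" for j
          using QI that by (intro local) auto
        have "(\<integral>\<^sup>+x\<in>{-pi..<pi}. (ennreal (Af x powr p x) * w x) \<partial>lebesgue)
          = (\<integral>\<^sup>+x. (\<Sum>j<N. ennreal (Af x powr p x) * w x * indicator (Q j) x) \<partial>lebesgue)"
          using cover by (simp add: sum_distrib_left[symmetric])
        also have "\<dots> = (\<Sum>j<N. \<integral>\<^sup>+x\<in>Q j. (ennreal (Af x powr p x) * w x) \<partial>lebesgue)"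
        proof (rule nn_integral_sum)
          have "(\<lambda>x. \<integral>\<^sup>+t\<in>{x-h..x+h}. f t \<partial>lebesgue) \<in> borel_measurable lebesgue"
            by (rule window_integral_measurable[OF fe])
          then have Afm: "Af \<in> borel_measurable lebesgue" unfolding Af_def by measurable
          have "0 \<le> Af x" for x using h by (simp add: Af_def)
          then show "(\<lambda>x. ennreal (Af x powr p x) * w x * indicator (Q j) x) \<in> borel_measurable lebesgue" if "j \<in> {..<N}" for j
            using that by (intro modular_on_measurable[OF Afm] Qm) auto
        qed
        also have "\<dots> \<le> (\<Sum>j<N. ennreal (3 powr P) * ((\<integral>\<^sup>+x\<in>Q j. w x \<partial>lebesgue) + ennreal C * ?F (I j)))"
          by (intro sum_mono loc) auto
        finally show ?thesis .
      qed
      also have "\<dots> = ennreal (3 powr P) * ((\<Sum>j<N. \<integral>\<^sup>+x\<in>Q j. w x \<partial>lebesgue) + ennreal C * (\<Sum>j<N. ?F (I j)))"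
        by (simp add: sum_distrib_left[symmetric] sum.distrib distrib_left)
      also have "(\<Sum>j<N. ?F (I j)) = (\<Sum>j<N. ?F (Q (pr j)) + ?F (Q j) + ?F (Q (su j)))"
        by (rule sum.cong) (use FI in auto)
      also have "\<dots> = (\<Sum>j<N. ?F (Q (pr j))) + (\<Sum>j<N. ?F (Q j)) + (\<Sum>j<N. ?F (Q (su j)))"
        by (simp add: sum.distrib)
      also have "(\<Sum>j<N. ?F (Q (pr j))) = (\<Sum>j<N. ?F (Q j))" by (rule sum.reindex_bij_betw[OF bij(1)])
      also have "(\<Sum>j<N. ?F (Q (su j))) = (\<Sum>j<N. ?F (Q j))" by (rule sum.reindex_bij_betw[OF bij(2)])
      also have "ennreal (3 powr P) * ((\<Sum>j<N. \<integral>\<^sup>+x\<in>Q j. w x \<partial>lebesgue) + ennreal C * ((\<Sum>j<N. ?F (Q j)) + (\<Sum>j<N. ?F (Q j)) + (\<Sum>j<N. ?F (Q j))))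
        \<le> ennreal (3 powr P) * (ennreal Vc + ennreal C * (1 + 1 + 1))"
        by (intro mult_left_mono add_mono FQ) (use sumQ[OF wm] Vc in auto)
      finally show ?thesis by simp
    qed
    also have "\<dots> = ennreal (3 powr P * (Vc + C * 3))"
      using Vc(2) C(1) by (simp add: ennreal_mult ennreal_plus)
    also have "\<dots> \<le> ennreal C2" by (intro ennreal_leI) (simp add: C2_def)
    finally show ?thesis unfolding Af_def .
  qed
  show ?thesis by (rule that[OF C2 main L1])
qed

text \<open>
  The passage from modulars to norms: \<open>p\<close> is at least 1, so dividing a function by \<open>C \<ge> 1\<close> divides
  its modular at least by \<open>C\<close>.
\<close>

lemma averages_bounded:
  obtains C where "1 \<le> C" "\<And>(f::real\<Rightarrow>real) h. \<lbrakk>f \<in> borel_measurable lebesgue; \<And>x. 0 \<le> f x; periodic_2pi f; wnorm p w f < top; 0 < h\<rbrakk>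
      \<Longrightarrow> wnorm p w (\<lambda>x. enn2real (\<integral>\<^sup>+t\<in>{x-h..x+h}. f t \<partial>lebesgue) / (2*h)) \<le> ennreal C * wnorm p w f"
    and "\<And>f::real\<Rightarrow>real. \<lbrakk>f \<in> borel_measurable lebesgue; \<And>x. 0 \<le> f x; wnorm p w f < top\<rbrakk>
      \<Longrightarrow> (\<integral>\<^sup>+x\<in>circ. f x \<partial>lebesgue) < top"
proof (cases "(\<integral>\<^sup>+x\<in>circ. w x \<partial>lebesgue) = top")
  case True
  note inf = infinite_weight[OF True]
  have zero: "AE x in lebesgue. x \<in> circ \<longrightarrow> f x = 0"
    if f: "f \<in> borel_measurable lebesgue" and fin: "wnorm p w f < top" for f :: "real \<Rightarrow> real"
  proof -
    obtain N where N: "wnorm p w f = ennreal N" "0 \<le> N" using fin by (cases "wnorm p w f") auto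
    let ?g = "\<lambda>x. ennreal ((norm (f x) / (N + 1)) powr p x) * w x * indicator circ x"
    have "(\<integral>\<^sup>+x. ?g x \<partial>lebesgue) \<le> 1"
      by (rule modular_le_1) (use N in \<open>simp add: ennreal_less_iff\<close>)
    then have "(\<integral>\<^sup>+x. ?g x \<partial>lebesgue) \<noteq> \<infinity>" by (auto simp: top_unique)
    then have "AE x in lebesgue. ?g x \<noteq> \<infinity>"
      by (rule nn_integral_noteq_infinite[OF modular_measurable[OF f]])
    with inf show ?thesis
    proof eventually_elim
      fix x assume x: "x \<in> circ \<longrightarrow> w x = top" "?g x \<noteq> \<infinity>"
      show "x \<in> circ \<longrightarrow> f x = 0"
      proof (intro impI, rule ccontr)
        assume "x \<in> circ" "f x \<noteq> 0"
        then have "0 < (norm (f x) / (N + 1)) powr p x" using N by simp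
        then show False using x \<open>x \<in> circ\<close> by (auto simp: ennreal_mult_top)
      qed
    qed
  qed
  have int0: "(\<integral>\<^sup>+x\<in>circ. f x \<partial>lebesgue) = 0"
    if "f \<in> borel_measurable lebesgue" "wnorm p w f < top" for f :: "real \<Rightarrow> real"
  proof -
    have "(\<integral>\<^sup>+x\<in>circ. f x \<partial>lebesgue) = (\<integral>\<^sup>+(x::real). 0 \<partial>lebesgue)"
      by (rule nn_integral_cong_AE) (use zero[OF that] in \<open>auto simp: indicator_def elim!: eventually_mono\<close>)
    then show ?thesis by simp
  qed
  show ?thesis
  proof (rule that[of 1])
    fix f :: "real \<Rightarrow> real" and h :: real
    assume f: "f \<in> borel_measurable lebesgue" "\<And>x. 0 \<le> f x" "periodic_2pi f" "wnorm p w f < top" "0 < h"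
    have fe: "(\<lambda>x. ennreal (f x)) \<in> borel_measurable lebesgue" using f by measurable
    have pere: "periodic_2pi (\<lambda>x. ennreal (f x))" using f by (simp add: periodic_2pi_def)
    define n where "n = nat \<lceil>h / pi\<rceil>"
    have n: "h / pi \<le> real n" using f(5) unfolding n_def by (auto simp: of_nat_nat)
    have "(\<integral>\<^sup>+t\<in>{x - h..x + h}. f t \<partial>lebesgue) = 0" for x
    proof -
      have "(\<integral>\<^sup>+t\<in>{x - h..x + h}. f t \<partial>lebesgue) = (\<integral>\<^sup>+t\<in>{x - h..<x + h}. f t \<partial>lebesgue)"
        by (rule nn_integral_Icc_Ico)
      also have "\<dots> \<le> (\<integral>\<^sup>+t\<in>{x - h..<(x - h) + 2 * pi * real n}. f t \<partial>lebesgue)"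
      proof (intro nn_integral_mono)
        have "x + h \<le> (x - h) + 2 * pi * real n" using n by (simp add: field_simps)
        then show "ennreal (f t) * indicator {x - h..<x + h} t \<le> ennreal (f t) * indicator {x - h..<(x - h) + 2 * pi * real n} t" for t
          by (auto simp: indicator_def)
      qed
      also have "\<dots> = of_nat n * (\<integral>\<^sup>+t\<in>circ. f t \<partial>lebesgue)" by (rule nn_integral_periods[OF fe pere])
      also have "\<dots> = 0" using int0[OF f(1,4)] by simp
      finally show ?thesis by simp
    qed
    then show "wnorm p w (\<lambda>x. enn2real (\<integral>\<^sup>+t\<in>{x-h..x+h}. f t \<partial>lebesgue) / (2*h)) \<le> ennreal 1 * wnorm p w f"
      by simp
  qed (use int0 in auto)
next
  case False
  then have fin: "(\<integral>\<^sup>+x\<in>circ. w x \<partial>lebesgue) < top" by (simp add: top.not_eq_extremum)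
  obtain C where C: "1 \<le> C" and main: "\<And>(f::real\<Rightarrow>real) h. \<lbrakk>f \<in> borel_measurable lebesgue; \<And>x. 0 \<le> f x; periodic_2pi f;
      (\<integral>\<^sup>+x\<in>circ. (ennreal (f x powr p x) * w x) \<partial>lebesgue) \<le> 1; 0 < h\<rbrakk>
    \<Longrightarrow> (\<integral>\<^sup>+x\<in>circ. (ennreal ((enn2real (\<integral>\<^sup>+t\<in>{x-h..x+h}. f t \<partial>lebesgue) / (2*h)) powr p x) * w x) \<partial>lebesgue) \<le> ennreal C"
    and L1: "\<And>(f::real\<Rightarrow>real). \<lbrakk>f \<in> borel_measurable lebesgue; \<And>x. 0 \<le> f x;
      (\<integral>\<^sup>+x\<in>circ. (ennreal (f x powr p x) * w x) \<partial>lebesgue) \<le> 1\<rbrakk> \<Longrightarrow> (\<integral>\<^sup>+x\<in>circ. f x \<partial>lebesgue) < top"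
    using average_modular_bound[OF fin] by blast
  have resc: "(\<integral>\<^sup>+x\<in>circ. f x \<partial>lebesgue) = ennreal a * (\<integral>\<^sup>+x\<in>circ. (f x / a) \<partial>lebesgue)"
    if "0 < a" "f \<in> borel_measurable lebesgue" "\<And>x. 0 \<le> f x" for f :: "real \<Rightarrow> real" and a
  proof -
    have "ennreal a * (\<integral>\<^sup>+x\<in>circ. (f x / a) \<partial>lebesgue) = (\<integral>\<^sup>+x. ennreal a * (ennreal (f x / a) * indicator circ x) \<partial>lebesgue)"
      by (rule nn_integral_cmult[symmetric]) (use that in \<open>auto intro!: borel_measurable_times_ennreal borel_measurable_indicator\<close>)
    also have "\<dots> = (\<integral>\<^sup>+x\<in>circ. f x \<partial>lebesgue)"
      using that by (intro nn_integral_cong) (simp add: mult.assoc[symmetric] ennreal_mult[symmetric])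
    finally show ?thesis by simp
  qed
  show ?thesis
  proof (rule that[OF C])
    fix f :: "real \<Rightarrow> real" and h :: real
    assume f: "f \<in> borel_measurable lebesgue" "\<And>x. 0 \<le> f x" "periodic_2pi f" "wnorm p w f < top" "0 < h"
    obtain N where N: "wnorm p w f = ennreal N" "0 \<le> N" using f(4) by (cases "wnorm p w f") auto
    let ?A = "\<lambda>x. enn2real (\<integral>\<^sup>+t\<in>{x-h..x+h}. f t \<partial>lebesgue) / (2*h)"
    have le: "wnorm p w ?A \<le> ennreal (C * a)" if a: "N < a" for a
    proof (rule wnorm_leI)
      have a0: "0 < a" using a N by simp
      show "0 < C * a" using a0 C by simp
      have mod: "(\<integral>\<^sup>+x\<in>circ. (ennreal ((f x / a) powr p x) * w x) \<partial>lebesgue) \<le> 1"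
        using modular_le_1[of f a] N a f(2) by (simp add: ennreal_less_iff)
      have sc: "enn2real (\<integral>\<^sup>+t\<in>{x-h..x+h}. (f t / a) \<partial>lebesgue) = enn2real (\<integral>\<^sup>+t\<in>{x-h..x+h}. f t \<partial>lebesgue) / a" for x
      proof -
        have "(\<integral>\<^sup>+t\<in>{x-h..x+h}. (f t / a) \<partial>lebesgue) = (\<integral>\<^sup>+t. ennreal (1/a) * (ennreal (f t) * indicator {x-h..x+h} t) \<partial>lebesgue)"
          using a0 f(2) by (intro nn_integral_cong) (simp add: mult.assoc[symmetric] ennreal_mult[symmetric])
        also have "\<dots> = ennreal (1/a) * (\<integral>\<^sup>+t\<in>{x-h..x+h}. f t \<partial>lebesgue)"
          by (rule nn_integral_cmult) (use f in \<open>auto intro!: borel_measurable_times_ennreal borel_measurable_indicator\<close>)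
        finally show ?thesis using a0 by (simp add: enn2real_mult)
      qed
      have m: "(\<integral>\<^sup>+x\<in>circ. (ennreal ((enn2real (\<integral>\<^sup>+t\<in>{x-h..x+h}. (f t / a) \<partial>lebesgue) / (2*h)) powr p x) * w x) \<partial>lebesgue) \<le> ennreal C"
        by (rule main) (use f a0 mod in \<open>auto simp: periodic_2pi_def\<close>)
      have "(\<integral>\<^sup>+x\<in>circ. (ennreal ((norm (?A x) / (C * a)) powr p x) * w x) \<partial>lebesgue)
        \<le> (\<integral>\<^sup>+x. ennreal (1/C) * (ennreal ((enn2real (\<integral>\<^sup>+t\<in>{x-h..x+h}. (f t / a) \<partial>lebesgue) / (2*h)) powr p x) * w x * indicator circ x) \<partial>lebesgue)"
      proof (rule nn_integral_mono)
        fix x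
        let ?B = "enn2real (\<integral>\<^sup>+t\<in>{x-h..x+h}. (f t / a) \<partial>lebesgue) / (2*h)"
        have B: "norm (?A x) / (C * a) = ?B * (1/C)" "0 \<le> ?B" using a0 f(5) C by (simp_all add: sc)
        show "ennreal ((norm (?A x) / (C * a)) powr p x) * w x * indicator circ x \<le> ennreal (1/C) * (ennreal (?B powr p x) * w x * indicator circ x)"
        proof (cases "x \<in> circ")
          case True
          have "(?B * (1/C)) powr p x = ?B powr p x * (1/C) powr p x" using B(2) C by (intro powr_mult)
          also have "(1/C) powr p x \<le> (1/C) powr 1" using C p_ge_1[OF True] by (intro powr_mono') auto
          also have "(1/C) powr 1 = 1/C" using C by simp
          finally have "(?B * (1/C)) powr p x \<le> (1/C) * ?B powr p x" by (simp add: mult_left_mono)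
          then have "ennreal ((norm (?A x) / (C * a)) powr p x) \<le> ennreal (1/C) * ennreal (?B powr p x)"
            unfolding B(1) using C by (simp add: ennreal_mult[symmetric] ennreal_leI)
          then have "ennreal ((norm (?A x) / (C * a)) powr p x) * w x \<le> ennreal (1/C) * ennreal (?B powr p x) * w x"
            by (intro mult_right_mono) auto
          then show ?thesis using True by (simp add: mult.assoc)
        qed simp
      qed
      also have "\<dots> = ennreal (1/C) * (\<integral>\<^sup>+x\<in>circ. (ennreal ((enn2real (\<integral>\<^sup>+t\<in>{x-h..x+h}. (f t / a) \<partial>lebesgue) / (2*h)) powr p x) * w x) \<partial>lebesgue)"
      proof (rule nn_integral_cmult, rule modular_on_measurable)
        have "(\<lambda>x. \<integral>\<^sup>+t\<in>{x-h..x+h}. (f t / a) \<partial>lebesgue) \<in> borel_measurable lebesgue"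
          by (rule window_integral_measurable) (use f in measurable)
        then show "(\<lambda>x. enn2real (\<integral>\<^sup>+t\<in>{x-h..x+h}. (f t / a) \<partial>lebesgue) / (2*h)) \<in> borel_measurable lebesgue" by measurable
      qed (use f in auto)
      also have "\<dots> \<le> ennreal (1/C) * ennreal C" by (intro mult_left_mono m) auto
      also have "\<dots> = 1" using C by (simp add: ennreal_mult[symmetric])
      finally show "(\<integral>\<^sup>+x\<in>circ. (ennreal ((norm (?A x) / (C * a)) powr p x) * w x) \<partial>lebesgue) \<le> 1" .
    qed
    show "wnorm p w ?A \<le> ennreal C * wnorm p w f"
    proof (rule ennreal_le_epsilon)
      fix e :: real assume "0 < e"
      have "wnorm p w ?A \<le> ennreal (C * (N + e / C))" by (rule le) (use \<open>0 < e\<close> C in simp)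
      also have "\<dots> = ennreal C * wnorm p w f + ennreal e"
        using C \<open>0 < e\<close> N by (simp add: distrib_left ennreal_mult ennreal_plus)
      finally show "wnorm p w ?A \<le> ennreal C * wnorm p w f + ennreal e" .
    qed
  next
    fix f :: "real \<Rightarrow> real"
    assume f: "f \<in> borel_measurable lebesgue" "\<And>x. 0 \<le> f x" "wnorm p w f < top"
    obtain N where N: "wnorm p w f = ennreal N" "0 \<le> N" using f(3) by (cases "wnorm p w f") auto
    have mod: "(\<integral>\<^sup>+x\<in>circ. (ennreal ((f x / (N + 1)) powr p x) * w x) \<partial>lebesgue) \<le> 1"
      using modular_le_1[of f "N + 1"] N f(2) by (simp add: ennreal_less_iff)
    have "(\<integral>\<^sup>+x\<in>circ. (f x / (N + 1)) \<partial>lebesgue) < top"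
      by (rule L1) (use f N mod in auto)
    then show "(\<integral>\<^sup>+x\<in>circ. f x \<partial>lebesgue) < top"
      using resc[of "N + 1" f] N f by (simp add: ennreal_mult_less_top)
  qed
qed

end

text \<open>
  The essential bound of \<open>p\<close> is replaced by a bound at every point: \<open>1 / p\<close> is continuous and
  positive on a compact set.
\<close>

lemma log_exponent_bounded:
  assumes "p \<in> log_exponents"
  obtains c P where "0 < c" "\<And>x y. x \<in> circ \<Longrightarrow> y \<in> circ \<Longrightarrow> x \<noteq> y \<Longrightarrow> \<bar>1 / p x - 1 / p y\<bar> \<le> log_modulus c \<bar>x - y\<bar>"
    "\<And>x. x \<in> circ \<Longrightarrow> p x \<le> P"
proof -
  from assms obtain c where c: "0 < c" "\<And>x y. x \<in> circ \<Longrightarrow> y \<in> circ \<Longrightarrow> x \<noteq> y \<Longrightarrow> \<bar>1 / p x - 1 / p y\<bar> \<le> log_modulus c \<bar>x - y\<bar>"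
    unfolding log_exponents_def log_modulus_def by blast
  have p1: "1 \<le> p x" if "x \<in> circ" for x using assms that by (auto simp: log_exponents_def exponents_def)
  have "continuous_on circ (\<lambda>x. 1 / p x)"
    unfolding continuous_on_iff
  proof (intro ballI allI impI)
    fix x \<epsilon> :: real assume x: "x \<in> circ" and "0 < \<epsilon>"
    obtain d where d: "0 < d" "log_modulus c d \<le> \<epsilon>/2" using log_modulus_small[OF c(1), of "\<epsilon>/2"] \<open>0 < \<epsilon>\<close> by auto
    show "\<exists>d>0. \<forall>y\<in>circ. dist y x < d \<longrightarrow> dist (1 / p y) (1 / p x) < \<epsilon>"
    proof (intro exI[of _ d] conjI ballI impI d)
      fix y assume y: "y \<in> circ" "dist y x < d"
      show "dist (1 / p y) (1 / p x) < \<epsilon>"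
      proof (cases "y = x")
        case False
        have "\<bar>1 / p y - 1 / p x\<bar> \<le> log_modulus c \<bar>y - x\<bar>" by (rule c(2)[OF y(1) x False])
        also have "\<dots> \<le> log_modulus c d" using y False c(1) by (intro log_modulus_mono) (auto simp: dist_real_def)
        finally show ?thesis using d \<open>0 < \<epsilon>\<close> by (simp add: dist_real_def)
      qed (use \<open>0 < \<epsilon>\<close> in simp)
    qed
  qed
  moreover have "circ \<noteq> {}" using pi_gt_zero by auto
  ultimately obtain z where z: "z \<in> circ" "\<And>x. x \<in> circ \<Longrightarrow> 1 / p z \<le> 1 / p x"
    using continuous_attains_inf[of circ "\<lambda>x. 1 / p x"] by auto
  have "p x \<le> p z" if "x \<in> circ" for x
    using z(2)[OF that] p1[OF z(1)] p1[OF that] by (simp add: field_simps)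
  with c show ?thesis by (rule that)
qed

lemma muckenhoupt_weight_intro:
  assumes "p \<in> log_exponents" "w \<in> muckenhoupt p"
  obtains c P A where "muckenhoupt_weight p w c P A"
proof -
  obtain c P where cP: "0 < c" "\<And>x y. x \<in> circ \<Longrightarrow> y \<in> circ \<Longrightarrow> x \<noteq> y \<Longrightarrow> \<bar>1 / p x - 1 / p y\<bar> \<le> log_modulus c \<bar>x - y\<bar>"
    "\<And>x. x \<in> circ \<Longrightarrow> p x \<le> P" using log_exponent_bounded[OF assms(1)] by blast
  let ?S = "SUP B\<in>circ_intervals.
        (\<integral>\<^sup>+x\<in>B. w x \<partial>lebesgue) / ennreal (measure lebesgue B powr harm_mean p B)
        * lux B (\<lambda>x. conj_exponent p x / ennreal (p x)) (\<lambda>x. 1 / w x)"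
  have "?S < \<infinity>" using assms(2) by (simp add: muckenhoupt_def)
  then obtain A where A: "?S = ennreal A" "0 \<le> A" by (cases ?S) auto
  have "muckenhoupt_weight p w c P A"
  proof (unfold_locales)
    show "(\<integral>\<^sup>+x\<in>B. w x \<partial>lebesgue) / ennreal (measure lebesgue B powr harm_mean p B)
        * lux B (\<lambda>x. conj_exponent p x / ennreal (p x)) (\<lambda>x. 1 / w x) \<le> ennreal A" if "B \<in> circ_intervals" for B
      unfolding A(1)[symmetric] using that by (rule SUP_upper)
  qed (use cP A assms in \<open>auto simp: log_exponents_def exponents_def muckenhoupt_def weights_def\<close>)
  then show ?thesis by (rule that)
qed

section \<open>Primitives, Steklov means and their differences\<close>

definition loc_integrable :: "(real \<Rightarrow> 'a::euclidean_space) \<Rightarrow> bool" where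
  "loc_integrable f \<longleftrightarrow> (\<forall>a b. f absolutely_integrable_on {a..b})"

text \<open>
  No derivative occurs here: the relation is stable under means, differences and translations,
  whereas the existence of derivatives would have to be proved each time.
\<close>

definition primitive_of :: "(real \<Rightarrow> 'a::euclidean_space) \<Rightarrow> (real \<Rightarrow> 'a) \<Rightarrow> bool" where
  "primitive_of F f \<longleftrightarrow> loc_integrable f \<and> (\<forall>x y. x \<le> y \<longrightarrow> F y - F x = integral {x..y} f)"

definition primitive :: "(real \<Rightarrow> 'a::euclidean_space) \<Rightarrow> real \<Rightarrow> 'a" where
  "primitive f x = (if 0 \<le> x then integral {0..x} f else - integral {x..0} f)"

lemma loc_integrableD:
  assumes "loc_integrable f"
  shows "f absolutely_integrable_on {a..b}" "f integrable_on {a..b}"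
    "(LINT t:{a..b}|lebesgue. f t) = integral {a..b} f"
proof -
  show *: "f absolutely_integrable_on {a..b}" using assms by (simp add: loc_integrable_def)
  then show "f integrable_on {a..b}" by (simp add: absolutely_integrable_on_def)
  show "(LINT t:{a..b}|lebesgue. f t) = integral {a..b} f" by (rule set_lebesgue_integral_eq_integral(2)[OF *])
qed

lemma steklov_eq: "loc_integrable f \<Longrightarrow> steklov h f x = (1 / h) *\<^sub>R integral {x..x + h} f"
  by (simp add: steklov_def loc_integrableD(3))

lemma loc_integrable_continuous: "(\<And>a b. continuous_on {a..b} f) \<Longrightarrow> loc_integrable f"
  using absolutely_integrable_continuous[of _ _ f] by (simp add: loc_integrable_def)

lemma loc_integrable_add: "loc_integrable f \<Longrightarrow> loc_integrable g \<Longrightarrow> loc_integrable (\<lambda>x. f x + g x)"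
  by (simp add: loc_integrable_def set_integral_add(1))

lemma loc_integrable_diff: "loc_integrable f \<Longrightarrow> loc_integrable g \<Longrightarrow> loc_integrable (\<lambda>x. f x - g x)"
  by (simp add: loc_integrable_def set_integral_diff(1))

lemma loc_integrable_scaleR: "loc_integrable f \<Longrightarrow> loc_integrable (\<lambda>x. c *\<^sub>R f x)"
  by (simp add: loc_integrable_def absolutely_integrable_scaleR_left)

lemma loc_integrable_norm: "loc_integrable f \<Longrightarrow> loc_integrable (\<lambda>x. norm (f x))"
  by (simp add: loc_integrable_def absolutely_integrable_norm[unfolded o_def])

lemma loc_integrable_shift:
  assumes "loc_integrable f" shows "loc_integrable (\<lambda>x. f (x + c))"
  unfolding loc_integrable_def
proof (intro allI)
  fix a b
  have "integrable lebesgue (\<lambda>x. indicator {a + c..b + c} x *\<^sub>R f x)"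
    using loc_integrableD(1)[OF assms, of "a + c" "b + c"] by (simp add: set_integrable_def)
  then have "integrable lebesgue (\<lambda>x. indicator {a + c..b + c} (c + 1 * x) *\<^sub>R f (c + 1 * x))"
    by (subst lebesgue_integrable_real_affine_iff) auto
  moreover have "indicator {a + c..b + c} (c + 1 * x) *\<^sub>R f (c + 1 * x) = indicator {a..b} x *\<^sub>R f (x + c)" for x
    by (simp add: indicator_def add.commute)
  ultimately show "(\<lambda>x. f (x + c)) absolutely_integrable_on {a..b}" by (simp add: set_integrable_def)
qed

lemma loc_integrable_measurable:
  assumes "loc_integrable f" shows "f \<in> borel_measurable lebesgue"
proof -
  have "(\<lambda>x. indicator {-real n..real n} x *\<^sub>R f x) \<in> borel_measurable lebesgue" for n
    using loc_integrableD(1)[OF assms, of "- real n" "real n"] by (simp add: set_integrable_def borel_measurable_integrable)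
  moreover have "(\<lambda>n. indicator {-real n..real n} x *\<^sub>R f x) \<longlonglongrightarrow> f x" for x
  proof -
    obtain N :: nat where "\<bar>x\<bar> \<le> real N" using real_arch_simple by blast
    then have "\<forall>\<^sub>F n in sequentially. indicator {-real n..real n} x *\<^sub>R f x = f x"
      by (intro eventually_sequentiallyI[of N]) (auto simp: indicator_def)
    then show ?thesis by (rule tendsto_eventually)
  qed
  ultimately show ?thesis by (rule borel_measurable_LIMSEQ_metric)
qed

lemma primitive_of_primitive:
  assumes "loc_integrable f" shows "primitive_of (primitive f) f"
  unfolding primitive_of_def
proof (intro conjI assms allI impI)
  fix x y :: real assume "x \<le> y"
  have c: "integral {a..b} f + integral {b..d} f = integral {a..d} f" if "a \<le> b" "b \<le> d" for a b d
    by (rule Henstock_Kurzweil_Integration.integral_combine[OF that loc_integrableD(2)[OF assms]])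
  show "primitive f y - primitive f x = integral {x..y} f"
    using c[of 0 x y] c[of x y 0] c[of x 0 y] \<open>x \<le> y\<close> by (auto simp: primitive_def algebra_simps)
qed

lemma primitive_of_continuous:
  assumes "primitive_of F f" shows "continuous_on A F"
proof -
  have "continuous_on {a..b} F" for a b
  proof -
    have "continuous_on {a..b} (\<lambda>x. F a + integral {a..x} f)"
      using assms by (intro continuous_intros indefinite_integral_continuous_1 loc_integrableD(2)) (simp add: primitive_of_def)
    then show ?thesis
      by (rule continuous_on_cong[THEN iffD1, rotated 2]) (use assms in \<open>auto simp: primitive_of_def algebra_simps\<close>)
  qed
  then have "isCont F x" for x
    using continuous_on_interior[of "{x - 1..x + 1}" F x] by simp
  then show ?thesis by (simp add: continuous_at_imp_continuous_on)
qed

lemma primitive_of_loc_integrable: "primitive_of F f \<Longrightarrow> loc_integrable F"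
  by (intro loc_integrable_continuous primitive_of_continuous)

lemma primitive_of_linear:
  assumes "primitive_of F f" "primitive_of G g"
  shows "primitive_of (\<lambda>x. a *\<^sub>R F x + b *\<^sub>R G x) (\<lambda>x. a *\<^sub>R f x + b *\<^sub>R g x)"
  unfolding primitive_of_def
proof (intro conjI allI impI)
  have fg: "loc_integrable f" "loc_integrable g" using assms by (auto simp: primitive_of_def)
  show "loc_integrable (\<lambda>x. a *\<^sub>R f x + b *\<^sub>R g x)" by (intro loc_integrable_add loc_integrable_scaleR fg)
  fix x y :: real assume "x \<le> y"
  have "integral {x..y} (\<lambda>x. a *\<^sub>R f x + b *\<^sub>R g x) = a *\<^sub>R integral {x..y} f + b *\<^sub>R integral {x..y} g"
    using fg by (subst Henstock_Kurzweil_Integration.integral_add) (auto intro!: integrable_cmul loc_integrableD(2) loc_integrable_scaleR)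
  also have "\<dots> = a *\<^sub>R (F y - F x) + b *\<^sub>R (G y - G x)"
    using assms \<open>x \<le> y\<close> by (simp add: primitive_of_def)
  finally show "a *\<^sub>R F y + b *\<^sub>R G y - (a *\<^sub>R F x + b *\<^sub>R G x) = integral {x..y} (\<lambda>x. a *\<^sub>R f x + b *\<^sub>R g x)"
    by (simp add: algebra_simps)
qed

lemma primitive_of_shift:
  assumes "primitive_of F f" shows "primitive_of (\<lambda>x. F (x + c)) (\<lambda>x. f (x + c))"
  unfolding primitive_of_def
proof (intro conjI allI impI)
  show "loc_integrable (\<lambda>x. f (x + c))" using assms by (intro loc_integrable_shift) (simp add: primitive_of_def)
  fix x y :: real assume "x \<le> y"
  then have "F (y + c) - F (x + c) = integral {x + c..y + c} f" using assms by (simp add: primitive_of_def)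
  also have "\<dots> = integral {x..y} (\<lambda>x. f (x + c))" using integral_shift_real_ivl[of "x + c" c "y + c" f] by simp
  finally show "F (y + c) - F (x + c) = integral {x..y} (\<lambda>x. f (x + c))" .
qed

lemma steklov_primitive:
  assumes "primitive_of F f" "0 < h"
  shows "steklov h f x = (1 / h) *\<^sub>R (F (x + h) - F x)"
  using assms by (simp add: steklov_eq primitive_of_def)

lemma steklov_continuous:
  assumes "loc_integrable f" "0 < h" shows "continuous_on A (steklov h f)"
proof -
  have p: "primitive_of (primitive f) f" by (rule primitive_of_primitive[OF assms(1)])
  have e: "steklov h f x = (1 / h) *\<^sub>R (primitive f (x + h) - primitive f x)" for x
    by (rule steklov_primitive[OF p assms(2)])
  show ?thesis unfolding e
    by (intro continuous_intros primitive_of_continuous[OF p] primitive_of_continuous[OF primitive_of_shift[OF p]])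
qed

lemma loc_integrable_steklov: "loc_integrable f \<Longrightarrow> 0 < h \<Longrightarrow> loc_integrable (steklov h f)"
  by (rule loc_integrable_continuous) (rule steklov_continuous)

text \<open>
  Means commute with taking primitives, by shifting the intervals of integration.
\<close>

lemma primitive_of_steklov:
  assumes F: "primitive_of F f" and h: "0 < h"
  shows "primitive_of (steklov h F) (steklov h f)"
  unfolding primitive_of_def
proof (intro conjI allI impI)
  have f: "loc_integrable f" using F by (simp add: primitive_of_def)
  note Fi = primitive_of_loc_integrable[OF F]
  show "loc_integrable (steklov h f)" by (rule loc_integrable_steklov[OF f h])
  fix x y :: real assume "x \<le> y"
  define G where "G = primitive F"
  have G: "primitive_of G F" unfolding G_def by (rule primitive_of_primitive[OF Fi])
  have "steklov h F y - steklov h F x = (1 / h) *\<^sub>R ((G (y + h) - G (x + h)) - (G y - G x))"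
    by (simp add: steklov_primitive[OF G h] algebra_simps)
  also have "\<dots> = ((1 / h) *\<^sub>R G (y + h) + (- 1 / h) *\<^sub>R G y) - ((1 / h) *\<^sub>R G (x + h) + (- 1 / h) *\<^sub>R G x)"
    by (simp add: algebra_simps)
  also have "\<dots> = integral {x..y} (\<lambda>s. (1 / h) *\<^sub>R F (s + h) + (- 1 / h) *\<^sub>R F s)"
    using primitive_of_linear[OF primitive_of_shift[OF G] G, of "1/h" h "-1/h"] \<open>x \<le> y\<close>
    unfolding primitive_of_def by blast
  also have "(\<lambda>s. (1 / h) *\<^sub>R F (s + h) + (- 1 / h) *\<^sub>R F s) = steklov h f"
    by (simp add: fun_eq_iff steklov_primitive[OF F h] algebra_simps)
  finally show "steklov h F y - steklov h F x = integral {x..y} (steklov h f)" .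
qed

lemma steklov_linear:
  assumes "loc_integrable f" "loc_integrable g"
  shows "steklov h (\<lambda>x. a *\<^sub>R f x + b *\<^sub>R g x) x = a *\<^sub>R steklov h f x + b *\<^sub>R steklov h g x"
  unfolding steklov_eq[OF loc_integrable_add[OF loc_integrable_scaleR[OF assms(1)] loc_integrable_scaleR[OF assms(2)]]]
    steklov_eq[OF assms(1)] steklov_eq[OF assms(2)]
  using assms by (subst Henstock_Kurzweil_Integration.integral_add) (auto intro!: integrable_cmul loc_integrableD(2) loc_integrable_scaleR simp: algebra_simps)

lemma steklov_diff:
  assumes "loc_integrable f" "loc_integrable g"
  shows "steklov h (\<lambda>x. f x - g x) = (\<lambda>x. steklov h f x - steklov h g x)"
  using steklov_linear[OF assms, of h 1 "-1"] by (simp add: fun_eq_iff)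

lemma steklov_add:
  assumes "loc_integrable f" "loc_integrable g"
  shows "steklov h (\<lambda>x. f x + g x) = (\<lambda>x. steklov h f x + steklov h g x)"
  using steklov_linear[OF assms, of h 1 "1"] by (simp add: fun_eq_iff)

lemma steklov_scaleR:
  assumes "loc_integrable f"
  shows "steklov h (\<lambda>x. c *\<^sub>R f x) = (\<lambda>x. c *\<^sub>R steklov h f x)"
  using steklov_linear[OF assms assms, of h c 0] by (simp add: fun_eq_iff)

lemma steklov_const: "0 < h \<Longrightarrow> steklov h (\<lambda>x. c) x = (c :: 'a :: euclidean_space)"
  by (simp add: steklov_eq loc_integrable_continuous)

text \<open>
  The first difference, so that \<^const>\<open>Delta\<close> is its iterate.
\<close>

definition Delta1 :: "real \<Rightarrow> (real \<Rightarrow> 'a::euclidean_space) \<Rightarrow> real \<Rightarrow> 'a" where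
  "Delta1 h f x = steklov h f x - f x"

lemma Delta_Suc: "Delta (Suc r) h f = Delta1 h (Delta r h f)" "Delta (Suc r) h f = Delta r h (Delta1 h f)"
proof -
  show "Delta (Suc r) h f = Delta1 h (Delta r h f)" by (simp add: Delta_def Delta1_def[abs_def])
  show "Delta (Suc r) h f = Delta r h (Delta1 h f)"
    by (simp only: Delta_def funpow_Suc_right o_apply Delta1_def[abs_def])
qed

lemma Delta_0: "Delta 0 h f = f" by (simp add: Delta_def)

lemma loc_integrable_Delta1: "loc_integrable f \<Longrightarrow> 0 < h \<Longrightarrow> loc_integrable (Delta1 h f)"
  unfolding Delta1_def by (intro loc_integrable_diff loc_integrable_steklov)

lemma loc_integrable_Delta: "loc_integrable f \<Longrightarrow> 0 < h \<Longrightarrow> loc_integrable (Delta r h f)"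
  by (induction r) (auto simp: Delta_0 Delta_Suc(1) loc_integrable_Delta1)

lemma Delta1_diff:
  assumes "loc_integrable f" "loc_integrable g"
  shows "Delta1 h (\<lambda>x. f x - g x) = (\<lambda>x. Delta1 h f x - Delta1 h g x)"
  by (simp add: Delta1_def fun_eq_iff steklov_diff[OF assms])

lemma Delta1_add:
  assumes "loc_integrable f" "loc_integrable g"
  shows "Delta1 h (\<lambda>x. f x + g x) = (\<lambda>x. Delta1 h f x + Delta1 h g x)"
  by (simp add: Delta1_def fun_eq_iff steklov_add[OF assms])

lemma Delta1_scaleR:
  assumes "loc_integrable f"
  shows "Delta1 h (\<lambda>x. c *\<^sub>R f x) = (\<lambda>x. c *\<^sub>R Delta1 h f x)"
  by (simp add: Delta1_def fun_eq_iff steklov_scaleR[OF assms] algebra_simps)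

lemma primitive_of_Delta1:
  assumes "primitive_of F f" "0 < h" shows "primitive_of (Delta1 h F) (Delta1 h f)"
  using primitive_of_linear[OF primitive_of_steklov[OF assms] assms(1), of 1 "-1"]
  by (simp add: Delta1_def[abs_def])

lemma periodic_steklov: "periodic_2pi f \<Longrightarrow> loc_integrable f \<Longrightarrow> periodic_2pi (steklov h f)"
  unfolding periodic_2pi_def
proof
  fix x assume "\<forall>x. f (x + 2 * pi) = f x" "loc_integrable f"
  moreover from this have "integral {x + 2 * pi..x + 2 * pi + h} f = integral {x..x + h} f"
    using integral_shift_real_ivl[of "x + 2 * pi" "2 * pi" "x + 2 * pi + h" f] by (simp add: algebra_simps)
  ultimately show "steklov h f (x + 2 * pi) = steklov h f x" by (simp add: steklov_eq)
qed

lemma periodic_Delta1: "periodic_2pi f \<Longrightarrow> loc_integrable f \<Longrightarrow> periodic_2pi (Delta1 h f)"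
  using periodic_steklov[of f h] by (simp add: periodic_2pi_def Delta1_def)

definition window :: "real \<Rightarrow> (real \<Rightarrow> 'a::euclidean_space) \<Rightarrow> real \<Rightarrow> real" where
  "window h f x = enn2real (\<integral>\<^sup>+t\<in>{x-h..x+h}. norm (f t) \<partial>lebesgue) / (2*h)"

lemma window_eq:
  assumes "loc_integrable f"
  shows "window h f x = integral {x-h..x+h} (\<lambda>t. norm (f t)) / (2*h)"
proof -
  have i: "integrable lebesgue (\<lambda>t. indicator {x-h..x+h} t *\<^sub>R norm (f t))"
    using loc_integrableD(1)[OF loc_integrable_norm[OF assms]] by (simp add: set_integrable_def)
  have "(\<integral>\<^sup>+t\<in>{x-h..x+h}. norm (f t) \<partial>lebesgue) = (\<integral>\<^sup>+t. ennreal (indicator {x-h..x+h} t *\<^sub>R norm (f t)) \<partial>lebesgue)"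
    by (intro nn_integral_cong) (auto simp: indicator_def)
  also have "\<dots> = ennreal (LINT t|lebesgue. indicator {x-h..x+h} t *\<^sub>R norm (f t))"
    by (rule nn_integral_eq_integral[OF i]) auto
  also have "(LINT t|lebesgue. indicator {x-h..x+h} t *\<^sub>R norm (f t)) = integral {x-h..x+h} (\<lambda>t. norm (f t))"
    using loc_integrableD(3)[OF loc_integrable_norm[OF assms], of "x-h" "x+h"] by (simp add: set_lebesgue_integral_def)
  finally show ?thesis
    using integral_nonneg[OF loc_integrableD(2)[OF loc_integrable_norm[OF assms]], of "x-h" "x+h"]
    by (simp add: window_def)
qed

lemma integral_norm_le_window:
  assumes "loc_integrable f" "0 < h" "x - h \<le> a" "b \<le> x + h"
  shows "integral {a..b} (\<lambda>t. norm (f t)) \<le> 2 * h * window h f x"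
proof -
  have "integral {a..b} (\<lambda>t. norm (f t)) \<le> integral {x-h..x+h} (\<lambda>t. norm (f t))"
    by (rule integral_subset_le) (use assms loc_integrableD(2)[OF loc_integrable_norm[OF assms(1)]] in auto)
  then show ?thesis using assms(2) by (simp add: window_eq[OF assms(1)])
qed

lemma norm_integral_le_window:
  assumes "loc_integrable f" "0 < h" "x - h \<le> a" "b \<le> x + h"
  shows "norm (integral {a..b} f) \<le> 2 * h * window h f x"
proof -
  have "norm (integral {a..b} f) \<le> integral {a..b} (\<lambda>t. norm (f t))"
    by (rule integral_norm_bound_integral) (use loc_integrableD(2)[OF loc_integrable_norm[OF assms(1)]] loc_integrableD(2)[OF assms(1)] in auto)
  then show ?thesis using integral_norm_le_window[OF assms] by simp
qed

lemma norm_steklov_le: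
  assumes "loc_integrable f" "0 < h"
  shows "norm (steklov h f x) \<le> 2 * window h f x"
  using norm_integral_le_window[OF assms, of x x "x + h"] assms
  by (simp add: steklov_eq field_simps)

text \<open>
  A mean over \<open>{x..x + h}\<close> stays within \<open>K\<close> of \<open>c\<close> if all the values do.
\<close>

lemma norm_mean_diff_le:
  fixes F :: "real \<Rightarrow> 'a::euclidean_space"
  assumes F: "loc_integrable F" and h: "0 < h" and le: "\<And>t. x \<le> t \<Longrightarrow> t \<le> x + h \<Longrightarrow> norm (F t - c) \<le> K"
  shows "norm (steklov h F x - c) \<le> K"
proof -
  have "steklov h (\<lambda>t. F t - c) x = steklov h F x - c"
    using steklov_diff[OF F loc_integrable_continuous[of "\<lambda>_. c"]] by (simp add: steklov_const[OF h])
  moreover have "norm (steklov h (\<lambda>t. F t - c) x) \<le> (1 / h) * (K * h)"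
  proof -
    have li: "loc_integrable (\<lambda>t. F t - c)" by (intro loc_integrable_diff F loc_integrable_continuous) auto
    have "norm (F x - c) \<le> K" using le[of x] h by simp
    then have "0 \<le> K" using norm_ge_zero order_trans by blast
    have "norm (integral {x..x + h} (\<lambda>t. F t - c)) \<le> integral {x..x + h} (\<lambda>_. K)"
      by (rule integral_norm_bound_integral) (use le loc_integrableD(2)[OF li] in auto)
    then have "norm (integral {x..x + h} (\<lambda>t. F t - c)) \<le> K * h" using h by (simp add: mult.commute)
    then show ?thesis using h by (simp add: steklov_eq[OF li] divide_right_mono pos_divide_le_eq)
  qed
  ultimately show ?thesis using h by simp
qed

lemma norm_Delta1_le:
  assumes "primitive_of F f" "0 < h"
  shows "norm (Delta1 h F x) \<le> 2 * h * window h f x"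
  unfolding Delta1_def
proof (rule norm_mean_diff_le[OF primitive_of_loc_integrable[OF assms(1)] assms(2)])
  fix t assume t: "x \<le> t" "t \<le> x + h"
  have f: "loc_integrable f" using assms by (simp add: primitive_of_def)
  have "F t - F x = integral {x..t} f" using assms t by (simp add: primitive_of_def)
  then show "norm (F t - F x) \<le> 2 * h * window h f x"
    using norm_integral_le_window[OF f assms(2), of x x t] t assms(2) by simp
qed

text \<open>
  Isolates the property of \<open>p\<close> and \<open>w\<close> on which all the following estimates rest.
\<close>

locale averaging = weighted_lebesgue +
  fixes C :: real
  assumes C_ge_1: "1 \<le> C"
    and averages: "\<And>(f::real\<Rightarrow>real) h. \<lbrakk>f \<in> borel_measurable lebesgue; \<And>x. 0 \<le> f x; periodic_2pi f; wnorm p w f < top; 0 < h\<rbrakk>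
      \<Longrightarrow> wnorm p w (\<lambda>x. enn2real (\<integral>\<^sup>+t\<in>{x-h..x+h}. f t \<partial>lebesgue) / (2*h)) \<le> ennreal C * wnorm p w f"
    and integrable_period: "\<And>f::real\<Rightarrow>real. \<lbrakk>f \<in> borel_measurable lebesgue; \<And>x. 0 \<le> f x; wnorm p w f < top\<rbrakk>
      \<Longrightarrow> (\<integral>\<^sup>+x\<in>circ. f x \<partial>lebesgue) < top"
begin

lemma wL_loc_integrable:
  fixes f :: "real \<Rightarrow> 'a::euclidean_space"
  assumes "f \<in> wL p w" shows "loc_integrable f"
  unfolding loc_integrable_def
proof (intro allI)
  fix a b :: real
  have f: "periodic_2pi f" "f \<in> borel_measurable lebesgue" "wnorm p w f < top" using assms by (auto simp: wL_def)
  have m: "(\<lambda>x. norm (f x)) \<in> borel_measurable lebesgue" using f by measurable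
  have me: "(\<lambda>x. ennreal (norm (f x))) \<in> borel_measurable lebesgue" using m by measurable
  have pe: "periodic_2pi (\<lambda>x. ennreal (norm (f x)))" using f by (simp add: periodic_2pi_def)
  have fin: "(\<integral>\<^sup>+x\<in>circ. norm (f x) \<partial>lebesgue) < top"
    by (rule integrable_period[OF m]) (use f in auto)
  define n where "n = nat \<lceil>(b - a) / (2 * pi)\<rceil>"
  have "(b - a) / (2 * pi) \<le> real n" unfolding n_def by linarith
  then have n: "b \<le> a + 2 * pi * real n" by (simp add: field_simps)
  have "(\<integral>\<^sup>+x\<in>{a..b}. norm (f x) \<partial>lebesgue) = (\<integral>\<^sup>+x\<in>{a..<b}. norm (f x) \<partial>lebesgue)" by (rule nn_integral_Icc_Ico)
  also have "\<dots> \<le> (\<integral>\<^sup>+x\<in>{a..<a + 2 * pi * real n}. norm (f x) \<partial>lebesgue)"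
    using n by (intro nn_integral_mono) (auto simp: indicator_def)
  also have "\<dots> = of_nat n * (\<integral>\<^sup>+x\<in>circ. norm (f x) \<partial>lebesgue)" by (rule nn_integral_periods[OF me pe])
  also have "\<dots> < top" using fin by (simp add: ennreal_mult_less_top of_nat_less_top)
  finally have "(\<integral>\<^sup>+x. ennreal (norm (indicator {a..b} x *\<^sub>R f x)) \<partial>lebesgue) < top"
    by (rule le_less_trans[rotated]) (auto intro!: nn_integral_mono simp: indicator_def)
  then show "f absolutely_integrable_on {a..b}"
    unfolding set_integrable_def integrable_iff_bounded using f(2)
    by (auto intro!: borel_measurable_scaleR borel_measurable_indicator)
qed

lemma wnorm_window:
  fixes f :: "real \<Rightarrow> 'a::euclidean_space"
  assumes "f \<in> wL p w" "0 < h"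
  shows "wnorm p w (window h f) \<le> ennreal C * wnorm p w f"
proof -
  have f: "periodic_2pi f" "f \<in> borel_measurable lebesgue" "wnorm p w f < top" using assms by (auto simp: wL_def)
  have "wnorm p w (window h f) \<le> ennreal C * wnorm p w (\<lambda>x. norm (f x))"
    unfolding window_def[abs_def] by (rule averages) (use f assms in \<open>auto simp: periodic_2pi_def\<close>)
  then show ?thesis by simp
qed

lemma wnorm_le_window:
  fixes f :: "real \<Rightarrow> 'a::euclidean_space" and g :: "real \<Rightarrow> 'b::real_normed_vector"
  assumes "f \<in> wL p w" "0 < h" "0 \<le> K" "\<And>x. norm (g x) \<le> K * window h f x"
  shows "wnorm p w g \<le> ennreal (K * C) * wnorm p w f"
proof -
  have "wnorm p w g \<le> wnorm p w (\<lambda>x. K *\<^sub>R window h f x)"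
    by (rule wnorm_mono) (use assms in \<open>auto intro: order_trans[OF _ abs_ge_self]\<close>)
  also have "\<dots> = ennreal K * wnorm p w (window h f)" using assms(3) by (simp only: wnorm_scale abs_of_nonneg)
  also have "\<dots> \<le> ennreal K * (ennreal C * wnorm p w f)"
    by (intro mult_left_mono wnorm_window assms) auto
  also have "\<dots> = ennreal (K * C) * wnorm p w f" using assms(3) C_ge_1 by (simp add: ennreal_mult mult.assoc)
  finally show ?thesis .
qed

lemma wL_measurable: "f \<in> wL p w \<Longrightarrow> f \<in> borel_measurable lebesgue"
  by (simp add: wL_def)

lemma window_measurable:
  fixes f :: "real \<Rightarrow> 'a::euclidean_space"
  assumes "f \<in> wL p w" shows "window k f \<in> borel_measurable lebesgue"
proof -
  have "(\<lambda>x. ennreal (norm (f x))) \<in> borel_measurable lebesgue" using wL_measurable[OF assms] by measurable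
  from window_integral_measurable[OF this] show ?thesis unfolding window_def[abs_def] by measurable
qed

text \<open>
  The radii may be different and arbitrarily many; only the sum of the coefficients matters.
\<close>

lemma wnorm_le_sum_windows:
  fixes f :: "real \<Rightarrow> 'a::euclidean_space" and g :: "real \<Rightarrow> 'b::real_normed_vector"
  assumes f: "f \<in> wL p w" and I: "finite I" and a: "\<And>i. i \<in> I \<Longrightarrow> 0 \<le> a i" and \<rho>: "\<And>i. i \<in> I \<Longrightarrow> 0 < \<rho> i"
    and le: "\<And>x. norm (g x) \<le> (\<Sum>i\<in>I. a i * window (\<rho> i) f x)"
  shows "wnorm p w g \<le> ennreal ((\<Sum>i\<in>I. a i) * C) * wnorm p w f"
proof -
  note m = window_measurable[OF f]
  have "wnorm p w g \<le> wnorm p w (\<lambda>x. \<Sum>i\<in>I. a i *\<^sub>R window (\<rho> i) f x)"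
  proof (rule wnorm_mono)
    show "norm (g x) \<le> norm (\<Sum>i\<in>I. a i *\<^sub>R window (\<rho> i) f x)" for x
      using le[of x] unfolding real_norm_def real_scaleR_def by (rule order_trans[OF _ abs_ge_self])
  qed
  also have "\<dots> \<le> (\<Sum>i\<in>I. wnorm p w (\<lambda>x. a i *\<^sub>R window (\<rho> i) f x))"
    by (rule wnorm_sum[OF I]) (intro borel_measurable_scaleR borel_measurable_const m)
  also have "\<dots> \<le> (\<Sum>i\<in>I. ennreal (a i * C) * wnorm p w f)"
  proof (rule sum_mono)
    fix i assume i: "i \<in> I"
    have "wnorm p w (\<lambda>x. a i *\<^sub>R window (\<rho> i) f x) = ennreal (a i) * wnorm p w (window (\<rho> i) f)"
      using a[OF i] by (simp only: wnorm_scale abs_of_nonneg)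
    also have "\<dots> \<le> ennreal (a i) * (ennreal C * wnorm p w f)"
      by (intro mult_left_mono wnorm_window f \<rho> i) simp
    also have "\<dots> = ennreal (a i * C) * wnorm p w f" using a[OF i] C_ge_1 by (simp add: ennreal_mult mult.assoc)
    finally show "wnorm p w (\<lambda>x. a i *\<^sub>R window (\<rho> i) f x) \<le> ennreal (a i * C) * wnorm p w f" .
  qed
  also have "\<dots> = ennreal ((\<Sum>i\<in>I. a i) * C) * wnorm p w f"
  proof -
    have "(\<Sum>i\<in>I. ennreal (a i * C)) = ennreal (\<Sum>i\<in>I. a i * C)" using a C_ge_1 by (intro sum_ennreal) auto
    then show ?thesis by (simp only: sum_distrib_right[symmetric])
  qed
  finally show ?thesis .
qed

lemma wL_dominated:
  fixes f :: "real \<Rightarrow> 'a::euclidean_space" and g :: "real \<Rightarrow> 'b::real_normed_vector"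
  assumes "f \<in> wL p w" "periodic_2pi g" "g \<in> borel_measurable lebesgue" "wnorm p w g \<le> ennreal K * wnorm p w f"
  shows "g \<in> wL p w"
proof -
  have "wnorm p w f < top" using assms(1) by (simp add: wL_def)
  then have "ennreal K * wnorm p w f < top" by (simp add: ennreal_mult_less_top)
  then show ?thesis using assms by (auto simp: wL_def intro: le_less_trans)
qed

lemma wnorm_steklov:
  fixes f :: "real \<Rightarrow> 'a::euclidean_space"
  assumes "f \<in> wL p w" "0 < h"
  shows "wnorm p w (steklov h f) \<le> ennreal (2 * C) * wnorm p w f"
  by (rule wnorm_le_window[OF assms]) (use norm_steklov_le[OF wL_loc_integrable[OF assms(1)] assms(2)] in auto)

lemma steklov_wL:
  fixes f :: "real \<Rightarrow> 'a::euclidean_space"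
  assumes "f \<in> wL p w" "0 < h" shows "steklov h f \<in> wL p w"
proof (rule wL_dominated[OF assms(1) _ _ wnorm_steklov[OF assms]])
  show "periodic_2pi (steklov h f)" using assms by (intro periodic_steklov wL_loc_integrable) (auto simp: wL_def)
  show "steklov h f \<in> borel_measurable lebesgue"
    by (intro loc_integrable_measurable loc_integrable_steklov wL_loc_integrable assms)
qed

lemma wL_add: "f \<in> wL p w \<Longrightarrow> g \<in> wL p w \<Longrightarrow> (\<lambda>x. f x + g x :: 'a::euclidean_space) \<in> wL p w"
  using wnorm_triangle[of f g] by (auto simp: wL_def periodic_2pi_def intro: le_less_trans)

lemma wL_diff: "f \<in> wL p w \<Longrightarrow> g \<in> wL p w \<Longrightarrow> (\<lambda>x. f x - g x :: 'a::euclidean_space) \<in> wL p w"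
  using wnorm_triangle_diff[of f g] by (auto simp: wL_def periodic_2pi_def intro: le_less_trans)

lemma wL_scaleR: "f \<in> wL p w \<Longrightarrow> (\<lambda>x. c *\<^sub>R f x :: 'a::euclidean_space) \<in> wL p w"
  by (auto simp: wL_def periodic_2pi_def wnorm_scale ennreal_mult_less_top)

lemma Delta1_wL:
  fixes f :: "real \<Rightarrow> 'a::euclidean_space"
  shows "f \<in> wL p w \<Longrightarrow> 0 < h \<Longrightarrow> Delta1 h f \<in> wL p w"
  unfolding Delta1_def by (intro wL_diff steklov_wL)

lemma Delta_wL:
  fixes f :: "real \<Rightarrow> 'a::euclidean_space"
  shows "f \<in> wL p w \<Longrightarrow> 0 < h \<Longrightarrow> Delta r h f \<in> wL p w"
  by (induction r) (auto simp: Delta_0 Delta_Suc(1) Delta1_wL)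

lemma wnorm_Delta1:
  fixes f :: "real \<Rightarrow> 'a::euclidean_space"
  assumes "f \<in> wL p w" "0 < h"
  shows "wnorm p w (Delta1 h f) \<le> ennreal (2 * C + 1) * wnorm p w f"
proof -
  have "wnorm p w (Delta1 h f) \<le> wnorm p w (steklov h f) + wnorm p w f"
    unfolding Delta1_def by (intro wnorm_triangle_diff wL_measurable steklov_wL assms)
  also have "\<dots> \<le> ennreal (2 * C) * wnorm p w f + wnorm p w f" by (intro add_right_mono wnorm_steklov assms)
  also have "\<dots> = ennreal (2 * C + 1) * wnorm p w f" using C_ge_1 by (simp add: ennreal_plus distrib_right)
  finally show ?thesis .
qed

lemma wnorm_Delta:
  fixes f :: "real \<Rightarrow> 'a::euclidean_space"
  assumes "f \<in> wL p w" "0 < h"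
  shows "wnorm p w (Delta r h f) \<le> ennreal ((2 * C + 1) ^ r) * wnorm p w f"
proof (induction r)
  case (Suc r)
  have "wnorm p w (Delta (Suc r) h f) \<le> ennreal (2 * C + 1) * wnorm p w (Delta r h f)"
    unfolding Delta_Suc(1) by (intro wnorm_Delta1 Delta_wL assms)
  also have "\<dots> \<le> ennreal (2 * C + 1) * (ennreal ((2 * C + 1) ^ r) * wnorm p w f)"
    by (intro mult_left_mono Suc) auto
  also have "\<dots> = ennreal ((2 * C + 1) ^ Suc r) * wnorm p w f"
    using C_ge_1 by (simp add: ennreal_mult mult.assoc)
  finally show ?case .
qed (simp add: Delta_0)

lemma wnorm_Delta1_primitive:
  fixes f F :: "real \<Rightarrow> 'a::euclidean_space"
  assumes "primitive_of F f" "f \<in> wL p w" "0 < h"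
  shows "wnorm p w (Delta1 h F) \<le> ennreal (2 * C * h) * wnorm p w f"
  using wnorm_le_window[OF assms(2,3), of "2 * h" "Delta1 h F"] norm_Delta1_le[OF assms(1,3)] assms(3) by (simp add: mult_ac)

lemma Delta1_primitive_wL:
  fixes f F :: "real \<Rightarrow> 'a::euclidean_space"
  assumes "primitive_of F f" "f \<in> wL p w" "periodic_2pi F" "0 < h"
  shows "Delta1 h F \<in> wL p w"
proof (rule wL_dominated[OF assms(2) _ _ wnorm_Delta1_primitive[OF assms(1,2,4)]])
  have li: "loc_integrable F" by (rule primitive_of_loc_integrable[OF assms(1)])
  show "periodic_2pi (Delta1 h F)" by (rule periodic_Delta1[OF assms(3) li])
  show "Delta1 h F \<in> borel_measurable lebesgue" by (rule loc_integrable_measurable[OF loc_integrable_Delta1[OF li assms(4)]])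
qed

text \<open>
  Each difference is traded for one derivative and a factor \<open>2 C h\<close>. The induction takes the first
  difference of the whole chain \<open>F\<close>, which is again a chain of primitives.
\<close>

lemma wnorm_Delta_chain:
  fixes F :: "nat \<Rightarrow> real \<Rightarrow> 'a::euclidean_space"
  assumes "\<And>k. k < r \<Longrightarrow> primitive_of (F k) (F (Suc k))" "\<And>k. k < r \<Longrightarrow> periodic_2pi (F k)" "F r \<in> wL p w" "0 < h"
  shows "wnorm p w (Delta r h (F 0)) \<le> ennreal ((2 * C * h) ^ r) * wnorm p w (F r)"
  using assms(1,2,3)
proof (induction r arbitrary: F)
  case (Suc r)
  have pr: "primitive_of (F r) (F (Suc r))" using Suc.prems(1) by simp
  have "wnorm p w (Delta (Suc r) h (F 0)) = wnorm p w (Delta r h (Delta1 h (F 0)))" by (simp add: Delta_Suc(2))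
  also have "\<dots> \<le> ennreal ((2 * C * h) ^ r) * wnorm p w (Delta1 h (F r))"
  proof (rule Suc.IH[of "\<lambda>k. Delta1 h (F k)"])
    show "primitive_of (Delta1 h (F k)) (Delta1 h (F (Suc k)))" if "k < r" for k
      using Suc.prems(1) that assms(4) by (intro primitive_of_Delta1) auto
    show "periodic_2pi (Delta1 h (F k))" if "k < r" for k
      using Suc.prems(1)[of k] Suc.prems(2)[of k] that by (intro periodic_Delta1 primitive_of_loc_integrable) auto
    show "Delta1 h (F r) \<in> wL p w" by (rule Delta1_primitive_wL[OF pr Suc.prems(3) _ assms(4)]) (use Suc.prems(2) in simp)
  qed
  also have "\<dots> \<le> ennreal ((2 * C * h) ^ r) * (ennreal (2 * C * h) * wnorm p w (F (Suc r)))"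
    by (intro mult_left_mono wnorm_Delta1_primitive[OF pr Suc.prems(3) assms(4)]) auto
  also have "\<dots> = ennreal ((2 * C * h) ^ Suc r) * wnorm p w (F (Suc r))"
  proof -
    have "ennreal ((2 * C * h) ^ r) * ennreal (2 * C * h) = ennreal ((2 * C * h) ^ Suc r)"
      using C_ge_1 assms(4) by (subst ennreal_mult[symmetric]) (auto simp: power_Suc2 simp del: power_Suc)
    then show ?thesis by (simp only: mult.assoc[symmetric])
  qed
  finally show ?case .
qed (simp add: Delta_0)

end

section \<open>Sobolev classes and chains of primitives\<close>

lemma abs_cont_on_subinterval:
  assumes "abs_cont_on a b F" "a \<le> a'" "b' \<le> b"
  shows "abs_cont_on a' b' F"
  unfolding abs_cont_on_def
proof (intro allI impI)
  fix \<epsilon> :: real assume "0 < \<epsilon>"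
  from assms(1)[unfolded abs_cont_on_def, rule_format, OF this]
  obtain \<delta> where "\<delta> > 0" and \<delta>: "\<forall>(n::nat) s t.
     (\<forall>i<n. a \<le> s i \<and> s i \<le> t i \<and> t i \<le> b) \<and>
     (\<forall>i<n. \<forall>j<n. i \<noteq> j \<longrightarrow> {s i<..<t i} \<inter> {s j<..<t j} = {}) \<and>
     (\<Sum>i<n. t i - s i) < \<delta> \<longrightarrow> (\<Sum>i<n. norm (F (t i) - F (s i))) < \<epsilon>"
    by (elim exE conjE) (rule that)
  show "\<exists>\<delta>>0. \<forall>(n::nat) s t.
     (\<forall>i<n. a' \<le> s i \<and> s i \<le> t i \<and> t i \<le> b') \<and>
     (\<forall>i<n. \<forall>j<n. i \<noteq> j \<longrightarrow> {s i<..<t i} \<inter> {s j<..<t j} = {}) \<and>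
     (\<Sum>i<n. t i - s i) < \<delta> \<longrightarrow> (\<Sum>i<n. norm (F (t i) - F (s i))) < \<epsilon>"
  proof (intro exI[of _ \<delta>] conjI \<open>\<delta> > 0\<close> allI impI)
    fix n :: nat and s t
    assume A: "(\<forall>i<n. a' \<le> s i \<and> s i \<le> t i \<and> t i \<le> b') \<and>
     (\<forall>i<n. \<forall>j<n. i \<noteq> j \<longrightarrow> {s i<..<t i} \<inter> {s j<..<t j} = {}) \<and> (\<Sum>i<n. t i - s i) < \<delta>"
    then have "\<forall>i<n. a \<le> s i \<and> s i \<le> t i \<and> t i \<le> b" using assms(2,3) by force
    with A show "(\<Sum>i<n. norm (F (t i) - F (s i))) < \<epsilon>" by (intro \<delta>[rule_format]) blast
  qed
qed

lemma periodic_vector_derivative: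
  assumes "periodic_2pi f" shows "periodic_2pi (\<lambda>x. vector_derivative f (at x))"
  unfolding periodic_2pi_def
proof
  fix x
  have f: "f (t + 2 * pi) = f t" for t using assms by (simp add: periodic_2pi_def)
  have d1: "((\<lambda>t. t + 2 * pi) has_vector_derivative 1) (at x)"
    and d2: "((\<lambda>t. t - 2 * pi) has_vector_derivative 1) (at (x + 2 * pi))"
    unfolding has_real_derivative_iff_has_vector_derivative[symmetric] by (auto intro!: derivative_eq_intros)
  have "(f has_vector_derivative D) (at (x + 2 * pi)) \<longleftrightarrow> (f has_vector_derivative D) (at x)" for D
  proof -
    have "(f has_vector_derivative D) (at (x + 2 * pi)) \<longleftrightarrow> ((\<lambda>t. f (t + 2 * pi)) has_vector_derivative D) (at x)"
    proof
      assume "(f has_vector_derivative D) (at (x + 2 * pi))"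
      then show "((\<lambda>t. f (t + 2 * pi)) has_vector_derivative D) (at x)"
        using vector_diff_chain_at[OF d1, of f D] by (simp add: o_def)
    next
      assume "((\<lambda>t. f (t + 2 * pi)) has_vector_derivative D) (at x)"
      then have "((\<lambda>t. f (t + 2 * pi)) has_vector_derivative D) (at ((x + 2 * pi) - 2 * pi))" by simp
      then show "(f has_vector_derivative D) (at (x + 2 * pi))"
        using vector_diff_chain_at[OF d2, of "\<lambda>t. f (t + 2 * pi)" D] by (simp add: o_def)
    qed
    then show ?thesis by (simp add: f)
  qed
  then show "vector_derivative f (at (x + 2 * pi)) = vector_derivative f (at x)"
    by (simp add: vector_derivative_def)
qed

lemma vderiv_Suc: "vderiv (Suc k) f = (\<lambda>x. vector_derivative (vderiv k f) (at x))" "vderiv 0 f = f"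
  by (simp_all add: vderiv_def)

lemma periodic_vderiv: "periodic_2pi f \<Longrightarrow> periodic_2pi (vderiv k f)"
  by (induction k) (auto simp: vderiv_Suc periodic_vector_derivative)

lemma periodic_shift_int:
  assumes "periodic_2pi f" shows "f (x + 2 * pi * of_int k) = f x"
proof -
  have nat: "f (x + 2 * pi * real n) = f x" for x n
  proof (induction n)
    case (Suc n)
    have "f (x + 2 * pi * real (Suc n)) = f ((x + 2 * pi * real n) + 2 * pi)" by (simp add: algebra_simps)
    then show ?case using assms Suc by (simp add: periodic_2pi_def)
  qed simp
  show ?thesis
  proof (cases "0 \<le> k")
    case True then show ?thesis using nat[of x "nat k"] by simp
  next
    case False
    then show ?thesis using nat[of "x + 2 * pi * of_int k" "nat (- k)"] by (simp add: algebra_simps)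
  qed
qed

text \<open>
  A primitive on one period determines the integral over a full period, which is 0 by periodicity of
  \<open>F\<close>; hence the primitive \<open>P\<close> of \<open>f\<close> is periodic too, and \<open>F - P\<close> is a periodic function that is
  constant on a period.
\<close>

lemma periodic_primitive:
  fixes F f :: "real \<Rightarrow> 'a::euclidean_space"
  assumes F: "periodic_2pi F" and f: "periodic_2pi f" "loc_integrable f"
    and local: "\<And>x y. -pi \<le> x \<Longrightarrow> x \<le> y \<Longrightarrow> y \<le> pi \<Longrightarrow> F y - F x = integral {x..y} f"
  shows "primitive_of F f"
proof -
  define P where "P = primitive f"
  have P: "primitive_of P f" unfolding P_def by (rule primitive_of_primitive[OF f(2)])
  define G where "G x = F x - P x" for x
  have Gc: "G x = G (-pi)" if "-pi \<le> x" "x \<le> pi" for x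
    using local[of "-pi" x] P that unfolding primitive_of_def G_def by (simp add: algebra_simps)
  have per: "integral {x..x + 2 * pi} f = 0" if "-pi \<le> x" "x \<le> pi" for x
  proof -
    have "integral {x..x + 2 * pi} f = integral {x..pi} f + integral {pi..x + 2 * pi} f"
      by (rule Henstock_Kurzweil_Integration.integral_combine[symmetric]) (use that loc_integrableD(2)[OF f(2)] in auto)
    also have "integral {pi..x + 2 * pi} f = integral {-pi..x} f"
    proof -
      have "integral {pi..x + 2 * pi} f = integral {-pi..x} (\<lambda>t. f (t + 2 * pi))"
        using integral_shift_real_ivl[of pi "2 * pi" "x + 2 * pi" f] by simp
      then show ?thesis using f(1) by (simp add: periodic_2pi_def)
    qed
    also have "integral {x..pi} f + integral {-pi..x} f = (F pi - F x) + (F x - F (-pi))"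
      using local[of x pi] local[of "-pi" x] that by simp
    also have "\<dots> = 0" using F[unfolded periodic_2pi_def, rule_format, of "-pi"] by simp
    finally show ?thesis .
  qed
  have perP: "P (x + 2 * pi) = P x" for x
  proof -
    define k where "k = \<lfloor>(x + pi) / (2 * pi)\<rfloor>"
    define z where "z = x - 2 * pi * of_int k"
    have "of_int k \<le> (x + pi) / (2 * pi)" "(x + pi) / (2 * pi) < of_int k + 1" unfolding k_def by linarith+
    then have z: "-pi \<le> z" "z \<le> pi" unfolding z_def by (simp_all add: field_simps)
    have "P (x + 2 * pi) - P x = integral {x..x + 2 * pi} f" using P by (simp add: primitive_of_def)
    also have "\<dots> = integral {z..z + 2 * pi} (\<lambda>t. f (t + 2 * pi * of_int k))"
      using integral_shift_real_ivl[of x "2 * pi * of_int k" "x + 2 * pi" f] by (simp add: z_def algebra_simps)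
    also have "\<dots> = 0" using per[OF z] periodic_shift_int[OF f(1), of _ k] by simp
    finally show ?thesis by simp
  qed
  have "periodic_2pi G" using F perP by (simp add: periodic_2pi_def G_def)
  have Gall: "G x = G (-pi)" for x
  proof -
    define k where "k = \<lfloor>(x + pi) / (2 * pi)\<rfloor>"
    define z where "z = x - 2 * pi * of_int k"
    have "of_int k \<le> (x + pi) / (2 * pi)" "(x + pi) / (2 * pi) < of_int k + 1" unfolding k_def by linarith+
    then have z: "-pi \<le> z" "z \<le> pi" unfolding z_def by (simp_all add: field_simps)
    have "G x = G z" using periodic_shift_int[OF \<open>periodic_2pi G\<close>, of z k] by (simp add: z_def)
    then show ?thesis using Gc[OF z] by simp
  qed
  have "F y - F x = P y - P x" for x y
  proof -
    have "G x = G y" using Gall[of x] Gall[of y] by simp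
    then show ?thesis by (simp add: G_def algebra_simps)
  qed
  then show ?thesis using P by (simp add: primitive_of_def)
qed

context averaging
begin

text \<open>
  The link between the Sobolev classes and \<open>wnorm_Delta_chain\<close>. The derivative of order \<open>r - 1\<close> is a primitive of the
  next one by absolute continuity; the lower ones are differentiable everywhere with a
  continuous derivative.
\<close>

lemma wW_primitives:
  fixes f :: "real \<Rightarrow> 'a::euclidean_space"
  assumes f: "f \<in> wW r p w" and "k < r"
  shows "primitive_of (vderiv k f) (vderiv (Suc k) f)" "periodic_2pi (vderiv k f)"
proof -
  have fp: "periodic_2pi f" using f by (simp add: wW_def wL_def)
  then show per: "periodic_2pi (vderiv k f)" by (rule periodic_vderiv)
  have cont: "continuous_on {a..b} (vderiv j f)" if "j < r - 1" for j a b
    using f that by (intro differentiable_imp_continuous_on) (auto simp: wW_def differentiable_on_def differentiable_at_withinI)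
  show "primitive_of (vderiv k f) (vderiv (Suc k) f)"
  proof (cases "Suc k = r")
    case True
    then have ac: "abs_cont_on (-pi) pi (vderiv k f)" using f by (auto simp: wW_def)
    have wl: "vderiv (Suc k) f \<in> wL p w" using f True by (simp add: wW_def)
    show ?thesis
    proof (rule periodic_primitive[OF per periodic_vderiv[OF fp] wL_loc_integrable[OF wl]])
      fix x y :: real assume xy: "-pi \<le> x" "x \<le> y" "y \<le> pi"
      have "abs_cont_on x y (vderiv k f)" using abs_cont_on_subinterval[OF ac] xy by simp
      from abs_cont_has_integral_vector_derivative[OF this xy(2)]
      show "vderiv k f y - vderiv k f x = integral {x..y} (vderiv (Suc k) f)"
        by (simp add: vderiv_Suc integral_unique)
    qed
  next
    case False
    then have k: "k < r - 1" using \<open>k < r\<close> by simp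
    have contS: "continuous_on {a..b} (vderiv (Suc k) f)" for a b
    proof (cases "Suc k = r - 1")
      case True
      then have ac: "abs_cont_on (-pi) pi (vderiv (Suc k) f)" using f by (simp add: wW_def)
      have perS: "periodic_2pi (vderiv (Suc k) f)" by (rule periodic_vderiv[OF fp])
      have "(vderiv (Suc (Suc k)) f) \<in> wL p w" using f True by (simp add: wW_def)
      then have wl: "vderiv (Suc (Suc k)) f \<in> wL p w" .
      have "primitive_of (vderiv (Suc k) f) (vderiv (Suc (Suc k)) f)"
      proof (rule periodic_primitive[OF perS periodic_vderiv[OF fp] wL_loc_integrable[OF wl]])
        fix x y :: real assume xy: "-pi \<le> x" "x \<le> y" "y \<le> pi"
        have "abs_cont_on x y (vderiv (Suc k) f)" using abs_cont_on_subinterval[OF ac] xy by simp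
        from abs_cont_has_integral_vector_derivative[OF this xy(2)]
        show "vderiv (Suc k) f y - vderiv (Suc k) f x = integral {x..y} (vderiv (Suc (Suc k)) f)"
          by (simp add: vderiv_Suc integral_unique)
      qed
      then show ?thesis by (rule primitive_of_continuous)
    next
      case False
      then show ?thesis using k by (intro cont) simp
    qed
    show ?thesis
      unfolding primitive_of_def
    proof (intro conjI allI impI)
      show "loc_integrable (vderiv (Suc k) f)" by (rule loc_integrable_continuous[OF contS])
      fix x y :: real assume "x \<le> y"
      have "(vderiv k f has_vector_derivative vderiv (Suc k) f t) (at t)" for t
        using f k by (simp add: wW_def vderiv_Suc vector_derivative_works[symmetric])
      then have "(vderiv (Suc k) f has_integral vderiv k f y - vderiv k f x) {x..y}"
        by (intro fundamental_theorem_of_calculus \<open>x \<le> y\<close>) (auto intro: has_vector_derivative_at_within)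
      then show "vderiv k f y - vderiv k f x = integral {x..y} (vderiv (Suc k) f)" by (simp add: integral_unique)
    qed
  qed
qed

end

section \<open>The renewal equation of the uniform distribution\<close>

text \<open>
  The sequence lists the pieces, on the intervals \<open>[n, n + 1]\<close>, of the function \<open>k\<close> on the half line
  determined by \<open>k t = 2 t - 1 + \<integral>\<^sub>0\<^sup>t k\<close> on \<open>[0, 1]\<close> and \<open>k t = \<integral>\<close> of \<open>k\<close> over \<open>[t - 1, t]\<close> afterwards, that is,
  \<open>k - k * 1\<^bsub>[0,1]\<^esub> = (2 t - 1) 1\<^bsub>[0,1]\<^esub>\<close>. The second equation of the definition is the solution of
  the linear differential equation \<open>k' t = k t - k (t - 1)\<close> whose initial value is the integral
  over the preceding piece.
\<close>

primrec renewal :: "nat \<Rightarrow> real \<Rightarrow> real" where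
  "renewal 0 t = exp t - 2"
| "renewal (Suc n) t = exp t * (integral {0..1} (renewal n) - integral {0..t} (\<lambda>s. exp (-s) * renewal n s))"

lemma renewal_continuous: "continuous_on {0..1} (renewal n)"
proof (induction n)
  case 0
  have "renewal 0 = (\<lambda>t. exp t - 2)" by (simp add: fun_eq_iff)
  then show ?case by (auto intro!: continuous_intros)
next
  case (Suc n)
  have e: "renewal (Suc n) = (\<lambda>t. exp t * (integral {0..1} (renewal n) - integral {0..t} (\<lambda>s. exp (-s) * renewal n s)))"
    by (simp add: fun_eq_iff)
  show ?case unfolding e
    by (intro continuous_intros indefinite_integral_continuous_1 integrable_continuous_real Suc)
qed

lemma renewal_integrable: "0 \<le> a \<Longrightarrow> b \<le> 1 \<Longrightarrow> renewal n integrable_on {a..b}"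
  by (rule integrable_continuous_real, rule continuous_on_subset[OF renewal_continuous]) auto

lemma renewal_derivative:
  assumes "t \<in> {0..1}"
  shows "(renewal (Suc n) has_vector_derivative (renewal (Suc n) t - renewal n t)) (at t within {0..1})"
proof -
  have e: "renewal (Suc n) = (\<lambda>t. exp t * (integral {0..1} (renewal n) - integral {0..t} (\<lambda>s. exp (-s) * renewal n s)))"
    by (simp add: fun_eq_iff)
  have "((\<lambda>u. integral {0..u} (\<lambda>s. exp (-s) * renewal n s)) has_vector_derivative exp (-t) * renewal n t) (at t within {0..1})"
    by (rule integral_has_vector_derivative[OF _ assms]) (intro continuous_intros renewal_continuous)
  then have I: "((\<lambda>u. integral {0..u} (\<lambda>s. exp (-s) * renewal n s)) has_real_derivative exp (-t) * renewal n t) (at t within {0..1})"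
    by (simp only: has_real_derivative_iff_has_vector_derivative)
  have "(renewal (Suc n) has_real_derivative
      exp t * (0 - exp (-t) * renewal n t) + exp t * (integral {0..1} (renewal n) - integral {0..t} (\<lambda>s. exp (-s) * renewal n s))) (at t within {0..1})"
    unfolding e by (rule DERIV_mult'[OF has_field_derivative_at_within[OF DERIV_exp] DERIV_diff[OF DERIV_const I]])
  moreover have "exp t * (0 - exp (-t) * renewal n t) + exp t * (integral {0..1} (renewal n) - integral {0..t} (\<lambda>s. exp (-s) * renewal n s))
    = renewal (Suc n) t - renewal n t"
    by (simp add: exp_minus)
  ultimately show ?thesis by (simp only: has_real_derivative_iff_has_vector_derivative)
qed

lemma renewal_increment:
  assumes "0 \<le> s" "s \<le> t" "t \<le> 1"
  shows "renewal (Suc n) t - renewal (Suc n) s = integral {s..t} (renewal (Suc n)) - integral {s..t} (renewal n)"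
proof -
  have "((\<lambda>u. renewal (Suc n) u - renewal n u) has_integral renewal (Suc n) t - renewal (Suc n) s) {s..t}"
    by (rule fundamental_theorem_of_calculus[OF assms(2)])
      (rule has_vector_derivative_within_subset[OF renewal_derivative], use assms in auto)
  then show ?thesis
    using assms Henstock_Kurzweil_Integration.integral_diff[OF renewal_integrable renewal_integrable, of s t "Suc n" n]
    by (simp add: integral_unique)
qed

lemma renewal_at_0: "renewal (Suc n) 0 = integral {0..1} (renewal n)" by simp

declare renewal.simps(2) [simp del]

lemma renewal_recurrence:
  assumes "t \<in> {0..1}"
  shows "renewal (Suc n) t - integral {0..t} (renewal (Suc n)) = integral {t..1} (renewal n)"
proof -
  have "integral {0..t} (renewal n) + integral {t..1} (renewal n) = integral {0..1} (renewal n)"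
    by (rule Henstock_Kurzweil_Integration.integral_combine) (use assms renewal_integrable in auto)
  then show ?thesis using renewal_increment[of 0 t n] assms unfolding renewal_at_0 by simp
qed

text \<open>
  The conserved quantity of the renewal equation. It vanishes for the first piece, and this is why
  the pieces tend to 0 and not to another constant.
\<close>

lemma renewal_first_moment: "integral {0..1} (\<lambda>t. t * renewal n t) = 0"
proof (induction n)
  case 0
  have "((\<lambda>t. t * renewal 0 t) has_integral ((1 - 1) * exp 1 - 1\<^sup>2) - ((0 - 1) * exp 0 - 0\<^sup>2)) {0..1}"
  proof (rule fundamental_theorem_of_calculus)
    fix t :: real
    have "((\<lambda>t. (t - 1) * exp t - t\<^sup>2) has_real_derivative t * renewal 0 t) (at t within {0..1})"
      by (auto intro!: derivative_eq_intros simp: algebra_simps power2_eq_square)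
    then show "((\<lambda>t. (t - 1) * exp t - t\<^sup>2) has_vector_derivative t * renewal 0 t) (at t within {0..1})"
      by (simp add: has_real_derivative_iff_has_vector_derivative)
  qed simp
  then show ?case by (simp add: integral_unique)
next
  case (Suc n)
  let ?U = "renewal (Suc n)"
  have tint: "(\<lambda>t. t * renewal k t) integrable_on {0..1}" for k
    by (intro integrable_continuous_real continuous_intros renewal_continuous)
  have "((\<lambda>t. ?U t + (t * ?U t - t * renewal n t)) has_integral 1 * ?U 1 - 0 * ?U 0) {0..1}"
  proof (rule fundamental_theorem_of_calculus)
    fix t :: real assume t: "t \<in> {0..1}"
    have "(?U has_real_derivative (?U t - renewal n t)) (at t within {0..1})"
      using renewal_derivative[OF t] by (simp only: has_real_derivative_iff_has_vector_derivative)
    from DERIV_mult'[OF DERIV_ident this]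
    have "((\<lambda>t. t * ?U t) has_real_derivative (?U t + (t * ?U t - t * renewal n t))) (at t within {0..1})"
      by (simp only: algebra_simps mult_1)
    then show "((\<lambda>t. t * ?U t) has_vector_derivative (?U t + (t * ?U t - t * renewal n t))) (at t within {0..1})"
      by (simp only: has_real_derivative_iff_has_vector_derivative)
  qed simp
  then have "integral {0..1} (\<lambda>t. ?U t + (t * ?U t - t * renewal n t)) = ?U 1" by (simp only: integral_unique mult_1 mult_zero_left diff_zero)
  moreover have "integral {0..1} (\<lambda>t. ?U t + (t * ?U t - t * renewal n t))
     = integral {0..1} ?U + (integral {0..1} (\<lambda>t. t * ?U t) - integral {0..1} (\<lambda>t. t * renewal n t))"
    unfolding Henstock_Kurzweil_Integration.integral_diff[OF tint tint, symmetric]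
    by (rule Henstock_Kurzweil_Integration.integral_add) (intro integrable_diff tint renewal_integrable order_refl)+
  moreover have "?U 1 - integral {0..1} ?U = 0" using renewal_recurrence[of 1 n] by (simp only: atLeastAtMost_iff) simp
  ultimately show ?case using Suc by simp
qed

lemma abs_integral_le:
  fixes f :: "real \<Rightarrow> real"
  assumes "f integrable_on {a..b}" "a \<le> b" "\<And>t. t \<in> {a..b} \<Longrightarrow> \<bar>f t\<bar> \<le> M"
  shows "\<bar>integral {a..b} f\<bar> \<le> M * (b - a)"
proof -
  have "norm (integral {a..b} f) \<le> integral {a..b} (\<lambda>_. M)"
    by (rule integral_norm_bound_integral) (use assms in auto)
  then show ?thesis using assms(2) by (simp add: mult.commute)
qed

text \<open>
  Every value of \<open>k\<close> is the mean of the values over the preceding unit interval, so a bound \<open>a\<close> is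
  inherited. As the first moment vanishes, the value at the left end of the new piece is the integral
  of \<open>(1 - t) k t\<close> over the preceding piece and at most \<open>a / 2\<close>. In modulus
  the new piece stays below \<open>3 a / 4\<close> on an interval of length \<open>1 / 8\<close>, and all the following means gain \<open>a / 4 * (1 / 8) = a / 32\<close>.
\<close>

lemma renewal_step_bound:
  assumes a: "\<And>t. t \<in> {0..1} \<Longrightarrow> \<bar>renewal n t\<bar> \<le> a" and t: "t \<in> {0..1}"
  shows "\<bar>renewal (Suc n) t\<bar> \<le> (31/32) * a"
proof -
  let ?U = "renewal (Suc n)"
  have a0: "0 \<le> a" using a[of 0] by simp
  have rec: "?U t = integral {t..1} (renewal n) + integral {0..t} ?U" if "t \<in> {0..1}" for t
    using renewal_recurrence[OF that, of n] by simp
  have tail: "\<bar>integral {t..1} (renewal n)\<bar> \<le> a * (1 - t)" if "t \<in> {0..1}" for t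
    by (rule abs_integral_le) (use that a renewal_integrable in auto)
  have inner: "\<bar>?U t\<bar> \<le> a" if t: "0 \<le> t" "t < 1" for t
  proof -
    have "continuous_on {0..t} (\<lambda>s. \<bar>?U s\<bar>)"
      by (intro continuous_intros continuous_on_subset[OF renewal_continuous]) (use t in auto)
    then obtain s where s: "s \<in> {0..t}" "\<And>u. u \<in> {0..t} \<Longrightarrow> \<bar>?U u\<bar> \<le> \<bar>?U s\<bar>"
      using continuous_attains_sup[of "{0..t}" "\<lambda>s. \<bar>?U s\<bar>"] t by auto
    have s1: "s \<in> {0..1}" "s < 1" using s t by auto
    have "\<bar>integral {0..s} ?U\<bar> \<le> \<bar>?U s\<bar> * (s - 0)"
      by (rule abs_integral_le) (use s s1 renewal_integrable in auto)
    moreover have "\<bar>?U s\<bar> \<le> \<bar>integral {s..1} (renewal n)\<bar> + \<bar>integral {0..s} ?U\<bar>"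
      by (subst rec[OF s1(1)]) (rule abs_triangle_ineq)
    ultimately have "\<bar>?U s\<bar> \<le> a * (1 - s) + \<bar>?U s\<bar> * s" using tail[OF s1(1)] by (simp only: diff_zero)
    then have "(1 - s) * \<bar>?U s\<bar> \<le> (1 - s) * a" by (simp add: algebra_simps)
    then have "\<bar>?U s\<bar> \<le> a" using s1 by (simp only: mult_le_cancel_left_pos diff_gt_0_iff_gt)
    moreover have "\<bar>?U t\<bar> \<le> \<bar>?U s\<bar>" using s(2)[of t] t by simp
    ultimately show ?thesis by simp
  qed
  have closed: "\<bar>?U t\<bar> \<le> a" if t: "t \<in> {0..1}" for t
  proof (cases "t < 1")
    case False
    then have "t = 1" using t by simp
    have "\<bar>?U t\<bar> \<le> a"
    proof -
      have c: "closure {0..<1::real} = {0..1}" by simp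
      have "norm (?U t) \<le> a"
        by (rule continuous_on_closure_norm_le[of "{0..<1}"]) (use inner t c renewal_continuous[of "Suc n"] in auto)
      then show ?thesis by simp
    qed
    then show ?thesis .
  qed (use inner t in auto)
  have at0: "\<bar>?U 0\<bar> \<le> a / 2"
  proof -
    have tint: "(\<lambda>t. t * renewal n t) integrable_on {0..1}"
      by (intro integrable_continuous_real continuous_intros renewal_continuous)
    have "integral {0..1} (renewal n) = integral {0..1} (renewal n) - integral {0..1} (\<lambda>t. t * renewal n t)"
      using renewal_first_moment by simp
    also have "\<dots> = integral {0..1} (\<lambda>t. renewal n t - t * renewal n t)"
      by (rule Henstock_Kurzweil_Integration.integral_diff[symmetric]) (use renewal_integrable tint in auto)
    finally have e: "?U 0 = integral {0..1} (\<lambda>t. renewal n t - t * renewal n t)" unfolding renewal_at_0 .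
    have lin: "((\<lambda>t. a * (1 - t)) has_integral a * (1 - 1\<^sup>2/2) - a * (0 - 0\<^sup>2/2)) {0..1}"
    proof (rule fundamental_theorem_of_calculus)
      fix t :: real
      have "((\<lambda>t. a * (t - t\<^sup>2/2)) has_real_derivative a * (1 - t)) (at t within {0..1})"
        by (auto intro!: derivative_eq_intros simp: algebra_simps)
      then show "((\<lambda>t. a * (t - t\<^sup>2/2)) has_vector_derivative a * (1 - t)) (at t within {0..1})"
        by (simp add: has_real_derivative_iff_has_vector_derivative)
    qed simp
    have "norm (integral {0..1} (\<lambda>t. renewal n t - t * renewal n t)) \<le> integral {0..1} (\<lambda>t. a * (1 - t))"
    proof (rule integral_norm_bound_integral)
      show "(\<lambda>t. renewal n t - t * renewal n t) integrable_on {0..1}" by (intro integrable_diff tint renewal_integrable) auto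
      show "(\<lambda>t. a * (1 - t)) integrable_on {0..1}" using lin by blast
      fix t :: real assume t: "t \<in> {0..1}"
      have "\<bar>(1 - t) * renewal n t\<bar> \<le> (1 - t) * a" unfolding abs_mult using a[OF t] t by (intro mult_mono) auto
      then show "norm (renewal n t - t * renewal n t) \<le> a * (1 - t)" by (simp add: algebra_simps)
    qed
    also have "\<dots> = a / 2" using integral_unique[OF lin] by simp
    finally show ?thesis unfolding e by simp
  qed
  have start: "\<bar>?U s\<bar> \<le> 3/4 * a" if s: "0 \<le> s" "s \<le> 1/8" for s
  proof -
    have "\<bar>integral {0..s} ?U\<bar> \<le> a * (s - 0)" "\<bar>integral {0..s} (renewal n)\<bar> \<le> a * (s - 0)"
      by (rule abs_integral_le; use s a closed renewal_integrable in auto)+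
    then have "\<bar>?U s\<bar> \<le> a / 2 + 2 * (a * s)" using at0 renewal_increment[of 0 s n] s by simp
    also have "a * s \<le> a * (1/8)" using s a0 by (intro mult_left_mono) auto
    finally show ?thesis by simp
  qed
  show ?thesis
  proof (cases "t \<le> 1/8")
    case True
    then show ?thesis using start[of t] t a0 by simp
  next
    case False
    have "integral {0..t} ?U = integral {0..1/8} ?U + integral {1/8..t} ?U"
      by (rule Henstock_Kurzweil_Integration.integral_combine[symmetric]) (use t False renewal_integrable in auto)
    moreover have "\<bar>integral {0..1/8} ?U\<bar> \<le> (3/4 * a) * (1/8 - 0)"
      by (rule abs_integral_le) (use start renewal_integrable in auto)
    moreover have "\<bar>integral {1/8..t} ?U\<bar> \<le> a * (t - 1/8)"
      by (rule abs_integral_le) (use closed False t renewal_integrable in auto)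
    ultimately have "\<bar>integral {0..t} ?U\<bar> \<le> (3/4 * a) * (1/8) + a * (t - 1/8)"
      by (simp only: diff_zero)
    moreover have "\<bar>?U t\<bar> \<le> \<bar>integral {t..1} (renewal n)\<bar> + \<bar>integral {0..t} ?U\<bar>"
      by (subst rec[OF t]) (rule abs_triangle_ineq)
    ultimately have "\<bar>?U t\<bar> \<le> a * (1 - t) + (3/4 * a) * (1/8) + a * (t - 1/8)"
      using tail[OF t] by linarith
    also have "\<dots> = (31/32) * a" by (simp add: algebra_simps)
    finally show ?thesis .
  qed
qed

lemma renewal_bound: "t \<in> {0..1} \<Longrightarrow> \<bar>renewal n t\<bar> \<le> (31/32) ^ n"
proof (induction n arbitrary: t)
  case 0
  have "1 \<le> exp t" using 0 by simp
  moreover have "exp t \<le> 3" by (rule order_trans[OF _ exp_le]) (use 0 in simp)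
  ultimately show ?case by (simp add: abs_le_iff)
next
  case (Suc n)
  show ?case using renewal_step_bound[OF Suc.IH Suc.prems] by simp
qed

section \<open>Expansion of a function in its differences\<close>

lemma loc_integrable_affine:
  fixes f :: "real \<Rightarrow> 'a::euclidean_space"
  assumes f: "loc_integrable f" and h: "0 < h"
  shows "loc_integrable (\<lambda>t. f (x + h * t))"
    "integral {a..b} (\<lambda>t. f (x + h * t)) = (1 / h) *\<^sub>R integral {x + h * a..x + h * b} f"
proof -
  have ind: "indicator {x + h * a..x + h * b} (x + h * t) *\<^sub>R f (x + h * t) = indicator {a..b} t *\<^sub>R f (x + h * t)" for a b t
    using h by (simp add: indicator_def)
  have int: "integrable lebesgue (\<lambda>t. indicator {a..b} t *\<^sub>R f (x + h * t))" for a b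
  proof -
    have "integrable lebesgue (\<lambda>x. indicator {x' + h * a..x' + h * b} x *\<^sub>R f x)" for x'
      using loc_integrableD(1)[OF f] by (simp add: set_integrable_def)
    then have "integrable lebesgue (\<lambda>t. indicator {x + h * a..x + h * b} (x + h * t) *\<^sub>R f (x + h * t))"
      using h by (subst lebesgue_integrable_real_affine_iff) auto
    then show ?thesis by (simp only: ind)
  qed
  show li: "loc_integrable (\<lambda>t. f (x + h * t))"
    using int by (simp add: loc_integrable_def set_integrable_def)
  have "integral {x + h * a..x + h * b} f = (LINT t|lebesgue. indicator {x + h * a..x + h * b} t *\<^sub>R f t)"
    using loc_integrableD(3)[OF f] by (simp add: set_lebesgue_integral_def)
  also have "\<dots> = \<bar>h\<bar> *\<^sub>R (LINT t|lebesgue. indicator {x + h * a..x + h * b} (x + h * t) *\<^sub>R f (x + h * t))"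
    by (rule lebesgue_integral_real_affine) (use h in simp)
  also have "\<dots> = h *\<^sub>R integral {a..b} (\<lambda>t. f (x + h * t))"
    using loc_integrableD(3)[OF li] h by (simp only: ind abs_of_pos set_lebesgue_integral_def)
  finally show "integral {a..b} (\<lambda>t. f (x + h * t)) = (1 / h) *\<^sub>R integral {x + h * a..x + h * b} f"
    using h by simp
qed

text \<open>
  Used for products: the increments of a product are dominated by those of its factors.
\<close>

lemma abs_cont_on_dominated:
  fixes F1 F2 H :: "real \<Rightarrow> real"
  assumes "abs_cont_on a b F1" "abs_cont_on a b F2" "0 < M"
    and dom: "\<And>s t. a \<le> s \<Longrightarrow> s \<le> t \<Longrightarrow> t \<le> b \<Longrightarrow> \<bar>H t - H s\<bar> \<le> M * (\<bar>F1 t - F1 s\<bar> + \<bar>F2 t - F2 s\<bar>)"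
  shows "abs_cont_on a b H"
  unfolding abs_cont_on_def
proof (intro allI impI)
  fix \<epsilon> :: real assume "0 < \<epsilon>"
  then have e: "0 < \<epsilon> / (2 * M)" using \<open>0 < M\<close> by simp
  from assms(1)[unfolded abs_cont_on_def, rule_format, OF e]
  obtain \<delta>1 where "\<delta>1 > 0" and \<delta>1: "\<forall>(n::nat) s t.
     (\<forall>i<n. a \<le> s i \<and> s i \<le> t i \<and> t i \<le> b) \<and>
     (\<forall>i<n. \<forall>j<n. i \<noteq> j \<longrightarrow> {s i<..<t i} \<inter> {s j<..<t j} = {}) \<and>
     (\<Sum>i<n. t i - s i) < \<delta>1 \<longrightarrow> (\<Sum>i<n. norm (F1 (t i) - F1 (s i))) < \<epsilon> / (2 * M)"
    by (elim exE conjE) (rule that)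
  from assms(2)[unfolded abs_cont_on_def, rule_format, OF e]
  obtain \<delta>2 where "\<delta>2 > 0" and \<delta>2: "\<forall>(n::nat) s t.
     (\<forall>i<n. a \<le> s i \<and> s i \<le> t i \<and> t i \<le> b) \<and>
     (\<forall>i<n. \<forall>j<n. i \<noteq> j \<longrightarrow> {s i<..<t i} \<inter> {s j<..<t j} = {}) \<and>
     (\<Sum>i<n. t i - s i) < \<delta>2 \<longrightarrow> (\<Sum>i<n. norm (F2 (t i) - F2 (s i))) < \<epsilon> / (2 * M)"
    by (elim exE conjE) (rule that)
  show "\<exists>\<delta>>0. \<forall>(n::nat) s t.
     (\<forall>i<n. a \<le> s i \<and> s i \<le> t i \<and> t i \<le> b) \<and>
     (\<forall>i<n. \<forall>j<n. i \<noteq> j \<longrightarrow> {s i<..<t i} \<inter> {s j<..<t j} = {}) \<and>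
     (\<Sum>i<n. t i - s i) < \<delta> \<longrightarrow> (\<Sum>i<n. norm (H (t i) - H (s i))) < \<epsilon>"
  proof (intro exI[of _ "min \<delta>1 \<delta>2"] conjI allI impI)
    fix n :: nat and s t
    assume A: "(\<forall>i<n. a \<le> s i \<and> s i \<le> t i \<and> t i \<le> b) \<and>
     (\<forall>i<n. \<forall>j<n. i \<noteq> j \<longrightarrow> {s i<..<t i} \<inter> {s j<..<t j} = {}) \<and> (\<Sum>i<n. t i - s i) < min \<delta>1 \<delta>2"
    have "(\<Sum>i<n. norm (F1 (t i) - F1 (s i))) < \<epsilon> / (2 * M)" by (rule \<delta>1[rule_format]) (use A in auto)
    moreover have "(\<Sum>i<n. norm (F2 (t i) - F2 (s i))) < \<epsilon> / (2 * M)" by (rule \<delta>2[rule_format]) (use A in auto)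
    ultimately have "M * ((\<Sum>i<n. norm (F1 (t i) - F1 (s i))) + (\<Sum>i<n. norm (F2 (t i) - F2 (s i)))) < M * (\<epsilon> / (2 * M) + \<epsilon> / (2 * M))"
      using \<open>0 < M\<close> by (intro mult_strict_left_mono add_strict_mono)
    also have "\<dots> = \<epsilon>" using \<open>0 < M\<close> by simp
    finally have "(\<Sum>i<n. M * (\<bar>F1 (t i) - F1 (s i)\<bar> + \<bar>F2 (t i) - F2 (s i)\<bar>)) < \<epsilon>"
      by (simp add: sum_distrib_left[symmetric] sum.distrib)
    moreover have "(\<Sum>i<n. norm (H (t i) - H (s i))) \<le> (\<Sum>i<n. M * (\<bar>F1 (t i) - F1 (s i)\<bar> + \<bar>F2 (t i) - F2 (s i)\<bar>))"
      using A dom by (intro sum_mono) auto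
    ultimately show "(\<Sum>i<n. norm (H (t i) - H (s i))) < \<epsilon>" by linarith
  qed (use \<open>\<delta>1 > 0\<close> \<open>\<delta>2 > 0\<close> in auto)
qed

lemma primitive_of_abs_cont:
  assumes "primitive_of F f" shows "abs_cont_on a b F"
  by (rule indefinite_integral_abs_cont[of a b f]) (use assms in \<open>auto simp: primitive_of_def loc_integrableD\<close>)

lemma primitive_of_derivative_ae:
  fixes F f :: "real \<Rightarrow> real"
  assumes "primitive_of F f"
  shows "AE x in lebesgue. (F has_vector_derivative f x) (at x)"
proof -
  have "AE x in lebesgue. x \<in> {- real n<..<real n} \<longrightarrow> (F has_vector_derivative f x) (at x)" for n :: nat
    by (rule indefinite_integral_derivative_ae) (use assms in \<open>auto simp: primitive_of_def loc_integrableD\<close>)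
  then have "AE x in lebesgue. \<forall>n::nat. x \<in> {- real n<..<real n} \<longrightarrow> (F has_vector_derivative f x) (at x)"
    unfolding AE_all_countable by blast
  then show ?thesis
  proof eventually_elim
    fix x assume *: "\<forall>n::nat. x \<in> {- real n<..<real n} \<longrightarrow> (F has_vector_derivative f x) (at x)"
    obtain n :: nat where "\<bar>x\<bar> < real n" using reals_Archimedean2 by blast
    then have "x \<in> {- real n<..<real n}" by auto
    then show "(F has_vector_derivative f x) (at x)" by (rule *[rule_format])
  qed
qed

lemma integration_by_parts_ae:
  fixes Y y G g :: "real \<Rightarrow> real"
  assumes Y: "primitive_of Y y" and G: "primitive_of G g" and "a \<le> b"
  shows "((\<lambda>t. Y t * g t + y t * G t) has_integral Y b * G b - Y a * G a) {a..b}"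
proof -
  have "bounded ((\<lambda>t. \<bar>Y t\<bar> + \<bar>G t\<bar>) ` {a..b})"
    by (intro compact_imp_bounded compact_continuous_image continuous_intros primitive_of_continuous[OF Y] primitive_of_continuous[OF G]) auto
  then obtain M where "0 < M" and M: "\<And>t. t \<in> {a..b} \<Longrightarrow> \<bar>Y t\<bar> + \<bar>G t\<bar> \<le> M"
    unfolding bounded_pos by fastforce
  have ac: "abs_cont_on a b (\<lambda>t. Y t * G t)"
  proof (rule abs_cont_on_dominated[OF primitive_of_abs_cont[OF Y] primitive_of_abs_cont[OF G] \<open>0 < M\<close>])
    fix s t assume st: "a \<le> s" "s \<le> t" "t \<le> b"
    have "Y t * G t - Y s * G s = G t * (Y t - Y s) + Y s * (G t - G s)" by (simp add: algebra_simps)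
    also have "\<bar>\<dots>\<bar> \<le> \<bar>G t\<bar> * \<bar>Y t - Y s\<bar> + \<bar>Y s\<bar> * \<bar>G t - G s\<bar>"
      by (rule order_trans[OF abs_triangle_ineq]) (simp add: abs_mult)
    also have "\<dots> \<le> M * \<bar>Y t - Y s\<bar> + M * \<bar>G t - G s\<bar>"
      using M[of t] M[of s] st by (intro add_mono mult_right_mono) auto
    finally show "\<bar>Y t * G t - Y s * G s\<bar> \<le> M * (\<bar>Y t - Y s\<bar> + \<bar>G t - G s\<bar>)" by (simp add: algebra_simps)
  qed
  have "AE x in lebesgue. (Y has_vector_derivative y x) (at x) \<and> (G has_vector_derivative g x) (at x)"
    using primitive_of_derivative_ae[OF Y] primitive_of_derivative_ae[OF G] by eventually_elim auto
  then obtain N where N: "N \<in> null_sets lebesgue"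
    "{x \<in> space lebesgue. \<not> ((Y has_vector_derivative y x) (at x) \<and> (G has_vector_derivative g x) (at x))} \<subseteq> N"
    unfolding eventually_ae_filter by blast
  show ?thesis
  proof (rule abs_cont_has_integral[OF ac \<open>a \<le> b\<close>])
    show "negligible N" using N(1) by (simp add: negligible_iff_null_sets)
    fix x assume "x \<in> {a<..<b} - N"
    then have "(Y has_real_derivative y x) (at x)" "(G has_real_derivative g x) (at x)"
      using N(2) by (auto simp: has_real_derivative_iff_has_vector_derivative)
    from DERIV_mult'[OF this] show "((\<lambda>t. Y t * G t) has_vector_derivative Y x * g x + y x * G x) (at x)"
      by (simp add: has_real_derivative_iff_has_vector_derivative)
  qed
qed

lemma kernel_integrable:
  fixes y g :: "real \<Rightarrow> real"
  assumes "continuous_on {a..b} y" "loc_integrable g"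
  shows "(\<lambda>t. y t * g t) absolutely_integrable_on {a..b}" "(\<lambda>t. y t * g t) integrable_on {a..b}"
proof -
  show "(\<lambda>t. y t * g t) absolutely_integrable_on {a..b}"
  proof (rule absolutely_integrable_bounded_measurable_product_real)
    show "y \<in> borel_measurable (lebesgue_on {a..b})"
      by (rule continuous_imp_measurable_on_sets_lebesgue[OF assms(1)]) auto
    show "bounded (y ` {a..b})" by (intro compact_imp_bounded compact_continuous_image assms) auto
  qed (use loc_integrableD(1)[OF assms(2)] in auto)
  then show "(\<lambda>t. y t * g t) integrable_on {a..b}" by (simp add: absolutely_integrable_on_def)
qed

text \<open>
  Fubini's theorem on a triangle, obtained by integration by parts for absolutely continuous
  functions.
\<close>

lemma kernel_primitive:
  fixes y g :: "real \<Rightarrow> real"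
  assumes y: "continuous_on {0..1} y" and g: "loc_integrable g"
  shows "integral {0..1} (\<lambda>t. y t * integral {0..t} g) = integral {0..1} (\<lambda>s. integral {s..1} y * g s)"
proof -
  \<comment> \<open>A continuous extension of \<open>y\<close>, so that the whole line carries a primitive.\<close>
  define y' where "y' t = (if t < 0 then y 0 else if t \<le> 1 then y t else y 1)" for t
  have y'eq: "y' t = y t" if "t \<in> {0..1}" for t using that by (auto simp: y'_def)
  have y'e: "y' t = y (max 0 (min 1 t))" for t by (auto simp: y'_def min_def max_def)
  have "continuous_on UNIV y'" unfolding y'e
    by (rule continuous_on_compose2[OF y]) (auto intro!: continuous_intros)
  then have y'li: "loc_integrable y'" by (intro loc_integrable_continuous) (auto intro: continuous_on_subset)
  define Y where "Y = primitive y'"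
  define G where "G = primitive g"
  have Y: "primitive_of Y y'" unfolding Y_def by (rule primitive_of_primitive[OF y'li])
  have G: "primitive_of G g" unfolding G_def by (rule primitive_of_primitive[OF g])
  have Y0: "Y 0 = 0" and G0: "G 0 = 0" by (simp_all add: Y_def G_def primitive_def)
  have Gt: "integral {0..t} g = G t" if "0 \<le> t" for t using that by (simp add: G_def primitive_def)
  have Yt: "integral {s..1} y = Y 1 - Y s" if "s \<in> {0..1}" for s
  proof -
    have "integral {s..1} y = integral {s..1} y'" by (rule Henstock_Kurzweil_Integration.integral_cong) (use that y'eq in auto)
    then show ?thesis using Y that by (simp add: primitive_of_def)
  qed
  have parts: "((\<lambda>t. Y t * g t + y' t * G t) has_integral Y 1 * G 1) {0..1}"
    using integration_by_parts_ae[OF Y G, of 0 1] by (simp add: Y0)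
  have i1: "(\<lambda>t. y' t * G t) integrable_on {0..1}"
    by (intro integrable_continuous_real continuous_intros primitive_of_continuous[OF G] continuous_on_subset[OF \<open>continuous_on UNIV y'\<close>]) auto
  from has_integral_diff[OF parts integrable_integral[OF i1]]
  have i2: "((\<lambda>t. Y t * g t) has_integral Y 1 * G 1 - integral {0..1} (\<lambda>t. y' t * G t)) {0..1}" by simp
  have i3: "((\<lambda>t. Y 1 * g t) has_integral Y 1 * G 1) {0..1}"
    using has_integral_mult_right[OF integrable_integral[OF loc_integrableD(2)[OF g]], of "Y 1" 0 1] Gt[of 1] by simp
  from has_integral_diff[OF i3 i2]
  have "((\<lambda>t. (Y 1 - Y t) * g t) has_integral integral {0..1} (\<lambda>t. y' t * G t)) {0..1}"
    by (simp add: algebra_simps)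
  then have "integral {0..1} (\<lambda>t. y' t * G t) = integral {0..1} (\<lambda>t. (Y 1 - Y t) * g t)" by (simp add: integral_unique)
  moreover have "integral {0..1} (\<lambda>t. y' t * G t) = integral {0..1} (\<lambda>t. y t * integral {0..t} g)"
    by (rule Henstock_Kurzweil_Integration.integral_cong) (simp add: y'eq Gt)
  moreover have "integral {0..1} (\<lambda>t. (Y 1 - Y t) * g t) = integral {0..1} (\<lambda>s. integral {s..1} y * g s)"
    by (rule Henstock_Kurzweil_Integration.integral_cong) (simp add: Yt)
  ultimately show ?thesis by simp
qed

lemma tail_continuous: "continuous_on {0..1} y \<Longrightarrow> continuous_on {0..1} (\<lambda>t. integral {t..1} y)" for y :: "real \<Rightarrow> real"
  using indefinite_integral_continuous_1'[OF integrable_continuous_real] by blast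

text \<open>
  Moves the unit-interval mean of \<open>g\<close> onto the kernel: the mean over \<open>{n + t..n + t + 1}\<close> meets the two
  consecutive intervals that start at \<open>n\<close> and \<open>n + 1\<close>.
\<close>

lemma kernel_step:
  fixes y g :: "real \<Rightarrow> real"
  assumes y: "continuous_on {0..1} y" and g: "loc_integrable g"
  shows "integral {0..1} (\<lambda>t. y t * integral {n + t..n + t + 1} g)
    = integral {0..1} (\<lambda>t. integral {0..t} y * g (n + t)) + integral {0..1} (\<lambda>t. integral {t..1} y * g (n + 1 + t))"
proof -
  define g0 where "g0 t = g (n + t)" for t
  define g1 where "g1 t = g (n + 1 + t)" for t
  have g0: "loc_integrable g0" and g1: "loc_integrable g1"
    using loc_integrable_shift[OF g, of n] loc_integrable_shift[OF g, of "n + 1"] by (simp_all add: g0_def[abs_def] g1_def[abs_def] add_ac)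
  have yi: "y integrable_on {a..b}" if "0 \<le> a" "b \<le> 1" for a b
    by (rule integrable_continuous_real, rule continuous_on_subset[OF y]) (use that in auto)
  have split: "integral {n + t..n + t + 1} g = integral {0..1} g0 - integral {0..t} g0 + integral {0..t} g1" if t: "t \<in> {0..1}" for t
  proof -
    have s0: "integral {n + a..n + b} g = integral {a..b} g0" for a b
      using integral_shift_real_ivl[of "n + a" n "n + b" g] by (simp add: g0_def[abs_def] add.commute)
    have s1: "integral {n + 1 + a..n + 1 + b} g = integral {a..b} g1" for a b
      using integral_shift_real_ivl[of "n + 1 + a" "n + 1" "n + 1 + b" g] by (simp add: g1_def[abs_def] add_ac)
    have "integral {n + t..n + t + 1} g = integral {n + t..n + 1} g + integral {n + 1..n + t + 1} g"
      by (rule Henstock_Kurzweil_Integration.integral_combine[symmetric]) (use t loc_integrableD(2)[OF g] in auto)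
    also have "integral {n + 1..n + t + 1} g = integral {0..t} g1" using s1[of 0 t] by (simp add: add_ac)
    also have "integral {n + t..n + 1} g = integral {t..1} g0" by (rule s0)
    also have "integral {t..1} g0 = integral {0..1} g0 - integral {0..t} g0"
      using Henstock_Kurzweil_Integration.integral_combine[of 0 t 1 g0] t loc_integrableD(2)[OF g0] by auto
    finally show ?thesis by simp
  qed
  have c0: "continuous_on {0..1} (\<lambda>t. integral {0..t} g0)" and c1: "continuous_on {0..1} (\<lambda>t. integral {0..t} g1)"
    by (intro indefinite_integral_continuous_1 loc_integrableD(2) g0 g1)+
  have "integral {0..1} (\<lambda>t. y t * integral {n + t..n + t + 1} g)
    = integral {0..1} (\<lambda>t. (y t * integral {0..1} g0 - y t * integral {0..t} g0) + y t * integral {0..t} g1)"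
    by (rule Henstock_Kurzweil_Integration.integral_cong) (simp only: split distrib_left right_diff_distrib)
  also have "\<dots> = (integral {0..1} (\<lambda>t. y t * integral {0..1} g0) - integral {0..1} (\<lambda>t. y t * integral {0..t} g0))
      + integral {0..1} (\<lambda>t. y t * integral {0..t} g1)"
  proof -
    have i: "(\<lambda>t. y t * integral {0..1} g0) integrable_on {0..1}" "(\<lambda>t. y t * integral {0..t} g0) integrable_on {0..1}"
      "(\<lambda>t. y t * integral {0..t} g1) integrable_on {0..1}"
      by (intro integrable_continuous_real continuous_intros y c0 c1)+
    show ?thesis
      unfolding Henstock_Kurzweil_Integration.integral_diff[OF i(1,2), symmetric]
      by (rule Henstock_Kurzweil_Integration.integral_add[OF integrable_diff[OF i(1,2)] i(3)])
  qed
  also have "integral {0..1} (\<lambda>t. y t * integral {0..1} g0) = integral {0..1} (\<lambda>s. integral {0..1} y * g0 s)"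
    by simp
  also have "integral {0..1} (\<lambda>t. y t * integral {0..t} g0) = integral {0..1} (\<lambda>s. integral {s..1} y * g0 s)"
    by (rule kernel_primitive[OF y g0])
  also have "integral {0..1} (\<lambda>t. y t * integral {0..t} g1) = integral {0..1} (\<lambda>s. integral {s..1} y * g1 s)"
    by (rule kernel_primitive[OF y g1])
  also have "integral {0..1} (\<lambda>s. integral {0..1} y * g0 s) - integral {0..1} (\<lambda>s. integral {s..1} y * g0 s)
    = integral {0..1} (\<lambda>s. integral {0..1} y * g0 s - integral {s..1} y * g0 s)"
    by (rule Henstock_Kurzweil_Integration.integral_diff[symmetric])
      (intro kernel_integrable(2) tail_continuous y g0 continuous_intros)+
  also have "\<dots> = integral {0..1} (\<lambda>t. integral {0..t} y * g0 t)"
  proof (rule Henstock_Kurzweil_Integration.integral_cong)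
    fix s :: real assume s: "s \<in> {0..1}"
    have "integral {0..s} y + integral {s..1} y = integral {0..1} y"
      by (rule Henstock_Kurzweil_Integration.integral_combine) (use s yi in auto)
    then have "integral {0..1} y = integral {0..s} y + integral {s..1} y" by simp
    then show "integral {0..1} y * g0 s - integral {s..1} y * g0 s = integral {0..s} y * g0 s"
      by (simp only: distrib_right add_diff_cancel_right')
  qed
  finally show ?thesis by (simp add: g0_def g1_def)
qed

text \<open>
  The sum is the integral of \<open>k F\<close> over \<open>[0, N + 1]\<close> for the solution \<open>k\<close> of the renewal equation.
  After \<open>kernel_step\<close> it telescopes, because \<open>k - k * 1\<^bsub>[0,1]\<^esub>\<close> vanishes beyond 1; what remains is the
  contribution \<open>(2 t - 1) g t\<close> of the first interval and a boundary term at \<open>N + 1\<close>.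
\<close>

lemma renewal_expansion:
  fixes g :: "real \<Rightarrow> real"
  assumes g: "loc_integrable g"
  defines "F \<equiv> \<lambda>t. g t - integral {t..t + 1} g"
  shows "g 0 - 2 * integral {0..1} (\<lambda>t. (1 - t) * g t)
    = F 0 + (\<Sum>n\<le>N. integral {0..1} (\<lambda>t. renewal n t * F (real n + t)))
      + integral {0..1} (\<lambda>t. integral {t..1} (renewal N) * g (real (Suc N) + t))"
proof -
  have gs: "loc_integrable (\<lambda>t. g (c + t))" for c using loc_integrable_shift[OF g, of c] by (simp add: add.commute)
  have st: "loc_integrable (\<lambda>t. integral {t..t + 1} g)"
    using loc_integrable_steklov[OF g, of 1] by (simp add: steklov_eq[OF g, abs_def] fun_eq_iff)
  have sts: "loc_integrable (\<lambda>t. integral {c + t..c + t + 1} g)" for c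
    using loc_integrable_shift[OF st, of c] by (simp add: add_ac)
  have one: "integral {0..1} (\<lambda>t. renewal n t * F (real n + t))
    = integral {0..1} (\<lambda>t. (renewal n t - integral {0..t} (renewal n)) * g (real n + t))
      - integral {0..1} (\<lambda>t. integral {t..1} (renewal n) * g (real (Suc n) + t))" for n
  proof -
    have "integral {0..1} (\<lambda>t. renewal n t * F (real n + t))
      = integral {0..1} (\<lambda>t. renewal n t * g (real n + t) - renewal n t * integral {real n + t..real n + t + 1} g)"
      by (simp add: F_def right_diff_distrib)
    also have "\<dots> = integral {0..1} (\<lambda>t. renewal n t * g (real n + t)) - integral {0..1} (\<lambda>t. renewal n t * integral {real n + t..real n + t + 1} g)"
      by (intro Henstock_Kurzweil_Integration.integral_diff kernel_integrable(2) renewal_continuous gs sts)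
    also have "integral {0..1} (\<lambda>t. renewal n t * integral {real n + t..real n + t + 1} g)
      = integral {0..1} (\<lambda>t. integral {0..t} (renewal n) * g (real n + t)) + integral {0..1} (\<lambda>t. integral {t..1} (renewal n) * g (real n + 1 + t))"
      by (rule kernel_step[OF renewal_continuous g])
    also have "integral {0..1} (\<lambda>t. renewal n t * g (real n + t)) - (integral {0..1} (\<lambda>t. integral {0..t} (renewal n) * g (real n + t)) + integral {0..1} (\<lambda>t. integral {t..1} (renewal n) * g (real n + 1 + t)))
      = integral {0..1} (\<lambda>t. renewal n t * g (real n + t) - integral {0..t} (renewal n) * g (real n + t)) - integral {0..1} (\<lambda>t. integral {t..1} (renewal n) * g (real n + 1 + t))"
      by (subst Henstock_Kurzweil_Integration.integral_diff)
        (auto intro!: kernel_integrable(2) renewal_continuous gs indefinite_integral_continuous_1 renewal_integrable)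
    finally show ?thesis by (simp add: left_diff_distrib add_ac)
  qed
  have zero: "integral {0..1} (\<lambda>t. (renewal 0 t - integral {0..t} (renewal 0)) * g (real 0 + t)) = integral {0..1} (\<lambda>t. (2 * t - 1) * g t)"
  proof (rule Henstock_Kurzweil_Integration.integral_cong)
    fix t :: real assume t: "t \<in> {0..1}"
    have "(renewal 0 has_integral (exp t - 2 * t) - (exp 0 - 2 * 0)) {0..t}"
    proof (rule fundamental_theorem_of_calculus)
      fix s :: real
      have "((\<lambda>t. exp t - 2 * t) has_real_derivative renewal 0 s) (at s within {0..t})"
        by (auto intro!: derivative_eq_intros)
      then show "((\<lambda>t. exp t - 2 * t) has_vector_derivative renewal 0 s) (at s within {0..t})"
        by (simp only: has_real_derivative_iff_has_vector_derivative)
    qed (use t in auto)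
    then have "integral {0..t} (renewal 0) = exp t - 2 * t - 1" by (simp add: integral_unique)
    then show "(renewal 0 t - integral {0..t} (renewal 0)) * g (real 0 + t) = (2 * t - 1) * g t" by simp
  qed
  have suc: "integral {0..1} (\<lambda>t. (renewal (Suc n) t - integral {0..t} (renewal (Suc n))) * g (real (Suc n) + t))
     = integral {0..1} (\<lambda>t. integral {t..1} (renewal n) * g (real (Suc n) + t))" for n
    by (rule Henstock_Kurzweil_Integration.integral_cong) (simp only: renewal_recurrence)
  have "(\<Sum>n\<le>N. integral {0..1} (\<lambda>t. renewal n t * F (real n + t)))
    = integral {0..1} (\<lambda>t. (2 * t - 1) * g t) - integral {0..1} (\<lambda>t. integral {t..1} (renewal N) * g (real (Suc N) + t))"
  proof (induction N)
    case 0 show ?case using one[of 0] zero by (simp del: renewal.simps)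
  next
    case (Suc N)
    show ?case unfolding sum.atMost_Suc Suc one[of "Suc N"] suc by simp
  qed
  moreover have "g 0 - 2 * integral {0..1} (\<lambda>t. (1 - t) * g t) = F 0 + integral {0..1} (\<lambda>t. (2 * t - 1) * g t)"
  proof -
    have i: "(\<lambda>t. (1 - t) * g t) integrable_on {0..1}" by (intro kernel_integrable(2) continuous_intros g)
    have "integral {0..1} (\<lambda>t. (2 * t - 1) * g t) = integral {0..1} (\<lambda>t. g t - 2 * ((1 - t) * g t))"
      by (simp add: algebra_simps)
    also have "\<dots> = integral {0..1} g - 2 * integral {0..1} (\<lambda>t. (1 - t) * g t)"
      using Henstock_Kurzweil_Integration.integral_diff[OF loc_integrableD(2)[OF g] integrable_on_cmult_left[OF i, of 2]] by simp
    finally show ?thesis by (simp add: F_def)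
  qed
  ultimately show ?thesis by simp
qed

section \<open>Smoothing by weighted means\<close>

text \<open>
  The weighted mean \<open>2 \<integral>\<^sub>0\<^sup>1 (1 - t) g (x + h t) dt\<close> (see \<open>wmean_integral\<close>). Defined as a difference of a
  primitive, it visibly commutes with differences and gains a derivative.
\<close>

definition wmean :: "real \<Rightarrow> (real \<Rightarrow> real) \<Rightarrow> real \<Rightarrow> real" where
  "wmean h g x = (2 / h) * Delta1 h (primitive g) x"

lemma Delta1_add_const:
  fixes f :: "real \<Rightarrow> 'a::euclidean_space"
  assumes "loc_integrable f" "0 < h"
  shows "Delta1 h (\<lambda>x. f x + c) = Delta1 h f"
proof -
  have c: "loc_integrable (\<lambda>x::real. c)" by (rule loc_integrable_continuous) auto
  show ?thesis by (simp add: Delta1_add[OF assms(1) c] fun_eq_iff) (simp add: Delta1_def steklov_const[OF assms(2)])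
qed

lemma wmean_eq:
  assumes "primitive_of G g" "0 < h"
  shows "wmean h g = (\<lambda>x. (2 / h) * Delta1 h G x)"
proof -
  have g: "loc_integrable g" using assms by (simp add: primitive_of_def)
  note P = primitive_of_primitive[OF g]
  define c where "c = G 0 - primitive g 0"
  have "G x = primitive g x + c" for x
  proof (cases "0 \<le> x")
    case True
    then have "G x - G 0 = primitive g x - primitive g 0" using assms(1) P by (simp add: primitive_of_def)
    then show ?thesis by (simp add: c_def)
  next
    case False
    then have "G 0 - G x = primitive g 0 - primitive g x" using assms(1) P by (simp add: primitive_of_def)
    then show ?thesis by (simp add: c_def)
  qed
  then have G: "G = (\<lambda>x. primitive g x + c)" by (rule ext)
  have "Delta1 h G = Delta1 h (primitive g)"
    unfolding G by (rule Delta1_add_const[OF primitive_of_loc_integrable[OF P] assms(2)])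
  then show ?thesis by (simp add: wmean_def fun_eq_iff)
qed

lemma primitive_of_wmean:
  assumes "loc_integrable g" "0 < h"
  shows "primitive_of (wmean h g) (\<lambda>x. (2 / h) * Delta1 h g x)"
proof -
  note P = primitive_of_Delta1[OF primitive_of_primitive[OF assms(1)] assms(2)]
  show ?thesis using primitive_of_linear[OF P P, of "2 / h" 0] by (simp add: wmean_def[abs_def])
qed

lemma loc_integrable_wmean: "loc_integrable g \<Longrightarrow> 0 < h \<Longrightarrow> loc_integrable (wmean h g)"
  by (rule primitive_of_loc_integrable[OF primitive_of_wmean])

lemma wmean_linear:
  assumes "loc_integrable f" "loc_integrable g" "0 < h"
  shows "wmean h (\<lambda>x. f x + c * g x) = (\<lambda>x. wmean h f x + c * wmean h g x)"
proof -
  note P = primitive_of_primitive[OF assms(1)] primitive_of_primitive[OF assms(2)]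
  note li = P[THEN primitive_of_loc_integrable]
  have "primitive_of (\<lambda>x. primitive f x + c *\<^sub>R primitive g x) (\<lambda>x. f x + c * g x)"
    using primitive_of_linear[OF P, of 1 c] by simp
  from wmean_eq[OF this assms(3)] show ?thesis
    by (simp only: Delta1_add[OF li(1) loc_integrable_scaleR[OF li(2)]] Delta1_scaleR[OF li(2)])
      (simp add: wmean_def fun_eq_iff algebra_simps)
qed

lemma wmean_Delta1:
  assumes "loc_integrable g" "0 < h"
  shows "wmean h (Delta1 h g) = Delta1 h (wmean h g)"
proof -
  note P = primitive_of_primitive[OF assms(1)]
  have "wmean h g = (\<lambda>x. (2 / h) *\<^sub>R Delta1 h (primitive g) x)" by (simp add: wmean_def fun_eq_iff)
  then have "Delta1 h (wmean h g) = (\<lambda>x. (2 / h) *\<^sub>R Delta1 h (Delta1 h (primitive g)) x)"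
    by (simp only: Delta1_scaleR[OF loc_integrable_Delta1[OF primitive_of_loc_integrable[OF P] assms(2)]])
  then show ?thesis unfolding wmean_eq[OF primitive_of_Delta1[OF P assms(2)] assms(2)] by simp
qed

lemma wmean_integral:
  assumes g: "loc_integrable g" and h: "0 < h"
  shows "wmean h g x = 2 * integral {0..1} (\<lambda>t. (1 - t) * g (x + h * t))"
proof -
  define G where "G = primitive g"
  have G: "primitive_of G g" unfolding G_def by (rule primitive_of_primitive[OF g])
  note Gi = primitive_of_loc_integrable[OF G]
  have inc: "G (x + h * t) - G x = h * integral {0..t} (\<lambda>t. g (x + h * t))" if "0 \<le> t" for t
    using G that h loc_integrable_affine(2)[OF g h, of 0 t x] by (simp add: primitive_of_def)
  have "Delta1 h G x = integral {0..1} (\<lambda>t. G (x + h * t)) - G x"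
    using loc_integrable_affine(2)[OF Gi h, of 0 1 x] by (simp add: Delta1_def steklov_eq[OF Gi])
  also have "\<dots> = integral {0..1} (\<lambda>t. G (x + h * t) - G x)"
    using Henstock_Kurzweil_Integration.integral_diff[OF loc_integrableD(2)[OF loc_integrable_affine(1)[OF Gi h]] integrable_const_ivl, of 0 1 x "G x"]
    by simp
  also have "\<dots> = integral {0..1} (\<lambda>t. h * (1 * integral {0..t} (\<lambda>t. g (x + h * t))))"
    by (rule Henstock_Kurzweil_Integration.integral_cong) (simp add: inc)
  also have "\<dots> = h * integral {0..1} (\<lambda>t. 1 * integral {0..t} (\<lambda>t. g (x + h * t)))" by (rule integral_mult_right)
  also have "integral {0..1} (\<lambda>t. 1 * integral {0..t} (\<lambda>t. g (x + h * t)))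
      = integral {0..1} (\<lambda>s. integral {s..1} (\<lambda>_. 1) * g (x + h * s))"
    by (rule kernel_primitive[OF continuous_on_const loc_integrable_affine(1)[OF g h]])
  also have "\<dots> = integral {0..1} (\<lambda>s. (1 - s) * g (x + h * s))"
    by (rule Henstock_Kurzweil_Integration.integral_cong) simp
  finally show ?thesis using h by (simp add: wmean_def G_def)
qed

lemma kernel_bound:
  fixes y f :: "real \<Rightarrow> real"
  assumes y: "continuous_on {0..1} y" and M: "\<And>t. t \<in> {0..1} \<Longrightarrow> \<bar>y t\<bar> \<le> M" and f: "loc_integrable f" and h: "0 < h"
  shows "\<bar>integral {0..1} (\<lambda>t. y t * f (x + h * (real n + t)))\<bar> \<le> M * (2 * (real n + 1)) * window (h * (real n + 1)) f x"
proof -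
  let ?c = "x + h * real n"
  note li = loc_integrable_affine(1)[OF f h, of ?c]
  have e: "x + h * (real n + t) = ?c + h * t" for t by (simp add: algebra_simps)
  have "0 \<le> M" using M[of 0] by simp
  have "norm (integral {0..1} (\<lambda>t. y t * f (?c + h * t))) \<le> integral {0..1} (\<lambda>t. M * norm (f (?c + h * t)))"
    by (rule integral_norm_bound_integral[OF kernel_integrable(2)[OF y li]])
      (use M \<open>0 \<le> M\<close> loc_integrableD(2)[OF loc_integrable_norm[OF li]] in \<open>auto simp: abs_mult intro!: mult_right_mono integrable_on_mult_right\<close>)
  also have "\<dots> = M * ((1 / h) * integral {?c..?c + h} (\<lambda>t. norm (f t)))"
    using loc_integrable_affine(2)[OF loc_integrable_norm[OF f] h, of 0 1 ?c] by simp
  also have "\<dots> \<le> M * ((1 / h) * (2 * (h * (real n + 1)) * window (h * (real n + 1)) f x))"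
  proof -
    have "x - h * (real n + 1) \<le> ?c" using h by (simp add: algebra_simps)
    then have "integral {?c..?c + h} (\<lambda>t. norm (f t)) \<le> 2 * (h * (real n + 1)) * window (h * (real n + 1)) f x"
      using h by (intro integral_norm_le_window f) (auto simp: distrib_left intro: add_pos_nonneg)
    then show ?thesis using \<open>0 \<le> M\<close> h by (intro mult_left_mono) auto
  qed
  also have "\<dots> = M * (2 * (real n + 1)) * window (h * (real n + 1)) f x" using h by simp
  finally show ?thesis by (simp add: e)
qed

text \<open>
  The expansion for the function \<open>t \<mapsto> g (x + h t)\<close>, in which \<open>F\<close> becomes the first difference of \<open>g\<close> with
  step \<open>h\<close>. Every integral over \<open>[n, n + 1]\<close> is an integral over an interval of length \<open>h\<close> at distance
  \<open>h n\<close> from \<open>x\<close>, and is bounded by an average of radius \<open>h (n + 1)\<close> at the price of a factor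
  \<open>2 (n + 1)\<close>; the exponential decay of the kernel absorbs it.
\<close>

lemma wmean_error_pointwise:
  assumes g: "loc_integrable g" and h: "0 < h"
  shows "\<bar>g x - wmean h g x\<bar> \<le> \<bar>Delta1 h g x\<bar>
    + (\<Sum>n\<le>N. (31/32) ^ n * (2 * (real n + 1)) * window (h * (real n + 1)) (Delta1 h g) x)
    + (31/32) ^ N * (2 * (real N + 2)) * window (h * (real N + 2)) g x"
proof -
  let ?\<gamma> = "\<lambda>t. g (x + h * t)"
  note \<gamma> = loc_integrable_affine(1)[OF g h, of x]
  have F: "?\<gamma> t - integral {t..t + 1} ?\<gamma> = - Delta1 h g (x + h * t)" for t
    using loc_integrable_affine(2)[OF g h, of t "t + 1" x]
    by (simp add: Delta1_def steklov_eq[OF g] algebra_simps)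
  have D: "loc_integrable (\<lambda>t. - Delta1 h g t)" using loc_integrable_scaleR[OF loc_integrable_Delta1[OF g h], of "-1"] by simp
  have w: "window k (\<lambda>t. - Delta1 h g t) x = window k (Delta1 h g) x" for k by (simp add: window_def)
  have 1: "\<bar>integral {0..1} (\<lambda>t. renewal n t * - Delta1 h g (x + h * (real n + t)))\<bar>
      \<le> (31/32) ^ n * (2 * (real n + 1)) * window (h * (real n + 1)) (Delta1 h g) x" for n
    using kernel_bound[OF renewal_continuous renewal_bound D h, of n x n] by (simp only: w)
  have 2: "\<bar>integral {0..1} (\<lambda>t. integral {t..1} (renewal N) * g (x + h * (real (Suc N) + t)))\<bar>
      \<le> (31/32) ^ N * (2 * (real (Suc N) + 1)) * window (h * (real (Suc N) + 1)) g x"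
  proof (rule kernel_bound[OF tail_continuous[OF renewal_continuous] _ g h])
    fix t :: real assume t: "t \<in> {0..1}"
    have "\<bar>integral {t..1} (renewal N)\<bar> \<le> (31/32) ^ N * (1 - t)"
      by (rule abs_integral_le) (use t renewal_integrable renewal_bound in auto)
    also have "\<dots> \<le> (31/32) ^ N * 1" using t by (intro mult_left_mono) auto
    finally show "\<bar>integral {t..1} (renewal N)\<bar> \<le> (31/32) ^ N" by simp
  qed
  have s: "real (Suc N) + 1 = real N + 2" by simp
  define I where "I n = integral {0..1} (\<lambda>t. renewal n t * - Delta1 h g (x + h * (real n + t)))" for n
  define J where "J = integral {0..1} (\<lambda>t. integral {t..1} (renewal N) * g (x + h * (real (Suc N) + t)))"
  have "g x - wmean h g x = - Delta1 h g x + (\<Sum>n\<le>N. I n) + J"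
    using renewal_expansion[OF \<gamma>, of N] unfolding F wmean_integral[OF g h] I_def J_def by simp
  moreover have "\<bar>\<Sum>n\<le>N. I n\<bar> \<le> (\<Sum>n\<le>N. (31/32) ^ n * (2 * (real n + 1)) * window (h * (real n + 1)) (Delta1 h g) x)"
    by (rule order_trans[OF sum_abs]) (rule sum_mono, unfold I_def, rule 1)
  moreover have "\<bar>J\<bar> \<le> (31/32) ^ N * (2 * (real N + 2)) * window (h * (real N + 2)) g x"
    using 2 unfolding s J_def .
  ultimately show ?thesis by linarith
qed

text \<open>
  The subtracted term is the rest of the series, whose sum is \<open>1 / (1 - 31 / 32)\<^sup>2 = 1024\<close>.
\<close>

lemma weighted_geometric_sum: "(\<Sum>n\<le>N. (real n + 1) * (31/32) ^ n) = 1024 - (31/32) ^ Suc N * (32 * real N + 1056)"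
proof (induction N)
  case (Suc N)
  have "(\<Sum>n\<le>Suc N. (real n + 1) * (31/32) ^ n) = 1024 - (31/32) ^ Suc N * (32 * real N + 1056) + (real N + 2) * (31/32 :: real) ^ Suc N"
    unfolding sum.atMost_Suc Suc by simp
  also have "\<dots> = 1024 - (31/32) ^ Suc N * (31/32 * (32 * real (Suc N) + 1056))"
    by (simp only: of_nat_Suc ring_distribs) simp
  finally show ?case by (simp only: power_Suc mult_ac)
qed simp

lemma weighted_geometric_limit: "(\<lambda>n. (31/32) ^ n * (real n + 2)) \<longlonglongrightarrow> 0"
proof -
  have "(\<lambda>n. real n * (31/32) ^ n + 2 * (31/32) ^ n :: real) \<longlonglongrightarrow> 0 + 2 * 0"
    by (intro tendsto_intros powser_times_n_limit_0 LIMSEQ_power_zero) auto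
  then show ?thesis by (simp add: algebra_simps)
qed

context averaging
begin

lemma wnorm_wmean:
  assumes "g \<in> wL p w" "0 < h"
  shows "wnorm p w (wmean h g) \<le> ennreal (4 * C) * wnorm p w g"
proof -
  note P = primitive_of_primitive[OF wL_loc_integrable[OF assms(1)]]
  have "norm (wmean h g x) \<le> 4 * window h g x" for x
    using norm_Delta1_le[OF P assms(2), of x] assms(2) by (simp add: wmean_def abs_mult field_simps)
  then show ?thesis by (intro wnorm_le_window[OF assms]) auto
qed

lemma wmean_wL:
  assumes "g \<in> wL p w" "0 < h" shows "wmean h g \<in> wL p w"
proof (rule wL_dominated[OF assms(1) _ _ wnorm_wmean[OF assms]])
  note li = wL_loc_integrable[OF assms(1)]
  show "wmean h g \<in> borel_measurable lebesgue" by (intro loc_integrable_measurable loc_integrable_wmean li assms)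
  have "g (x + 2 * pi + s) = g (x + s)" for x s
    using assms(1) by (auto simp: wL_def periodic_2pi_def add_ac dest: spec[of _ "x + s"])
  then show "periodic_2pi (wmean h g)" by (simp add: periodic_2pi_def wmean_integral[OF li assms(2)])
qed

text \<open>
  Let \<open>N\<close> tend to infinity in \<open>wmean_error_pointwise\<close>. The remainder tends to 0 because \<open>g\<close> has
  finite norm.
\<close>

lemma wnorm_wmean_error:
  assumes g: "g \<in> wL p w" and h: "0 < h"
  shows "wnorm p w (\<lambda>x. g x - wmean h g x) \<le> ennreal (1 + 2048 * C) * wnorm p w (Delta1 h g)"
proof -
  note li = wL_loc_integrable[OF g]
  have Dg: "Delta1 h g \<in> wL p w" by (rule Delta1_wL[OF g h])
  have fin: "wnorm p w g < top" using g by (simp add: wL_def)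
  then obtain G where G: "wnorm p w g = ennreal G" "0 \<le> G" by (cases "wnorm p w g") auto
  have step: "wnorm p w (\<lambda>x. g x - wmean h g x) \<le> ennreal (1 + 2048 * C) * wnorm p w (Delta1 h g)
      + ennreal ((31/32) ^ N * (real N + 2) * (2 * C * G))" for N
  proof -
    define S where "S x = (\<Sum>n\<le>N. (31/32) ^ n * (2 * (real n + 1)) * window (h * (real n + 1)) (Delta1 h g) x)" for x
    define a where "a = (31/32 :: real) ^ N * (2 * (real N + 2))"
    define R where "R x = a * window (h * (real N + 2)) g x" for x
    have w0: "0 \<le> window k f x" if "0 < k" for k x and f :: "real \<Rightarrow> real" using that by (simp add: window_def)
    have S0: "0 \<le> S x" for x unfolding S_def using h by (intro sum_nonneg mult_nonneg_nonneg w0) auto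
    have Sm: "S \<in> borel_measurable lebesgue" unfolding S_def[abs_def]
      by (intro borel_measurable_sum borel_measurable_times borel_measurable_const window_measurable[OF Dg])
    have Rm: "R \<in> borel_measurable lebesgue" unfolding R_def[abs_def]
      by (intro borel_measurable_times borel_measurable_const window_measurable[OF g])
    have am: "(\<lambda>x. norm (Delta1 h g x)) \<in> borel_measurable lebesgue" using wL_measurable[OF Dg] by measurable
    have R: "wnorm p w R \<le> ennreal (a * C) * wnorm p w g"
      by (rule wnorm_le_window[OF g, of "h * (real N + 2)"])
        (use h w0 in \<open>auto simp: R_def a_def abs_mult\<close>)
    have S: "wnorm p w S \<le> ennreal (2048 * C) * wnorm p w (Delta1 h g)"
    proof -
      have "wnorm p w S \<le> ennreal ((\<Sum>n\<le>N. (31/32) ^ n * (2 * (real n + 1))) * C) * wnorm p w (Delta1 h g)"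
      proof (rule wnorm_le_sum_windows[OF Dg finite_atMost, where \<rho> = "\<lambda>n. h * (real n + 1)"])
        show "norm (S x) \<le> (\<Sum>n\<le>N. (31/32) ^ n * (2 * (real n + 1)) * window (h * (real n + 1)) (Delta1 h g) x)" for x
          using S0[of x] by (simp only: real_norm_def abs_of_nonneg S_def[symmetric] order_refl)
      qed (use h in auto)
      also have "\<dots> \<le> ennreal (2048 * C) * wnorm p w (Delta1 h g)"
      proof (intro mult_right_mono ennreal_leI)
        have "(\<Sum>n\<le>N. (31/32) ^ n * (2 * (real n + 1))) = 2 * (\<Sum>n\<le>N. (real n + 1) * (31/32 :: real) ^ n)"
          unfolding sum_distrib_left by (intro sum.cong refl) simp
        also have "\<dots> \<le> 2048"
        proof -
          have "0 \<le> (31/32::real) ^ Suc N * (32 * real N + 1056)" by simp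
          then have "(\<Sum>n\<le>N. (real n + 1) * (31/32 :: real) ^ n) \<le> 1024" unfolding weighted_geometric_sum by linarith
          then show ?thesis by linarith
        qed
        finally show "(\<Sum>n\<le>N. (31/32) ^ n * (2 * (real n + 1))) \<le> (2048 :: real)" .
      qed (use C_ge_1 in auto)
      finally show ?thesis .
    qed
    have "wnorm p w (\<lambda>x. g x - wmean h g x) \<le> wnorm p w (\<lambda>x. (norm (Delta1 h g x) + S x) + R x)"
    proof (rule wnorm_mono)
      fix x
      have "\<bar>g x - wmean h g x\<bar> \<le> (norm (Delta1 h g x) + S x) + R x"
        using wmean_error_pointwise[OF li h, of x N] by (simp add: S_def R_def a_def)
      then show "norm (g x - wmean h g x) \<le> norm ((norm (Delta1 h g x) + S x) + R x)"
        unfolding real_norm_def by (rule order_trans[OF _ abs_ge_self])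
    qed
    also have "\<dots> \<le> wnorm p w (\<lambda>x. norm (Delta1 h g x) + S x) + wnorm p w R"
      by (rule wnorm_triangle[OF borel_measurable_add[OF am Sm] Rm])
    also have "\<dots> \<le> (wnorm p w (Delta1 h g) + wnorm p w S) + wnorm p w R"
      using wnorm_triangle[OF am Sm] by (intro add_right_mono) (simp only: wnorm_norm)
    also have "\<dots> \<le> (wnorm p w (Delta1 h g) + ennreal (2048 * C) * wnorm p w (Delta1 h g)) + ennreal (a * C) * wnorm p w g"
      by (intro add_mono S R order_refl)
    also have "wnorm p w (Delta1 h g) + ennreal (2048 * C) * wnorm p w (Delta1 h g) = ennreal (1 + 2048 * C) * wnorm p w (Delta1 h g)"
      using C_ge_1 by (simp add: ennreal_plus distrib_right)
    also have "ennreal (a * C) * wnorm p w g = ennreal ((31/32) ^ N * (real N + 2) * (2 * C * G))"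
      unfolding G(1) a_def using C_ge_1 G(2) by (subst ennreal_mult[symmetric]) (auto simp: mult_ac)
    finally show ?thesis .
  qed
  show ?thesis
  proof (rule ennreal_le_epsilon)
    fix e :: real assume "0 < e"
    have "(\<lambda>N. (31/32) ^ N * (real N + 2) * (2 * C * G)) \<longlonglongrightarrow> 0 * (2 * C * G)"
      by (intro tendsto_mult weighted_geometric_limit tendsto_const)
    then have "\<forall>\<^sub>F N in sequentially. (31/32) ^ N * (real N + 2) * (2 * C * G) < e"
      by (rule order_tendstoD) (use \<open>0 < e\<close> in simp)
    then obtain N where "(31/32) ^ N * (real N + 2) * (2 * C * G) < e" by (auto simp: eventually_sequentially)
    then show "wnorm p w (\<lambda>x. g x - wmean h g x) \<le> ennreal (1 + 2048 * C) * wnorm p w (Delta1 h g) + ennreal e"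
      by (intro order_trans[OF step[of N]] add_left_mono ennreal_leI) simp
  qed
qed

end

section \<open>The K-functional and differences\<close>

lemma primitive_of_Delta:
  "primitive_of F f \<Longrightarrow> 0 < h \<Longrightarrow> primitive_of (Delta k h F) (Delta k h f)"
  by (induction k) (auto simp: Delta_0 Delta_Suc(1) primitive_of_Delta1)

lemma Delta_scaleR:
  fixes f :: "real \<Rightarrow> 'a::euclidean_space"
  assumes "loc_integrable f" "0 < h"
  shows "Delta k h (\<lambda>x. c *\<^sub>R f x) = (\<lambda>x. c *\<^sub>R Delta k h f x)"
  by (induction k) (simp_all add: Delta_0 Delta_Suc(1) Delta1_scaleR loc_integrable_Delta assms)

lemma Delta_add:
  assumes "loc_integrable f" "loc_integrable g" "0 < h"
  shows "Delta k h (\<lambda>x. f x + g x) = (\<lambda>x. Delta k h f x + Delta k h g x)"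
  by (induction k) (simp_all add: Delta_0 Delta_Suc(1) Delta1_add loc_integrable_Delta assms)

lemma loc_integrable_wmean_pow: "loc_integrable g \<Longrightarrow> 0 < h \<Longrightarrow> loc_integrable ((wmean h ^^ m) g)"
  by (induction m) (auto intro: loc_integrable_wmean)

lemma wmean_pow_add:
  assumes "loc_integrable f" "loc_integrable g" "0 < h"
  shows "(wmean h ^^ m) (\<lambda>x. f x + g x) = (\<lambda>x. (wmean h ^^ m) f x + (wmean h ^^ m) g x)"
proof (induction m)
  case (Suc m)
  show ?case
    using wmean_linear[OF loc_integrable_wmean_pow[OF assms(1,3), of m] loc_integrable_wmean_pow[OF assms(2,3), of m] assms(3), of 1]
    by (simp add: Suc)
qed simp

lemma wmean_pow_Delta1:
  assumes "loc_integrable g" "0 < h"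
  shows "(wmean h ^^ m) (Delta1 h g) = Delta1 h ((wmean h ^^ m) g)"
  by (induction m) (simp_all add: wmean_Delta1 loc_integrable_wmean_pow assms)

text \<open>
  The operator \<open>E = 1 - L\<^sup>r\<close>, where \<open>L\<close> is the weighted mean.
\<close>

definition wdefect :: "nat \<Rightarrow> real \<Rightarrow> (real \<Rightarrow> real) \<Rightarrow> real \<Rightarrow> real" where
  "wdefect r h g x = g x - (wmean h ^^ r) g x"

lemma loc_integrable_wdefect: "loc_integrable g \<Longrightarrow> 0 < h \<Longrightarrow> loc_integrable (wdefect r h g)"
  unfolding wdefect_def by (intro loc_integrable_diff loc_integrable_wmean_pow)

lemma loc_integrable_wdefect_pow: "loc_integrable g \<Longrightarrow> 0 < h \<Longrightarrow> loc_integrable ((wdefect r h ^^ m) g)"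
  by (induction m) (auto intro: loc_integrable_wdefect)

lemma wdefect_Delta1:
  assumes "loc_integrable g" "0 < h"
  shows "wdefect r h (Delta1 h g) = Delta1 h (wdefect r h g)"
proof -
  have "wdefect r h g = (\<lambda>x. g x - (wmean h ^^ r) g x)" by (simp add: wdefect_def fun_eq_iff)
  then show ?thesis
    by (simp only: Delta1_diff[OF assms(1) loc_integrable_wmean_pow[OF assms]]) (simp add: wdefect_def fun_eq_iff wmean_pow_Delta1 assms)
qed

lemma wdefect_pow_Delta1:
  assumes "loc_integrable g" "0 < h"
  shows "(wdefect r h ^^ m) (Delta1 h g) = Delta1 h ((wdefect r h ^^ m) g)"
  by (induction m) (simp_all add: wdefect_Delta1 loc_integrable_wdefect_pow assms)

lemma wdefect_pow_Delta:
  assumes "loc_integrable g" "0 < h"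
  shows "(wdefect r h ^^ m) (Delta k h g) = Delta k h ((wdefect r h ^^ m) g)"
  by (induction k) (simp_all add: Delta_0 Delta_Suc(1) wdefect_pow_Delta1 loc_integrable_Delta assms)

lemma primitive_of_has_derivative:
  fixes F f :: "real \<Rightarrow> 'a::euclidean_space"
  assumes F: "primitive_of F f" and f: "continuous_on UNIV f"
  shows "(F has_vector_derivative f x) (at x)"
proof -
  have "((\<lambda>u. integral {x - 1..u} f) has_vector_derivative f x) (at x within {x - 1..x + 1})"
    by (rule integral_has_vector_derivative[OF continuous_on_subset[OF f]]) auto
  then have "((\<lambda>u. integral {x - 1..u} f) has_vector_derivative f x) (at x)"
    by (subst (asm) at_within_interior) auto
  then have "((\<lambda>u. F (x - 1) + integral {x - 1..u} f) has_vector_derivative 0 + f x) (at x)"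
    by (intro has_vector_derivative_add has_vector_derivative_const)
  then have "((\<lambda>u. F (x - 1) + integral {x - 1..u} f) has_vector_derivative f x) (at x)" by simp
  then show ?thesis
  proof (rule has_vector_derivative_transform_within_open[of _ _ _ "{x - 1<..}"])
    fix u assume "u \<in> {x - 1<..}"
    then have "F u - F (x - 1) = integral {x - 1..u} f" using F by (simp add: primitive_of_def)
    then show "F (x - 1) + integral {x - 1..u} f = F u" by (simp add: algebra_simps)
  qed auto
qed

lemma ennreal_le_mult_iff:
  assumes "0 < c"
  shows "x \<le> ennreal c * y \<longleftrightarrow> ennreal (1 / c) * x \<le> y"
proof -
  have e: "ennreal c * (ennreal (1 / c) * z) = z" "ennreal (1 / c) * (ennreal c * z) = z" for z
    using assms by (simp_all add: mult.assoc[symmetric] ennreal_mult[symmetric])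
  show ?thesis
    using mult_left_mono[of x "ennreal c * y" "ennreal (1 / c)"] mult_left_mono[of "ennreal (1 / c) * x" y "ennreal c"]
    by (auto simp: e)
qed

context averaging
begin

text \<open>
  The converse of \<open>wW_primitives\<close>. The derivative of order \<open>r\<close> exists and equals \<open>U r\<close> only almost
  everywhere, which suffices for its measurability and its norm.
\<close>

lemma wW_of_primitives:
  fixes U :: "nat \<Rightarrow> real \<Rightarrow> real"
  assumes r: "1 \<le> r" and U: "\<And>k. k < r \<Longrightarrow> primitive_of (U k) (U (Suc k))" and U0: "U 0 \<in> wL p w" and Ur: "U r \<in> wL p w"
  shows "U 0 \<in> wW r p w" "wnorm p w (vderiv r (U 0)) = wnorm p w (U r)"
proof -
  have der: "(U k has_vector_derivative U (Suc k) x) (at x)" if "Suc k < r" for k x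
    by (rule primitive_of_has_derivative[OF U primitive_of_continuous[OF U]]) (use that in auto)
  have eq: "vderiv k (U 0) = U k" if "k < r" for k
    using that
  proof (induction k)
    case (Suc k)
    have "vderiv (Suc k) (U 0) = (\<lambda>x. vector_derivative (U k) (at x))" using Suc by (simp add: vderiv_Suc)
    also have "\<dots> = U (Suc k)" using der[OF Suc.prems] by (simp add: fun_eq_iff vector_derivative_at)
    finally show ?case .
  qed (simp add: vderiv_Suc)
  obtain s where s: "r = Suc s" using r by (cases r) auto
  have "AE x in lebesgue. (U s has_vector_derivative U (Suc s) x) (at x)"
    by (rule primitive_of_derivative_ae[OF U]) (simp add: s)
  then have ae: "AE x in lebesgue. U r x = vderiv r (U 0) x"
    by (rule eventually_mono) (simp add: s vderiv_Suc eq vector_derivative_at)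
  show n: "wnorm p w (vderiv r (U 0)) = wnorm p w (U r)"
    by (rule wnorm_cong_AE, rule eventually_mono[OF ae]) simp
  have "vderiv r (U 0) \<in> wL p w"
    unfolding wL_def
  proof (intro CollectI conjI)
    show "periodic_2pi (vderiv r (U 0))" using U0 by (intro periodic_vderiv) (simp add: wL_def)
    show "vderiv r (U 0) \<in> borel_measurable lebesgue" by (rule borel_measurable_AE[OF wL_measurable[OF Ur] ae])
    show "wnorm p w (vderiv r (U 0)) < \<infinity>" unfolding n using Ur by (simp add: wL_def)
  qed
  moreover have "abs_cont_on (- pi) pi (vderiv (r - 1) (U 0))"
    using primitive_of_abs_cont[OF U[of s]] by (simp add: s eq)
  moreover have "vderiv k (U 0) differentiable (at x)" if "k < r - 1" for k x
    using der[of k x] that eq[of k] by (auto simp: differentiableI_vector less_diff_conv)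
  ultimately show "U 0 \<in> wW r p w" using U0 by (simp add: wW_def)
qed

lemma wmean_pow_wL: "g \<in> wL p w \<Longrightarrow> 0 < h \<Longrightarrow> (wmean h ^^ m) g \<in> wL p w"
  by (induction m) (auto intro: wmean_wL)

lemma wnorm_wmean_pow:
  assumes "g \<in> wL p w" "0 < h"
  shows "wnorm p w ((wmean h ^^ m) g) \<le> ennreal ((4 * C) ^ m) * wnorm p w g"
proof (induction m)
  case (Suc m)
  have "wnorm p w ((wmean h ^^ Suc m) g) \<le> ennreal (4 * C) * wnorm p w ((wmean h ^^ m) g)"
    using wnorm_wmean[OF wmean_pow_wL[OF assms] assms(2)] by simp
  also have "\<dots> \<le> ennreal (4 * C) * (ennreal ((4 * C) ^ m) * wnorm p w g)"
    by (intro mult_left_mono Suc) auto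
  also have "\<dots> = ennreal ((4 * C) ^ Suc m) * wnorm p w g"
  proof -
    have "ennreal (4 * C) * ennreal ((4 * C) ^ m) = ennreal ((4 * C) ^ Suc m)"
      using C_ge_1 by (subst ennreal_mult[symmetric]) auto
    then show ?thesis by (simp only: mult.assoc[symmetric])
  qed
  finally show ?case .
qed simp

lemma wdefect_wL: "g \<in> wL p w \<Longrightarrow> 0 < h \<Longrightarrow> wdefect r h g \<in> wL p w"
  unfolding wdefect_def by (intro wL_diff wmean_pow_wL)

lemma wdefect_pow_wL: "g \<in> wL p w \<Longrightarrow> 0 < h \<Longrightarrow> (wdefect r h ^^ m) g \<in> wL p w"
  by (induction m) (auto intro: wdefect_wL)

text \<open>
  Factor \<open>1 - L\<^sup>r = (1 - L) (1 + L + \<dots> + L\<^sup>r\<^sup>-\<^sup>1)\<close> and apply \<open>wnorm_wmean_error\<close> to every \<open>L\<^sup>j g\<close>; powers of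
  \<open>L\<close> are bounded and commute with the difference.
\<close>

lemma wnorm_wdefect:
  "\<exists>K\<ge>0. \<forall>h>0. \<forall>g\<in>wL p w. wnorm p w (wdefect r h g) \<le> ennreal K * wnorm p w (Delta1 h g)"
proof (induction r)
  case 0
  show ?case by (rule exI[of _ 0]) (simp add: wdefect_def[abs_def])
next
  case (Suc r)
  then obtain K where "0 \<le> K" and K: "\<And>h g. 0 < h \<Longrightarrow> g \<in> wL p w \<Longrightarrow> wnorm p w (wdefect r h g) \<le> ennreal K * wnorm p w (Delta1 h g)"
    by blast
  let ?K = "K + (1 + 2048 * C) * (4 * C) ^ r"
  show ?case
  proof (intro exI[of _ ?K] conjI allI impI ballI)
    show "0 \<le> ?K" using \<open>0 \<le> K\<close> C_ge_1 by simp
    fix h :: real and g :: "real \<Rightarrow> real" assume h: "0 < h" and g: "g \<in> wL p w"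
    let ?z = "(wmean h ^^ r) g"
    have z: "?z \<in> wL p w" by (rule wmean_pow_wL[OF g h])
    have "wdefect (Suc r) h g = (\<lambda>x. wdefect r h g x + (?z x - wmean h ?z x))" by (simp add: wdefect_def fun_eq_iff)
    then have "wnorm p w (wdefect (Suc r) h g) \<le> wnorm p w (wdefect r h g) + wnorm p w (\<lambda>x. ?z x - wmean h ?z x)"
      using wnorm_triangle[OF wL_measurable[OF wdefect_wL[OF g h]] wL_measurable[OF wL_diff[OF z wmean_wL[OF z h]]]] by (simp only:)
    also have "wnorm p w (\<lambda>x. ?z x - wmean h ?z x) \<le> ennreal (1 + 2048 * C) * wnorm p w (Delta1 h ?z)" by (rule wnorm_wmean_error[OF z h])
    also have "wnorm p w (Delta1 h ?z) \<le> ennreal ((4 * C) ^ r) * wnorm p w (Delta1 h g)"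
      using wnorm_wmean_pow[OF Delta1_wL[OF g h] h, of r] by (simp only: wmean_pow_Delta1[OF wL_loc_integrable[OF g] h])
    also have "wnorm p w (wdefect r h g) \<le> ennreal K * wnorm p w (Delta1 h g)" by (rule K[OF h g])
    also have "ennreal K * wnorm p w (Delta1 h g) + ennreal (1 + 2048 * C) * (ennreal ((4 * C) ^ r) * wnorm p w (Delta1 h g))
      = ennreal ?K * wnorm p w (Delta1 h g)"
      using \<open>0 \<le> K\<close> C_ge_1 by (subst mult.assoc[symmetric], subst ennreal_mult[symmetric]) (auto simp: ennreal_plus distrib_right)
    finally show "wnorm p w (wdefect (Suc r) h g) \<le> ennreal ?K * wnorm p w (Delta1 h g)"
      by (simp add: add_left_mono add_right_mono mult_left_mono)
  qed
qed

lemma wnorm_wdefect_pow: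
  "\<exists>K\<ge>0. \<forall>h>0. \<forall>g\<in>wL p w. wnorm p w ((wdefect r h ^^ m) g) \<le> ennreal K * wnorm p w (Delta m h g)"
proof (induction m)
  case 0
  show ?case by (rule exI[of _ 1]) (simp add: Delta_0)
next
  case (Suc m)
  then obtain K where "0 \<le> K" and K: "\<And>h g. 0 < h \<Longrightarrow> g \<in> wL p w \<Longrightarrow> wnorm p w ((wdefect r h ^^ m) g) \<le> ennreal K * wnorm p w (Delta m h g)"
    by blast
  obtain L where "0 \<le> L" and L: "\<And>h g. 0 < h \<Longrightarrow> g \<in> wL p w \<Longrightarrow> wnorm p w (wdefect r h g) \<le> ennreal L * wnorm p w (Delta1 h g)"
    using wnorm_wdefect by blast
  show ?case
  proof (intro exI[of _ "L * K"] conjI allI impI ballI)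
    show "0 \<le> L * K" using \<open>0 \<le> K\<close> \<open>0 \<le> L\<close> by simp
    fix h :: real and g :: "real \<Rightarrow> real" assume h: "0 < h" and g: "g \<in> wL p w"
    have "wnorm p w ((wdefect r h ^^ Suc m) g) \<le> ennreal L * wnorm p w (Delta1 h ((wdefect r h ^^ m) g))"
      using L[OF h wdefect_pow_wL[OF g h]] by simp
    also have "\<dots> = ennreal L * wnorm p w ((wdefect r h ^^ m) (Delta1 h g))"
      by (simp only: wdefect_pow_Delta1[OF wL_loc_integrable[OF g] h])
    also have "\<dots> \<le> ennreal L * (ennreal K * wnorm p w (Delta m h (Delta1 h g)))"
      by (intro mult_left_mono K h Delta1_wL g) auto
    also have "\<dots> = ennreal (L * K) * wnorm p w (Delta (Suc m) h g)"
      using \<open>0 \<le> K\<close> \<open>0 \<le> L\<close> by (simp add: ennreal_mult mult.assoc Delta_Suc(2))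
    finally show "wnorm p w ((wdefect r h ^^ Suc m) g) \<le> ennreal (L * K) * wnorm p w (Delta (Suc m) h g)" .
  qed
qed

text \<open>
  \<open>1 - E\<^sup>m = L\<^sup>r (1 + E + \<dots> + E\<^sup>m\<^sup>-\<^sup>1)\<close>, with \<open>v\<close> the value of the last factor at \<open>g\<close>. Its differences
  of order \<open>r\<close> are controlled because \<open>E\<close> is bounded and commutes with differences.
\<close>

lemma wdefect_pow_remainder:
  "\<exists>K\<ge>0. \<forall>h>0. \<forall>g\<in>wL p w. \<exists>v\<in>wL p w. (\<forall>x. g x - (wdefect r h ^^ m) g x = (wmean h ^^ r) v x)
     \<and> wnorm p w (Delta r h v) \<le> ennreal K * wnorm p w (Delta r h g)"
proof (induction m)
  case 0
  show ?case
  proof (intro exI[of _ 0] conjI allI impI ballI bexI[of _ "\<lambda>x. 0"])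
    fix h :: real assume h: "0 < h"
    have D0: "Delta1 h (\<lambda>x. 0 :: real) = (\<lambda>x. 0)" by (simp add: fun_eq_iff Delta1_def steklov_const[OF h])
    have p0: "primitive_of (\<lambda>x. 0) (\<lambda>x. 0 :: real)" by (simp add: primitive_of_def loc_integrable_continuous)
    have "(wmean h ^^ r) (\<lambda>x. 0) = (\<lambda>x. 0)" by (induction r) (simp_all add: wmean_eq[OF p0 h] D0)
    then show "g x - (wdefect r h ^^ 0) g x = (wmean h ^^ r) (\<lambda>x. 0) x" for g x by simp
    have "Delta r h (\<lambda>x. 0 :: real) = (\<lambda>x. 0)" by (induction r) (simp_all add: Delta_0 Delta_Suc(1) D0)
    then show "wnorm p w (Delta r h (\<lambda>x. 0 :: real)) \<le> ennreal 0 * wnorm p w (Delta r h g)" for g :: "real \<Rightarrow> real" by simp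
    show "(\<lambda>x. 0 :: real) \<in> wL p w" by (simp add: wL_def periodic_2pi_def)
  qed simp
next
  case (Suc m)
  then obtain K where "0 \<le> K" and K: "\<And>h g. 0 < h \<Longrightarrow> g \<in> wL p w \<Longrightarrow> \<exists>v\<in>wL p w. (\<forall>x. g x - (wdefect r h ^^ m) g x = (wmean h ^^ r) v x)
     \<and> wnorm p w (Delta r h v) \<le> ennreal K * wnorm p w (Delta r h g)"
    by blast
  obtain L where "0 \<le> L" and L: "\<And>h g. 0 < h \<Longrightarrow> g \<in> wL p w \<Longrightarrow> wnorm p w ((wdefect r h ^^ m) g) \<le> ennreal L * wnorm p w (Delta m h g)"
    using wnorm_wdefect_pow by blast
  let ?L = "L * (2 * C + 1) ^ m"
  show ?case
  proof (intro exI[of _ "K + ?L"] conjI allI impI ballI)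
    show "0 \<le> K + ?L" using \<open>0 \<le> K\<close> \<open>0 \<le> L\<close> C_ge_1 by simp
    fix h :: real and g :: "real \<Rightarrow> real" assume h: "0 < h" and g: "g \<in> wL p w"
    from K[OF h g] obtain v where vL: "v \<in> wL p w" and v': "(\<forall>x. g x - (wdefect r h ^^ m) g x = (wmean h ^^ r) v x)
      \<and> wnorm p w (Delta r h v) \<le> ennreal K * wnorm p w (Delta r h g)" by (rule bexE)
    note v = vL conjunct1[OF v', rule_format] conjunct2[OF v']
    let ?e = "(wdefect r h ^^ m) g"
    have e: "?e \<in> wL p w" by (rule wdefect_pow_wL[OF g h])
    show "\<exists>v\<in>wL p w. (\<forall>x. g x - (wdefect r h ^^ Suc m) g x = (wmean h ^^ r) v x)
       \<and> wnorm p w (Delta r h v) \<le> ennreal (K + ?L) * wnorm p w (Delta r h g)"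
    proof (intro bexI[of _ "\<lambda>x. v x + ?e x"] conjI allI)
      show "(\<lambda>x. v x + ?e x) \<in> wL p w" by (intro wL_add v e)
      note li = wL_loc_integrable[OF v(1)] wL_loc_integrable[OF e] h
      show "g x - (wdefect r h ^^ Suc m) g x = (wmean h ^^ r) (\<lambda>x. v x + ?e x) x" for x
        unfolding wmean_pow_add[OF li] v(2)[symmetric] by (simp add: wdefect_def)
      have "wnorm p w (Delta r h ?e) = wnorm p w ((wdefect r h ^^ m) (Delta r h g))"
        by (simp only: wdefect_pow_Delta[OF wL_loc_integrable[OF g] h])
      also have "\<dots> \<le> ennreal L * wnorm p w (Delta m h (Delta r h g))" by (intro L h Delta_wL g)
      also have "\<dots> \<le> ennreal L * (ennreal ((2 * C + 1) ^ m) * wnorm p w (Delta r h g))"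
        by (intro mult_left_mono wnorm_Delta Delta_wL g h) auto
      also have "\<dots> = ennreal ?L * wnorm p w (Delta r h g)"
        using \<open>0 \<le> L\<close> C_ge_1 by (simp add: ennreal_mult mult.assoc)
      finally have "wnorm p w (Delta r h ?e) \<le> ennreal ?L * wnorm p w (Delta r h g)" .
      moreover have "wnorm p w (Delta r h (\<lambda>x. v x + ?e x)) \<le> wnorm p w (Delta r h v) + wnorm p w (Delta r h ?e)"
        unfolding Delta_add[OF li] by (intro wnorm_triangle wL_measurable Delta_wL v e h)
      ultimately have "wnorm p w (Delta r h (\<lambda>x. v x + ?e x)) \<le> ennreal K * wnorm p w (Delta r h g) + ennreal ?L * wnorm p w (Delta r h g)"
        using v(3) by (meson add_mono order_trans)
      then show "wnorm p w (Delta r h (\<lambda>x. v x + ?e x)) \<le> ennreal (K + ?L) * wnorm p w (Delta r h g)"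
        using \<open>0 \<le> K\<close> \<open>0 \<le> L\<close> C_ge_1 by (simp add: ennreal_plus distrib_right)
    qed
  qed
qed

text \<open>
  The competitor is \<open>L\<^sup>r v = g - E\<^sup>r g\<close>. Its derivative of order \<open>k\<close> is \<open>(2 / h)\<^sup>k \<Delta>\<^sub>h\<^sup>k L\<^sup>r\<^sup>-\<^sup>k v\<close>, as each
  weighted mean gains one derivative and turns into a difference.
\<close>

lemma Kfun_le_wnorm_Delta:
  assumes r: "1 \<le> r"
  shows "\<exists>K>0. \<forall>h>0. \<forall>g\<in>wL p w. Kfun r (g :: real \<Rightarrow> real) h p w \<le> ennreal K * wnorm p w (Delta r h g)"
proof -
  from wdefect_pow_remainder[of r r] obtain K where "0 \<le> K"
    and K: "\<forall>h>0. \<forall>g\<in>wL p w. \<exists>v\<in>wL p w. (\<forall>x. g x - (wdefect r h ^^ r) g x = (wmean h ^^ r) v x)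
      \<and> wnorm p w (Delta r h v) \<le> ennreal K * wnorm p w (Delta r h g)" by (elim exE conjE) (rule that)
  obtain L where "0 \<le> L" and L: "\<And>h g. 0 < h \<Longrightarrow> g \<in> wL p w \<Longrightarrow> wnorm p w ((wdefect r h ^^ r) g) \<le> ennreal L * wnorm p w (Delta r h g)"
    using wnorm_wdefect_pow by blast
  show ?thesis
  proof (intro exI[of _ "1 + (L + 2 ^ r * K)"] conjI allI impI ballI)
    show "0 < 1 + (L + 2 ^ r * K)" using \<open>0 \<le> K\<close> \<open>0 \<le> L\<close> by (simp add: add_pos_nonneg)
    fix h :: real and g :: "real \<Rightarrow> real" assume h: "0 < h" and g: "g \<in> wL p w"
    from K[rule_format, OF h g] obtain v where vL: "v \<in> wL p w" and v': "(\<forall>x. g x - (wdefect r h ^^ r) g x = (wmean h ^^ r) v x)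
      \<and> wnorm p w (Delta r h v) \<le> ennreal K * wnorm p w (Delta r h g)" by (rule bexE)
    note v = vL conjunct1[OF v', rule_format] conjunct2[OF v']
    define U where "U k = (\<lambda>x. (2 / h) ^ k *\<^sub>R Delta k h ((wmean h ^^ (r - k)) v) x)" for k
    have U0: "U 0 = (wmean h ^^ r) v" by (simp add: U_def Delta_0)
    have Ur: "U r = (\<lambda>x. (2 / h) ^ r *\<^sub>R Delta r h v x)" by (simp add: U_def)
    have prim: "primitive_of (U k) (U (Suc k))" if "k < r" for k
    proof -
      define z where "z = (wmean h ^^ (r - Suc k)) v"
      have z: "loc_integrable z" unfolding z_def by (rule loc_integrable_wmean_pow[OF wL_loc_integrable[OF v(1)] h])
      have s: "r - k = Suc (r - Suc k)" using that by simp
      have "primitive_of (Delta k h (wmean h z)) (Delta k h (\<lambda>x. (2 / h) *\<^sub>R Delta1 h z x))"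
        using primitive_of_Delta[OF primitive_of_wmean[OF z h] h] by simp
      then have P: "primitive_of (Delta k h (wmean h z)) (\<lambda>x. (2 / h) *\<^sub>R Delta k h (Delta1 h z) x)"
        by (simp only: Delta_scaleR[OF loc_integrable_Delta1[OF z h] h])
      have "primitive_of (\<lambda>x. (2 / h) ^ k *\<^sub>R Delta k h (wmean h z) x + 0 *\<^sub>R Delta k h (wmean h z) x)
          (\<lambda>x. (2 / h) ^ k *\<^sub>R ((2 / h) *\<^sub>R Delta k h (Delta1 h z) x) + 0 *\<^sub>R ((2 / h) *\<^sub>R Delta k h (Delta1 h z) x))"
        by (rule primitive_of_linear[OF P P])
      moreover have "U k = (\<lambda>x. (2 / h) ^ k *\<^sub>R Delta k h (wmean h z) x)" by (simp add: U_def s z_def)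
      moreover have "U (Suc k) = (\<lambda>x. (2 / h) ^ k *\<^sub>R ((2 / h) *\<^sub>R Delta k h (Delta1 h z) x))"
        by (simp add: U_def z_def Delta_Suc(2) mult_ac)
      ultimately show ?thesis by simp
    qed
    have U0L: "U 0 \<in> wL p w" unfolding U0 by (rule wmean_pow_wL[OF v(1) h])
    have UrL: "U r \<in> wL p w" unfolding Ur by (rule wL_scaleR[OF Delta_wL[OF v(1) h]])
    have W: "U 0 \<in> wW r p w" "wnorm p w (vderiv r (U 0)) = wnorm p w (U r)"
      by (rule wW_of_primitives[OF r _ U0L UrL], erule prim)+
    have "Kfun r g h p w \<le> wnorm p w (\<lambda>x. g x - U 0 x) + ennreal (h ^ r) * wnorm p w (vderiv r (U 0))"
      unfolding Kfun_def by (rule INF_lower[OF W(1)])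
    also have "(\<lambda>x. g x - U 0 x) = (wdefect r h ^^ r) g" using v(2) by (simp add: fun_eq_iff U0 algebra_simps)
    also have "wnorm p w ((wdefect r h ^^ r) g) \<le> ennreal L * wnorm p w (Delta r h g)" by (rule L[OF h g])
    also have "ennreal (h ^ r) * wnorm p w (vderiv r (U 0)) = ennreal (2 ^ r) * wnorm p w (Delta r h v)"
    proof -
      have 1: "wnorm p w (U r) = ennreal ((2 / h) ^ r) * wnorm p w (Delta r h v)"
        unfolding Ur wnorm_scale using h by simp
      have 2: "ennreal (h ^ r) * ennreal ((2 / h) ^ r) = ennreal (2 ^ r)"
        using h by (subst ennreal_mult[symmetric]) (auto simp: power_mult_distrib[symmetric])
      have "ennreal (h ^ r) * wnorm p w (vderiv r (U 0)) = ennreal (h ^ r) * (ennreal ((2 / h) ^ r) * wnorm p w (Delta r h v))"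
        unfolding W(2) by (simp only: 1)
      also have "\<dots> = ennreal (2 ^ r) * wnorm p w (Delta r h v)" unfolding mult.assoc[symmetric] 2 ..
      finally show ?thesis .
    qed
    also have "wnorm p w (Delta r h v) \<le> ennreal K * wnorm p w (Delta r h g)" by (rule v(3))
    also have "ennreal L * wnorm p w (Delta r h g) + ennreal (2 ^ r) * (ennreal K * wnorm p w (Delta r h g))
        = ennreal (L + 2 ^ r * K) * wnorm p w (Delta r h g)"
      using \<open>0 \<le> K\<close> \<open>0 \<le> L\<close> by (simp add: ennreal_plus ennreal_mult distrib_right mult.assoc)
    also have "\<dots> \<le> ennreal (1 + (L + 2 ^ r * K)) * wnorm p w (Delta r h g)"
      by (intro mult_right_mono ennreal_leI) auto
    finally show "Kfun r g h p w \<le> \<dots>" by (simp add: add_left_mono add_right_mono mult_left_mono)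
  qed
qed

lemma wnorm_Delta_wW:
  fixes f :: "real \<Rightarrow> 'a::euclidean_space"
  assumes f: "f \<in> wW r p w" and h: "0 < h"
  shows "wnorm p w (Delta r h f) \<le> ennreal ((2 * C * h) ^ r) * wnorm p w (vderiv r f)"
proof -
  have "vderiv r f \<in> wL p w" using f by (simp add: wW_def)
  from wnorm_Delta_chain[of r "\<lambda>k. vderiv k f", OF wW_primitives[OF f] this h]
  show ?thesis by (simp add: vderiv_Suc)
qed

text \<open>
  For a competitor \<open>u\<close> the differences of \<open>g - u\<close> are bounded by its norm, those of \<open>u\<close> by its
  derivative.
\<close>

lemma wnorm_Delta_le_Kfun:
  fixes g :: "real \<Rightarrow> 'a::euclidean_space"
  assumes g: "g \<in> wL p w" and h: "0 < h"
  shows "wnorm p w (Delta r h g) \<le> ennreal ((2 * C + 1) ^ r) * Kfun r g h p w"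
proof -
  have pos: "0 < (2 * C + 1) ^ r" using C_ge_1 by simp
  show ?thesis
    unfolding ennreal_le_mult_iff[OF pos] Kfun_def
  proof (rule INF_greatest)
    fix u :: "real \<Rightarrow> 'a" assume u: "u \<in> wW r p w"
    then have uL: "u \<in> wL p w" by (simp add: wW_def)
    have gu: "(\<lambda>x. g x - u x) \<in> wL p w" by (rule wL_diff[OF g uL])
    have "g = (\<lambda>x. (g x - u x) + u x)" by simp
    then have "Delta r h g = (\<lambda>x. Delta r h (\<lambda>x. g x - u x) x + Delta r h u x)"
      using Delta_add[OF wL_loc_integrable[OF gu] wL_loc_integrable[OF uL] h, of r] by simp
    then have "wnorm p w (Delta r h g) \<le> wnorm p w (Delta r h (\<lambda>x. g x - u x)) + wnorm p w (Delta r h u)"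
      using wnorm_triangle[OF wL_measurable[OF Delta_wL[OF gu h, of r]] wL_measurable[OF Delta_wL[OF uL h, of r]]] by (simp only:)
    also have "wnorm p w (Delta r h (\<lambda>x. g x - u x)) \<le> ennreal ((2 * C + 1) ^ r) * wnorm p w (\<lambda>x. g x - u x)"
      by (rule wnorm_Delta[OF gu h])
    also have "wnorm p w (Delta r h u) \<le> ennreal ((2 * C * h) ^ r) * wnorm p w (vderiv r u)"
      by (rule wnorm_Delta_wW[OF u h])
    also have "ennreal ((2 * C * h) ^ r) * wnorm p w (vderiv r u) \<le> ennreal ((2 * C + 1) ^ r) * (ennreal (h ^ r) * wnorm p w (vderiv r u))"
    proof -
      have "(2 * C * h) ^ r \<le> (2 * C + 1) ^ r * h ^ r"
        unfolding power_mult_distrib[symmetric] using C_ge_1 h by (intro power_mono mult_right_mono) auto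
      then have "ennreal ((2 * C * h) ^ r) \<le> ennreal ((2 * C + 1) ^ r) * ennreal (h ^ r)"
        using C_ge_1 h by (subst ennreal_mult[symmetric]) (auto intro: ennreal_leI)
      then show ?thesis by (simp only: mult.assoc[symmetric]) (rule mult_right_mono, auto)
    qed
    also have "ennreal ((2 * C + 1) ^ r) * wnorm p w (\<lambda>x. g x - u x) + ennreal ((2 * C + 1) ^ r) * (ennreal (h ^ r) * wnorm p w (vderiv r u))
       = ennreal ((2 * C + 1) ^ r) * (wnorm p w (\<lambda>x. g x - u x) + ennreal (h ^ r) * wnorm p w (vderiv r u))"
      by (simp only: distrib_left)
    finally show "ennreal (1 / (2 * C + 1) ^ r) * wnorm p w (Delta r h g) \<le> wnorm p w (\<lambda>x. g x - u x) + ennreal (h ^ r) * wnorm p w (vderiv r u)"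
      unfolding ennreal_le_mult_iff[OF pos, symmetric] by (simp add: add_left_mono add_right_mono)
  qed
qed

end

section \<open>A Fejer kernel for the derivative of trigonometric polynomials\<close>

lemma has_vector_derivative_cis_linear:
  "((\<lambda>x. c * cis (a * x)) has_vector_derivative \<i> * of_real a * c * cis (a * x)) (at x within A)"
proof -
  have "((\<lambda>x. a * x) has_derivative (\<lambda>t. a * t)) (at x within A)" by (auto intro!: derivative_eq_intros)
  from has_derivative_mult_right[OF has_derivative_cis[OF this], of c]
  show ?thesis
    unfolding has_vector_derivative_def
    by (rule has_derivative_eq_rhs) (auto simp: fun_eq_iff scaleR_conv_of_real)
qed

lemma has_integral_cis_int:
  "((\<lambda>t. cis (of_int k * t)) has_integral (if k = 0 then 2 * of_real pi else 0)) {-pi..pi}"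
proof (cases "k = 0")
  case True
  then show ?thesis using has_integral_const_real[of "1::complex" "-pi" pi] by (simp add: scaleR_conv_of_real)
next
  case False
  have "((\<lambda>t. cis (of_int k * t)) has_integral (1 / (\<i> * of_int k)) * cis (of_int k * pi) - (1 / (\<i> * of_int k)) * cis (of_int k * (-pi))) {-pi..pi}"
  proof (rule fundamental_theorem_of_calculus)
    fix x :: real
    show "((\<lambda>x. (1 / (\<i> * of_int k)) * cis (of_int k * x)) has_vector_derivative cis (of_int k * x)) (at x within {-pi..pi})"
      using has_vector_derivative_cis_linear[of "1 / (\<i> * of_int k)" "of_int k" x "{-pi..pi}"] False by simp
  qed simp
  moreover have "cis (of_int k * pi) = cis (of_int k * (-pi))"
    by (simp add: complex_eq_iff sin_times_pi_eq_0)
  ultimately show ?thesis using False by simp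
qed

definition exp_sum :: "nat \<Rightarrow> real \<Rightarrow> complex" where
  "exp_sum m t = (\<Sum>j<m. cis (real j * t))"

text \<open>
  This is \<open>2 m sin (m t)\<close> times the Fejer kernel \<open>\<bar>exp_sum m t\<bar>\<^sup>2 / m\<close>. The modulation by \<open>sin (m t)\<close>
  moves the triangular Fourier coefficients of the Fejer kernel so that they equal a multiple of \<open>k\<close> for \<open>\<bar>k\<bar> \<le> m\<close>.
\<close>

definition fejer_kernel :: "nat \<Rightarrow> real \<Rightarrow> complex" where
  "fejer_kernel m t = 2 * of_real (sin (real m * t)) * (exp_sum m t * cnj (exp_sum m t))"

text \<open>
  The Fourier coefficients of \<open>\<bar>exp_sum m t\<bar>\<^sup>2\<close>.
\<close>

lemma count_shifted_pairs:
  "(\<Sum>j<m. \<Sum>l<m. if d + int j - int l = 0 then 1 else 0 :: complex) = of_int (max 0 (int m - \<bar>d\<bar>))"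
proof -
  have inner: "(\<Sum>l<m. if d + int j - int l = 0 then 1 else 0 :: complex) = (if j \<in> {nat (- d)..<nat (int m - d)} then 1 else 0)" for j
  proof -
    have "(\<Sum>l<m. if d + int j - int l = 0 then 1 else 0 :: complex) = (\<Sum>l<m. if nat (d + int j) = l then (if 0 \<le> d + int j then 1 else 0) else 0)"
      by (intro sum.cong) auto
    also have "\<dots> = (if nat (d + int j) < m \<and> 0 \<le> d + int j then 1 else 0)" by (simp add: sum.delta)
    also have "(nat (d + int j) < m \<and> 0 \<le> d + int j) = (j \<in> {nat (- d)..<nat (int m - d)})" by auto
    finally show ?thesis .
  qed
  have "(\<Sum>j<m. \<Sum>l<m. if d + int j - int l = 0 then 1 else 0 :: complex) = of_nat (card ({..<m} \<inter> {nat (- d)..<nat (int m - d)}))"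
    unfolding inner by (simp only: sum.If_cases finite_lessThan Collect_mem_eq) simp
  also have "{..<m} \<inter> {nat (- d)..<nat (int m - d)} = {nat (- d)..<min m (nat (int m - d))}" by auto
  also have "of_nat (card \<dots>) = (of_int (int (min m (nat (int m - d)) - nat (- d))) :: complex)" by simp
  also have "int (min m (nat (int m - d)) - nat (- d)) = max 0 (int m - \<bar>d\<bar>)" by auto
  finally show ?thesis .
qed

text \<open>
  Two shifted triangles are subtracted: for \<open>\<bar>k\<bar> \<le> m\<close> the numbers \<open>max 0 (m - \<bar>k + m\<bar>)\<close> and
  \<open>max 0 (m - \<bar>k - m\<bar>)\<close> differ by \<open>k\<close>.
\<close>

lemma has_integral_cis_fejer_kernel:
  assumes "\<bar>k\<bar> \<le> int m"
  shows "((\<lambda>t. cis (of_int k * t) * fejer_kernel m t) has_integral 2 * of_real pi * \<i> * of_int k) {-pi..pi}"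
proof -
  let ?e = "\<lambda>d j l t. cis (of_int (d + int j - int l) * t)"
  have two_sin: "2 * of_real (sin a) = - \<i> * (cis a - cis (- a))" for a by (simp add: complex_eq_iff)
  have sq: "exp_sum m t * cnj (exp_sum m t) = (\<Sum>j<m. \<Sum>l<m. cis (real j * t) * cis (- (real l * t)))" for t
    by (simp add: exp_sum_def sum_product cis_cnj)
  have eq: "cis (of_int k * t) * fejer_kernel m t
    = - \<i> * ((\<Sum>j<m. \<Sum>l<m. ?e (k + int m) j l t) - (\<Sum>j<m. \<Sum>l<m. ?e (k - int m) j l t))" for t
  proof -
    have 1: "cis (of_int k * t) * cis (real m * t) * (cis (real j * t) * cis (- (real l * t))) = ?e (k + int m) j l t" for j l
      by (simp add: cis_mult algebra_simps)
    have 2: "cis (of_int k * t) * cis (- (real m * t)) * (cis (real j * t) * cis (- (real l * t))) = ?e (k - int m) j l t" for j l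
      by (simp add: cis_mult algebra_simps)
    have "cis (of_int k * t) * fejer_kernel m t
      = - \<i> * (cis (of_int k * t) * cis (real m * t) * (\<Sum>j<m. \<Sum>l<m. cis (real j * t) * cis (- (real l * t)))
        - cis (of_int k * t) * cis (- (real m * t)) * (\<Sum>j<m. \<Sum>l<m. cis (real j * t) * cis (- (real l * t))))"
      unfolding fejer_kernel_def two_sin sq by (simp add: algebra_simps)
    then show ?thesis by (simp only: sum_distrib_left 1 2)
  qed
  have I: "((\<lambda>t. \<Sum>j<m. \<Sum>l<m. ?e d j l t) has_integral 2 * of_real pi * of_int (max 0 (int m - \<bar>d\<bar>))) {-pi..pi}" for d
  proof -
    have "((\<lambda>t. \<Sum>j<m. \<Sum>l<m. ?e d j l t) has_integral (\<Sum>j<m. \<Sum>l<m. if d + int j - int l = 0 then 2 * of_real pi else 0)) {-pi..pi}"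
      by (intro has_integral_sum finite_lessThan has_integral_cis_int)
    also have "(\<Sum>j<m. \<Sum>l<m. if d + int j - int l = 0 then 2 * of_real pi else 0 :: complex)
      = 2 * of_real pi * (\<Sum>j<m. \<Sum>l<m. if d + int j - int l = 0 then 1 else 0)"
      unfolding sum_distrib_left by (intro sum.cong) auto
    finally show ?thesis by (simp only: count_shifted_pairs)
  qed
  have "max 0 (int m - \<bar>k + int m\<bar>) - max 0 (int m - \<bar>k - int m\<bar>) = - k" using assms by auto
  then have "(of_int (max 0 (int m - \<bar>k + int m\<bar>)) - of_int (max 0 (int m - \<bar>k - int m\<bar>)) :: complex) = - of_int k"
    by (metis of_int_diff of_int_minus)
  then have "- \<i> * (2 * of_real pi * of_int (max 0 (int m - \<bar>k + int m\<bar>)) - 2 * of_real pi * of_int (max 0 (int m - \<bar>k - int m\<bar>)))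
      = 2 * of_real pi * \<i> * of_int k"
    unfolding right_diff_distrib[symmetric] by simp
  moreover have "((\<lambda>t. cis (of_int k * t) * fejer_kernel m t) has_integral
     - \<i> * (2 * of_real pi * of_int (max 0 (int m - \<bar>k + int m\<bar>)) - 2 * of_real pi * of_int (max 0 (int m - \<bar>k - int m\<bar>)))) {-pi..pi}"
    unfolding eq by (intro has_integral_mult_right has_integral_diff I)
  ultimately show ?thesis by (simp only:)
qed

text \<open>
  A cheap substitute for Jordan's inequality: \<open>sin x = 2 sin y cos y\<close> with \<open>y = x / 2 \<le> pi / 4\<close>, where
  \<open>cos \<ge> sqrt 2 / 2\<close> and hence \<open>sin y \<ge> y sqrt 2 / 2\<close>.
\<close>

lemma half_le_sin:
  assumes "0 \<le> x" "x \<le> pi / 2" shows "x / 2 \<le> sin x"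
proof (cases "x = 0")
  case False
  define y where "y = x / 2"
  have y: "0 < y" "y \<le> pi / 4" using assms False by (auto simp: y_def)
  have c: "sqrt 2 / 2 \<le> cos z" if "0 \<le> z" "z \<le> pi / 4" for z
    using cos_monotone_0_pi_le[of z "pi / 4"] that by (simp add: cos_45)
  obtain z where z: "0 < z" "z < y" "sin y - sin 0 = (y - 0) * cos z"
    using MVT2[of 0 y sin cos] y by auto
  have "y * (sqrt 2 / 2) \<le> sin y" using z c[of z] y by (auto intro!: mult_left_mono)
  then have "2 * ((y * (sqrt 2 / 2)) * (sqrt 2 / 2)) \<le> 2 * (sin y * cos y)"
    using c[of y] y sin_ge_zero[of y] by (intro mult_left_mono mult_mono) auto
  also have "2 * ((y * (sqrt 2 / 2)) * (sqrt 2 / 2)) = y" by simp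
  also have "2 * (sin y * cos y) = sin x" using sin_double[of y] by (simp add: y_def)
  finally show ?thesis by (simp add: y_def)
qed auto

lemma norm_one_minus_cis_ge:
  assumes "\<bar>t\<bar> \<le> pi" shows "\<bar>t\<bar> / 2 \<le> norm (1 - cis t)"
proof -
  have "cmod (1 - cis t) ^ 2 = (2 * sin (\<bar>t\<bar> / 2)) ^ 2"
  proof -
    have "cmod (1 - cis t) ^ 2 = (1 - cos t)\<^sup>2 + (sin t)\<^sup>2" by (simp add: cmod_power2)
    also have "\<dots> = 2 - 2 * cos \<bar>t\<bar>" by (simp add: sin_squared_eq power2_eq_square algebra_simps)
    also have "cos \<bar>t\<bar> = 1 - 2 * (sin (\<bar>t\<bar> / 2))\<^sup>2" using cos_double_sin[of "\<bar>t\<bar> / 2"] by simp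
    finally show ?thesis by (simp add: power2_eq_square)
  qed
  moreover have "\<bar>t\<bar> / 2 / 2 \<le> sin (\<bar>t\<bar> / 2)" by (rule half_le_sin) (use assms in auto)
  ultimately have "(\<bar>t\<bar> / 2)\<^sup>2 \<le> cmod (1 - cis t) ^ 2"
    by (simp only:) (rule power_mono, auto)
  then show ?thesis by (rule power2_le_imp_le) simp
qed

lemma norm_exp_sum_le: "norm (exp_sum m t) \<le> real m"
proof -
  have "norm (exp_sum m t) \<le> (\<Sum>j<m. norm (cis (real j * t)))" unfolding exp_sum_def by (rule norm_sum)
  then show ?thesis by simp
qed

lemma norm_exp_sum_le_inverse:
  assumes "\<bar>t\<bar> \<le> pi" shows "norm (exp_sum m t) * \<bar>t\<bar> \<le> 4"
proof -
  have "exp_sum m t = (\<Sum>j<m. cis t ^ j)" unfolding exp_sum_def by (rule sum.cong) (simp_all add: Complex.DeMoivre)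
  then have "(1 - cis t) * exp_sum m t = 1 - cis t ^ m" by (simp only: one_diff_power_eq)
  then have "norm (1 - cis t) * norm (exp_sum m t) = norm (1 - cis t ^ m)" by (simp flip: norm_mult)
  also have "\<dots> \<le> 2" using norm_triangle_ineq4[of 1 "cis t ^ m"] by (simp add: norm_power)
  finally have "norm (1 - cis t) * norm (exp_sum m t) \<le> 2" .
  moreover have "\<bar>t\<bar> / 2 * norm (exp_sum m t) \<le> norm (1 - cis t) * norm (exp_sum m t)"
    by (rule mult_right_mono[OF norm_one_minus_cis_ge[OF assms]]) simp
  ultimately show ?thesis by (simp add: mult.commute)
qed

text \<open>
  The kernel is at most \<open>2 m\<^sup>2\<close> everywhere and at most \<open>32 / t\<^sup>2\<close>. Splitting \<open>{-pi..pi}\<close> into dyadic shells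
  around 0 turns this into a combination of indicators of intervals centred at 0; the bound for the
  innermost interval containing \<open>t\<close> is enough.
\<close>

lemma norm_fejer_kernel_le:
  assumes t: "\<bar>t\<bar> \<le> pi" and m: "1 \<le> m"
  shows "norm (fejer_kernel m t) \<le> (\<Sum>k\<le>m. if \<bar>t\<bar> \<le> 2 ^ k * (pi / real m) then 32 * (real m)\<^sup>2 / 4 ^ k else 0)"
proof -
  have "real m \<le> 2 ^ m" using less_exp[of m] by (metis less_imp_le of_nat_less_numeral_power_cancel_iff less_eq_real_def)
  then have "\<bar>t\<bar> \<le> 2 ^ m * (pi / real m)"
    using t m by (intro order_trans[OF t]) (simp add: field_simps)
  then have ex: "\<exists>k. \<bar>t\<bar> \<le> 2 ^ k * (pi / real m)" by blast
  define k where "k = (LEAST k. \<bar>t\<bar> \<le> 2 ^ k * (pi / real m))"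
  have k: "\<bar>t\<bar> \<le> 2 ^ k * (pi / real m)" unfolding k_def by (rule LeastI_ex[OF ex])
  have km: "k \<le> m" unfolding k_def by (rule Least_le) fact
  have b: "(norm (exp_sum m t))\<^sup>2 \<le> 16 * (real m)\<^sup>2 / 4 ^ k"
  proof (cases k)
    case 0
    have "(norm (exp_sum m t))\<^sup>2 \<le> (real m)\<^sup>2" by (rule power_mono[OF norm_exp_sum_le]) simp
    also have "\<dots> \<le> 16 * (real m)\<^sup>2" by simp
    finally show ?thesis using 0 by simp
  next
    case (Suc i)
    have "\<not> \<bar>t\<bar> \<le> 2 ^ i * (pi / real m)" using not_less_Least[of i "\<lambda>k. \<bar>t\<bar> \<le> 2 ^ k * (pi / real m)"] Suc by (simp add: k_def)
    moreover have "2 ^ i * (2 / real m) \<le> 2 ^ i * (pi / real m)"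
      using pi_ge_two by (intro mult_left_mono divide_right_mono) auto
    ultimately have t2: "2 ^ i * (2 / real m) \<le> \<bar>t\<bar>" by linarith
    have "norm (exp_sum m t) * (2 ^ i * (2 / real m)) \<le> norm (exp_sum m t) * \<bar>t\<bar>"
      by (rule mult_left_mono[OF t2]) simp
    also have "\<dots> \<le> 4" by (rule norm_exp_sum_le_inverse[OF t])
    finally have "norm (exp_sum m t) \<le> 4 * real m / 2 ^ k" using m by (simp add: Suc field_simps)
    then have "(norm (exp_sum m t))\<^sup>2 \<le> (4 * real m / 2 ^ k)\<^sup>2" by (rule power_mono) simp
    also have "\<dots> = 16 * (real m)\<^sup>2 / 4 ^ k"
      by (simp add: power_divide power_mult_distrib power_mult[symmetric] mult.commute[of k]) (simp add: power_mult)
    finally show ?thesis .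
  qed
  have "norm (fejer_kernel m t) = 2 * \<bar>sin (real m * t)\<bar> * (norm (exp_sum m t))\<^sup>2"
    by (simp add: fejer_kernel_def norm_mult power2_eq_square)
  also have "\<dots> \<le> 2 * 1 * (16 * (real m)\<^sup>2 / 4 ^ k)" using b by (intro mult_mono) auto
  also have "\<dots> = (if \<bar>t\<bar> \<le> 2 ^ k * (pi / real m) then 32 * (real m)\<^sup>2 / 4 ^ k else 0)" using k by simp
  also have "\<dots> \<le> (\<Sum>k\<le>m. if \<bar>t\<bar> \<le> 2 ^ k * (pi / real m) then 32 * (real m)\<^sup>2 / 4 ^ k else 0)"
    by (rule member_le_sum) (use km in auto)
  finally show ?thesis .
qed

section \<open>Bernstein's inequality and the derivatives of trigonometric polynomials\<close>

lemma trig_polys_continuous: "T \<in> trig_polys n \<Longrightarrow> continuous_on A T"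
  by (auto simp: trig_polys_def intro!: continuous_intros)

lemma trig_polys_loc_integrable: "T \<in> trig_polys n \<Longrightarrow> loc_integrable T"
  by (rule loc_integrable_continuous) (rule trig_polys_continuous)

lemma trig_polys_periodic: "T \<in> trig_polys n \<Longrightarrow> periodic_2pi T"
proof -
  have "cis (of_int k * (x + 2 * pi)) = cis (of_int k * x)" for k x
  proof -
    have "cis (of_int k * (x + 2 * pi)) = cis (of_int k * x) * cis (2 * pi * of_int k)"
      by (simp add: cis_mult algebra_simps)
    then show ?thesis by simp
  qed
  then show "T \<in> trig_polys n \<Longrightarrow> periodic_2pi T" by (auto simp: trig_polys_def periodic_2pi_def)
qed

lemma trig_polys_derivative:
  assumes "T \<in> trig_polys n"
  shows "(\<lambda>x. vector_derivative T (at x)) \<in> trig_polys n"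
    "(T has_vector_derivative vector_derivative T (at x)) (at x)"
    "primitive_of T (\<lambda>x. vector_derivative T (at x))"
proof -
  obtain c where T: "T = (\<lambda>x. \<Sum>k\<in>{- int n..int n}. c k * cis (of_int k * x))"
    using assms by (auto simp: trig_polys_def)
  have d: "(T has_vector_derivative (\<Sum>k\<in>{- int n..int n}. \<i> * of_int k * c k * cis (of_int k * x))) (at x)" for x
    unfolding T using has_vector_derivative_cis_linear[of _ "of_int _"]
    by (intro has_vector_derivative_sum) simp
  then have eq: "vector_derivative T (at x) = (\<Sum>k\<in>{- int n..int n}. \<i> * of_int k * c k * cis (of_int k * x))" for x
    by (rule vector_derivative_at)
  show T': "(\<lambda>x. vector_derivative T (at x)) \<in> trig_polys n"
    unfolding trig_polys_def by (intro CollectI exI[of _ "\<lambda>k. \<i> * of_int k * c k"]) (simp add: eq)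
  show der: "(T has_vector_derivative vector_derivative T (at x)) (at x)" for x using d[of x] by (simp only: eq)
  show "primitive_of T (\<lambda>x. vector_derivative T (at x))"
    unfolding primitive_of_def
  proof (intro conjI allI impI)
    show "loc_integrable (\<lambda>x. vector_derivative T (at x))" by (rule trig_polys_loc_integrable[OF T'])
    fix x y :: real assume "x \<le> y"
    then have "((\<lambda>x. vector_derivative T (at x)) has_integral T y - T x) {x..y}"
      by (intro fundamental_theorem_of_calculus has_vector_derivative_at_within[OF der])
    then show "T y - T x = integral {x..y} (\<lambda>x. vector_derivative T (at x))" by (simp add: integral_unique)
  qed
qed

text \<open>
  Means multiply \<open>cis (k x)\<close> by a constant \<open>\<mu> k\<close>, so they preserve the degree.
\<close>

lemma trig_polys_Delta1:
  assumes "T \<in> trig_polys n" "0 < h" shows "Delta1 h T \<in> trig_polys n"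
proof -
  obtain c where T: "T = (\<lambda>x. \<Sum>k\<in>{- int n..int n}. c k * cis (of_int k * x))"
    using assms by (auto simp: trig_polys_def)
  define \<mu> where "\<mu> k = (1 / h) *\<^sub>R integral {0..h} (\<lambda>t. cis (of_int k * t))" for k :: int
  have I: "((\<lambda>t. cis (of_int k * t)) has_integral cis (of_int k * x) * (h *\<^sub>R \<mu> k)) {x..x + h}" for k x
  proof -
    have i: "(\<lambda>t. cis (of_int k * t)) integrable_on {a..b}" for a b
      by (intro integrable_continuous_real continuous_intros)
    have "integral {x..x + h} (\<lambda>t. cis (of_int k * t)) = integral {0..h} (\<lambda>t. cis (of_int k * (t + x)))"
      using integral_shift_real_ivl[of x x "x + h" "\<lambda>t. cis (of_int k * t)"] by simp
    also have "\<dots> = integral {0..h} (\<lambda>t. cis (of_int k * x) * cis (of_int k * t))"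
      by (simp add: cis_mult algebra_simps)
    also have "\<dots> = cis (of_int k * x) * integral {0..h} (\<lambda>t. cis (of_int k * t))" by (rule integral_mult_right)
    finally show ?thesis using integrable_integral[OF i, of x "x + h"] assms(2) by (simp add: \<mu>_def)
  qed
  have "Delta1 h T x = (\<Sum>k\<in>{- int n..int n}. (c k * \<mu> k - c k) * cis (of_int k * x))" for x
  proof -
    have "(T has_integral (\<Sum>k\<in>{- int n..int n}. c k * (cis (of_int k * x) * (h *\<^sub>R \<mu> k)))) {x..x + h}"
      unfolding T by (intro has_integral_sum has_integral_mult_right I) simp
    then have "steklov h T x = (\<Sum>k\<in>{- int n..int n}. c k * \<mu> k * cis (of_int k * x))"
      using assms(2) by (simp add: steklov_eq[OF trig_polys_loc_integrable[OF assms(1)]] integral_unique scaleR_sum_right mult_ac)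
    then show ?thesis by (simp add: Delta1_def T sum_subtractf left_diff_distrib)
  qed
  then show ?thesis
    unfolding trig_polys_def by (intro CollectI exI[of _ "\<lambda>k. c k * \<mu> k - c k"]) (simp add: fun_eq_iff)
qed

lemma vector_derivative_Delta1:
  assumes "T \<in> trig_polys n" "0 < h"
  shows "(\<lambda>x. vector_derivative (Delta1 h T) (at x)) = Delta1 h (\<lambda>x. vector_derivative T (at x))"
proof
  fix x
  have "continuous_on UNIV (Delta1 h (\<lambda>x. vector_derivative T (at x)))"
    by (rule trig_polys_continuous[OF trig_polys_Delta1[OF trig_polys_derivative(1)[OF assms(1)] assms(2)]])
  from primitive_of_has_derivative[OF primitive_of_Delta1[OF trig_polys_derivative(3)[OF assms(1)] assms(2)] this]
  show "vector_derivative (Delta1 h T) (at x) = Delta1 h (\<lambda>x. vector_derivative T (at x)) x" by (rule vector_derivative_at)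
qed

lemma vderiv_Suc_inner: "vderiv (Suc k) f = vderiv k (\<lambda>x. vector_derivative f (at x))"
  by (simp only: vderiv_def funpow_Suc_right o_apply)

lemma trig_polys_derivative_integral:
  assumes T: "T \<in> trig_polys n"
  shows "((\<lambda>t. T (x + t) * fejer_kernel n t) has_integral 2 * of_real pi * vector_derivative T (at x)) {-pi..pi}"
proof -
  obtain c where Tc: "T = (\<lambda>x. \<Sum>k\<in>{- int n..int n}. c k * cis (of_int k * x))"
    using assms by (auto simp: trig_polys_def)
  have "(T has_vector_derivative (\<Sum>k\<in>{- int n..int n}. \<i> * of_int k * c k * cis (of_int k * x))) (at x)" for x
    unfolding Tc using has_vector_derivative_cis_linear[of _ "of_int _"]
    by (intro has_vector_derivative_sum) simp
  then have eq: "vector_derivative T (at x) = (\<Sum>k\<in>{- int n..int n}. \<i> * of_int k * c k * cis (of_int k * x))"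
    by (rule vector_derivative_at)
  have "((\<lambda>t. \<Sum>k\<in>{- int n..int n}. (c k * cis (of_int k * x)) * (cis (of_int k * t) * fejer_kernel n t))
     has_integral (\<Sum>k\<in>{- int n..int n}. (c k * cis (of_int k * x)) * (2 * of_real pi * \<i> * of_int k))) {-pi..pi}"
    by (intro has_integral_sum has_integral_mult_right has_integral_cis_fejer_kernel) auto
  moreover have "(\<Sum>k\<in>{- int n..int n}. (c k * cis (of_int k * x)) * (cis (of_int k * t) * fejer_kernel n t)) = T (x + t) * fejer_kernel n t" for t
    unfolding Tc sum_distrib_right by (intro sum.cong refl) (simp add: distrib_left cis_mult[symmetric])
  moreover have "(\<Sum>k\<in>{- int n..int n}. (c k * cis (of_int k * x)) * (2 * of_real pi * \<i> * of_int k)) = 2 * of_real pi * vector_derivative T (at x)"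
    unfolding eq sum_distrib_left by (intro sum.cong refl) simp
  ultimately show ?thesis by (simp only:)
qed

text \<open>
  The kernel bound is a combination of indicators of intervals of radius \<open>2\<^sup>k pi / n\<close>, so the convolution is bounded by
  averages over these intervals, with coefficients that sum up to a multiple of \<open>n\<close>.
\<close>

lemma norm_trig_polys_derivative_le:
  assumes T: "T \<in> trig_polys n" and n: "1 \<le> n"
  shows "norm (vector_derivative T (at x)) \<le> (\<Sum>k\<le>n. 32 * real n / 2 ^ k * window (2 ^ k * (pi / real n)) T x)"
proof -
  define \<rho> where "\<rho> k = 2 ^ k * (pi / real n)" for k :: nat
  have \<rho>: "0 < \<rho> k" for k using n by (simp add: \<rho>_def)
  have li: "loc_integrable T" by (rule trig_polys_loc_integrable[OF T])
  let ?f = "\<lambda>t. norm (T (t + x))"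
  have li': "loc_integrable ?f" by (rule loc_integrable_norm[OF loc_integrable_shift[OF li]])
  have cut: "(\<lambda>t. if t \<in> {-\<rho> k..\<rho> k} then ?f t else 0) integrable_on {-pi..pi}" for k
    unfolding integrable_restrict_Int Int_atLeastAtMost by (rule loc_integrableD(2)[OF li'])
  have cut_le: "integral {-pi..pi} (\<lambda>t. if t \<in> {-\<rho> k..\<rho> k} then ?f t else 0) \<le> 2 * \<rho> k * window (\<rho> k) T x" for k
  proof -
    let ?a = "max (-\<rho> k) (-pi)" and ?b = "min (\<rho> k) pi"
    have "integral {-pi..pi} (\<lambda>t. if t \<in> {-\<rho> k..\<rho> k} then ?f t else 0) = integral {?a..?b} ?f"
      unfolding integral_restrict_Int Int_atLeastAtMost ..
    also have "\<dots> = integral {?a + x..?b + x} (\<lambda>t. norm (T t))"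
      using integral_shift_real_ivl[of "?a + x" x "?b + x" "\<lambda>t. norm (T t)"] by simp
    also have "\<dots> \<le> 2 * \<rho> k * window (\<rho> k) T x" by (rule integral_norm_le_window[OF li \<rho>]) auto
    finally show ?thesis .
  qed
  have "norm (integral {-pi..pi} (\<lambda>t. T (x + t) * fejer_kernel n t))
    \<le> integral {-pi..pi} (\<lambda>t. \<Sum>k\<le>n. 32 * (real n)\<^sup>2 / 4 ^ k * (if t \<in> {-\<rho> k..\<rho> k} then ?f t else 0))"
  proof (rule integral_norm_bound_integral)
    show "(\<lambda>t. T (x + t) * fejer_kernel n t) integrable_on {-pi..pi}" using trig_polys_derivative_integral[OF T] by blast
    show "(\<lambda>t. \<Sum>k\<le>n. 32 * (real n)\<^sup>2 / 4 ^ k * (if t \<in> {-\<rho> k..\<rho> k} then ?f t else 0)) integrable_on {-pi..pi}"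
      by (intro integrable_sum integrable_on_mult_right cut) simp
    fix t assume "t \<in> {-pi..pi}"
    then have "norm (T (x + t) * fejer_kernel n t) \<le> norm (T (x + t)) * (\<Sum>k\<le>n. if \<bar>t\<bar> \<le> \<rho> k then 32 * (real n)\<^sup>2 / 4 ^ k else 0)"
      unfolding norm_mult \<rho>_def by (intro mult_left_mono norm_fejer_kernel_le n) auto
    also have "\<dots> = (\<Sum>k\<le>n. 32 * (real n)\<^sup>2 / 4 ^ k * (if t \<in> {-\<rho> k..\<rho> k} then ?f t else 0))"
      unfolding sum_distrib_left by (intro sum.cong refl) (auto simp: add.commute)
    finally show "norm (T (x + t) * fejer_kernel n t) \<le> \<dots>" .
  qed
  also have "\<dots> = (\<Sum>k\<le>n. 32 * (real n)\<^sup>2 / 4 ^ k * integral {-pi..pi} (\<lambda>t. if t \<in> {-\<rho> k..\<rho> k} then ?f t else 0))"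
    by (subst Henstock_Kurzweil_Integration.integral_sum) (simp_all only: integrable_on_mult_right cut finite_atMost integral_mult_right)
  also have "\<dots> \<le> (\<Sum>k\<le>n. 32 * (real n)\<^sup>2 / 4 ^ k * (2 * \<rho> k * window (\<rho> k) T x))"
    by (intro sum_mono mult_left_mono cut_le) simp
  also have "\<dots> = 2 * pi * (\<Sum>k\<le>n. 32 * real n / 2 ^ k * window (\<rho> k) T x)"
    unfolding sum_distrib_left
  proof (intro sum.cong refl)
    fix k
    have "(4::real) ^ k = 2 ^ k * 2 ^ k" by (simp flip: power_mult_distrib)
    then show "32 * (real n)\<^sup>2 / 4 ^ k * (2 * \<rho> k * window (\<rho> k) T x) = 2 * pi * (32 * real n / 2 ^ k * window (\<rho> k) T x)"
      using n unfolding \<rho>_def by (simp add: field_simps power2_eq_square)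
  qed
  finally have "norm (2 * of_real pi * vector_derivative T (at x)) \<le> 2 * pi * (\<Sum>k\<le>n. 32 * real n / 2 ^ k * window (\<rho> k) T x)"
    by (simp only: integral_unique[OF trig_polys_derivative_integral[OF T]])
  then show ?thesis by (simp add: norm_mult \<rho>_def)
qed

text \<open>
  Second-order Taylor expansion: the mean over \<open>{x..x + h}\<close> of the linear part \<open>(t - x) f1 x\<close> is
  \<open>(h / 2) f1 x\<close>, and \<open>f1\<close> varies by at most the integral of \<open>f2\<close>.
\<close>

lemma Delta1_derivative_error:
  fixes f f1 f2 :: "real \<Rightarrow> 'a::euclidean_space"
  assumes f: "primitive_of f f1" and f1: "primitive_of f1 f2" and h: "0 < h"
  shows "norm (Delta1 h f x - (h / 2) *\<^sub>R f1 x) \<le> 2 * h\<^sup>2 * window h f2 x"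
proof -
  have li: "loc_integrable f" "loc_integrable f1" "loc_integrable f2"
    using primitive_of_loc_integrable[OF f] f f1 by (simp_all add: primitive_of_def)
  have W: "0 \<le> window h f2 x" using h by (simp add: window_def)
  define l where "l t = (t - x) *\<^sub>R f1 x" for t
  have lc: "loc_integrable l" unfolding l_def by (intro loc_integrable_continuous continuous_intros)
  have "steklov h l x = (h / 2) *\<^sub>R f1 x"
  proof -
    have "(l has_integral ((x + h - x)\<^sup>2 / 2) *\<^sub>R f1 x - ((x - x)\<^sup>2 / 2) *\<^sub>R f1 x) {x..x + h}"
    proof (rule fundamental_theorem_of_calculus)
      fix t
      have "((\<lambda>t. (t - x)\<^sup>2 / 2) has_vector_derivative (t - x)) (at t within {x..x + h})"
        unfolding has_real_derivative_iff_has_vector_derivative[symmetric] by (auto intro!: derivative_eq_intros)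
      from has_vector_derivative_scaleR[OF this[folded has_real_derivative_iff_has_vector_derivative] has_vector_derivative_const]
      show "((\<lambda>t. ((t - x)\<^sup>2 / 2) *\<^sub>R f1 x) has_vector_derivative l t) (at t within {x..x + h})" by (simp add: l_def)
    qed (use h in simp)
    then show ?thesis using h by (simp add: steklov_eq[OF lc] integral_unique power2_eq_square)
  qed
  then have "Delta1 h f x - (h / 2) *\<^sub>R f1 x = steklov h (\<lambda>t. f t - l t) x - f x"
    by (simp add: Delta1_def steklov_diff[OF li(1) lc])
  also have "norm \<dots> \<le> 2 * h\<^sup>2 * window h f2 x"
  proof (rule norm_mean_diff_le[OF loc_integrable_diff[OF li(1) lc] h])
    fix t assume t: "x \<le> t" "t \<le> x + h"
    have c: "loc_integrable (\<lambda>_::real. f1 x)" by (rule loc_integrable_continuous) auto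
    have "integral {x..t} (\<lambda>s. f1 s - f1 x) = integral {x..t} f1 - integral {x..t} (\<lambda>_. f1 x)"
      by (rule Henstock_Kurzweil_Integration.integral_diff) (intro loc_integrableD(2) li c)+
    then have "f t - l t - f x = integral {x..t} (\<lambda>s. f1 s - f1 x)"
      using f t by (simp add: primitive_of_def l_def)
    also have "norm \<dots> \<le> integral {x..t} (\<lambda>_. 2 * h * window h f2 x)"
    proof (rule integral_norm_bound_integral)
      show "(\<lambda>s. f1 s - f1 x) integrable_on {x..t}" by (intro loc_integrableD(2) loc_integrable_diff li c)
      fix s assume s: "s \<in> {x..t}"
      have "f1 s - f1 x = integral {x..s} f2" using f1 s by (simp add: primitive_of_def)
      then show "norm (f1 s - f1 x) \<le> 2 * h * window h f2 x"
        using norm_integral_le_window[OF li(3) h, of x x s] s t h by simp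
    qed (rule integrable_const_ivl)
    also have "\<dots> = (t - x) * (2 * h * window h f2 x)" using t by simp
    also have "\<dots> \<le> h * (2 * h * window h f2 x)" using t h W by (intro mult_right_mono) auto
    finally show "norm (f t - l t - f x) \<le> 2 * h\<^sup>2 * window h f2 x" by (simp add: power2_eq_square mult_ac)
  qed
  finally show ?thesis .
qed

context averaging
begin

lemma bernstein:
  assumes T: "T \<in> trig_polys n" "T \<in> wL p w" and n: "1 \<le> n"
  shows "wnorm p w (\<lambda>x. vector_derivative T (at x)) \<le> ennreal (64 * C * real n) * wnorm p w T"
    "(\<lambda>x. vector_derivative T (at x)) \<in> wL p w"
proof -
  have "wnorm p w (\<lambda>x. vector_derivative T (at x)) \<le> ennreal ((\<Sum>k\<le>n. 32 * real n / 2 ^ k) * C) * wnorm p w T"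
    by (rule wnorm_le_sum_windows[OF T(2) finite_atMost, where \<rho> = "\<lambda>k. 2 ^ k * (pi / real n)"])
      (use n norm_trig_polys_derivative_le[OF T(1) n] in auto)
  also have "\<dots> \<le> ennreal (64 * C * real n) * wnorm p w T"
  proof (intro mult_right_mono ennreal_leI)
    have "(\<Sum>k\<le>N. 1 / 2 ^ k :: real) = 2 - 1 / 2 ^ N" for N by (induction N) (simp_all add: field_simps)
    then have "(\<Sum>k\<le>n. 1 / 2 ^ k :: real) \<le> 2" by simp
    then have "32 * real n * (\<Sum>k\<le>n. 1 / 2 ^ k) \<le> 32 * real n * 2" by (rule mult_left_mono) simp
    then have "(\<Sum>k\<le>n. 32 * real n / 2 ^ k) \<le> 64 * real n" by (simp add: sum_distrib_left)
    then show "(\<Sum>k\<le>n. 32 * real n / 2 ^ k) * C \<le> 64 * C * real n"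
      using C_ge_1 mult_right_mono[of "\<Sum>k\<le>n. 32 * real n / 2 ^ k" "64 * real n" C] by (simp add: mult_ac)
  qed simp
  finally show le: "wnorm p w (\<lambda>x. vector_derivative T (at x)) \<le> ennreal (64 * C * real n) * wnorm p w T" .
  show "(\<lambda>x. vector_derivative T (at x)) \<in> wL p w"
    by (rule wL_dominated[OF T(2) trig_polys_periodic[OF trig_polys_derivative(1)[OF T(1)]]
        loc_integrable_measurable[OF trig_polys_loc_integrable[OF trig_polys_derivative(1)[OF T(1)]]] le])
qed

text \<open>
  In \<open>\<Delta>\<^sub>h T = (h / 2) T' + O(h\<^sup>2 T'')\<close> Bernstein's inequality for \<open>T'\<close> bounds the error by
  \<open>(h / 4) \<parallel>T'\<parallel>\<close>. It is absorbed into the left side, which requires \<open>\<parallel>T'\<parallel>\<close> to be finite.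
\<close>

lemma wnorm_derivative_le_Delta1:
  assumes T: "T \<in> trig_polys n" "T \<in> wL p w" and n: "1 \<le> n" and h: "0 < h" "512 * C\<^sup>2 * (h * real n) \<le> 1"
  shows "wnorm p w (\<lambda>x. vector_derivative T (at x)) \<le> ennreal (4 / h) * wnorm p w (Delta1 h T)"
proof -
  let ?T1 = "\<lambda>x. vector_derivative T (at x)"
  let ?T2 = "\<lambda>x. vector_derivative ?T1 (at x)"
  have T1: "?T1 \<in> trig_polys n" "?T1 \<in> wL p w" by (rule trig_polys_derivative[OF T(1)], rule bernstein[OF T n])
  have T2: "?T2 \<in> wL p w" by (rule bernstein[OF T1 n])
  let ?E = "\<lambda>x. Delta1 h T x - (h / 2) *\<^sub>R ?T1 x"
  have "wnorm p w ?E \<le> ennreal (2 * h\<^sup>2 * C) * wnorm p w ?T2"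
    by (rule wnorm_le_window[OF T2 h(1) _ Delta1_derivative_error[OF trig_polys_derivative(3)[OF T(1)] trig_polys_derivative(3)[OF T1(1)] h(1)]]) simp
  also have "\<dots> \<le> ennreal (2 * h\<^sup>2 * C) * (ennreal (64 * C * real n) * wnorm p w ?T1)"
    by (intro mult_left_mono bernstein T1 n) auto
  also have "\<dots> = ennreal ((2 * h\<^sup>2 * C) * (64 * C * real n)) * wnorm p w ?T1"
  proof -
    have "ennreal (2 * h\<^sup>2 * C) * ennreal (64 * C * real n) = ennreal ((2 * h\<^sup>2 * C) * (64 * C * real n))"
      using C_ge_1 by (intro ennreal_mult[symmetric]) auto
    then show ?thesis by (simp only: mult.assoc[symmetric])
  qed
  also have "\<dots> \<le> ennreal (h / 4) * wnorm p w ?T1"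
  proof (intro mult_right_mono ennreal_leI)
    have "(h / 4) * (512 * C\<^sup>2 * (h * real n)) \<le> (h / 4) * 1" using h by (intro mult_left_mono) auto
    then show "(2 * h\<^sup>2 * C) * (64 * C * real n) \<le> h / 4" by (simp add: power2_eq_square mult_ac)
  qed simp
  finally have E: "wnorm p w ?E \<le> ennreal (h / 4) * wnorm p w ?T1" .
  obtain N where N: "wnorm p w ?T1 = ennreal N" "0 \<le> N" using T1(2) by (cases "wnorm p w ?T1") (auto simp: wL_def)
  have D: "Delta1 h T \<in> wL p w" by (rule Delta1_wL[OF T(2) h(1)])
  obtain M where M: "wnorm p w (Delta1 h T) = ennreal M" "0 \<le> M" using D by (cases "wnorm p w (Delta1 h T)") (auto simp: wL_def)
  have "wnorm p w (\<lambda>x. Delta1 h T x - ?E x) \<le> wnorm p w (Delta1 h T) + wnorm p w ?E"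
    by (intro wnorm_triangle_diff wL_measurable wL_diff wL_scaleR D T1)
  then have "wnorm p w (\<lambda>x. (h / 2) *\<^sub>R ?T1 x) \<le> wnorm p w (Delta1 h T) + ennreal (h / 4) * wnorm p w ?T1"
    using E by (simp add: order_trans[OF _ add_left_mono])
  then have "ennreal (h / 2 * N) \<le> ennreal (M + h / 4 * N)"
    unfolding wnorm_scale M(1) N(1) using h(1) M(2) N(2) by (simp add: ennreal_mult[symmetric] ennreal_plus[symmetric] del: ennreal_plus)
  then have "h / 2 * N \<le> M + h / 4 * N" using h(1) M(2) N(2) by (subst (asm) ennreal_le_iff) auto
  then have "N \<le> 4 / h * M" using h(1) by (simp add: field_simps)
  then show ?thesis unfolding M(1) N(1) using h(1) M(2) by (simp add: ennreal_mult[symmetric] ennreal_leI)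
qed

lemma wnorm_vderiv_le_Delta:
  assumes "T \<in> trig_polys n" "T \<in> wL p w" and n: "1 \<le> n" and h: "0 < h" "512 * C\<^sup>2 * (h * real n) \<le> 1"
  shows "wnorm p w (vderiv r T) \<le> ennreal ((4 / h) ^ r) * wnorm p w (Delta r h T)"
  using assms(1,2)
proof (induction r arbitrary: T)
  case (Suc r)
  let ?D = "\<lambda>T x. vector_derivative T (at x) :: complex"
  have Delta1_r: "Delta r h T \<in> trig_polys n" "?D (Delta r h T) = Delta r h (?D T)"
  proof (induction r)
    case (Suc r)
    show "Delta (Suc r) h T \<in> trig_polys n" unfolding Delta_Suc(1) by (rule trig_polys_Delta1[OF Suc(1) h(1)])
    show "?D (Delta (Suc r) h T) = Delta (Suc r) h (?D T)"
      unfolding Delta_Suc(1) vector_derivative_Delta1[OF Suc(1) h(1)] Suc(2) ..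
  qed (use Suc.prems in \<open>simp_all add: Delta_0\<close>)
  have "wnorm p w (vderiv (Suc r) T) = wnorm p w (vderiv r (?D T))" by (simp only: vderiv_Suc_inner)
  also have "\<dots> \<le> ennreal ((4 / h) ^ r) * wnorm p w (Delta r h (?D T))"
    by (intro Suc.IH trig_polys_derivative(1) bernstein(2)[OF Suc.prems n] Suc.prems)
  also have "\<dots> \<le> ennreal ((4 / h) ^ r) * (ennreal (4 / h) * wnorm p w (Delta (Suc r) h T))"
    unfolding Delta1_r(2)[symmetric] Delta_Suc(1)
    by (intro mult_left_mono wnorm_derivative_le_Delta1[OF Delta1_r(1) Delta_wL[OF Suc.prems(2) h(1)] n h]) auto
  also have "\<dots> = ennreal ((4 / h) ^ Suc r) * wnorm p w (Delta (Suc r) h T)"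
  proof -
    have "ennreal ((4 / h) ^ r) * ennreal (4 / h) = ennreal ((4 / h) ^ Suc r)"
      using h(1) by (subst ennreal_mult[symmetric]) (auto simp: mult.commute)
    then show ?thesis by (simp only: mult.assoc[symmetric])
  qed
  finally show ?case .
qed (simp add: Delta_0 vderiv_Suc)

lemma Kfun_mono: "0 \<le> \<delta> \<Longrightarrow> \<delta> \<le> \<delta>' \<Longrightarrow> Kfun r f \<delta> p w \<le> Kfun r f \<delta>' p w"
  unfolding Kfun_def by (intro INF_mono') (auto intro!: add_left_mono mult_right_mono ennreal_leI power_mono)

text \<open>
  The norm of a trigonometric polynomial is infinite if \<open>w\<close> is not integrable and the polynomial does
  not vanish; the right side of the second inequality is then infinite too.
\<close>

lemma Kfun_infinite:
  fixes f :: "real \<Rightarrow> 'a::euclidean_space"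
  assumes "periodic_2pi f" "f \<in> borel_measurable lebesgue" "f \<notin> wL p w"
  shows "Kfun r f \<delta> p w = top"
proof -
  have top: "wnorm p w f = top" using assms by (simp add: wL_def top.not_eq_extremum[symmetric])
  have "wnorm p w (\<lambda>x. f x - g x) = top" if g: "g \<in> wW r p w" for g
  proof -
    have gL: "g \<in> wL p w" using g by (simp add: wW_def)
    have "wnorm p w (\<lambda>x. (f x - g x) + g x) \<le> wnorm p w (\<lambda>x. f x - g x) + wnorm p w g"
      by (intro wnorm_triangle borel_measurable_diff assms wL_measurable[OF gL])
    then have "top \<le> wnorm p w (\<lambda>x. f x - g x) + wnorm p w g" by (simp add: top)
    then show ?thesis using gL by (auto simp: wL_def top_unique ennreal_add_eq_top)
  qed
  then show ?thesis unfolding Kfun_def by (simp add: INF_top_conv)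
qed

text \<open>
  The step \<open>h = \<epsilon> / n\<close> is below \<open>pi / n\<close>, so the bound by the K-functional at \<open>h\<close> implies that at \<open>pi / n\<close>.
\<close>

lemma wnorm_vderiv_le_Kfun:
  "\<exists>c>0. \<forall>n\<ge>1. \<forall>T\<in>trig_polys n. ennreal (1 / real n ^ r) * wnorm p w (vderiv r T) \<le> ennreal c * Kfun r T (pi / real n) p w"
proof -
  \<comment> \<open>The largest value of \<open>h n\<close> admitted by \<open>wnorm_derivative_le_Delta1\<close>.\<close>
  define \<epsilon> where "\<epsilon> = 1 / (512 * C\<^sup>2)"
  have \<epsilon>: "0 < \<epsilon>" "\<epsilon> \<le> 1" "512 * C\<^sup>2 * \<epsilon> = 1"
  proof -
    have C2: "1 \<le> C\<^sup>2" by (rule one_le_power[OF C_ge_1])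
    have "1 / (512 * C\<^sup>2) \<le> 1 / 1" by (rule divide_left_mono) (use C2 in linarith)+
    then show "0 < \<epsilon>" "\<epsilon> \<le> 1" "512 * C\<^sup>2 * \<epsilon> = 1" using C_ge_1 by (auto simp: \<epsilon>_def)
  qed
  let ?c = "(4 / \<epsilon>) ^ r * (2 * C + 1) ^ r"
  show ?thesis
  proof (intro exI[of _ ?c] conjI allI impI ballI)
    show c: "0 < ?c" using \<epsilon> C_ge_1 by simp
    fix n :: nat and T assume n: "1 \<le> n" and T: "T \<in> trig_polys n"
    show "ennreal (1 / real n ^ r) * wnorm p w (vderiv r T) \<le> ennreal ?c * Kfun r T (pi / real n) p w"
    proof (cases "T \<in> wL p w")
      case False
      have "Kfun r T (pi / real n) p w = top"
        by (rule Kfun_infinite[OF trig_polys_periodic[OF T] loc_integrable_measurable[OF trig_polys_loc_integrable[OF T]] False])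
      moreover have "ennreal ?c \<noteq> 0" using c by (simp only: ennreal_eq_0_iff not_le)
      ultimately show ?thesis by (simp only: ennreal_mult_top if_False top_greatest)
    next
      case True
      define h where "h = \<epsilon> / real n"
      have h: "0 < h" "512 * C\<^sup>2 * (h * real n) \<le> 1" using \<epsilon> n by (auto simp: h_def)
      have "h \<le> pi / real n" unfolding h_def using \<epsilon>(2) pi_ge_two by (intro divide_right_mono) auto
      have "ennreal (1 / real n ^ r) * wnorm p w (vderiv r T) \<le> ennreal (1 / real n ^ r) * (ennreal ((4 / h) ^ r) * wnorm p w (Delta r h T))"
        by (intro mult_left_mono wnorm_vderiv_le_Delta[OF T True n h]) simp
      also have "\<dots> = ennreal ((4 / \<epsilon>) ^ r) * wnorm p w (Delta r h T)"
      proof -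
        have "1 / real n ^ r * (4 / h) ^ r = (4 / \<epsilon>) ^ r"
          using n by (simp add: h_def power_divide power_mult_distrib)
        then have "ennreal (1 / real n ^ r) * ennreal ((4 / h) ^ r) = ennreal ((4 / \<epsilon>) ^ r)"
          using h(1) by (subst ennreal_mult[symmetric]) auto
        then show ?thesis by (simp only: mult.assoc[symmetric])
      qed
      also have "\<dots> \<le> ennreal ((4 / \<epsilon>) ^ r) * (ennreal ((2 * C + 1) ^ r) * Kfun r T (pi / real n) p w)"
      proof (intro mult_left_mono)
        have "wnorm p w (Delta r h T) \<le> ennreal ((2 * C + 1) ^ r) * Kfun r T h p w" by (rule wnorm_Delta_le_Kfun[OF True h(1)])
        also have "\<dots> \<le> ennreal ((2 * C + 1) ^ r) * Kfun r T (pi / real n) p w"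
          by (intro mult_left_mono Kfun_mono) (use h(1) \<open>h \<le> pi / real n\<close> in auto)
        finally show "wnorm p w (Delta r h T) \<le> \<dots>" .
      qed simp
      also have "\<dots> = ennreal ?c * Kfun r T (pi / real n) p w"
        using \<epsilon>(1) C_ge_1 by (simp add: ennreal_mult mult.assoc)
      finally show ?thesis .
    qed
  qed
qed

end

section \<open>Differences, derivatives and the K-functional\<close>

theorem theorem3p4:
  fixes p :: "real \<Rightarrow> real" and w :: "real \<Rightarrow> ennreal" and r :: nat
  assumes "p \<in> log_exponents" and "w \<in> muckenhoupt p" and "1 \<le> r"
  shows "\<exists>c1 c2 c3 c4 :: real. 0 < c1 \<and> 0 < c2 \<and> 0 < c3 \<and> 0 < c4 \<and>
    (\<forall>(n::nat) (\<delta>::real) (T :: real \<Rightarrow> complex) (f :: real \<Rightarrow> real) (g :: real \<Rightarrow> real).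
       1 \<le> n \<longrightarrow> 0 < \<delta> \<longrightarrow> T \<in> trig_polys n \<longrightarrow> f \<in> wW r p w \<longrightarrow> g \<in> wL p w \<longrightarrow>
         wnorm p w (Delta r \<delta> f) \<le> ennreal (c1 * \<delta> ^ r) * wnorm p w (vderiv r f) \<and>
         ennreal (1 / real n ^ r) * wnorm p w (vderiv r T) \<le> ennreal c2 * Kfun r T (pi / real n) p w \<and>
         ennreal c3 * Kfun r g \<delta> p w \<le> wnorm p w (Delta r \<delta> g) \<and>
         wnorm p w (Delta r \<delta> g) \<le> ennreal c4 * Kfun r g \<delta> p w)"
proof -
  obtain c P A where "muckenhoupt_weight p w c P A" using muckenhoupt_weight_intro[OF assms(1,2)] by blast
  then interpret muckenhoupt_weight p w c P A .
  obtain C where C: "1 \<le> C"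
    "\<And>(f::real\<Rightarrow>real) h. \<lbrakk>f \<in> borel_measurable lebesgue; \<And>x. 0 \<le> f x; periodic_2pi f; wnorm p w f < top; 0 < h\<rbrakk>
      \<Longrightarrow> wnorm p w (\<lambda>x. enn2real (\<integral>\<^sup>+t\<in>{x-h..x+h}. f t \<partial>lebesgue) / (2*h)) \<le> ennreal C * wnorm p w f"
    "\<And>f::real\<Rightarrow>real. \<lbrakk>f \<in> borel_measurable lebesgue; \<And>x. 0 \<le> f x; wnorm p w f < top\<rbrakk> \<Longrightarrow> (\<integral>\<^sup>+x\<in>circ. f x \<partial>lebesgue) < top"
    using averages_bounded by blast
  interpret averaging p w C by unfold_locales (use C in auto)
  obtain c2 where c2: "0 < c2" "\<And>n T. 1 \<le> n \<Longrightarrow> T \<in> trig_polys n \<Longrightarrow>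
      ennreal (1 / real n ^ r) * wnorm p w (vderiv r T) \<le> ennreal c2 * Kfun r T (pi / real n) p w"
    using wnorm_vderiv_le_Kfun by blast
  obtain K where K: "0 < K" "\<And>h g. 0 < h \<Longrightarrow> g \<in> wL p w \<Longrightarrow> Kfun r (g :: real \<Rightarrow> real) h p w \<le> ennreal K * wnorm p w (Delta r h g)"
    using Kfun_le_wnorm_Delta[OF assms(3)] by blast
  show ?thesis
  proof (rule exI[of _ "(2 * C) ^ r"], rule exI[of _ c2], rule exI[of _ "1 / K"], rule exI[of _ "(2 * C + 1) ^ r"], intro conjI allI impI)
    show "0 < (2 * C) ^ r" "0 < (2 * C + 1) ^ r" using \<open>1 \<le> C\<close> by simp_all
    show "0 < c2" "0 < 1 / K" using c2 K by simp_all
    fix n :: nat and \<delta> :: real and T :: "real \<Rightarrow> complex" and f g :: "real \<Rightarrow> real"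
    assume n: "1 \<le> n" and \<delta>: "0 < \<delta>" and T: "T \<in> trig_polys n" and f: "f \<in> wW r p w" and g: "g \<in> wL p w"
    show "wnorm p w (Delta r \<delta> f) \<le> ennreal ((2 * C) ^ r * \<delta> ^ r) * wnorm p w (vderiv r f)"
      using wnorm_Delta_wW[OF f \<delta>] by (simp only: power_mult_distrib)
    show "ennreal (1 / real n ^ r) * wnorm p w (vderiv r T) \<le> ennreal c2 * Kfun r T (pi / real n) p w" by (rule c2(2)[OF n T])
    show "ennreal (1 / K) * Kfun r g \<delta> p w \<le> wnorm p w (Delta r \<delta> g)"
      unfolding ennreal_le_mult_iff[OF K(1), symmetric] by (rule K(2)[OF \<delta> g])
    show "wnorm p w (Delta r \<delta> g) \<le> ennreal ((2 * C + 1) ^ r) * Kfun r g \<delta> p w" by (rule wnorm_Delta_le_Kfun[OF g \<delta>])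
  qed
qed

end
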